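(* The rational measures $\lambda_0,\ldots,\lambda_n\colon\mathscr P^{(n)}\to\mathbb R_{\ge0}$, for each $n=1,2,\ldots$, are uniquely characterized by properties (i)-(vi) below. That is: the family of maps $\lambda_d\colon\mathscr P^{(n)}\to\mathbb R_{\ge0}$ ($n\ge1$, $0\le d\le n$) satisfies (i)-(vi), and if for each $n\ge 1$ and each $d=0,\ldots,n$ a map $\mu_d^{(n)}\colon\mathscr P^{(n)}\to\mathbb R_{\ge0}$ is given such that the family $(\mu^{(n)}_d)_{n\ge1,\,0\le d\le n}$ satisfies (i)-(vi), then $\mu_d^{(n)}(P)=\lambda_d(P)$ for all $n\ge1$, $0\le d\le n$ and $P\in\mathscr P^{(n)}$. The properties, for a family $(\mu^{(n)}_d)_{n\ge 1,\,0\le d\le n}$, are the following, required for all $n\ge1$, $0\le d\le n$ and $P,Q\in\mathscr P^{(n)}$: (i) (Invariance) If $P=\gamma(Q)$ for some $\gamma\in\mathcal G_n$, then $\mu_d^{(n)}(P)=\mu_d^{(n)}(Q)$. (ii) (Valuation) $\mu_d^{(n)}(\emptyset)=0$, $\mu_d^{(n)}(P)=\mu_d^{(n)}(P^{(d)})$, and if $P,Q$ have dimension at most $d$ then $\mu_d^{(n)}(P)+\mu_d^{(n)}(Q)=\mu_d^{(n)}(P\cup Q)+\mu_d^{(n)}(P\cap Q)$. (iii) (Conservativity) With $(P,0)=\{(x,0)\in\mathbb R^{n+1}\mid x\in P\}$, one has $\mu_d^{(n)}(P)=\mu_d^{(n+1)}(P,0)$. (iv) (Pyramid) For $k=1,\ldots,n$,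 if $\operatorname{conv}(v_0,\ldots,v_k)$ is a regular $k$-simplex in $\mathbb R^n$ with $v_0\in\mathbb Z^n$, then $\mu_k^{(n)}(\operatorname{conv}(v_0,\ldots,v_k))=\mu_{k-1}^{(n)}(\operatorname{conv}(v_1,\ldots,v_k))/k$. (v) (Normalization) For $j=1,\ldots,n$, if $B=\{w_1,\ldots,w_j\}\subseteq\mathbb Z^n$ (of $j$ elements) is part of a basis of the free abelian group $\mathbb Z^n$ and $P_B=\{x\in\mathbb R^n\mid x=\sum_{i=1}^j\gamma_iw_i,\ 0\le\gamma_i\le1\}$, then $\mu_j^{(n)}(P_B)=1$. (vi) (Proportionality) For every $m=0,\ldots,n$ and every $m$-dimensional rational affine subspace $A$ of $\mathbb R^n$ there is a constant $\kappa_A>0$, depending only on $A$, such that $\mu_m^{(n)}(Q)=\kappa_A\cdot\mathcal H^m(Q)$ for every rational $m$-simplex $Q\subseteq A$, where $\mathcal H^m$ denotes $m$-dimensional Hausdorff measure.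
   Context: A rational polyhedron in $\mathbb R^n$ is a union of finitely many (closed) simplexes in $\mathbb R^n$ whose vertices are in $\mathbb Q^n$ (the empty set is included; it need not be convex or connected). $\mathscr P^{(n)}$ is the set of all rational polyhedra in $\mathbb R^n$. $\mathcal G_n=GL(n,\mathbb Z)\ltimes\mathbb Z^n$ is the group of maps $x\mapsto Ax+t$ of $\mathbb R^n$, with $t\in\mathbb Z^n$ and $A$ an $n\times n$ integer matrix of determinant $\pm1$. For a rational point $x=(x_1,\ldots,x_n)\in\mathbb Q^n$, $\operatorname{den}(x)$ is the least common denominator (a positive integer) of its coordinates, and $\tilde x=\operatorname{den}(x)(x_1,\ldots,x_n,1)\in\mathbb Z^{n+1}$ is its homogeneous correspondent. A simplex is rational if all its vertices are rational. A rational $m$-simplex $\operatorname{conv}(v_0,\ldots,v_m)\subseteq\mathbb R^n$ is regular if $\{\tilde v_0,\ldots,\tilde v_m\}$ is part of a basis of the free abelian group $\mathbb Z^{n+1}$. A simplicial complex $\Delta$ is a finite set of simplexes in $\mathbb R^n$, closed under taking faces, any two of which intersect in a common face; it is regular if all its simplexes are rational and regular; its support is the union of its simplexes; a triangulation of $P$ is a simplicial complex with support $P$. For a triangulation $\mathcal T$ and $i=0,1,\ldots$, $\mathcal T^{\max}(i)$ denotes the set of $i$-dimensional simplexes of $\mathcal T$ that are maximal (with respect to inclusion) in $\mathcal T$. The $i$-dimensional part of a polyhedron $Q$ is $Q^{(i)}=\bigcup\{T\mid T\in\mathcal T^{\max}(i)\}$, for any triangulation $\mathcal T$ of $Q$ (this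 does not depend on $\mathcal T$). For a regular simplex $S=\operatorname{conv}(v_0,\ldots,v_m)$ put $\operatorname{den}(S)=\prod_{j=0}^m\operatorname{den}(v_j)$. For $P\in\mathscr P^{(n)}$ the $d$-dimensional rational measure is $$\lambda_d(P)=\sum_{T\in\Delta^{\max}(d)}\frac{1}{d!\,\operatorname{den}(T)},$$ where $\Delta$ is an arbitrary regular triangulation of $P$ (one exists and the value does not depend on the choice of $\Delta$), the sum being $0$ if $\Delta^{\max}(d)=\emptyset$. The same symbol $\lambda_d$ is used for every ambient space $\mathbb R^n$. A rational affine hyperplane in $\mathbb R^n$ is a set $\{x\in\mathbb R^n\mid a\circ x+t=0\}$ with $\circ$ the scalar product, $0\neq a\in\mathbb Q^n$ and $t\in\mathbb Q$; a rational affine subspace of $\mathbb R^n$ is the intersection of a finite (possibly empty) set of rational hyperplanes, the empty intersection being $\mathbb R^n$. Hausdorff measure $\mathcal H^m$ is normalized to agree with Lebesgue measure on $\mathbb R^m$; $\mathcal H^0$ is counting measure. *)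

theory Defs
  imports
    "HOL-Analysis.Analysis"
    "HOL-Analysis.Finite_Function_Topology"
    "Jordan_Normal_Form.Determinant"
begin

text \<open>
  The statement compares spaces of different dimensions, so all of them are realised inside one
  vector space: \<open>\<real>\<^sup>n\<close> is the set of finitely supported sequences that vanish from index \<open>n\<close> on
  (coordinates are numbered from \<open>0\<close>). The library notions \<^term>\<open>convex hull V\<close>,
  \<^const>\<open>affine_dependent\<close>, \<^const>\<open>face_of\<close> and \<^const>\<open>extreme_point_of\<close> only need a real
  vector space and apply as they stand. The library norm of this type is the sum norm, so it is
  not used below.
\<close>

type_synonym point = "nat \<Rightarrow>\<^sub>0 real"

abbreviation coord :: "point \<Rightarrow> nat \<Rightarrow> real" where
  "coord \<equiv> Poly_Mapping.lookup"

definition Rn :: "nat \<Rightarrow> point set" where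
  "Rn n = {x. \<forall>i\<ge>n. coord x i = 0}"

definition Qn :: "nat \<Rightarrow> point set" where
  "Qn n = {x \<in> Rn n. \<forall>i. coord x i \<in> \<rat>}"

definition Zn :: "nat \<Rightarrow> point set" where
  "Zn n = {x \<in> Rn n. \<forall>i. coord x i \<in> \<int>}"

text \<open>For \<open>x \<in> \<real>\<^sup>n\<close> this is the point \<open>(x, c)\<close> of \<open>\<real>\<^sup>n\<^sup>+\<^sup>1\<close>.\<close>

definition snoc :: "nat \<Rightarrow> point \<Rightarrow> real \<Rightarrow> point" where
  "snoc n x c = x + Poly_Mapping.single n c"


section \<open>Simplexes and rational polyhedra\<close>

definition simplex_in :: "nat \<Rightarrow> nat \<Rightarrow> point set \<Rightarrow> bool" where
  "simplex_in n m S \<longleftrightarrow>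
     (\<exists>V \<subseteq> Rn n. finite V \<and> card V = Suc m \<and> \<not> affine_dependent V \<and> S = convex hull V)"

definition rational_simplex :: "nat \<Rightarrow> nat \<Rightarrow> point set \<Rightarrow> bool" where
  "rational_simplex n m S \<longleftrightarrow>
     (\<exists>V \<subseteq> Qn n. finite V \<and> card V = Suc m \<and> \<not> affine_dependent V \<and> S = convex hull V)"

definition rational_polyhedra :: "nat \<Rightarrow> point set set" where
  "rational_polyhedra n = {\<Union>F | F. finite F \<and> (\<forall>S\<in>F. \<exists>m. rational_simplex n m S)}"

text \<open>
  The dimension of a polyhedron is the largest dimension of a simplex contained in it; the empty
  polyhedron has dimension at most \<open>d\<close> for every \<open>d\<close>.
\<close>

definition dim_at_most :: "nat \<Rightarrow> nat \<Rightarrow> point set \<Rightarrow> bool" where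
  "dim_at_most n d P \<longleftrightarrow> (\<forall>m S. simplex_in n m S \<and> S \<subseteq> P \<longrightarrow> m \<le> d)"

text \<open>
  Simplexes are nonempty here. Since \<^const>\<open>face_of\<close> admits the empty face, the third condition
  is restricted to nonempty faces, and the last one allows disjoint simplexes.
\<close>

definition simplicial_complex_in :: "nat \<Rightarrow> point set set \<Rightarrow> bool" where
  "simplicial_complex_in n \<Delta> \<longleftrightarrow>
     finite \<Delta> \<and>
     (\<forall>S\<in>\<Delta>. \<exists>m. simplex_in n m S) \<and>
     (\<forall>S\<in>\<Delta>. \<forall>F. F face_of S \<and> F \<noteq> {} \<longrightarrow> F \<in> \<Delta>) \<and>
     (\<forall>S\<in>\<Delta>. \<forall>T\<in>\<Delta>. (S \<inter> T) face_of S \<and> (S \<inter> T) face_of T)"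

definition triangulates :: "nat \<Rightarrow> point set set \<Rightarrow> point set \<Rightarrow> bool" where
  "triangulates n \<Delta> P \<longleftrightarrow> simplicial_complex_in n \<Delta> \<and> \<Union>\<Delta> = P"

definition maximal_simplexes :: "nat \<Rightarrow> point set set \<Rightarrow> nat \<Rightarrow> point set set" where
  "maximal_simplexes n \<Delta> i =
     {S \<in> \<Delta>. simplex_in n i S \<and> (\<forall>T\<in>\<Delta>. S \<subseteq> T \<longrightarrow> T = S)}"

definition dim_part :: "nat \<Rightarrow> nat \<Rightarrow> point set \<Rightarrow> point set" where
  "dim_part n i P = \<Union>(maximal_simplexes n (SOME \<Delta>. triangulates n \<Delta> P) i)"


section \<open>Regular simplexes\<close>

text \<open>Spans and independence over \<open>\<int>\<close>.\<close>

interpretation int_module: Modules.module "\<lambda>(k::int) (x::point). of_int k *\<^sub>R x"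
  by unfold_locales (simp_all add: algebra_simps)

definition lattice_basis :: "nat \<Rightarrow> point set \<Rightarrow> bool" where
  "lattice_basis n B \<longleftrightarrow> int_module.independent B \<and> int_module.span B = Zn n"

definition part_of_basis :: "nat \<Rightarrow> point set \<Rightarrow> bool" where
  "part_of_basis n B \<longleftrightarrow> (\<exists>C. B \<subseteq> C \<and> lattice_basis n C)"

definition den :: "point \<Rightarrow> nat" where
  "den x = (LEAST q. q > 0 \<and> (\<forall>i. real q * coord x i \<in> \<int>))"

definition homog :: "nat \<Rightarrow> point \<Rightarrow> point" where
  "homog n x = real (den x) *\<^sub>R snoc n x 1"

definition regular_vertices :: "nat \<Rightarrow> point set \<Rightarrow> bool" where
  "regular_vertices n V \<longleftrightarrow>
     V \<subseteq> Qn n \<and> finite V \<and> \<not> affine_dependent V \<and> part_of_basis (Suc n) (homog n ` V)"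

definition regular_simplex :: "nat \<Rightarrow> nat \<Rightarrow> point set \<Rightarrow> bool" where
  "regular_simplex n m S \<longleftrightarrow>
     (\<exists>V. regular_vertices n V \<and> card V = Suc m \<and> S = convex hull V)"

definition regular_triangulates :: "nat \<Rightarrow> point set set \<Rightarrow> point set \<Rightarrow> bool" where
  "regular_triangulates n \<Delta> P \<longleftrightarrow>
     triangulates n \<Delta> P \<and> (\<forall>S\<in>\<Delta>. \<exists>m. regular_simplex n m S)"

text \<open>The vertices of a simplex are its extreme points.\<close>

definition den_simplex :: "point set \<Rightarrow> nat" where
  "den_simplex S = (\<Prod>v | v extreme_point_of S. den v)"

definition rational_measure :: "nat \<Rightarrow> nat \<Rightarrow> point set \<Rightarrow> real" where
  "rational_measure n d P =
     (\<Sum>T \<in> maximal_simplexes n (SOME \<Delta>. regular_triangulates n \<Delta> P) d.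
        1 / (fact d * real (den_simplex T)))"


section \<open>Integral affine maps and rational affine subspaces\<close>

definition affine_int_map :: "nat \<Rightarrow> int mat \<Rightarrow> point \<Rightarrow> point \<Rightarrow> point" where
  "affine_int_map n A t x =
     (\<Sum>i<n. Poly_Mapping.single i (\<Sum>j<n. of_int (A $$ (i, j)) * coord x j)) + t"

definition affine_GL_Z :: "nat \<Rightarrow> (point \<Rightarrow> point) set" where
  "affine_GL_Z n =
     {affine_int_map n A t | A t.
        A \<in> carrier_mat n n \<and> Determinant.det A \<in> {1, -1} \<and> t \<in> Zn n}"

definition rational_hyperplane :: "nat \<Rightarrow> point set \<Rightarrow> bool" where
  "rational_hyperplane n H \<longleftrightarrow>
     (\<exists>a\<in>Qn n. \<exists>t\<in>\<rat>. a \<noteq> 0 \<and> H = {x \<in> Rn n. (\<Sum>i<n. coord a i * coord x i) + t = 0})"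

definition rational_affine_subspace :: "nat \<Rightarrow> point set \<Rightarrow> bool" where
  "rational_affine_subspace n A \<longleftrightarrow>
     (\<exists>F. finite F \<and> (\<forall>H\<in>F. rational_hyperplane n H) \<and> A = Rn n \<inter> \<Inter>F)"

definition affine_dim_eq :: "nat \<Rightarrow> point set \<Rightarrow> bool" where
  "affine_dim_eq m A \<longleftrightarrow>
     (\<exists>V. finite V \<and> card V = Suc m \<and> \<not> affine_dependent V \<and> affine hull V = A)"


section \<open>Hausdorff measure for the Euclidean distance\<close>

definition euclid_dist :: "point \<Rightarrow> point \<Rightarrow> real" where
  "euclid_dist x y = L2_set (coord (x - y)) (Poly_Mapping.keys (x - y))"

definition euclid_diam :: "point set \<Rightarrow> ennreal" where
  "euclid_diam U = (SUP x\<in>U. SUP y\<in>U. ennreal (euclid_dist x y))"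

text \<open>
  The factor \<^const>\<open>unit_ball_vol\<close>, the Lebesgue measure of the Euclidean unit ball of \<open>\<real>\<^sup>m\<close>,
  normalizes \<open>\<H>\<^sup>m\<close> to Lebesgue measure on \<open>\<real>\<^sup>m\<close>. The case distinction only matters for \<open>m = 0\<close>,
  where nonempty sets get weight \<open>1\<close> (as \<open>0\<^sup>0 = 1\<close>) and the empty set weight \<open>0\<close>.
\<close>

definition hausdorff_weight :: "nat \<Rightarrow> point set \<Rightarrow> ennreal" where
  "hausdorff_weight m U =
     (if U = {} then 0 else ennreal (unit_ball_vol (real m)) * (euclid_diam U / 2) ^ m)"

definition hausdorff_premeasure :: "nat \<Rightarrow> real \<Rightarrow> point set \<Rightarrow> ennreal" where
  "hausdorff_premeasure m \<delta> S =
     (INF U \<in> {U :: nat \<Rightarrow> point set. S \<subseteq> (\<Union>i. U i) \<and> (\<forall>i. euclid_diam (U i) \<le> ennreal \<delta>)}.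
        suminf (\<lambda>i. hausdorff_weight m (U i)))"

definition hausdorff_measure :: "nat \<Rightarrow> point set \<Rightarrow> ennreal" where
  "hausdorff_measure m S = (SUP \<delta>\<in>{0<..}. hausdorff_premeasure m \<delta> S)"


section \<open>The characteristic properties\<close>

text \<open>
  A family is a function \<open>\<mu>\<close> with \<open>\<mu> n d\<close> in the role of the map \<open>\<mu>\<close> of index \<open>d\<close> on the rational
  polyhedra of \<open>\<real>\<^sup>n\<close>. Only the indices \<open>n \<ge> 1\<close>, \<open>d \<le> n\<close> and arguments in
  \<^term>\<open>rational_polyhedra n\<close> are meaningful; other values are unconstrained.
\<close>

type_synonym family = "nat \<Rightarrow> nat \<Rightarrow> point set \<Rightarrow> real"

definition nonneg_valued :: "family \<Rightarrow> bool" where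
  "nonneg_valued \<mu> \<longleftrightarrow>
     (\<forall>n\<ge>1. \<forall>d\<le>n. \<forall>P\<in>rational_polyhedra n. \<mu> n d P \<ge> 0)"

definition invariance :: "family \<Rightarrow> bool" where
  "invariance \<mu> \<longleftrightarrow>
     (\<forall>n\<ge>1. \<forall>d\<le>n. \<forall>P\<in>rational_polyhedra n. \<forall>Q\<in>rational_polyhedra n.
        (\<exists>\<gamma>\<in>affine_GL_Z n. P = \<gamma> ` Q) \<longrightarrow> \<mu> n d P = \<mu> n d Q)"

definition valuation :: "family \<Rightarrow> bool" where
  "valuation \<mu> \<longleftrightarrow>
     (\<forall>n\<ge>1. \<forall>d\<le>n.
        \<mu> n d {} = 0 \<and>
        (\<forall>P\<in>rational_polyhedra n. \<mu> n d P = \<mu> n d (dim_part n d P)) \<and>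
        (\<forall>P\<in>rational_polyhedra n. \<forall>Q\<in>rational_polyhedra n.
           dim_at_most n d P \<and> dim_at_most n d Q \<longrightarrow>
           \<mu> n d P + \<mu> n d Q = \<mu> n d (P \<union> Q) + \<mu> n d (P \<inter> Q)))"

definition conservativity :: "family \<Rightarrow> bool" where
  "conservativity \<mu> \<longleftrightarrow>
     (\<forall>n\<ge>1. \<forall>d\<le>n. \<forall>P\<in>rational_polyhedra n.
        \<mu> n d P = \<mu> (Suc n) d ((\<lambda>x. snoc n x 0) ` P))"

definition pyramid :: "family \<Rightarrow> bool" where
  "pyramid \<mu> \<longleftrightarrow>
     (\<forall>n\<ge>1. \<forall>k\<in>{1..n}. \<forall>v :: nat \<Rightarrow> point.
        inj_on v {0..k} \<and> regular_vertices n (v ` {0..k}) \<and> v 0 \<in> Zn n \<longrightarrow>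
        \<mu> n k (convex hull (v ` {0..k})) = \<mu> n (k - 1) (convex hull (v ` {1..k})) / real k)"

definition normalization :: "family \<Rightarrow> bool" where
  "normalization \<mu> \<longleftrightarrow>
     (\<forall>n\<ge>1. \<forall>j\<in>{1..n}. \<forall>B \<subseteq> Zn n.
        card B = j \<and> part_of_basis n B \<longrightarrow>
        \<mu> n j {\<Sum>w\<in>B. g w *\<^sub>R w | g. \<forall>w\<in>B. 0 \<le> g w \<and> g w \<le> 1} = 1)"

definition proportionality :: "family \<Rightarrow> bool" where
  "proportionality \<mu> \<longleftrightarrow>
     (\<forall>n\<ge>1. \<forall>m\<le>n. \<forall>A.
        rational_affine_subspace n A \<and> affine_dim_eq m A \<longrightarrow>
        (\<exists>\<kappa>>0. \<forall>Q. rational_simplex n m Q \<and> Q \<subseteq> A \<longrightarrow>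
           ennreal (\<mu> n m Q) = ennreal \<kappa> * hausdorff_measure m Q))"

definition characteristic_properties :: "family \<Rightarrow> bool" where
  "characteristic_properties \<mu> \<longleftrightarrow>
     invariance \<mu> \<and> valuation \<mu> \<and> conservativity \<mu> \<and> pyramid \<mu> \<and> normalization \<mu> \<and>
     proportionality \<mu>"

end

theory Submission
  imports Defs
begin

text \<open>
  For a rational polyhedron \<open>P\<close> let \<open>N(P, K)\<close> be the number of pairs \<open>(k, x)\<close> with \<open>1 \<le> k \<le> K\<close>,
  \<open>x \<in> P\<close> and \<open>k x\<close> integral. In a regular \<open>d\<close>-simplex such pairs are the nonnegative integer combinations
  of the homogeneous correspondents of the vertices, so if \<open>P\<close> has dimension at most \<open>d\<close>, then
  \<open>N(P, K) / K\<^sup>d\<^sup>+\<^sup>1\<close> tends to \<open>\<lambda>\<^sub>d(P) / (d + 1)\<close>. The left-hand side does not refer to a triangulation, and it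
  gives the valuation property, invariance and normalization. Regular triangulations
  are obtained from the fan of the coordinate half-orthants by starring edges at their Farey mediants
  until no cone crosses any of the finitely many hyperplanes that bound \<open>P\<close>.

  For proportionality, the numbers of lattice points in the slices of two rational simplexes of the
  same affine subspace are compared with the number of lattice cells in their dilations, each cell
  having the same Hausdorff measure up to scaling.

  For uniqueness, a regular simplex \<open>T\<close> of \<open>\<real>\<^sup>n\<close> is coned in \<open>\<real>\<^sup>n\<^sup>+\<^sup>1\<close> from the apex \<open>(0, \<dots>, 0, -1)\<close>.
  The pyramid property reduces \<open>T\<close> to the cone, and by proportionality the cone is compared with a
  unit parallelepiped of the same affine subspace, whose value is fixed by normalization.
\<close>

section \<open>Simplexes and their faces\<close>

text \<open>Cumulative counts are forced. At a single level \<open>k\<close> the number of points of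
  \<open>P\<close> with \<open>k x\<close> integral oscillates with \<open>k\<close> (for the point
  1/2 it is 1 or 0), so only the sum over all levels up to \<open>K\<close> has a limit after
  normalization. Summation raises the order of growth from \<open>d\<close> to \<open>d + 1\<close>
  and brings in the factor \<open>1 / (d + 1)\<close>.

  Additivity of Hausdorff measure is never established. Monotonicity, subadditivity and scaling give
  upper bounds only; a lower bound for a convex body comes from filling a large box, whose cells
  outside the body cannot account for the whole box.

  In the uniqueness part, an affine subspace such as x = 1/2 contains no integer point, hence no
  integer translate of a unit parallelepiped, and normalization says nothing about it directly. An
  integer apex one dimension higher yields a subspace that does contain such a parallelepiped, and
  conservativity gives access to the larger space.\<close>

definition open_simplex :: "'a::real_vector set \<Rightarrow> 'a set" where
  "open_simplex V = {\<Sum>v\<in>V. u v *\<^sub>R v | u. (\<forall>v\<in>V. 0 < u v) \<and> sum u V = 1}"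

definition vertices :: "'a::real_vector set \<Rightarrow> 'a set" where
  "vertices S = {v. v extreme_point_of S}"

text \<open>For finite nonempty \<open>V\<close> this is the linear space parallel to the affine
  hull. Coefficients of sum 0 avoid the choice of a base vertex.\<close>

definition directions :: "'a::real_vector set \<Rightarrow> 'a set" where
  "directions V = {\<Sum>v\<in>V. c v *\<^sub>R v | c. sum c V = 0}"

lemma affine_independent_unique:
  fixes V :: "'a::real_vector set"
  assumes V: "finite V" "\<not> affine_dependent V"
    and "sum a V = sum b V" "(\<Sum>v\<in>V. a v *\<^sub>R v) = (\<Sum>v\<in>V. b v *\<^sub>R v)" "v \<in> V"
  shows "a v = b v"
proof (rule ccontr)
  assume "a v \<noteq> b v"
  moreover have "sum (\<lambda>v. a v - b v) V = 0" "(\<Sum>v\<in>V. (a v - b v) *\<^sub>R v) = 0"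
    using assms by (simp_all add: sum_subtractf algebra_simps)
  ultimately have "\<exists>U. sum U V = 0 \<and> (\<exists>v\<in>V. U v \<noteq> 0) \<and> (\<Sum>v\<in>V. U v *\<^sub>R v) = 0"
    using assms(5) by (intro exI[where x = "\<lambda>v. a v - b v"]) auto
  then show False
    using V affine_dependent_explicit_finite[OF V(1)] by simp
qed

lemma convex_hull_finiteI:
  fixes V :: "'a::real_vector set"
  assumes "finite V" "\<And>v. v \<in> V \<Longrightarrow> 0 \<le> u v" "sum u V = 1" "x = (\<Sum>v\<in>V. u v *\<^sub>R v)"
  shows "x \<in> convex hull V"
  using assms by (auto simp: convex_hull_finite)

lemma convex_hull_finiteE:
  fixes V :: "'a::real_vector set"
  assumes "x \<in> convex hull V" "finite V"
  obtains u where "\<And>v. v \<in> V \<Longrightarrow> 0 \<le> u v" "sum u V = 1" "x = (\<Sum>v\<in>V. u v *\<^sub>R v)"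
  using assms by (auto simp: convex_hull_finite)

lemma convex_hull_support:
  fixes V :: "'a::real_vector set"
  assumes "finite V" "W \<subseteq> V" "\<And>v. v \<in> V \<Longrightarrow> 0 \<le> u v" "sum u V = 1" "\<And>v. v \<in> V - W \<Longrightarrow> u v = 0"
  shows "(\<Sum>v\<in>V. u v *\<^sub>R v) \<in> convex hull W"
proof (rule convex_hull_finiteI[where u = u])
  show "finite W" using assms finite_subset by blast
  show "sum u W = 1"
    using assms(4) sum.mono_neutral_right[of V W u] assms by simp
  show "(\<Sum>v\<in>V. u v *\<^sub>R v) = (\<Sum>v\<in>W. u v *\<^sub>R v)"
    using assms by (intro sum.mono_neutral_right) auto
  show "0 \<le> u v" if "v \<in> W" for v using that assms by blast
qed

text \<open>Barycentric coordinates are unique and nonnegative. If a strict convex combination of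
  \<open>a\<close> and \<open>b\<close> has coordinate 0 at every vertex outside \<open>W\<close>,
  then so have \<open>a\<close> and \<open>b\<close>.\<close>

lemma face_of_affine_independent_convex_hull:
  fixes V :: "'a::real_vector set"
  assumes V: "finite V" "\<not> affine_dependent V" and W: "W \<subseteq> V"
  shows "(convex hull W) face_of (convex hull V)"
  unfolding face_of_def
proof (intro conjI ballI impI)
  show "convex hull W \<subseteq> convex hull V" using W by (rule hull_mono)
  show "convex (convex hull W)" by simp
  fix a b x assume ab: "a \<in> convex hull V" "b \<in> convex hull V" and x: "x \<in> convex hull W"
    and seg: "x \<in> open_segment a b"
  have finW: "finite W" using V W finite_subset by blast
  obtain \<alpha> where \<alpha>: "\<And>v. v \<in> V \<Longrightarrow> 0 \<le> \<alpha> v" "sum \<alpha> V = 1" "a = (\<Sum>v\<in>V. \<alpha> v *\<^sub>R v)"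
    using ab(1) V(1) by (rule convex_hull_finiteE) blast
  obtain \<beta> where \<beta>: "\<And>v. v \<in> V \<Longrightarrow> 0 \<le> \<beta> v" "sum \<beta> V = 1" "b = (\<Sum>v\<in>V. \<beta> v *\<^sub>R v)"
    using ab(2) V(1) by (rule convex_hull_finiteE) blast
  obtain \<gamma> where \<gamma>: "sum \<gamma> W = 1" "x = (\<Sum>v\<in>W. \<gamma> v *\<^sub>R v)"
    using x finW by (rule convex_hull_finiteE) blast
  obtain t where t: "0 < t" "t < 1" "x = (1 - t) *\<^sub>R a + t *\<^sub>R b"
    using seg by (auto simp: in_segment)
  define g where "g = (\<lambda>v. if v \<in> W then \<gamma> v else 0)"
  have g: "sum g V = 1" "(\<Sum>v\<in>V. g v *\<^sub>R v) = x"
  proof -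
    have "sum g V = sum \<gamma> W" "(\<Sum>v\<in>V. g v *\<^sub>R v) = (\<Sum>v\<in>W. \<gamma> v *\<^sub>R v)"
      by (rule sum.mono_neutral_cong_right; use V W in \<open>auto simp: g_def\<close>)+
    then show "sum g V = 1" "(\<Sum>v\<in>V. g v *\<^sub>R v) = x"
      using \<gamma> by auto
  qed
  have eq: "g v = (1 - t) * \<alpha> v + t * \<beta> v" if "v \<in> V" for v
  proof (rule affine_independent_unique[OF V _ _ that])
    show "sum g V = (\<Sum>v\<in>V. (1 - t) * \<alpha> v + t * \<beta> v)"
      using \<alpha> \<beta> g by (simp add: sum.distrib flip: sum_distrib_left)
    show "(\<Sum>v\<in>V. g v *\<^sub>R v) = (\<Sum>v\<in>V. ((1 - t) * \<alpha> v + t * \<beta> v) *\<^sub>R v)"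
      using t(3) \<alpha>(3) \<beta>(3) g
      by (simp add: sum.distrib scaleR_add_left scaleR_sum_right flip: scaleR_scaleR)
  qed
  have "\<alpha> v = 0 \<and> \<beta> v = 0" if "v \<in> V - W" for v
  proof -
    have "(1 - t) * \<alpha> v + t * \<beta> v = 0" using that eq[of v] by (auto simp: g_def)
    moreover have "(1 - t) * \<alpha> v \<ge> 0" "t * \<beta> v \<ge> 0" using that t \<alpha> \<beta> by auto
    ultimately have "(1 - t) * \<alpha> v = 0" "t * \<beta> v = 0" by linarith+
    then show ?thesis using t by auto
  qed
  then show "a \<in> convex hull W" "b \<in> convex hull W"
    unfolding \<alpha>(3) \<beta>(3) by (intro convex_hull_support[OF V(1) W] \<alpha> \<beta>; blast)+
qed

text \<open>Renormalizing the other coefficients gives a point \<open>y\<close> of the hull such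
  that the given point lies strictly between \<open>y\<close> and \<open>w\<close>, and a face
  contains both ends of such a segment. The segment degenerates if \<open>u w = 1\<close> or
  \<open>y = w\<close>, but then the given point is \<open>w\<close> itself.\<close>

lemma face_of_convex_hull_mem:
  fixes V :: "'a::real_vector set"
  assumes F: "F face_of (convex hull V)" and V: "finite V"
    and u: "\<And>v. v \<in> V \<Longrightarrow> 0 \<le> u v" "sum u V = 1" "(\<Sum>v\<in>V. u v *\<^sub>R v) \<in> F"
    and w: "w \<in> V" "0 < u w"
  shows "w \<in> F"
proof -
  define x where "x = (\<Sum>v\<in>V. u v *\<^sub>R v)"
  have split: "sum u (V - {w}) = 1 - u w" "x = u w *\<^sub>R w + (\<Sum>v\<in>V-{w}. u v *\<^sub>R v)"
    using sum.remove[OF V w(1), of u] sum.remove[OF V w(1), of "\<lambda>v. u v *\<^sub>R v"] u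
    by (auto simp: x_def)
  have nn: "sum u (V - {w}) \<ge> 0" using u by (intro sum_nonneg) auto
  show ?thesis
  proof (cases "u w = 1")
    case True
    then have "u v = 0" if "v \<in> V - {w}" for v
      using split(1) that u V sum_nonneg_eq_0_iff[of "V-{w}" u] by auto
    then have "x = w" using split True by auto
    then show ?thesis using u by (simp add: x_def)
  next
    case False
    then have lt: "0 < 1 - u w" using nn split by simp
    define y where "y = (\<Sum>v\<in>V-{w}. (u v / (1 - u w)) *\<^sub>R v)"
    have "y \<in> convex hull (V - {w})"
      by (rule convex_hull_finiteI[where u = "\<lambda>v. u v / (1 - u w)"])
        (use V u lt split in \<open>auto simp: y_def divide_nonneg_pos simp flip: sum_divide_distrib\<close>)
    then have y: "y \<in> convex hull V" using hull_mono[of "V-{w}" V] by blast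
    have "(1 - u w) *\<^sub>R y = (\<Sum>v\<in>V-{w}. u v *\<^sub>R v)"
      unfolding y_def using lt by (simp add: scaleR_sum_right)
    then have x: "x = (1 - u w) *\<^sub>R y + u w *\<^sub>R w" using split by simp
    show ?thesis
    proof (cases "y = w")
      case True
      then have "x = w" using x by (simp flip: scaleR_add_left)
      then show ?thesis using u by (simp add: x_def)
    next
      case False
      then have "x \<in> open_segment y w"
        using x w lt by (auto simp: in_segment)
      then show ?thesis
        using face_ofD[OF F _ y] u(3) w hull_inc[of w V] by (auto simp: x_def)
    qed
  qed
qed

lemma face_of_convex_hull_eq:
  fixes V :: "'a::real_vector set"
  assumes F: "F face_of (convex hull V)" and V: "finite V"
  shows "F = convex hull (V \<inter> F)"
proof
  have "convex F" using F face_of_def by blast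
  then show "convex hull (V \<inter> F) \<subseteq> F" by (intro hull_minimal) auto
  show "F \<subseteq> convex hull (V \<inter> F)"
  proof
    fix x assume x: "x \<in> F"
    then have "x \<in> convex hull V" using face_of_imp_subset[OF F] by blast
    then obtain u where u: "\<And>v. v \<in> V \<Longrightarrow> 0 \<le> u v" "sum u V = 1" "x = (\<Sum>v\<in>V. u v *\<^sub>R v)"
      using V by (rule convex_hull_finiteE) blast
    have "u v = 0" if "v \<in> V - V \<inter> F" for v
      using face_of_convex_hull_mem[OF F V u(1,2), of v] u that x
      by (metis DiffD1 DiffD2 IntI order_le_less)
    then show "x \<in> convex hull (V \<inter> F)"
      unfolding u(3) by (intro convex_hull_support V u) auto
  qed
qed

lemma open_simplex_subset:
  "finite V \<Longrightarrow> open_simplex V \<subseteq> convex hull (V :: 'a::real_vector set)"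
proof
  fix x assume V: "finite V" and "x \<in> open_simplex V"
  then obtain u where "\<forall>v\<in>V. 0 < u v" "sum u V = 1" "x = (\<Sum>v\<in>V. u v *\<^sub>R v)"
    by (auto simp: open_simplex_def)
  then show "x \<in> convex hull V" using V by (intro convex_hull_finiteI[where u = u]) (auto simp: less_imp_le)
qed

lemma open_simplex_nonempty:
  fixes V :: "'a::real_vector set"
  assumes "finite V" "V \<noteq> {}"
  shows "open_simplex V \<noteq> {}"
proof -
  have "(\<Sum>v\<in>V. (1 / real (card V)) *\<^sub>R v) \<in> open_simplex V"
    unfolding open_simplex_def mem_Collect_eq
    by (rule exI[where x = "\<lambda>_. 1 / real (card V)"]) (use assms in \<open>auto simp: card_gt_0_iff\<close>)
  then show ?thesis by blast
qed

lemma face_of_open_simplex: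
  fixes V :: "'a::real_vector set"
  assumes F: "F face_of (convex hull V)" and V: "finite V" and x: "x \<in> F" "x \<in> open_simplex V"
  shows "F = convex hull V"
proof -
  obtain u where u: "\<forall>v\<in>V. 0 < u v" "sum u V = 1" "x = (\<Sum>v\<in>V. u v *\<^sub>R v)"
    using x(2) by (auto simp: open_simplex_def)
  have "V \<subseteq> F"
    using face_of_convex_hull_mem[OF F V, of u] u x(1) by (auto simp: less_imp_le)
  then show ?thesis using face_of_convex_hull_eq[OF F V] by (simp add: Int_absorb2)
qed

lemma convex_hull_open_simplex:
  fixes V :: "'a::real_vector set"
  assumes "x \<in> convex hull V" and V: "finite V"
  obtains W where "W \<subseteq> V" "W \<noteq> {}" "x \<in> open_simplex W"
proof -
  obtain u where u: "\<And>v. v \<in> V \<Longrightarrow> 0 \<le> u v" "sum u V = 1" "x = (\<Sum>v\<in>V. u v *\<^sub>R v)"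
    using assms by (rule convex_hull_finiteE) blast
  let ?W = "{v\<in>V. u v > 0}"
  have eq: "sum u ?W = sum u V" "(\<Sum>v\<in>?W. u v *\<^sub>R v) = (\<Sum>v\<in>V. u v *\<^sub>R v)"
    by (rule sum.mono_neutral_left; use V u in \<open>force simp: order_le_less\<close>)+
  then have "x \<in> open_simplex ?W"
    unfolding open_simplex_def mem_Collect_eq using u by (intro exI[where x = u]) auto
  moreover have "?W \<noteq> {}"
  proof
    assume "?W = {}"
    then show False using eq(1) u(2) by (metis sum.empty zero_neq_one)
  qed
  ultimately show ?thesis using that[of ?W] by blast
qed

text \<open>Makes the vertex set a function of the simplex, so that later statements can speak of
  \<open>vertices S\<close> instead of a chosen \<open>V\<close>.\<close>

lemma vertices_convex_hull:
  fixes V :: "'a::real_vector set"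
  assumes V: "finite V" "\<not> affine_dependent V"
  shows "vertices (convex hull V) = V"
proof
  show "vertices (convex hull V) \<subseteq> V"
    using extreme_point_of_convex_hull by (auto simp: vertices_def)
  show "V \<subseteq> vertices (convex hull V)"
    using face_of_affine_independent_convex_hull[OF V, of "{v}" for v]
    by (auto simp: vertices_def simp flip: face_of_singleton)
qed

section \<open>Vertices as canonical data of a simplex\<close>

lemma simplex_in_iff:
  "simplex_in n m S \<longleftrightarrow> vertices S \<subseteq> Rn n \<and> finite (vertices S) \<and> card (vertices S) = Suc m \<and>
     \<not> affine_dependent (vertices S) \<and> S = convex hull (vertices S)"
  unfolding simplex_in_def by (metis vertices_convex_hull)

lemma rational_simplex_iff:
  "rational_simplex n m S \<longleftrightarrow> vertices S \<subseteq> Qn n \<and> finite (vertices S) \<and> card (vertices S) = Suc m \<and>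
     \<not> affine_dependent (vertices S) \<and> S = convex hull (vertices S)"
  unfolding rational_simplex_def by (metis vertices_convex_hull)

lemma regular_simplex_iff:
  "regular_simplex n m S \<longleftrightarrow>
     regular_vertices n (vertices S) \<and> card (vertices S) = Suc m \<and> S = convex hull (vertices S)"
  unfolding regular_simplex_def regular_vertices_def by (metis vertices_convex_hull)

lemma Qn_subset_Rn: "Qn n \<subseteq> Rn n"
  by (auto simp: Qn_def)

lemma rational_imp_simplex: "rational_simplex n m S \<Longrightarrow> simplex_in n m S"
  unfolding rational_simplex_def simplex_in_def using Qn_subset_Rn by blast

lemma regular_imp_rational: "regular_simplex n m S \<Longrightarrow> rational_simplex n m S"
  unfolding regular_simplex_def rational_simplex_def regular_vertices_def by blast

lemma simplex_in_unique: "simplex_in n m S \<Longrightarrow> simplex_in n' m' S \<Longrightarrow> m = m'"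
  by (simp add: simplex_in_iff)

section \<open>Direction spaces and dimension\<close>

lemma subspace_directions: "subspace (directions V)"
  unfolding subspace_def
proof (intro conjI ballI allI)
  show "0 \<in> directions V"
    unfolding directions_def by (auto intro!: exI[where x = "\<lambda>_. 0"])
  fix x y assume "x \<in> directions V" "y \<in> directions V"
  then obtain c d where "sum c V = 0" "x = (\<Sum>v\<in>V. c v *\<^sub>R v)" "sum d V = 0" "y = (\<Sum>v\<in>V. d v *\<^sub>R v)"
    by (auto simp: directions_def)
  then show "x + y \<in> directions V"
    unfolding directions_def
    by (auto simp: sum.distrib algebra_simps intro!: exI[where x = "\<lambda>v. c v + d v"])
next
  fix r x assume "x \<in> directions V"
  then obtain c where "sum c V = 0" "x = (\<Sum>v\<in>V. c v *\<^sub>R v)"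
    by (auto simp: directions_def)
  then show "r *\<^sub>R x \<in> directions V"
    unfolding directions_def
    by (auto simp: scaleR_sum_right intro!: exI[where x = "\<lambda>v. r * c v"] simp flip: sum_distrib_left)
qed

lemma diff_in_directions:
  fixes V :: "'a::real_vector set"
  assumes "x \<in> convex hull V" "y \<in> convex hull V" "finite V"
  shows "x - y \<in> directions V"
proof -
  obtain u where u: "sum u V = 1" "x = (\<Sum>v\<in>V. u v *\<^sub>R v)"
    using assms(1,3) by (rule convex_hull_finiteE) blast
  obtain w where w: "sum w V = 1" "y = (\<Sum>v\<in>V. w v *\<^sub>R v)"
    using assms(2,3) by (rule convex_hull_finiteE) blast
  show ?thesis
    unfolding directions_def using u w
    by (auto simp: sum_subtractf algebra_simps intro!: exI[where x = "\<lambda>v. u v - w v"])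
qed

lemma directions_eq_span:
  fixes V :: "'a::real_vector set"
  assumes "finite V" "a \<in> V"
  shows "directions V = span ((\<lambda>v. - a + v) ` (V - {a}))"
proof
  show "span ((\<lambda>v. - a + v) ` (V - {a})) \<subseteq> directions V"
  proof (rule span_minimal[OF _ subspace_directions])
    show "(\<lambda>v. - a + v) ` (V - {a}) \<subseteq> directions V"
      using diff_in_directions[OF _ _ assms(1), of _ a] assms by (auto simp: hull_inc)
  qed
  show "directions V \<subseteq> span ((\<lambda>v. - a + v) ` (V - {a}))"
  proof
    fix x assume "x \<in> directions V"
    then obtain c where c: "sum c V = 0" "x = (\<Sum>v\<in>V. c v *\<^sub>R v)"
      by (auto simp: directions_def)
    have "x = (\<Sum>v\<in>V. c v *\<^sub>R (- a + v))"
      using c by (simp add: algebra_simps sum_subtractf flip: scaleR_sum_left)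
    also have "\<dots> = (\<Sum>v\<in>V-{a}. c v *\<^sub>R (- a + v))"
      using assms by (simp add: sum.remove)
    also have "\<dots> \<in> span ((\<lambda>v. - a + v) ` (V - {a}))"
      by (intro span_sum span_scale span_base) auto
    finally show "x \<in> span ((\<lambda>v. - a + v) ` (V - {a}))" .
  qed
qed

lemma card_diff_image: "finite V \<Longrightarrow> a \<in> V \<Longrightarrow> card ((\<lambda>v. - a + v) ` (V - {a})) = card V - 1"
  for a :: "'a::real_vector"
  by (subst card_image) (auto simp: inj_on_def)

lemma card_le_of_directions:
  fixes V W :: "'a::real_vector set"
  assumes V: "finite V" "\<not> affine_dependent V" and W: "finite W" "W \<noteq> {}"
    and sub: "directions V \<subseteq> directions W"
  shows "card V \<le> card W"
proof (cases "V = {}")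
  case False
  then obtain a b where ab: "a \<in> V" "b \<in> W" using W by blast
  have "independent ((\<lambda>v. - a + v) ` (V - {a}))"
    using V ab affine_dependent_iff_dependent2 by blast
  moreover have "(\<lambda>v. - a + v) ` (V - {a}) \<subseteq> span ((\<lambda>v. - b + v) ` (W - {b}))"
    using sub unfolding directions_eq_span[OF V(1) ab(1)] directions_eq_span[OF W(1) ab(2)]
    by (rule order_trans[OF span_superset])
  ultimately have "card V - 1 \<le> card W - 1"
    using independent_span_bound[of "(\<lambda>v. - b + v) ` (W - {b})"] card_diff_image V W ab
    by (metis finite_Diff finite_imageI)
  moreover have "card W > 0" using W by (simp add: card_gt_0_iff)
  ultimately show ?thesis by linarith
qed simp

text \<open>If a generator of the space on the right were missing on the left, adjoining it to the
  generators on the left would give too many independent vectors.\<close>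

lemma directions_eqI:
  fixes V W :: "'a::real_vector set"
  assumes V: "finite V" "\<not> affine_dependent V" and W: "finite W" "W \<noteq> {}"
    and sub: "directions V \<subseteq> directions W" and card: "card V = card W"
  shows "directions V = directions W"
proof -
  have "card W > 0" using W by (simp add: card_gt_0_iff)
  then have "V \<noteq> {}" using card by auto
  then obtain a b where ab: "a \<in> V" "b \<in> W" using W by blast
  let ?A = "(\<lambda>v. - a + v) ` (V - {a})" and ?B = "(\<lambda>v. - b + v) ` (W - {b})"
  have i: "independent ?A"
    using V ab affine_dependent_iff_dependent2 by blast
  have s: "?A \<subseteq> span ?B"
    using sub unfolding directions_eq_span[OF V(1) ab(1)] directions_eq_span[OF W(1) ab(2)]
    by (rule order_trans[OF span_superset])
  have "?B \<subseteq> span ?A"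
  proof
    fix x assume x: "x \<in> ?B"
    show "x \<in> span ?A"
    proof (rule ccontr)
      assume n: "x \<notin> span ?A"
      then have "independent (insert x ?A)" using i by (simp add: independent_insertI)
      moreover have "insert x ?A \<subseteq> span ?B" using s span_base[OF x] by (rule insert_subsetI[rotated])
      ultimately have "card (insert x ?A) \<le> card ?B"
        using independent_span_bound[of ?B "insert x ?A"] W by blast
      moreover have "x \<notin> ?A" using n by (metis span_base)
      ultimately show False
        using card_diff_image[OF V(1) ab(1)] card_diff_image[OF W(1) ab(2)] card V by simp
    qed
  qed
  then have "span ?B \<subseteq> span ?A" by (simp add: span_minimal)
  then show ?thesis
    using directions_eq_span[OF V(1) ab(1)] directions_eq_span[OF W(1) ab(2)] sub by simp
qed

section \<open>Finite covers of simplexes\<close>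

text \<open>Take \<open>x\<close> outside all old members, hence in \<open>W\<close>, and
  \<open>y\<close> outside \<open>W\<close>. No \<open>y + k x\<close> lies in \<open>W\<close>, so
  by pigeonhole two of them share an old member, which then contains their difference and so
  \<open>x\<close>.\<close>

lemma subspace_finite_Union:
  fixes L :: "'a::real_vector set"
  assumes "finite \<W>" "subspace L" "\<And>W. W \<in> \<W> \<Longrightarrow> subspace W" "L \<subseteq> \<Union>\<W>"
  shows "\<exists>W\<in>\<W>. L \<subseteq> W"
  using assms
proof (induction \<W> rule: finite_induct)
  case empty
  then show ?case using subspace_0 by blast
next
  case (insert W \<W>)
  show ?case
  proof (cases "L \<subseteq> \<Union>\<W> \<or> L \<subseteq> W")
    case True
    then show ?thesis using insert by blast
  next
    case False
    then obtain x y where x: "x \<in> L" "x \<notin> \<Union>\<W>" and y: "y \<in> L" "y \<notin> W" by blast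
    have xW: "x \<in> W" using x insert.prems by blast
    have ex: "\<exists>U\<in>\<W>. y + real k *\<^sub>R x \<in> U" for k
    proof -
      have "y + real k *\<^sub>R x \<in> L"
        using x y insert.prems(1) by (simp add: subspace_add subspace_scale)
      moreover have "y + real k *\<^sub>R x \<notin> W"
      proof
        assume "y + real k *\<^sub>R x \<in> W"
        then have "y + real k *\<^sub>R x - real k *\<^sub>R x \<in> W"
          using xW insert.prems(2)[of W] by (intro subspace_diff subspace_scale) auto
        then show False using y by simp
      qed
      ultimately show ?thesis using insert.prems(3) by blast
    qed
    then obtain U where U: "\<And>k. U k \<in> \<W> \<and> y + real k *\<^sub>R x \<in> U k" by metis
    have "\<not> inj U"
    proof
      assume "inj U"
      moreover have "range U \<subseteq> \<W>" using U by blast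
      ultimately show False using insert.hyps(1) finite_subset finite_imageD infinite_UNIV_nat by blast
    qed
    then obtain j k where jk: "j \<noteq> k" "U j = U k" by (auto simp: inj_def)
    have sub: "subspace (U j)" using U insert.prems(2) by blast
    have "(y + real j *\<^sub>R x) - (y + real k *\<^sub>R x) \<in> U j"
      using U[of j] U[of k] jk by (intro subspace_diff[OF sub]) auto
    then have "(real j - real k) *\<^sub>R x \<in> U j" by (simp add: algebra_simps)
    then have "(1 / (real j - real k)) *\<^sub>R ((real j - real k) *\<^sub>R x) \<in> U j"
      by (rule subspace_scale[OF sub])
    then have "x \<in> U j" using jk by simp
    then show ?thesis using x U by blast
  qed
qed

text \<open>Otherwise every member is missed on an initial interval, and the shortest of these
  finitely many intervals contradicts the covering. In the applications \<open>p\<close> runs along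
  a segment as \<open>t\<close> tends to 0.\<close>

lemma frequently_in_member:
  fixes p :: "real \<Rightarrow> 'a"
  assumes "finite \<T>" "e > 0" "\<And>t. 0 < t \<Longrightarrow> t \<le> e \<Longrightarrow> \<exists>T\<in>\<T>. p t \<in> T"
  shows "\<exists>T\<in>\<T>. \<forall>e>0. \<exists>t. 0 < t \<and> t < e \<and> p t \<in> T"
proof (rule ccontr)
  assume "\<not> ?thesis"
  then have "\<forall>T\<in>\<T>. \<exists>e>0. \<forall>t. 0 < t \<and> t < e \<longrightarrow> p t \<notin> T" by blast
  then obtain f where f: "\<And>T. T \<in> \<T> \<Longrightarrow> f T > 0 \<and> (\<forall>t. 0 < t \<and> t < f T \<longrightarrow> p t \<notin> T)" by metis
  define m where "m = Min (insert e (f ` \<T>))"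
  have m: "m > 0" "m \<le> e" "\<And>T. T \<in> \<T> \<Longrightarrow> m \<le> f T"
    using assms f by (auto simp: m_def)
  obtain T where "T \<in> \<T>" "p (m/2) \<in> T" using assms(3)[of "m/2"] m by auto
  moreover have "m / 2 < f T" using m(1) m(3)[OF calculation(1)] by linarith
  ultimately show False using f[of T] m(1) by auto
qed

text \<open>Simplexes are closed along lines; this replaces all topological arguments on the infinite
  dimensional ambient space.\<close>

lemma simplex_closed_along_line:
  fixes V :: "'a::real_vector set"
  assumes V: "finite V" "\<not> affine_dependent V"
    and freq: "\<forall>e>0. \<exists>t. 0 < t \<and> t < e \<and> x + t *\<^sub>R u \<in> convex hull V"
  shows "x \<in> convex hull V"
proof -
  obtain s where s: "0 < s" "x + s *\<^sub>R u \<in> convex hull V" using freq[rule_format, of 1] by auto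
  obtain r where r: "0 < r" "r < s" "x + r *\<^sub>R u \<in> convex hull V" using freq[rule_format, of s] s(1) by auto
  obtain \<alpha> where \<alpha>: "sum \<alpha> V = 1" "x + s *\<^sub>R u = (\<Sum>v\<in>V. \<alpha> v *\<^sub>R v)"
    using s(2) V(1) by (rule convex_hull_finiteE) blast
  obtain \<beta> where \<beta>: "sum \<beta> V = 1" "x + r *\<^sub>R u = (\<Sum>v\<in>V. \<beta> v *\<^sub>R v)"
    using r(3) V(1) by (rule convex_hull_finiteE) blast
  \<comment> \<open>Two sample points determine the barycentric coordinates along the whole line: at
    parameter \<open>t\<close> they are \<open>g + t c\<close>.\<close>
  define c where "c = (\<lambda>v. (\<alpha> v - \<beta> v) / (s - r))"
  define g where "g = (\<lambda>v. \<alpha> v - s * c v)"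
  have c: "sum c V = 0"
    using \<alpha> \<beta> by (simp add: c_def sum_subtractf flip: sum_divide_distrib)
  have "(s - r) *\<^sub>R (\<Sum>v\<in>V. c v *\<^sub>R v) = (x + s *\<^sub>R u) - (x + r *\<^sub>R u)"
    unfolding \<alpha>(2) \<beta>(2) using r by (simp add: c_def scaleR_sum_right sum_subtractf scaleR_diff_left)
  also have "\<dots> = (s - r) *\<^sub>R u" by (simp add: algebra_simps)
  finally have u: "(\<Sum>v\<in>V. c v *\<^sub>R v) = u" using r by simp
  have g: "sum g V = 1" "(\<Sum>v\<in>V. g v *\<^sub>R v) = x"
  proof -
    show "sum g V = 1" using \<alpha> c by (simp add: g_def sum_subtractf flip: sum_distrib_left)
    have "(\<Sum>v\<in>V. g v *\<^sub>R v) = (x + s *\<^sub>R u) - s *\<^sub>R u"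
      unfolding \<alpha>(2) unfolding u[symmetric]
      by (simp add: g_def sum_subtractf scaleR_sum_right scaleR_diff_left)
    then show "(\<Sum>v\<in>V. g v *\<^sub>R v) = x" by simp
  qed
  have "g v \<ge> 0" if v: "v \<in> V" for v
  proof (rule ccontr)
    assume "\<not> 0 \<le> g v"
    \<comment> \<open>Below this bound \<open>g v + t c v\<close> stays negative. The added 1 avoids
      division by zero.\<close>
    then have "0 < - g v / (\<bar>c v\<bar> + 1)" by (simp add: divide_neg_pos)
    then obtain t where t: "0 < t" "t < - g v / (\<bar>c v\<bar> + 1)" "x + t *\<^sub>R u \<in> convex hull V"
      using freq by blast
    obtain \<gamma> where \<gamma>: "\<And>v. v \<in> V \<Longrightarrow> 0 \<le> \<gamma> v" "sum \<gamma> V = 1" "x + t *\<^sub>R u = (\<Sum>v\<in>V. \<gamma> v *\<^sub>R v)"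
      using t(3) V(1) by (rule convex_hull_finiteE) blast
    have "\<gamma> v = g v + t * c v"
    proof (rule affine_independent_unique[OF V _ _ v])
      show "sum \<gamma> V = (\<Sum>v\<in>V. g v + t * c v)"
        using \<gamma> g c by (simp add: sum.distrib flip: sum_distrib_left)
      show "(\<Sum>v\<in>V. \<gamma> v *\<^sub>R v) = (\<Sum>v\<in>V. (g v + t * c v) *\<^sub>R v)"
        unfolding \<gamma>(3)[symmetric] g(2)[symmetric] u[symmetric]
        by (simp add: sum.distrib scaleR_sum_right algebra_simps)
    qed
    moreover have "t * c v \<le> t * \<bar>c v\<bar>" using t by simp
    moreover have "t * (\<bar>c v\<bar> + 1) < - g v"
      using t(2) by (subst (asm) pos_less_divide_eq) auto
    then have "t * \<bar>c v\<bar> + t < - g v" by (simp add: algebra_simps)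
    ultimately show False using \<gamma>(1)[OF v] t(1) by linarith
  qed
  then show ?thesis using g V by (intro convex_hull_finiteI[where u = g]) auto
qed

lemma open_simplex_small_move:
  fixes V :: "'a::real_vector set"
  assumes V: "finite V" and x: "x \<in> open_simplex V" and u: "u \<in> directions V"
  shows "\<exists>e>0. \<forall>t. \<bar>t\<bar> \<le> e \<longrightarrow> x + t *\<^sub>R u \<in> open_simplex V"
proof -
  obtain a where a: "\<forall>v\<in>V. 0 < a v" "sum a V = 1" "x = (\<Sum>v\<in>V. a v *\<^sub>R v)"
    using x by (auto simp: open_simplex_def)
  obtain c where c: "sum c V = 0" "u = (\<Sum>v\<in>V. c v *\<^sub>R v)"
    using u by (auto simp: directions_def)
  \<comment> \<open>A move of size at most \<open>e\<close> changes each coordinate by less than its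
    value. The inserted 1 keeps the argument of \<open>Min\<close> nonempty.\<close>
  define e where "e = Min (insert 1 ((\<lambda>v. a v / (\<bar>c v\<bar> + 1)) ` V))"
  have e: "e > 0" "\<And>v. v \<in> V \<Longrightarrow> e \<le> a v / (\<bar>c v\<bar> + 1)"
    using V a by (auto simp: e_def)
  have "x + t *\<^sub>R u \<in> open_simplex V" if t: "\<bar>t\<bar> \<le> e" for t
    unfolding open_simplex_def mem_Collect_eq
  proof (intro exI[where x = "\<lambda>v. a v + t * c v"] conjI ballI)
    show "x + t *\<^sub>R u = (\<Sum>v\<in>V. (a v + t * c v) *\<^sub>R v)"
      unfolding a(3) c(2) by (simp add: sum.distrib scaleR_sum_right algebra_simps)
    show "(\<Sum>v\<in>V. a v + t * c v) = 1"
      using a c by (simp add: sum.distrib flip: sum_distrib_left)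
    fix v assume v: "v \<in> V"
    have "e * (\<bar>c v\<bar> + 1) \<le> a v"
      using e(2)[OF v] by (simp add: pos_le_divide_eq)
    moreover have "\<bar>t * c v\<bar> \<le> e * \<bar>c v\<bar>" using t by (simp add: abs_mult mult_right_mono)
    moreover have "e * (\<bar>c v\<bar> + 1) > e * \<bar>c v\<bar>" using e(1) by simp
    ultimately show "0 < a v + t * c v" by linarith
  qed
  then show ?thesis using e(1) by blast
qed

text \<open>Every direction \<open>u\<close> at \<open>x\<close> is followed at arbitrarily small
  times by one simplex of the cover; that simplex is closed along the line, so it contains
  \<open>x\<close> and has \<open>u\<close> among its directions. Thus finitely many direction
  spaces cover \<open>directions V\<close>, and one of them must contain it. This takes the place of
  a category argument.\<close>

lemma tangent_cover:
  fixes V :: "'a::real_vector set"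
  assumes V: "finite V" "x \<in> open_simplex V" "convex hull V \<subseteq> \<Union>\<T>"
    and T: "finite \<T>" "\<And>T. T \<in> \<T> \<Longrightarrow> finite (vertices T) \<and> \<not> affine_dependent (vertices T) \<and> T = convex hull (vertices T)"
  shows "\<exists>T\<in>\<T>. x \<in> T \<and> directions V \<subseteq> directions (vertices T)"
proof -
  have "\<exists>T\<in>\<T>. x \<in> T \<and> u \<in> directions (vertices T)" if u: "u \<in> directions V" for u
  proof -
    obtain e where e: "e > 0" "\<And>t. \<bar>t\<bar> \<le> e \<Longrightarrow> x + t *\<^sub>R u \<in> open_simplex V"
      using open_simplex_small_move[OF V(1,2) u] by blast
    have "\<exists>T\<in>\<T>. \<forall>e>0. \<exists>t. 0 < t \<and> t < e \<and> x + t *\<^sub>R u \<in> T"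
    proof (rule frequently_in_member[OF T(1) e(1)])
      fix t assume "0 < t" "t \<le> e"
      then show "\<exists>T\<in>\<T>. x + t *\<^sub>R u \<in> T"
        using e(2)[of t] open_simplex_subset[OF V(1)] V(3) by auto
    qed
    then obtain T where T': "T \<in> \<T>" "\<forall>e>0. \<exists>t. 0 < t \<and> t < e \<and> x + t *\<^sub>R u \<in> T" by blast
    let ?W = "vertices T"
    have W: "finite ?W" "\<not> affine_dependent ?W" "T = convex hull ?W" using T(2)[OF T'(1)] by auto
    have x: "x \<in> convex hull ?W"
      using simplex_closed_along_line[OF W(1,2), of x u] T'(2) W(3) by metis
    obtain t where t: "0 < t" "x + t *\<^sub>R u \<in> convex hull ?W"
      using T'(2)[rule_format, of 1] W(3) by auto
    have "(1/t) *\<^sub>R (x + t *\<^sub>R u - x) \<in> directions ?W"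
      by (intro subspace_scale subspace_directions diff_in_directions t x W)
    then have "u \<in> directions ?W" using t by simp
    then show ?thesis using T'(1) x W(3) by auto
  qed
  then have "directions V \<subseteq> \<Union>((\<lambda>T. directions (vertices T)) ` {T\<in>\<T>. x \<in> T})" by blast
  then have "\<exists>W\<in>(\<lambda>T. directions (vertices T)) ` {T\<in>\<T>. x \<in> T}. directions V \<subseteq> W"
    using T(1) subspace_directions by (intro subspace_finite_Union) auto
  then show ?thesis by blast
qed

section \<open>Simplicial complexes\<close>

lemma complexD:
  assumes "simplicial_complex_in n \<Delta>"
  shows "finite \<Delta>"
    and "S \<in> \<Delta> \<Longrightarrow> \<exists>m. simplex_in n m S"
    and "S \<in> \<Delta> \<Longrightarrow> finite (vertices S)"
    and "S \<in> \<Delta> \<Longrightarrow> \<not> affine_dependent (vertices S)"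
    and "S \<in> \<Delta> \<Longrightarrow> convex hull (vertices S) = S"
    and "S \<in> \<Delta> \<Longrightarrow> vertices S \<noteq> {}"
    and "S \<in> \<Delta> \<Longrightarrow> vertices S \<subseteq> Rn n"
    and "S \<in> \<Delta> \<Longrightarrow> F face_of S \<Longrightarrow> F \<noteq> {} \<Longrightarrow> F \<in> \<Delta>"
    and "S \<in> \<Delta> \<Longrightarrow> T \<in> \<Delta> \<Longrightarrow> (S \<inter> T) face_of S"
    and "S \<in> \<Delta> \<Longrightarrow> T \<in> \<Delta> \<Longrightarrow> (S \<inter> T) face_of T"
proof -
  have \<Delta>: "finite \<Delta>" "\<And>S. S \<in> \<Delta> \<Longrightarrow> \<exists>m. simplex_in n m S"
    "\<And>S F. S \<in> \<Delta> \<Longrightarrow> F face_of S \<Longrightarrow> F \<noteq> {} \<Longrightarrow> F \<in> \<Delta>"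
    "\<And>S T. S \<in> \<Delta> \<Longrightarrow> T \<in> \<Delta> \<Longrightarrow> (S \<inter> T) face_of S \<and> (S \<inter> T) face_of T"
    using assms unfolding simplicial_complex_in_def by auto
  show "finite \<Delta>" by fact
  show "S \<in> \<Delta> \<Longrightarrow> F face_of S \<Longrightarrow> F \<noteq> {} \<Longrightarrow> F \<in> \<Delta>" by (rule \<Delta>(3))
  show "S \<in> \<Delta> \<Longrightarrow> T \<in> \<Delta> \<Longrightarrow> (S \<inter> T) face_of S" "S \<in> \<Delta> \<Longrightarrow> T \<in> \<Delta> \<Longrightarrow> (S \<inter> T) face_of T"
    using \<Delta>(4) by auto
  assume "S \<in> \<Delta>"
  then show "\<exists>m. simplex_in n m S" by (rule \<Delta>(2))
  then obtain m where m: "simplex_in n m S" by blast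
  then show "finite (vertices S)" "\<not> affine_dependent (vertices S)" "convex hull (vertices S) = S"
    "vertices S \<noteq> {}" "vertices S \<subseteq> Rn n"
    by (auto simp: simplex_in_iff)
qed

lemma subcomplex:
  assumes "simplicial_complex_in n \<Delta>"
  shows "simplicial_complex_in n {T\<in>\<Delta>. T \<subseteq> P}"
  unfolding simplicial_complex_in_def
proof (intro conjI ballI allI impI)
  note D = complexD[OF assms]
  show "finite {T\<in>\<Delta>. T \<subseteq> P}" using D(1) by simp
  fix S assume S: "S \<in> {T\<in>\<Delta>. T \<subseteq> P}"
  then show "\<exists>m. simplex_in n m S" using D(2) by simp
  show "F \<in> {T\<in>\<Delta>. T \<subseteq> P}" if "F face_of S \<and> F \<noteq> {}" for F
    using D(8)[of S F] face_of_imp_subset[of F S] that S by auto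
  show "S \<inter> T face_of S" "S \<inter> T face_of T" if "T \<in> {T\<in>\<Delta>. T \<subseteq> P}" for T
    using D(9,10)[of S T] that S by auto
qed

text \<open>\<open>S \<inter> T\<close> is a face of \<open>S\<close> that meets its relative
  interior, so it is all of \<open>S\<close>.\<close>

lemma complex_subset_of_open_simplex:
  assumes \<Delta>: "simplicial_complex_in n \<Delta>" "S \<in> \<Delta>" "T \<in> \<Delta>"
    and x: "x \<in> open_simplex (vertices S)" "x \<in> T"
  shows "S \<subseteq> T"
proof -
  have "x \<in> S" using open_simplex_subset[of "vertices S"] complexD[OF \<Delta>(1)] \<Delta>(2) x by blast
  then have "S \<inter> T = S"
    using face_of_open_simplex[of "S \<inter> T" "vertices S" x] complexD[OF \<Delta>(1)] \<Delta> x by simp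
  then show ?thesis by blast
qed

text \<open>The relatively open simplexes partition the support (a vertex is its own open simplex),
  which later turns counting over a complex into a sum over its members.\<close>

lemma complex_carrier:
  assumes \<Delta>: "simplicial_complex_in n \<Delta>" and x: "x \<in> \<Union>\<Delta>"
  shows "\<exists>!S. S \<in> \<Delta> \<and> x \<in> open_simplex (vertices S)"
proof -
  obtain T where T: "T \<in> \<Delta>" "x \<in> T" using x by blast
  note D = complexD[OF \<Delta>]
  obtain W where W: "W \<subseteq> vertices T" "W \<noteq> {}" "x \<in> open_simplex W"
    using convex_hull_open_simplex[of x "vertices T"] T D(3,5)[OF T(1)] by metis
  have finW: "finite W" using W D(3) T finite_subset by blast
  have "(convex hull W) face_of T"
    using face_of_affine_independent_convex_hull[OF D(3,4)[OF T(1)] W(1)] D(5)[OF T(1)] by simp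
  then have "convex hull W \<in> \<Delta>" using D(8)[OF T(1)] W by simp
  moreover have "vertices (convex hull W) = W"
    using vertices_convex_hull finW affine_independent_subset[OF D(4)[OF T(1)] W(1)] by blast
  ultimately have "convex hull W \<in> \<Delta> \<and> x \<in> open_simplex (vertices (convex hull W))"
    using W by simp
  moreover have "S = S'" if "S \<in> \<Delta> \<and> x \<in> open_simplex (vertices S)"
    "S' \<in> \<Delta> \<and> x \<in> open_simplex (vertices S')" for S S'
  proof -
    have "x \<in> S" "x \<in> S'" using that D(3,5) open_simplex_subset by blast+
    then show ?thesis using complex_subset_of_open_simplex[OF \<Delta>] that by blast
  qed
  ultimately show ?thesis by (intro ex_ex1I) blast+
qed

lemma simplex_in_complex_iff:
  assumes "simplicial_complex_in n \<Delta>" "T \<in> \<Delta>"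
  shows "simplex_in n d T \<longleftrightarrow> card (vertices T) = Suc d"
  using complexD[OF assms(1)] assms(2) by (auto simp: simplex_in_iff)

lemma complex_face_eq:
  assumes \<Delta>: "simplicial_complex_in n \<Delta>" "T \<in> \<Delta>" "S \<in> \<Delta>" "T \<subseteq> S" "card (vertices S) \<le> card (vertices T)"
  shows "T = S"
proof -
  note D = complexD[OF \<Delta>(1)]
  have "T face_of S" using D(10)[OF \<Delta>(2,3)] \<Delta>(4) by (simp add: Int_absorb2)
  then have "vertices T \<subseteq> vertices S" using extreme_point_of_face by (auto simp: vertices_def)
  then have "vertices T = vertices S" using D(3) \<Delta> by (simp add: card_seteq)
  then show ?thesis using D(5) \<Delta> by metis
qed

section \<open>Independence of the chosen triangulation\<close>

text \<open>Near a relative interior point \<open>x\<close> of a maximal simplex \<open>S\<close>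
  the support is just \<open>S\<close>. Hence every \<open>T\<close> through \<open>x\<close> in the
  other complex has its directions inside those of \<open>S\<close>, while
  \<open>tangent_cover\<close> finds one that has all of them; that one has dimension
  \<open>d\<close> and is maximal. By symmetry the \<open>d\<close>-dimensional part does not depend
  on the triangulation.\<close>

lemma maximal_simplexes_subset_Union:
  assumes \<Delta>: "simplicial_complex_in n \<Delta>" and \<Delta>': "simplicial_complex_in n \<Delta>'" and eq: "\<Union>\<Delta> = \<Union>\<Delta>'"
  shows "\<Union>(maximal_simplexes n \<Delta> d) \<subseteq> \<Union>(maximal_simplexes n \<Delta>' d)"
proof
  fix z assume "z \<in> \<Union>(maximal_simplexes n \<Delta> d)"
  then obtain S where S: "S \<in> \<Delta>" "simplex_in n d S" "\<And>T. T \<in> \<Delta> \<Longrightarrow> S \<subseteq> T \<Longrightarrow> T = S" and z: "z \<in> S"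
    by (auto simp: maximal_simplexes_def)
  note D = complexD[OF \<Delta>] and D' = complexD[OF \<Delta>']
  let ?V = "vertices S"
  note V = D(3,4,5,6)[OF S(1)]
  have key: "\<exists>T\<in>maximal_simplexes n \<Delta>' d. x \<in> T" if x: "x \<in> open_simplex ?V" for x
  proof -
    \<comment> \<open>A segment from \<open>x\<close> into \<open>T\<close> meets some
      \<open>S'\<close> arbitrarily close to \<open>x\<close>, so \<open>S'\<close> contains
      \<open>x\<close>; as \<open>x\<close> is interior to \<open>S\<close>, maximality of
      \<open>S\<close> gives \<open>S' = S\<close>.\<close>
    have upper: "directions (vertices T) \<subseteq> directions ?V" if T: "T \<in> \<Delta>'" "x \<in> T" for T
    proof -
      have "y - x \<in> directions ?V" if y: "y \<in> T" for y
      proof -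
        have "\<exists>S'\<in>\<Delta>. \<forall>e>0. \<exists>t. 0 < t \<and> t < e \<and> x + t *\<^sub>R (y - x) \<in> S'"
        proof (rule frequently_in_member[OF D(1), of 1])
          show "0 < (1::real)" by simp
          fix t :: real assume t: "0 < t" "t \<le> 1"
          have "convex T" using D'(5)[OF T(1)] convex_convex_hull by metis
          then have "(1 - t) *\<^sub>R x + t *\<^sub>R y \<in> T" using T y t by (simp add: convexD)
          moreover have "(1 - t) *\<^sub>R x + t *\<^sub>R y = x + t *\<^sub>R (y - x)" by (simp add: algebra_simps)
          ultimately show "\<exists>S'\<in>\<Delta>. x + t *\<^sub>R (y - x) \<in> S'" using T eq by auto
        qed
        then obtain S' where S': "S' \<in> \<Delta>" "\<forall>e>0. \<exists>t. 0 < t \<and> t < e \<and> x + t *\<^sub>R (y - x) \<in> S'"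
          by blast
        have "x \<in> S'"
          using simplex_closed_along_line[OF D(3,4)[OF S'(1)], of x "y - x"] S'(2) D(5)[OF S'(1)] by metis
        then have "S' = S" using complex_subset_of_open_simplex[OF \<Delta> S(1) S'(1) x] S(3) S'(1) by blast
        then obtain t where t: "0 < t" "x + t *\<^sub>R (y - x) \<in> S" using S'(2)[rule_format, of 1] by auto
        have "x \<in> convex hull ?V" using x open_simplex_subset V by blast
        then have "(1/t) *\<^sub>R (x + t *\<^sub>R (y - x) - x) \<in> directions ?V"
          using t V by (intro subspace_scale subspace_directions diff_in_directions) auto
        then show ?thesis using t by simp
      qed
      note * = this
      obtain b where b: "b \<in> vertices T" using D'(6)[OF T(1)] by blast
      have inT: "v \<in> T" if "v \<in> vertices T" for v using that D'(5)[OF T(1)] hull_inc by metis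
      have "- b + v \<in> directions ?V" if "v \<in> vertices T" for v
        using subspace_diff[OF subspace_directions *[OF inT[OF that]] *[OF inT[OF b]]] by simp
      then show ?thesis
        unfolding directions_eq_span[OF D'(3)[OF T(1)] b]
        by (intro span_minimal subspace_directions) auto
    qed
    have "convex hull ?V \<subseteq> \<Union>\<Delta>'" using V S eq by auto
    then obtain T where T: "T \<in> \<Delta>'" "x \<in> T" "directions ?V \<subseteq> directions (vertices T)"
      using tangent_cover[OF V(1) x, of \<Delta>'] D' by blast
    have "card ?V \<le> card (vertices T)"
      using card_le_of_directions[OF V(1,2) D'(3,6)[OF T(1) ] T(3)] T(1) by simp
    have le: "card (vertices T') \<le> card ?V" if "T' \<in> \<Delta>'" "x \<in> T'" for T'
      using card_le_of_directions[OF D'(3,4)[OF that(1)] V(1,4)] upper[OF that] by blast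
    have "card (vertices T) = Suc d"
      using le[OF T(1,2)] \<open>card ?V \<le> _\<close> S(2) by (simp add: simplex_in_iff)
    moreover have "T' = T" if T': "T' \<in> \<Delta>'" "T \<subseteq> T'" for T'
      using complex_face_eq[OF \<Delta>' T(1) T'] le[of T'] T' T \<open>card ?V \<le> _\<close> by (metis dual_order.trans subsetD)
    ultimately have "T \<in> maximal_simplexes n \<Delta>' d"
      using T(1) simplex_in_complex_iff[OF \<Delta>' T(1)] by (auto simp: maximal_simplexes_def)
    then show ?thesis using T by blast
  qed
  \<comment> \<open>An arbitrary point \<open>z\<close> of \<open>S\<close> is approached along the
    segment from the interior point \<open>x\<close>: all points with \<open>t > 0\<close> are
    interior, and one maximal \<open>T\<close> catches them for arbitrarily small
    \<open>t\<close>.\<close>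
  obtain x where x: "x \<in> open_simplex ?V" using open_simplex_nonempty[OF V(1,4)] by auto
  have fin: "finite (maximal_simplexes n \<Delta>' d)" using D'(1) by (simp add: maximal_simplexes_def)
  have "\<exists>T\<in>maximal_simplexes n \<Delta>' d. \<forall>e>0. \<exists>t. 0 < t \<and> t < e \<and> z + t *\<^sub>R (x - z) \<in> T"
  proof (rule frequently_in_member[OF fin, of 1])
    show "0 < (1::real)" by simp
    fix t :: real assume t: "0 < t" "t \<le> 1"
    obtain a where a: "\<forall>v\<in>?V. 0 < a v" "sum a ?V = 1" "x = (\<Sum>v\<in>?V. a v *\<^sub>R v)"
      using x by (auto simp: open_simplex_def)
    obtain b where b: "\<And>v. v \<in> ?V \<Longrightarrow> 0 \<le> b v" "sum b ?V = 1" "z = (\<Sum>v\<in>?V. b v *\<^sub>R v)"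
      using convex_hull_finiteE[of z ?V] z V(1,3) by auto
    have "z + t *\<^sub>R (x - z) = (\<Sum>v\<in>?V. ((1 - t) * b v + t * a v) *\<^sub>R v)"
      unfolding a(3) b(3) by (simp add: sum.distrib sum_subtractf scaleR_sum_right algebra_simps)
    moreover have "(\<Sum>v\<in>?V. (1 - t) * b v + t * a v) = 1"
      using a b by (simp add: sum.distrib flip: sum_distrib_left)
    moreover have "0 < (1 - t) * b v + t * a v" if "v \<in> ?V" for v
      using that a b t by (simp add: add_nonneg_pos)
    ultimately have "z + t *\<^sub>R (x - z) \<in> open_simplex ?V"
      unfolding open_simplex_def mem_Collect_eq
      by (intro exI[where x = "\<lambda>v. (1 - t) * b v + t * a v"]) simp
    then show "\<exists>T\<in>maximal_simplexes n \<Delta>' d. z + t *\<^sub>R (x - z) \<in> T" by (rule key)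
  qed
  then obtain T where T: "T \<in> maximal_simplexes n \<Delta>' d" "\<forall>e>0. \<exists>t. 0 < t \<and> t < e \<and> z + t *\<^sub>R (x - z) \<in> T"
    by blast
  have "T \<in> \<Delta>'" using T(1) by (simp add: maximal_simplexes_def)
  then have "z \<in> T"
    using simplex_closed_along_line[OF D'(3,4), of T z "x - z"] T(2) D'(5)[of T] by metis
  then show "z \<in> \<Union>(maximal_simplexes n \<Delta>' d)" using T(1) by blast
qed

lemma dim_part_eq:
  assumes "triangulates n \<Delta> P"
  shows "dim_part n d P = \<Union>(maximal_simplexes n \<Delta> d)"
proof -
  have "triangulates n (SOME \<Delta>. triangulates n \<Delta> P) P" using assms by (rule someI)
  then show ?thesis
    unfolding dim_part_def using assms maximal_simplexes_subset_Union
    unfolding triangulates_def by (metis subset_antisym)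
qed

text \<open>By \<open>tangent_cover\<close> the directions of any simplex inside the support lie
  among those of one member, so a single triangulation bounds all dimensions.\<close>

lemma dim_at_most_iff:
  assumes "triangulates n \<Delta> P"
  shows "dim_at_most n d P \<longleftrightarrow> (\<forall>T\<in>\<Delta>. card (vertices T) \<le> Suc d)"
proof
  have \<Delta>: "simplicial_complex_in n \<Delta>" "\<Union>\<Delta> = P" using assms by (auto simp: triangulates_def)
  note D = complexD[OF \<Delta>(1)]
  show "\<forall>T\<in>\<Delta>. card (vertices T) \<le> Suc d" if "dim_at_most n d P"
  proof
    fix T assume T: "T \<in> \<Delta>"
    obtain m where "simplex_in n m T" using D(2)[OF T] by blast
    moreover have "m \<le> d" using that \<Delta>(2) T calculation unfolding dim_at_most_def by blast
    ultimately show "card (vertices T) \<le> Suc d" by (simp add: simplex_in_iff)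
  qed
  show "dim_at_most n d P" if le: "\<forall>T\<in>\<Delta>. card (vertices T) \<le> Suc d"
    unfolding dim_at_most_def
  proof (intro allI impI, elim conjE)
    fix m S assume S: "simplex_in n m S" "S \<subseteq> P"
    let ?V = "vertices S"
    have V: "finite ?V" "\<not> affine_dependent ?V" "S = convex hull ?V" "card ?V = Suc m"
      using S(1) by (auto simp: simplex_in_iff)
    then have "?V \<noteq> {}" by auto
    then obtain x where x: "x \<in> open_simplex ?V" using open_simplex_nonempty[OF V(1)] by auto
    have "convex hull ?V \<subseteq> \<Union>\<Delta>" using S V \<Delta> by simp
    then obtain T where "T \<in> \<Delta>" "directions ?V \<subseteq> directions (vertices T)"
      using tangent_cover[OF V(1) x, of \<Delta>] D by blast
    then have "card ?V \<le> card (vertices T)"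
      using card_le_of_directions[OF V(1,2) D(3,6)] by simp
    also have "\<dots> \<le> Suc d" using le \<open>T \<in> \<Delta>\<close> by blast
    finally show "m \<le> d" using V by simp
  qed
qed

lemma maximal_simplexes_top:
  assumes \<Delta>: "simplicial_complex_in n \<Delta>" and le: "\<forall>T\<in>\<Delta>. card (vertices T) \<le> Suc d"
  shows "maximal_simplexes n \<Delta> d = {T\<in>\<Delta>. card (vertices T) = Suc d}"
  using complex_face_eq[OF \<Delta>] simplex_in_complex_iff[OF \<Delta>] le
  by (auto simp: maximal_simplexes_def) (metis subsetD)

lemma dim_part_complex:
  fixes n d :: nat
  assumes \<Delta>: "simplicial_complex_in n \<Delta>"
  defines "\<Delta>' \<equiv> {T\<in>\<Delta>. T \<subseteq> \<Union>(maximal_simplexes n \<Delta> d)}"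
  shows "triangulates n \<Delta>' (\<Union>(maximal_simplexes n \<Delta> d))"
    and "\<forall>T\<in>\<Delta>'. card (vertices T) \<le> Suc d"
    and "maximal_simplexes n \<Delta>' d = maximal_simplexes n \<Delta> d"
proof -
  note D = complexD[OF \<Delta>]
  have sub: "maximal_simplexes n \<Delta> d \<subseteq> \<Delta>'" by (auto simp: \<Delta>'_def maximal_simplexes_def)
  have c: "simplicial_complex_in n \<Delta>'" unfolding \<Delta>'_def by (rule subcomplex[OF \<Delta>])
  then show "triangulates n \<Delta>' (\<Union>(maximal_simplexes n \<Delta> d))"
    using sub by (auto simp: triangulates_def \<Delta>'_def)
  \<comment> \<open>A member inside the union lies inside a single maximal simplex, namely one that
    contains a relative interior point of it.\<close>
  have face: "\<exists>S\<in>maximal_simplexes n \<Delta> d. T \<subseteq> S" if T: "T \<in> \<Delta>'" for T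
  proof -
    have T\<Delta>: "T \<in> \<Delta>" using T by (simp add: \<Delta>'_def)
    obtain x where x: "x \<in> open_simplex (vertices T)"
      using open_simplex_nonempty[OF D(3,6)] T\<Delta> by auto
    then have "x \<in> T" using open_simplex_subset[OF D(3)] D(5) T\<Delta> by blast
    then obtain S where S: "S \<in> maximal_simplexes n \<Delta> d" "x \<in> S" using T by (auto simp: \<Delta>'_def)
    have "S \<in> \<Delta>" using S by (simp add: maximal_simplexes_def)
    then show ?thesis using complex_subset_of_open_simplex[OF \<Delta> T\<Delta> _ x S(2)] S(1) by blast
  qed
  have vsub: "vertices T \<subseteq> vertices S" if "T \<in> \<Delta>" "S \<in> \<Delta>" "T \<subseteq> S" for T S
  proof -
    have "T face_of S" using D(10)[OF that(1,2)] that(3) by (simp add: Int_absorb2)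
    then show ?thesis using extreme_point_of_face by (auto simp: vertices_def)
  qed
  show le: "\<forall>T\<in>\<Delta>'. card (vertices T) \<le> Suc d"
  proof
    fix T assume T: "T \<in> \<Delta>'"
    obtain S where S: "S \<in> maximal_simplexes n \<Delta> d" "T \<subseteq> S" using face[OF T] by blast
    then have "S \<in> \<Delta>" "card (vertices S) = Suc d" by (auto simp: maximal_simplexes_def simplex_in_iff)
    then show "card (vertices T) \<le> Suc d"
      using card_mono[OF D(3) vsub, of S T] S T by (auto simp: \<Delta>'_def)
  qed
  show "maximal_simplexes n \<Delta>' d = maximal_simplexes n \<Delta> d"
  proof
    show "maximal_simplexes n \<Delta> d \<subseteq> maximal_simplexes n \<Delta>' d"
      using sub by (auto simp: maximal_simplexes_def \<Delta>'_def)
    show "maximal_simplexes n \<Delta>' d \<subseteq> maximal_simplexes n \<Delta> d"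
    proof
      fix T assume "T \<in> maximal_simplexes n \<Delta>' d"
      then have T: "T \<in> \<Delta>'" "\<And>S. S \<in> \<Delta>' \<Longrightarrow> T \<subseteq> S \<Longrightarrow> S = T" by (auto simp: maximal_simplexes_def)
      then show "T \<in> maximal_simplexes n \<Delta> d" using face[OF T(1)] sub by blast
    qed
  qed
qed

section \<open>Lattice bases and integral forms\<close>

lemma lookup_scaleR [simp]: "Poly_Mapping.lookup (r *\<^sub>R x) i = r *\<^sub>R Poly_Mapping.lookup x i"
  for x :: "'a \<Rightarrow>\<^sub>0 'b::real_vector"
proof -
  have "finite {i. r *\<^sub>R Poly_Mapping.lookup x i \<noteq> 0}"
    by (rule finite_subset[OF _ finite_lookup[of x]]) auto
  then show ?thesis by (simp add: scaleR_poly_mapping_def)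
qed

lemmas coord_simps = lookup_add lookup_minus lookup_sum lookup_single when_def

lemma linear_coord: "linear (\<lambda>x. coord x i)"
  by (rule linearI) (simp_all add: lookup_add)

lemma linear_real_sum:
  fixes h :: "'a::real_vector \<Rightarrow> real"
  assumes "linear h"
  shows "h (\<Sum>v\<in>A. a v *\<^sub>R v) = (\<Sum>v\<in>A. a v * h v)"
  using assms by (simp add: linear_sum linear_scale)

lemma linear_real_combine:
  fixes f g :: "'a::real_vector \<Rightarrow> real"
  assumes "linear f" "linear g"
  shows "linear (\<lambda>x. f x - c * g x)" "linear (\<lambda>x. c * f x)" "linear (\<lambda>x. f x / c)"
  by (rule linearI; simp add: linear_add[OF assms(1)] linear_add[OF assms(2)] linear_scale[OF assms(1)]
      linear_scale[OF assms(2)] algebra_simps add_divide_distrib)+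

lemma Rn_add: "x \<in> Rn n \<Longrightarrow> y \<in> Rn n \<Longrightarrow> x + y \<in> Rn n"
  by (auto simp: Rn_def lookup_add)

lemma Rn_diff: "x \<in> Rn n \<Longrightarrow> y \<in> Rn n \<Longrightarrow> x - y \<in> Rn n"
  by (auto simp: Rn_def lookup_minus)

lemma Rn_scaleR: "x \<in> Rn n \<Longrightarrow> r *\<^sub>R x \<in> Rn n"
  by (auto simp: Rn_def)

lemma Rn_sum: "(\<And>v. v \<in> A \<Longrightarrow> f v \<in> Rn n) \<Longrightarrow> sum f A \<in> Rn n"
  by (auto simp: Rn_def lookup_sum)

lemma subspace_Rn: "subspace (Rn n)"
  by (auto simp: subspace_def Rn_add Rn_scaleR) (simp add: Rn_def)

lemma Rn_convex_hull: "V \<subseteq> Rn n \<Longrightarrow> convex hull V \<subseteq> Rn n"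
  by (intro hull_minimal subspace_imp_convex subspace_Rn)

lemma Rn_mono: "m \<le> n \<Longrightarrow> Rn m \<subseteq> Rn n"
  by (auto simp: Rn_def)

lemma Zn_subset_Qn: "Zn n \<subseteq> Qn n"
  using Ints_subset_Rats by (auto simp: Qn_def Zn_def)

lemma Zn_subset_Rn: "Zn n \<subseteq> Rn n"
  by (auto simp: Zn_def)

lemmas Zn_in_Qn = subsetD[OF Zn_subset_Qn]
lemmas Zn_in_Rn = subsetD[OF Zn_subset_Rn]
lemmas Qn_in_Rn = subsetD[OF Qn_subset_Rn]

lemma Rn_eq_sum_single:
  assumes "x \<in> Rn n"
  shows "x = (\<Sum>i<n. coord x i *\<^sub>R Poly_Mapping.single i 1)"
proof (rule poly_mapping_eqI)
  fix k
  have "coord (\<Sum>i<n. coord x i *\<^sub>R Poly_Mapping.single i 1) k = (\<Sum>i<n. if i = k then coord x i else 0)"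
    by (simp add: coord_simps if_distrib cong: if_cong)
  also have "\<dots> = coord x k" using assms by (auto simp: Rn_def)
  finally show "coord x k = coord (\<Sum>i<n. coord x i *\<^sub>R Poly_Mapping.single i 1) k" by simp
qed

lemma linear_Rn_sum:
  fixes h :: "point \<Rightarrow> real"
  assumes "linear h" "x \<in> Rn n"
  shows "h x = (\<Sum>i<n. coord x i * h (Poly_Mapping.single i 1))"
  by (subst Rn_eq_sum_single[OF assms(2)]) (simp add: linear_sum[OF assms(1)] linear_scale[OF assms(1)])

lemma single_in_Zn: "i < n \<Longrightarrow> Poly_Mapping.single i 1 \<in> Zn n"
  by (auto simp: Zn_def Rn_def coord_simps)

lemma int_subspace_Zn: "int_module.subspace (Zn n)"
  by (auto simp: int_module.subspace_def Zn_def Rn_def lookup_add)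

lemma Zn_add: "x \<in> Zn n \<Longrightarrow> y \<in> Zn n \<Longrightarrow> x + y \<in> Zn n"
  by (auto simp: Zn_def Rn_def lookup_add)

lemma lattice_basis_subset: "lattice_basis n C \<Longrightarrow> C \<subseteq> Zn n"
  using int_module.span_superset by (auto simp: lattice_basis_def)

section \<open>Dual forms of lattice bases\<close>

text \<open>The integer coordinates with respect to \<open>C\<close>, extended to real-linear forms
  by their values on the unit vectors. They extract the coefficients of real combinations and at the
  same time certify integrality.\<close>

lemma lattice_basis_dual:
  assumes "lattice_basis n C"
  obtains D :: "point \<Rightarrow> point \<Rightarrow> real" where "\<And>c. linear (D c)"
    "\<And>c c'. c \<in> C \<Longrightarrow> c' \<in> C \<Longrightarrow> D c c' = (if c' = c then 1 else 0)"
    "\<And>c x. x \<in> Zn n \<Longrightarrow> D c x \<in> \<int>"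
proof -
  have ind: "int_module.independent C" and span: "int_module.span C = Zn n"
    using assms by (auto simp: lattice_basis_def)
  define r where "r = int_module.representation C"
  define D where "D = (\<lambda>c x. \<Sum>i<n. coord x i * real_of_int (r (Poly_Mapping.single i 1) c))"
  have lin: "linear (D c)" for c
    by (rule linearI) (auto simp: D_def lookup_add algebra_simps sum.distrib sum_distrib_left)
  have D: "D c x = real_of_int (r x c)" if x: "x \<in> Zn n" for x c
  proof -
    have fl: "of_int \<lfloor>coord x i\<rfloor> = coord x i" for i using x by (simp add: Zn_def)
    have s: "Poly_Mapping.single i 1 \<in> int_module.span C" if "i < n" for i
      using single_in_Zn[OF that] span by simp
    have "x = (\<Sum>i<n. of_int \<lfloor>coord x i\<rfloor> *\<^sub>R Poly_Mapping.single i 1)"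
      unfolding fl by (rule Rn_eq_sum_single[OF Zn_in_Rn[OF x]])
    then have "r x c = r (\<Sum>i<n. of_int \<lfloor>coord x i\<rfloor> *\<^sub>R Poly_Mapping.single i 1) c" by simp
    also have "\<dots> = (\<Sum>i<n. \<lfloor>coord x i\<rfloor> * r (Poly_Mapping.single i 1) c)"
      unfolding r_def using s int_module.span_scale
      by (subst int_module.representation_sum[OF ind]) (auto simp: int_module.representation_scale[OF ind])
    finally have "real_of_int (r x c) = (\<Sum>i<n. of_int \<lfloor>coord x i\<rfloor> * of_int (r (Poly_Mapping.single i 1) c))"
      by simp
    then show ?thesis unfolding fl by (simp add: D_def)
  qed
  show ?thesis
  proof
    show "linear (D c)" for c by (rule lin)
    show "D c c' = (if c' = c then 1 else 0)" if "c \<in> C" "c' \<in> C" for c c'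
      using D[of c' c] that int_module.representation_basis[OF ind that(2)] lattice_basis_subset[OF assms]
      by (auto simp: r_def)
    show "D c x \<in> \<int>" if "x \<in> Zn n" for c x using D[OF that] by simp
  qed
qed

text \<open>A form that is 1 at one vector and 0 at the others reads off a coefficient of any
  relation, so such forms certify independence.\<close>

lemma lattice_basisI:
  assumes C: "C \<subseteq> Zn n" "Zn n \<subseteq> int_module.span C"
    and dual: "\<And>c. c \<in> C \<Longrightarrow> \<exists>f::point \<Rightarrow> real. linear f \<and> f c = 1 \<and> (\<forall>c'\<in>C - {c}. f c' = 0)"
  shows "lattice_basis n C"
  unfolding lattice_basis_def
proof
  show "int_module.span C = Zn n"
    using C int_module.span_minimal[OF C(1) int_subspace_Zn] by blast
  show "int_module.independent C"
    unfolding int_module.independent_explicit_module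
  proof (intro allI impI)
    fix t u v assume t: "finite t" "t \<subseteq> C" "(\<Sum>v\<in>t. real_of_int (u v) *\<^sub>R v) = 0" "v \<in> t"
    obtain f :: "point \<Rightarrow> real" where f: "linear f" "f v = 1" "\<forall>c'\<in>C - {v}. f c' = 0"
      using dual t by blast
    have "0 = f (\<Sum>v\<in>t. real_of_int (u v) *\<^sub>R v)" using t(3) f(1) by (simp add: linear_0)
    also have "\<dots> = (\<Sum>z\<in>t. real_of_int (u z) * f z)" by (rule linear_real_sum[OF f(1)])
    also have "\<dots> = (\<Sum>z\<in>t. if z = v then real_of_int (u v) else 0)"
      using f t by (intro sum.cong) auto
    also have "\<dots> = real_of_int (u v)" using t by simp
    finally show "u v = 0" by simp
  qed
qed

lemma part_of_basis_mono: "part_of_basis n \<sigma> \<Longrightarrow> \<tau> \<subseteq> \<sigma> \<Longrightarrow> part_of_basis n \<tau>"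
  unfolding part_of_basis_def by blast

text \<open>An elementary unimodular operation. The new dual forms are \<open>D w\<close> at
  \<open>v + w\<close>, the difference of \<open>D v\<close> and \<open>D w\<close> at
  \<open>v\<close>, and the old ones elsewhere.\<close>

lemma lattice_basis_exchange:
  assumes C: "lattice_basis n C" "v \<in> C" "w \<in> C" "v \<noteq> w"
  shows "lattice_basis n (insert (v + w) (C - {w}))"
proof (rule lattice_basisI)
  obtain D :: "point \<Rightarrow> point \<Rightarrow> real" where D: "\<And>c. linear (D c)"
    "\<And>c c'. c \<in> C \<Longrightarrow> c' \<in> C \<Longrightarrow> D c c' = (if c' = c then 1 else 0)"
    using lattice_basis_dual[OF C(1)] by metis
  let ?C = "insert (v + w) (C - {w})"
  have CZ: "C \<subseteq> Zn n" by (rule lattice_basis_subset[OF C(1)])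
  then show "?C \<subseteq> Zn n" using C(2,3) by (auto intro!: Zn_add)
  have v: "v \<in> int_module.span ?C" using C by (intro int_module.span_base) auto
  have u: "v + w \<in> int_module.span ?C" by (intro int_module.span_base) auto
  have "w \<in> int_module.span ?C" using int_module.span_diff[OF u v] by simp
  then have "C \<subseteq> int_module.span ?C" using int_module.span_superset[of ?C] by auto
  then have "int_module.span C \<subseteq> int_module.span ?C"
    by (rule int_module.span_minimal) (rule int_module.subspace_span)
  then show "Zn n \<subseteq> int_module.span ?C" using C by (simp add: lattice_basis_def)
  fix c assume c: "c \<in> ?C"
  show "\<exists>f::point \<Rightarrow> real. linear f \<and> f c = 1 \<and> (\<forall>c'\<in>?C - {c}. f c' = 0)"
  proof (cases "c = v + w")
    case True
    then show ?thesis
      using D C by (intro exI[where x = "D w"]) (auto simp: linear_add)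
  next
    case cu: False
    show ?thesis
    proof (cases "c = v")
      case True
      then show ?thesis
        using D(2) C(2,3,4) cu linear_real_combine(1)[OF D(1) D(1), of v 1 w]
        by (intro exI[where x = "\<lambda>x. D v x - 1 * D w x"])
          (auto simp: linear_add[OF D(1)] split: if_splits)
    next
      case False
      then show ?thesis
        using D C cu c by (intro exI[where x = "D c"]) (auto simp: linear_add)
    qed
  qed
qed

section \<open>Rational and integral linear forms\<close>

lemma common_denominator:
  fixes A :: "real set"
  assumes "finite A" "A \<subseteq> \<rat>"
  obtains D :: nat where "D > 0" "\<And>r. r \<in> A \<Longrightarrow> real D * r \<in> \<int>"
proof -
  have "\<exists>D::nat. D > 0 \<and> (\<forall>r\<in>A. real D * r \<in> \<int>)"
    using assms
  proof (induction A rule: finite_induct)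
    case empty
    show ?case by (intro exI[where x = 1]) auto
  next
    case (insert r A)
    then obtain D :: nat where D: "D > 0" "\<forall>r\<in>A. real D * r \<in> \<int>" by auto
    obtain q :: nat and p :: int where q: "q > 0" "r = of_int p / real q"
    proof -
      have "r \<in> \<rat>" using insert by auto
      then obtain a b :: int where "b > 0" "r = of_int a / of_int b"
        by (auto elim: Rats_cases')
      then show ?thesis using that[of "nat b" a] by simp
    qed
    have "real (D * q) * r = real D * of_int p" using q by simp
    moreover have "real (D * q) * s = real q * (real D * s)" for s by simp
    ultimately have "\<forall>s\<in>insert r A. real (D * q) * s \<in> \<int>"
      using D(2) by (metis Ints_mult Ints_of_int Ints_of_nat insert_iff)
    then show ?case using D(1) q(1) by (intro exI[where x = "D * q"]) auto
  qed
  then show ?thesis using that by blast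
qed

definition rational_form :: "nat \<Rightarrow> (point \<Rightarrow> real) \<Rightarrow> bool" where
  "rational_form n h \<longleftrightarrow> linear h \<and> (\<forall>x\<in>Qn n. h x \<in> \<rat>)"

definition integral_form :: "nat \<Rightarrow> (point \<Rightarrow> real) \<Rightarrow> bool" where
  "integral_form n h \<longleftrightarrow> linear h \<and> (\<forall>x\<in>Zn n. h x \<in> \<int>)"

lemma rational_form_scale:
  assumes "rational_form n h"
  obtains D :: nat where "D > 0" "integral_form n (\<lambda>x. real D * h x)"
proof -
  have lin: "linear h" using assms by (simp add: rational_form_def)
  have "(\<lambda>i. h (Poly_Mapping.single i 1)) ` {..<n} \<subseteq> \<rat>"
    using assms by (auto simp: rational_form_def intro!: Zn_in_Qn single_in_Zn)
  then obtain D :: nat where D: "D > 0" "\<And>r. r \<in> (\<lambda>i. h (Poly_Mapping.single i 1)) ` {..<n} \<Longrightarrow> real D * r \<in> \<int>"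
    using common_denominator[of "(\<lambda>i. h (Poly_Mapping.single i 1)) ` {..<n}"] by auto
  have "real D * h x \<in> \<int>" if x: "x \<in> Zn n" for x
  proof -
    have "real D * h x = (\<Sum>i<n. coord x i * (real D * h (Poly_Mapping.single i 1)))"
      using linear_Rn_sum[OF lin Zn_in_Rn[OF x]] by (simp add: sum_distrib_left algebra_simps)
    also have "\<dots> \<in> \<int>" using x by (intro Ints_sum Ints_mult D(2)) (auto simp: Zn_def)
    finally show ?thesis .
  qed
  then show ?thesis
    using that[of D] D(1) linear_real_combine(2)[OF lin lin] by (simp add: integral_form_def)
qed

text \<open>Gaussian elimination over the rationals. The forms \<open>G\<close> are equations of the
  span and the \<open>f v\<close> are coordinates on it; together they describe a simplicial cone by
  equations and inequalities.\<close>

lemma rational_dual_forms: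
  assumes "finite V" "V \<subseteq> Qn n" "independent V"
  shows "\<exists>G f. finite G \<and> (\<forall>g\<in>G. rational_form n g) \<and> (\<forall>v\<in>V. rational_form n (f v)) \<and>
    (\<forall>v\<in>V. \<forall>w\<in>V. f v w = (if w = v then 1 else 0)) \<and>
    (\<forall>x\<in>Rn n. x \<in> span V \<longleftrightarrow> (\<forall>g\<in>G. g x = 0))"
  using assms
proof (induction V rule: finite_induct)
  case empty
  have *: "x = 0" if "x \<in> Rn n" "\<forall>i<n. coord x i = 0" for x
  proof (rule poly_mapping_eqI)
    show "coord x k = coord 0 k" for k using that by (cases "k < n") (auto simp: Rn_def)
  qed
  show ?case
    by (rule exI[where x = "(\<lambda>i x. coord x i) ` {..<n}"])
      (use * in \<open>auto simp: rational_form_def linear_coord Qn_def\<close>)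
next
  case (insert v V)
  then have "independent V" "V \<subseteq> Qn n" using independent_mono[OF insert.prems(2), of V] by auto
  then obtain G f where *: "finite G" "\<forall>g\<in>G. rational_form n g" "\<forall>v\<in>V. rational_form n (f v)"
    "\<forall>v\<in>V. \<forall>w\<in>V. f v w = (if w = v then 1 else 0)"
    "\<forall>x\<in>Rn n. x \<in> span V \<longleftrightarrow> (\<forall>g\<in>G. g x = 0)"
    using insert.IH by blast
  have G: "finite G" "\<And>g. g \<in> G \<Longrightarrow> rational_form n g"
    and f: "\<And>v. v \<in> V \<Longrightarrow> rational_form n (f v)" "\<And>v w. v \<in> V \<Longrightarrow> w \<in> V \<Longrightarrow> f v w = (if w = v then 1 else 0)"
    and span: "\<And>x. x \<in> Rn n \<Longrightarrow> x \<in> span V \<longleftrightarrow> (\<forall>g\<in>G. g x = 0)"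
    using * by auto
  have v: "v \<in> Qn n" "v \<in> Rn n" using insert.prems Qn_subset_Rn by auto
  have VR: "V \<subseteq> Rn n" using insert.prems Qn_subset_Rn by auto
  have "v \<notin> span V" using insert.prems(2) insert.hyps(2) by (simp add: independent_insert)
  \<comment> \<open>The pivot: an equation of the old span that the new vector violates.\<close>
  then obtain g0 where g0: "g0 \<in> G" "g0 v \<noteq> 0" using span[OF v(2)] by auto
  have r0: "rational_form n g0" by (rule G(2)[OF g0(1)])
  have lin: "linear g" if "g \<in> G" for g using G(2)[OF that] by (simp add: rational_form_def)
  have rat: "rational_form n (\<lambda>x. h x - c * g0 x)" if "rational_form n h" "c \<in> \<rat>" for h c
    using that r0 linear_real_combine(1)[of h g0 c] by (auto simp: rational_form_def)
  have ratdiv: "h v / g0 v \<in> \<rat>" if "rational_form n h" for h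
    using that r0 v by (auto simp: rational_form_def)
  \<comment> \<open>Subtracting a multiple of the pivot makes each equation vanish at
    \<open>v\<close>. The pivot itself turns into the zero form, and rescaled it becomes the
    coordinate of \<open>v\<close>.\<close>
  define G' where "G' = (\<lambda>g x. g x - (g v / g0 v) * g0 x) ` G"
  define f' where "f' = (\<lambda>w x. if w = v then g0 x / g0 v else f w x - (f w v / g0 v) * g0 x)"
  have zero: "g w = 0" if "g \<in> G" "w \<in> V" for g w
    using span[of w] that VR span_base[of w V] by auto
  show ?case
  proof (intro exI[where x = G'] exI[where x = f'] conjI ballI)
    show "finite G'" using G by (simp add: G'_def)
    show "rational_form n g" if "g \<in> G'" for g
    proof -
      from that[unfolded G'_def] obtain g' where "g = (\<lambda>x. g' x - (g' v / g0 v) * g0 x)" "g' \<in> G"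
        by (rule imageE)
      then show ?thesis using rat[OF G(2) ratdiv[OF G(2)], of g' g'] by simp
    qed
    show "rational_form n (f' w)" if "w \<in> insert v V" for w
    proof (cases "w = v")
      case True
      have "linear (\<lambda>x. g0 x / g0 v)" using r0 by (intro linear_real_combine(3)[of g0 g0]) (auto simp: rational_form_def)
      then show ?thesis using True r0 v by (auto simp: f'_def rational_form_def)
    next
      case False
      then have w: "w \<in> V" using that by simp
      show ?thesis unfolding f'_def using rat[OF f(1)[OF w] ratdiv[OF f(1)[OF w]]] False by simp
    qed
    show "f' w z = (if z = w then 1 else 0)" if "w \<in> insert v V" "z \<in> insert v V" for w z
      using that g0 f(2) zero[OF g0(1)] insert.hyps by (auto simp: f'_def)
    fix x assume x: "x \<in> Rn n"
    show "x \<in> span (insert v V) \<longleftrightarrow> (\<forall>g\<in>G'. g x = 0)"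
    proof
      assume "x \<in> span (insert v V)"
      then obtain k where k: "x - k *\<^sub>R v \<in> span V" by (auto simp: span_breakdown_eq)
      have "g x = k * g v" if "g \<in> G" for g
      proof -
        have "g (x - k *\<^sub>R v) = 0" using span[of "x - k *\<^sub>R v"] k that x v by (auto simp: Rn_diff Rn_scaleR)
        then show ?thesis using lin[OF that] by (simp add: linear_diff linear_scale)
      qed
      note k = this
      have "g x - (g v / g0 v) * g0 x = 0" if "g \<in> G" for g
        using g0(2) by (simp add: k[OF that] k[OF g0(1)])
      then show "\<forall>g\<in>G'. g x = 0" unfolding G'_def by blast
    next
      assume z: "\<forall>g\<in>G'. g x = 0"
      have "g (x - (g0 x / g0 v) *\<^sub>R v) = 0" if "g \<in> G" for g
      proof -
        have "(\<lambda>x. g x - (g v / g0 v) * g0 x) \<in> G'" unfolding G'_def using that by (rule imageI)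
        from bspec[OF z this] have "g x - (g v / g0 v) * g0 x = 0" .
        then show ?thesis using lin[OF that] by (simp add: linear_diff linear_scale)
      qed
      then have "x - (g0 x / g0 v) *\<^sub>R v \<in> span V"
        using span[of "x - (g0 x / g0 v) *\<^sub>R v"] x v by (auto simp: Rn_diff Rn_scaleR)
      then show "x \<in> span (insert v V)" by (auto simp: span_breakdown_eq)
    qed
  qed
qed

section \<open>Regular fans\<close>

text \<open>Strict positivity on the cone and 0 elsewhere let \<open>a\<close> determine its cone as
  the set where it is positive. Uniqueness of \<open>a\<close> therefore concerns both the cone and
  the coordinates.\<close>

definition cone_rep :: "point set set \<Rightarrow> (point \<Rightarrow> real) \<Rightarrow> point \<Rightarrow> bool" where
  "cone_rep \<Sigma> a x \<longleftrightarrow>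
     (\<exists>\<sigma>\<in>\<Sigma>. (\<forall>v. v \<notin> \<sigma> \<longrightarrow> a v = 0) \<and> (\<forall>v\<in>\<sigma>. a v > 0) \<and> x = (\<Sum>v\<in>\<sigma>. a v *\<^sub>R v))"

text \<open>The last clause says that the relatively open cones are disjoint; it stands in for the
  usual condition on intersections of cones. The set \<open>X\<close> is what the fan covers, and
  the empty generator set represents the cone of the origin.\<close>

definition regular_fan :: "nat \<Rightarrow> point set \<Rightarrow> point set set \<Rightarrow> bool" where
  "regular_fan n X \<Sigma> \<longleftrightarrow> finite \<Sigma> \<and> (\<forall>\<sigma>\<in>\<Sigma>. finite \<sigma> \<and> part_of_basis n \<sigma>) \<and>
     (\<forall>\<sigma>\<in>\<Sigma>. \<forall>\<tau>\<subseteq>\<sigma>. \<tau> \<in> \<Sigma>) \<and> (\<forall>x\<in>X. \<exists>a. cone_rep \<Sigma> a x) \<and>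
     (\<forall>x a b. cone_rep \<Sigma> a x \<longrightarrow> cone_rep \<Sigma> b x \<longrightarrow> a = b)"

text \<open>The stellar subdivision of the cone spanned by \<open>v\<close> and \<open>w\<close> at its Farey mediant \<open>v + w\<close>.\<close>

definition star :: "point set set \<Rightarrow> point \<Rightarrow> point \<Rightarrow> point set set" where
  "star \<Sigma> v w = {\<sigma>\<in>\<Sigma>. \<not> {v, w} \<subseteq> \<sigma>} \<union>
     {insert (v + w) \<tau> | \<tau>. \<tau> \<union> {v, w} \<in> \<Sigma> \<and> \<not> {v, w} \<subseteq> \<tau>}"

definition sign_consistent :: "(point \<Rightarrow> real) \<Rightarrow> point set set \<Rightarrow> bool" where
  "sign_consistent h \<Sigma> \<longleftrightarrow> (\<forall>\<sigma>\<in>\<Sigma>. (\<forall>v\<in>\<sigma>. 0 \<le> h v) \<or> (\<forall>v\<in>\<sigma>. h v \<le> 0))"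

lemma regular_fanD:
  assumes "regular_fan n X \<Sigma>"
  shows "finite \<Sigma>" "\<sigma> \<in> \<Sigma> \<Longrightarrow> finite \<sigma>" "\<sigma> \<in> \<Sigma> \<Longrightarrow> part_of_basis n \<sigma>"
    "\<sigma> \<in> \<Sigma> \<Longrightarrow> \<tau> \<subseteq> \<sigma> \<Longrightarrow> \<tau> \<in> \<Sigma>" "x \<in> X \<Longrightarrow> \<exists>a. cone_rep \<Sigma> a x"
    "cone_rep \<Sigma> a x \<Longrightarrow> cone_rep \<Sigma> b x \<Longrightarrow> a = b"
  using assms[unfolded regular_fan_def] by (elim conjE; simp)+

lemma fan_subset_Zn: "regular_fan n X \<Sigma> \<Longrightarrow> \<sigma> \<in> \<Sigma> \<Longrightarrow> \<sigma> \<subseteq> Zn n"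
  using regular_fanD(3) lattice_basis_subset unfolding part_of_basis_def by blast

text \<open>As a generator, \<open>v + w\<close> would have two coefficient functions: 1 at itself,
  and 1 at each of \<open>v\<close> and \<open>w\<close>.\<close>

lemma mediant_new:
  assumes fan: "regular_fan n X \<Sigma>" and vw: "{v, w} \<in> \<Sigma>" "v \<noteq> w" and \<sigma>: "\<sigma> \<in> \<Sigma>"
  shows "v + w \<notin> \<sigma>"
proof
  assume "v + w \<in> \<sigma>"
  then have "{v + w} \<in> \<Sigma>" using regular_fanD(4)[OF fan \<sigma>] by simp
  then have a: "cone_rep \<Sigma> (\<lambda>z. if z = v + w then 1 else 0) (v + w)"
    unfolding cone_rep_def by (intro bexI[where x = "{v + w}"]) auto
  have "cone_rep \<Sigma> (\<lambda>z. if z \<in> {v, w} then 1 else 0) (v + w)"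
    unfolding cone_rep_def using vw by (intro bexI[where x = "{v, w}"]) auto
  from regular_fanD(6)[OF fan a this]
  have eq: "(if z = v + w then 1 else 0::real) = (if z \<in> {v, w} then 1 else 0)" for z by meson
  from eq[of v] eq[of w] have "v = v + w" "w = v + w" by (auto split: if_splits)
  then show False using vw(2) by simp
qed

text \<open>Coefficients with respect to a stellar subdivision translate into coefficients with respect to
  the original fan by distributing the coefficient of the mediant.\<close>

definition unstar :: "point \<Rightarrow> point \<Rightarrow> (point \<Rightarrow> real) \<Rightarrow> point \<Rightarrow> real" where
  "unstar v w a = (\<lambda>z. if z = v + w then 0 else a z + (if z = v \<or> z = w then a (v + w) else 0))"

text \<open>No cone of the subdivision contains both \<open>v\<close> and \<open>w\<close>. The
  resulting alternative in the last conclusion is what makes \<open>unstar\<close>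
  injective.\<close>

lemma cone_rep_unstar:
  assumes fan: "regular_fan n X \<Sigma>" and vw: "{v, w} \<in> \<Sigma>" "v \<noteq> w"
    and a: "cone_rep (star \<Sigma> v w) a x"
  shows "cone_rep \<Sigma> (unstar v w a) x" "\<And>z. a z \<ge> 0" "a v = 0 \<or> a w = 0"
proof -
  let ?u = "v + w"
  note new = mediant_new[OF fan vw]
  have uvw: "?u \<noteq> v" "?u \<noteq> w" using new[OF vw(1)] by auto
  obtain \<sigma> where \<sigma>: "\<sigma> \<in> star \<Sigma> v w" "\<And>z. z \<notin> \<sigma> \<Longrightarrow> a z = 0" "\<And>z. z \<in> \<sigma> \<Longrightarrow> a z > 0"
    "x = (\<Sum>z\<in>\<sigma>. a z *\<^sub>R z)"
    using a by (auto simp: cone_rep_def)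
  show nn: "a z \<ge> 0" for z using \<sigma>(2,3)[of z] by (cases "z \<in> \<sigma>") auto
  have "v \<notin> \<sigma> \<or> w \<notin> \<sigma>" using \<sigma>(1) uvw by (auto simp: star_def)
  then show "a v = 0 \<or> a w = 0" using \<sigma>(2) by blast
  from \<sigma>(1) consider (old) "\<sigma> \<in> \<Sigma>" "\<not> {v, w} \<subseteq> \<sigma>"
    | (new) \<tau> where "\<sigma> = insert ?u \<tau>" "\<tau> \<union> {v, w} \<in> \<Sigma>" "\<not> {v, w} \<subseteq> \<tau>"
    by (auto simp: star_def)
  then show "cone_rep \<Sigma> (unstar v w a) x"
  proof cases
    case old
    have "a ?u = 0" using \<sigma>(2) new[OF old(1)] by blast
    then have "unstar v w a = a" by (auto simp: unstar_def)
    then show ?thesis using old \<sigma> by (auto simp: cone_rep_def)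
  next
    case (new \<tau>)
    have fin: "finite (\<tau> \<union> {v, w})" using regular_fanD(2)[OF fan new(2)] .
    have u\<tau>: "?u \<notin> \<tau> \<union> {v, w}" using \<open>\<And>\<sigma>. \<sigma> \<in> \<Sigma> \<Longrightarrow> ?u \<notin> \<sigma>\<close>[OF new(2)] .
    have "(\<Sum>z\<in>\<tau> \<union> {v, w}. unstar v w a z *\<^sub>R z) =
      (\<Sum>z\<in>\<tau> \<union> {v, w}. a z *\<^sub>R z) + (\<Sum>z\<in>\<tau> \<union> {v, w}. if z \<in> {v, w} then a ?u *\<^sub>R z else 0)"
      unfolding sum.distrib[symmetric]
      by (intro sum.cong) (use u\<tau> in \<open>auto simp: unstar_def scaleR_add_left\<close>)
    also have "(\<Sum>z\<in>\<tau> \<union> {v, w}. if z \<in> {v, w} then a ?u *\<^sub>R z else 0) = (\<Sum>z\<in>{v, w}. a ?u *\<^sub>R z)"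
      using fin by (intro sum.mono_neutral_cong_right) auto
    also have "\<dots> = a ?u *\<^sub>R ?u" using vw(2) by (simp add: scaleR_add_right)
    also have "(\<Sum>z\<in>\<tau> \<union> {v, w}. a z *\<^sub>R z) = (\<Sum>z\<in>\<tau>. a z *\<^sub>R z)"
    proof (rule sum.mono_neutral_right[OF fin])
      show "\<forall>i\<in>\<tau> \<union> {v, w} - \<tau>. a i *\<^sub>R i = 0"
      proof
        fix i assume "i \<in> \<tau> \<union> {v, w} - \<tau>"
        then have "i \<notin> \<sigma>" using new(1) uvw by auto
        then show "a i *\<^sub>R i = 0" using \<sigma>(2) by simp
      qed
    qed auto
    also have "(\<Sum>z\<in>\<tau>. a z *\<^sub>R z) + a ?u *\<^sub>R ?u = x"
      unfolding \<sigma>(4) new(1) using fin u\<tau> by (subst sum.insert) auto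
    finally have sum: "x = (\<Sum>z\<in>\<tau> \<union> {v, w}. unstar v w a z *\<^sub>R z)" ..
    have "a ?u > 0" using \<sigma>(3) new(1) by blast
    then have pos: "unstar v w a z > 0" if "z \<in> \<tau> \<union> {v, w}" for z
      using that u\<tau> \<sigma>(3)[of z] nn[of z] new(1) by (auto simp: unstar_def add_nonneg_pos)
    have zero: "unstar v w a z = 0" if "z \<notin> \<tau> \<union> {v, w}" for z
      using that \<sigma>(2)[of z] new(1) by (auto simp: unstar_def)
    show ?thesis unfolding cone_rep_def
      using sum pos zero new(2) by (intro bexI[where x = "\<tau> \<union> {v, w}"]) auto
  qed
qed

text \<open>Known are the sums \<open>a v + a (v + w)\<close> and \<open>a w + a (v + w)\<close>. As
  one of \<open>a v\<close>, \<open>a w\<close> is 0 and neither is negative, the coefficient of the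
  mediant is the smaller sum.\<close>

lemma unstar_inject:
  assumes a: "\<And>z. a z \<ge> 0" "a v = 0 \<or> a w = 0" and b: "\<And>z. b z \<ge> 0" "b v = 0 \<or> b w = 0"
    and eq: "unstar v w a = unstar v w b" and uvw: "v + w \<noteq> v" "v + w \<noteq> w"
  shows "a = b"
proof
  fix z
  have e: "unstar v w a y = unstar v w b y" for y using eq by simp
  have v: "a v + a (v + w) = b v + b (v + w)" using e[of v] uvw by (simp add: unstar_def)
  have w: "a w + a (v + w) = b w + b (v + w)" using e[of w] uvw by (simp add: unstar_def)
  have u: "a (v + w) = b (v + w)"
    using v w a(2) b(2) a(1)[of v] a(1)[of w] b(1)[of v] b(1)[of w] by linarith
  then show "a z = b z"
    using e[of z] by (auto simp: unstar_def split: if_splits)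
qed

lemma cone_rep_star:
  assumes fan: "regular_fan n X \<Sigma>" and vw: "{v, w} \<in> \<Sigma>" "v \<noteq> w" and a: "cone_rep \<Sigma> a x"
  shows "\<exists>b. cone_rep (star \<Sigma> v w) b x"
proof -
  let ?u = "v + w"
  note new = mediant_new[OF fan vw]
  have uvw: "?u \<noteq> v" "?u \<noteq> w" using new[OF vw(1)] by auto
  obtain \<sigma> where \<sigma>: "\<sigma> \<in> \<Sigma>" "\<And>z. z \<notin> \<sigma> \<Longrightarrow> a z = 0" "\<And>z. z \<in> \<sigma> \<Longrightarrow> a z > 0"
    "x = (\<Sum>z\<in>\<sigma>. a z *\<^sub>R z)"
    using a by (auto simp: cone_rep_def)
  show ?thesis
  proof (cases "{v, w} \<subseteq> \<sigma>")
    case False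
    then show ?thesis using \<sigma> a by (auto simp: cone_rep_def star_def)
  next
    case True
    \<comment> \<open>The common part of the two coefficients moves to the mediant. The generators
      in \<open>\<rho>\<close>, at least one of \<open>v\<close> and \<open>w\<close>, are left with
      coefficient 0 and leave the cone.\<close>
    define s where "s = min (a v) (a w)"
    have s: "s > 0" "s \<le> a v" "s \<le> a w" "s = a v \<or> s = a w" using \<sigma>(3) True by (auto simp: s_def)
    define \<rho> where "\<rho> = {z\<in>{v, w}. a z = s}"
    define \<tau> where "\<tau> = \<sigma> - \<rho>"
    define b where "b = (\<lambda>z. if z = ?u then s else if z \<in> {v, w} then a z - s else a z)"
    have fin: "finite \<sigma>" using regular_fanD(2)[OF fan \<sigma>(1)] .
    have u\<sigma>: "?u \<notin> \<sigma>" using new[OF \<sigma>(1)] .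
    have \<tau>: "\<tau> \<union> {v, w} = \<sigma>" "\<not> {v, w} \<subseteq> \<tau>" using True s(4) by (auto simp: \<tau>_def \<rho>_def)
    have "(\<Sum>z\<in>insert ?u \<tau>. b z *\<^sub>R z) = s *\<^sub>R ?u + (\<Sum>z\<in>\<tau>. b z *\<^sub>R z)"
      using fin u\<sigma> by (subst sum.insert) (auto simp: \<tau>_def b_def)
    also have "(\<Sum>z\<in>\<tau>. b z *\<^sub>R z) = (\<Sum>z\<in>\<sigma>. b z *\<^sub>R z)"
      using fin uvw by (intro sum.mono_neutral_left) (auto simp: \<tau>_def \<rho>_def b_def)
    also have "\<dots> = (\<Sum>z\<in>\<sigma>. a z *\<^sub>R z - (if z \<in> {v, w} then s *\<^sub>R z else 0))"
      using u\<sigma> by (intro sum.cong) (auto simp: b_def scaleR_diff_left)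
    also have "\<dots> = x - (\<Sum>z\<in>\<sigma>. if z \<in> {v, w} then s *\<^sub>R z else 0)"
      unfolding \<sigma>(4) by (rule sum_subtractf)
    also have "(\<Sum>z\<in>\<sigma>. if z \<in> {v, w} then s *\<^sub>R z else 0) = (\<Sum>z\<in>{v, w}. s *\<^sub>R z)"
      using fin True by (intro sum.mono_neutral_cong_right) auto
    also have "\<dots> = s *\<^sub>R ?u" using vw(2) by (simp add: scaleR_add_right)
    finally have sum: "x = (\<Sum>z\<in>insert ?u \<tau>. b z *\<^sub>R z)" by simp
    have "insert ?u \<tau> \<in> star \<Sigma> v w" unfolding star_def using \<tau> \<sigma>(1) by auto
    moreover have "b z = 0" if "z \<notin> insert ?u \<tau>" for z
      using that \<sigma>(2)[of z] True by (auto simp: b_def \<tau>_def \<rho>_def)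
    moreover have "b z > 0" if "z \<in> insert ?u \<tau>" for z
      using that \<sigma>(3)[of z] s by (auto simp: b_def \<tau>_def \<rho>_def order_less_le)
    ultimately show ?thesis unfolding cone_rep_def using sum by blast
  qed
qed

lemma regular_fan_star:
  assumes fan: "regular_fan n X \<Sigma>" and vw: "{v, w} \<in> \<Sigma>" "v \<noteq> w"
  shows "regular_fan n X (star \<Sigma> v w)"
  unfolding regular_fan_def
proof (intro conjI ballI allI impI)
  let ?u = "v + w"
  note D = regular_fanD[OF fan]
  have uvw: "?u \<noteq> v" "?u \<noteq> w" using mediant_new[OF fan vw vw(1)] by auto
  have "star \<Sigma> v w \<subseteq> \<Sigma> \<union> insert ?u ` \<Sigma>"
    unfolding star_def using D(4) by auto
  then show "finite (star \<Sigma> v w)" using D(1) finite_subset by blast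
  show "a = b" if "cone_rep (star \<Sigma> v w) a x" "cone_rep (star \<Sigma> v w) b x" for x a b
    using unstar_inject[OF cone_rep_unstar(2,3)[OF fan vw that(1)] cone_rep_unstar(2,3)[OF fan vw that(2)]]
      D(6)[OF cone_rep_unstar(1)[OF fan vw that(1)] cone_rep_unstar(1)[OF fan vw that(2)]] uvw by blast
  show "\<exists>a. cone_rep (star \<Sigma> v w) a x" if "x \<in> X" for x
    using D(5)[OF that] cone_rep_star[OF fan vw] by blast
  fix \<sigma> assume \<sigma>: "\<sigma> \<in> star \<Sigma> v w"
  consider (old) "\<sigma> \<in> \<Sigma>" "\<not> {v, w} \<subseteq> \<sigma>"
    | (new) \<tau> where "\<sigma> = insert ?u \<tau>" "\<tau> \<union> {v, w} \<in> \<Sigma>" "\<not> {v, w} \<subseteq> \<tau>"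
    using \<sigma> by (auto simp: star_def)
  note cases = this
  from cases show "finite \<sigma>"
  proof cases
    case old
    then show ?thesis using D(2) by blast
  next
    case new
    then show ?thesis using D(2)[OF new(2)] by simp
  qed
  from cases show "part_of_basis n \<sigma>"
  proof cases
    case old
    then show ?thesis using D(3) by blast
  next
    case new
    obtain C where C: "\<tau> \<union> {v, w} \<subseteq> C" "lattice_basis n C"
      using D(3)[OF new(2)] by (auto simp: part_of_basis_def)
    \<comment> \<open>The exchange has to remove a vector that \<open>\<sigma>\<close> does not
      contain: \<open>w\<close> if it is missing from \<open>\<tau>\<close>, otherwise
      \<open>v\<close>.\<close>
    show ?thesis
    proof (cases "w \<in> \<tau>")
      case False
      have "lattice_basis n (insert ?u (C - {w}))"
        using C vw(2) by (intro lattice_basis_exchange) auto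
      moreover have "\<sigma> \<subseteq> insert ?u (C - {w})" using new(1) False C(1) by auto
      ultimately show ?thesis unfolding part_of_basis_def by (intro exI conjI)
    next
      case True
      have "lattice_basis n (insert (w + v) (C - {v}))"
        using C vw(2) by (intro lattice_basis_exchange) auto
      then have "lattice_basis n (insert ?u (C - {v}))" by (simp add: add.commute)
      moreover have "v \<notin> \<tau>" using True new(3) by blast
      then have "\<sigma> \<subseteq> insert ?u (C - {v})" using new(1) C(1) by auto
      ultimately show ?thesis unfolding part_of_basis_def by (intro exI conjI)
    qed
  qed
  fix \<sigma>' assume sub: "\<sigma>' \<subseteq> \<sigma>"
  from cases show "\<sigma>' \<in> star \<Sigma> v w"
  proof cases
    case old
    then show ?thesis using D(4)[OF old(1) sub] sub by (auto simp: star_def)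
  next
    case new
    show ?thesis
    proof (cases "?u \<in> \<sigma>'")
      case True
      then have "\<sigma>' = insert ?u (\<sigma>' - {?u})" by auto
      moreover have "(\<sigma>' - {?u}) \<union> {v, w} \<subseteq> \<tau> \<union> {v, w}" using sub new by auto
      then have "(\<sigma>' - {?u}) \<union> {v, w} \<in> \<Sigma>" using D(4)[OF new(2)] by blast
      moreover have "\<not> {v, w} \<subseteq> \<sigma>' - {?u}" using sub new by blast
      ultimately show ?thesis unfolding star_def by blast
    next
      case False
      then have "\<sigma>' \<subseteq> \<tau>" using sub new by auto
      then show ?thesis using D(4)[OF new(2), of \<sigma>'] new(3) by (auto simp: star_def)
    qed
  qed
qed

text \<open>The mediant of two vectors on one side of a hyperplane stays on that side, so refining
  for one hyperplane does not spoil those already treated.\<close>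

lemma sign_consistent_star:
  assumes fan: "regular_fan n X \<Sigma>" and "linear h" "sign_consistent h \<Sigma>"
  shows "sign_consistent h (star \<Sigma> v w)"
  unfolding sign_consistent_def
proof
  fix \<sigma> assume "\<sigma> \<in> star \<Sigma> v w"
  then consider "\<sigma> \<in> \<Sigma>" | \<tau> where "\<sigma> = insert (v + w) \<tau>" "\<tau> \<union> {v, w} \<in> \<Sigma>"
    by (auto simp: star_def)
  then show "(\<forall>v\<in>\<sigma>. 0 \<le> h v) \<or> (\<forall>v\<in>\<sigma>. h v \<le> 0)"
  proof cases
    case 1
    then show ?thesis using assms by (auto simp: sign_consistent_def)
  next
    case 2
    then have "(\<forall>z\<in>\<tau> \<union> {v, w}. 0 \<le> h z) \<or> (\<forall>z\<in>\<tau> \<union> {v, w}. h z \<le> 0)"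
      using assms by (auto simp: sign_consistent_def)
    then show ?thesis using 2(1) linear_add[OF assms(2), of v w] by auto
  qed
qed

section \<open>Removing the crossings of a hyperplane\<close>

definition crossings :: "(point \<Rightarrow> real) \<Rightarrow> point set set \<Rightarrow> (point \<times> point) set" where
  "crossings h \<Sigma> = {(v, w). {v, w} \<in> \<Sigma> \<and> h v > 0 \<and> h w < 0}"

text \<open>The spread \<open>h v - h w\<close> of a crossing edge drops when an edge of maximal spread is starred.\<close>

lemma crossings_star:
  assumes fan: "regular_fan n X \<Sigma>" and lin: "linear h" and vw: "(v, w) \<in> crossings h \<Sigma>"
    and max: "\<And>p q. (p, q) \<in> crossings h \<Sigma> \<Longrightarrow> h p - h q \<le> D"
    and pq: "(p, q) \<in> crossings h (star \<Sigma> v w)"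
  shows "h p - h q < D \<or> (p, q) \<in> crossings h \<Sigma> - {(v, w)}"
proof -
  let ?u = "v + w"
  have hu: "h ?u = h v + h w" using lin by (rule linear_add)
  have v: "h v > 0" "h w < 0" using vw by (auto simp: crossings_def)
  have p: "h p > 0" "h q < 0" "{p, q} \<in> star \<Sigma> v w" using pq by (auto simp: crossings_def)
  from p(3) consider (old) "{p, q} \<in> \<Sigma>" "\<not> {v, w} \<subseteq> {p, q}"
    | (new) \<tau> where "{p, q} = insert ?u \<tau>" "\<tau> \<union> {v, w} \<in> \<Sigma>"
    by (auto simp: star_def)
  then show ?thesis
  proof cases
    case old
    then show ?thesis using p by (auto simp: crossings_def)
  next
    case new
    have mem: "{x, y} \<in> \<Sigma>" if "x \<in> \<tau> \<union> {v, w}" "y \<in> \<tau> \<union> {v, w}" for x y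
      using regular_fanD(4)[OF fan new(2), of "{x, y}"] that by blast
    have "?u \<in> {p, q}" unfolding new(1) by simp
    then have "p = ?u \<or> q = ?u" by auto
    then show ?thesis
    proof
      \<comment> \<open>The pair \<open>(v, q)\<close> was already a crossing edge, and
        \<open>h p = h v + h w\<close> is smaller than \<open>h v\<close>. The other case is
        symmetric.\<close>
      assume pu: "p = ?u"
      then have "q \<noteq> ?u" using p by auto
      then have "q \<in> \<tau>" using new(1) by blast
      then have "(v, q) \<in> crossings h \<Sigma>" using mem[of v q] p v by (auto simp: crossings_def)
      then have "h v - h q \<le> D" by (rule max)
      then show ?thesis using hu v pu by auto
    next
      assume qu: "q = ?u"
      then have "p \<noteq> ?u" using p by auto
      then have "p \<in> \<tau>" using new(1) by blast
      then have "(p, w) \<in> crossings h \<Sigma>" using mem[of p w] p v by (auto simp: crossings_def)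
      then have "h p - h w \<le> D" by (rule max)
      then show ?thesis using hu v qu by auto
    qed
  qed
qed

text \<open>Spreads are integers because the generators are integer vectors and \<open>h\<close> is
  integral. The outer induction lowers the bound on the spreads; the inner one removes the edges of
  maximal spread one at a time, each star creating only crossings of smaller spread. Bound 0 leaves
  no crossing, as a crossing has positive spread.\<close>

lemma fan_refine_form:
  assumes h: "integral_form n h"
  shows "regular_fan n X \<Sigma> \<Longrightarrow> (\<And>p q. (p, q) \<in> crossings h \<Sigma> \<Longrightarrow> h p - h q \<le> real D) \<Longrightarrow>
    \<exists>\<Sigma>'. regular_fan n X \<Sigma>' \<and> sign_consistent h \<Sigma>' \<and>
      (\<forall>h'. linear h' \<and> sign_consistent h' \<Sigma> \<longrightarrow> sign_consistent h' \<Sigma>')"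
proof (induction D arbitrary: \<Sigma>)
  case 0
  have "sign_consistent h \<Sigma>"
    unfolding sign_consistent_def
  proof (rule ballI, rule ccontr)
    fix \<sigma> assume \<sigma>: "\<sigma> \<in> \<Sigma>" and "\<not> ((\<forall>v\<in>\<sigma>. 0 \<le> h v) \<or> (\<forall>v\<in>\<sigma>. h v \<le> 0))"
    then obtain p q where pq: "p \<in> \<sigma>" "q \<in> \<sigma>" "h p > 0" "h q < 0" by (auto simp: not_le)
    then have "{p, q} \<in> \<Sigma>" using regular_fanD(4)[OF 0(1) \<sigma>] by simp
    then have "h p - h q \<le> 0" using 0(2)[of p q] pq by (simp add: crossings_def)
    then show False using pq by linarith
  qed
  then show ?case using 0(1) by blast
next
  case (Suc D)
  have lin: "linear h" using h by (simp add: integral_form_def)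
  define top where "top = (\<lambda>\<Sigma>. {(p, q) \<in> crossings h \<Sigma>. h p - h q = real (Suc D)})"
  have fin: "finite (top \<Sigma>)" if "regular_fan n X \<Sigma>" for \<Sigma>
  proof -
    have "top \<Sigma> \<subseteq> (\<Union>\<Sigma>) \<times> (\<Union>\<Sigma>)" by (auto simp: top_def crossings_def)
    moreover have "finite (\<Union>\<Sigma>)" using regular_fanD(1,2)[OF that] by auto
    ultimately show ?thesis using finite_subset by blast
  qed
  have "\<exists>\<Sigma>'. regular_fan n X \<Sigma>' \<and> sign_consistent h \<Sigma>' \<and>
      (\<forall>h'. linear h' \<and> sign_consistent h' \<Sigma> \<longrightarrow> sign_consistent h' \<Sigma>')"
    if "regular_fan n X \<Sigma>" "\<And>p q. (p, q) \<in> crossings h \<Sigma> \<Longrightarrow> h p - h q \<le> real (Suc D)" for \<Sigma>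
    using that
  proof (induction "card (top \<Sigma>)" arbitrary: \<Sigma> rule: less_induct)
    case less
    show ?case
    proof (cases "top \<Sigma> = {}")
      case True
      have "h p - h q \<le> real D" if pq: "(p, q) \<in> crossings h \<Sigma>" for p q
      proof -
        have "{p, q} \<subseteq> Zn n" using pq fan_subset_Zn[OF less(2)] by (auto simp: crossings_def)
        then have "h p \<in> \<int>" "h q \<in> \<int>" using h by (auto simp: integral_form_def)
        then have "h p - h q \<in> \<int>" by simp
        then obtain k where k: "h p - h q = of_int k" by (auto elim: Ints_cases)
        have "h p - h q \<noteq> real (Suc D)" using True pq by (auto simp: top_def)
        then have "of_int k < (of_int (int (Suc D)) :: real)" using less(3)[OF pq] k by simp
        then have "k \<le> int D" by (subst (asm) of_int_less_iff) simp
        then have "(of_int k :: real) \<le> of_int (int D)" by (subst of_int_le_iff)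
        then show ?thesis using k by simp
      qed
      then show ?thesis using Suc.IH[OF less(2)] by blast
    next
      case False
      then obtain v w where vw: "(v, w) \<in> crossings h \<Sigma>" "h v - h w = real (Suc D)"
        by (auto simp: top_def)
      have e: "{v, w} \<in> \<Sigma>" "v \<noteq> w" using vw(1) by (auto simp: crossings_def)
      let ?S = "star \<Sigma> v w"
      have fan: "regular_fan n X ?S" by (rule regular_fan_star[OF less(2) e])
      have cr: "h p - h q < real (Suc D) \<or> (p, q) \<in> crossings h \<Sigma> - {(v, w)}"
        if "(p, q) \<in> crossings h ?S" for p q
        by (rule crossings_star[OF less(2) lin vw(1) _ that]) (rule less(3))
      have "top ?S \<subseteq> top \<Sigma> - {(v, w)}"
      proof clarify
        fix p q assume "(p, q) \<in> top ?S"
        then have "(p, q) \<in> crossings h ?S" "h p - h q = real (Suc D)" by (simp_all add: top_def)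
        then show "(p, q) \<in> top \<Sigma> - {(v, w)}" using cr[of p q] by (simp add: top_def)
      qed
      moreover have "(v, w) \<in> top \<Sigma>" using vw by (simp add: top_def)
      ultimately have "top ?S \<subset> top \<Sigma>" by blast
      then have "card (top ?S) < card (top \<Sigma>)" using fin[OF less(2)] by (rule psubset_card_mono[rotated])
      moreover have "h p - h q \<le> real (Suc D)" if "(p, q) \<in> crossings h ?S" for p q
        using cr[OF that] less(3)[of p q] by auto
      ultimately obtain \<Sigma>' where "regular_fan n X \<Sigma>'" "sign_consistent h \<Sigma>'"
        "\<forall>h'. linear h' \<and> sign_consistent h' ?S \<longrightarrow> sign_consistent h' \<Sigma>'"
        using less(1)[OF _ fan] by blast
      then show ?thesis using sign_consistent_star[OF less(2)] by blast
    qed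
  qed
  then show ?case using Suc.prems by blast
qed

lemma fan_refine:
  assumes fan: "regular_fan n X \<Sigma>" and "finite H" and "\<forall>h\<in>H. integral_form n h"
  shows "\<exists>\<Sigma>'. regular_fan n X \<Sigma>' \<and> (\<forall>h\<in>H. sign_consistent h \<Sigma>')"
  using assms(2,3)
proof (induction H rule: finite_induct)
  case empty
  then show ?case using fan by blast
next
  case (insert h H)
  then obtain \<Sigma>' where \<Sigma>': "regular_fan n X \<Sigma>'" "\<forall>h\<in>H. sign_consistent h \<Sigma>'" by auto
  have "finite (\<Union>\<Sigma>')" using regular_fanD(1,2)[OF \<Sigma>'(1)] by auto
  then have "finite (\<Union>\<Sigma>' \<times> \<Union>\<Sigma>')" by simp
  then have fin: "finite (crossings h \<Sigma>')"
    by (rule finite_subset[rotated]) (auto simp: crossings_def)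
  obtain D :: nat where D: "\<forall>e\<in>(\<lambda>(p, q). h p - h q) ` crossings h \<Sigma>'. e \<le> real D"
  proof -
    obtain M where M: "\<forall>e\<in>(\<lambda>(p, q). h p - h q) ` crossings h \<Sigma>'. e \<le> M"
      using finite_imageI[OF fin] bdd_above_finite bdd_above.unfold by metis
    obtain D :: nat where "M \<le> real D" using real_arch_simple by blast
    then show ?thesis using M that[of D] by fastforce
  qed
  have "h p - h q \<le> real D" if "(p, q) \<in> crossings h \<Sigma>'" for p q using D that by force
  then obtain \<Sigma>'' where "regular_fan n X \<Sigma>''" "sign_consistent h \<Sigma>''"
    "\<forall>h'. linear h' \<and> sign_consistent h' \<Sigma>' \<longrightarrow> sign_consistent h' \<Sigma>''"
    using fan_refine_form[OF _ \<Sigma>'(1)] insert.prems by blast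
  moreover have "linear h'" if "h' \<in> H" for h' using insert.prems that by (simp add: integral_form_def)
  ultimately show ?case using \<Sigma>'(2) by (intro exI[where x = \<Sigma>'']) auto
qed

section \<open>The fan of coordinate half-orthants\<close>

abbreviation unit_vec :: "nat \<Rightarrow> point" where
  "unit_vec i \<equiv> Poly_Mapping.single i 1"

text \<open>Only the last coordinate lacks its negative unit vector: homogenized points have last
  coordinate 1, so covering a half-space suffices.\<close>

definition orthant_gens :: "nat \<Rightarrow> point set" where
  "orthant_gens n = insert (unit_vec n) (unit_vec ` {..<n} \<union> (\<lambda>i. - unit_vec i) ` {..<n})"

definition orthant_fan :: "nat \<Rightarrow> point set set" where
  "orthant_fan n = {\<sigma>. \<sigma> \<subseteq> orthant_gens n \<and> (\<forall>i. \<not> (unit_vec i \<in> \<sigma> \<and> - unit_vec i \<in> \<sigma>))}"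

lemma coord_unit_vec: "coord (unit_vec i) j = (if i = j then 1 else 0)"
  by (simp add: coord_simps)

lemma unit_vec_neq: "unit_vec i \<noteq> - unit_vec j"
proof
  assume "unit_vec i = - unit_vec j"
  then have "coord (unit_vec i) i = coord (- unit_vec j) i" by simp
  then show False by (simp add: coord_unit_vec split: if_splits)
qed

lemma unit_vec_inject: "unit_vec i = unit_vec j \<longleftrightarrow> i = j"
  by (metis coord_unit_vec zero_neq_one)

lemma orthant_gens_cases:
  assumes "z \<in> orthant_gens n"
  obtains j where "j \<le> n" "z = unit_vec j" | j where "j < n" "z = - unit_vec j"
proof -
  have "\<exists>j. (j \<le> n \<and> z = unit_vec j) \<or> (j < n \<and> z = - unit_vec j)"
    using assms less_imp_le unfolding orthant_gens_def by blast
  then show ?thesis using that by blast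
qed

lemma finite_orthant_gens: "finite (orthant_gens n)"
  by (simp add: orthant_gens_def)

lemma unit_vec_in_gens: "j \<le> n \<Longrightarrow> unit_vec j \<in> orthant_gens n"
  by (cases "j = n") (auto simp: orthant_gens_def)

lemma minus_unit_vec_in_gens: "- unit_vec j \<in> orthant_gens n \<longleftrightarrow> j < n"
  using unit_vec_neq[of _ j] by (auto simp: orthant_gens_def unit_vec_inject dest: sym)

lemma orthant_coord_sum:
  assumes "\<sigma> \<subseteq> orthant_gens n" "\<And>z. z \<notin> \<sigma> \<Longrightarrow> a z = 0"
  shows "coord (\<Sum>z\<in>\<sigma>. a z *\<^sub>R z) j = a (unit_vec j) - a (- unit_vec j)"
proof -
  have fin: "finite \<sigma>" using assms finite_orthant_gens finite_subset by blast
  have "(\<Sum>z\<in>\<sigma>. a z * coord z j) = (\<Sum>z\<in>{unit_vec j, - unit_vec j}. a z * coord z j)"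
  proof (rule sum.mono_neutral_cong[OF _ fin])
    show "a i * coord i j = 0" if "i \<in> \<sigma> - {unit_vec j, - unit_vec j}" for i
    proof -
      have "i \<in> orthant_gens n" using that assms(1) by blast
      then show ?thesis using that by (cases rule: orthant_gens_cases) (auto simp: coord_unit_vec)
    qed
  qed (use assms in auto)
  then show ?thesis using unit_vec_neq[of j j] by (simp add: coord_unit_vec lookup_sum)
qed

text \<open>The formula is the positive part of the inner product of \<open>x\<close> with the
  generator, that is, the positive or negative part of one coordinate. Being explicit, it gives
  uniqueness.\<close>

lemma orthant_rep_unique:
  assumes "cone_rep (orthant_fan n) a x"
  shows "a z = (if z \<in> orthant_gens n then max 0 (\<Sum>i\<le>n. coord z i * coord x i) else 0)"
proof -
  obtain \<sigma> where \<sigma>: "\<sigma> \<in> orthant_fan n" "\<And>z. z \<notin> \<sigma> \<Longrightarrow> a z = 0" "\<And>z. z \<in> \<sigma> \<Longrightarrow> a z > 0"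
    "x = (\<Sum>z\<in>\<sigma>. a z *\<^sub>R z)"
    using assms by (auto simp: cone_rep_def)
  have sub: "\<sigma> \<subseteq> orthant_gens n" using \<sigma>(1) by (simp add: orthant_fan_def)
  have nn: "a z \<ge> 0" for z using \<sigma>(2,3)[of z] by (cases "z \<in> \<sigma>") auto
  have diff: "coord x j = a (unit_vec j) - a (- unit_vec j)" for j
    unfolding \<sigma>(4) by (rule orthant_coord_sum[OF sub \<sigma>(2)])
  have "a (unit_vec j) = 0 \<or> a (- unit_vec j) = 0" for j
    using \<sigma>(1,2) by (auto simp: orthant_fan_def)
  then have m: "a (unit_vec j) = max 0 (coord x j)" "a (- unit_vec j) = max 0 (- coord x j)" for j
    using diff[of j] nn[of "unit_vec j"] nn[of "- unit_vec j"] by (smt (verit))+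
  show ?thesis
  proof (cases "z \<in> orthant_gens n")
    case True
    then show ?thesis
    proof (cases rule: orthant_gens_cases)
      case (1 j)
      then have "(\<Sum>i\<le>n. coord z i * coord x i) = (\<Sum>i\<le>n. if i = j then coord x i else 0)"
        by (intro sum.cong) (auto simp: coord_unit_vec)
      then show ?thesis using 1 True m by simp
    next
      case (2 j)
      then have "(\<Sum>i\<le>n. coord z i * coord x i) = (\<Sum>i\<le>n. if i = j then - coord x i else 0)"
        by (intro sum.cong) (auto simp: coord_unit_vec)
      then show ?thesis using 2 True m by simp
    qed
  next
    case False
    then show ?thesis using \<sigma>(2) sub by auto
  qed
qed

lemma orthant_rep_exists:
  assumes "x \<in> Rn (Suc n)" "coord x n \<ge> 0"
  shows "\<exists>a. cone_rep (orthant_fan n) a x"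
proof -
  define a where "a = (\<lambda>z. if z \<in> orthant_gens n then max 0 (\<Sum>i\<le>n. coord z i * coord x i) else 0)"
  define \<sigma> where "\<sigma> = {z. a z > 0}"
  have nn: "a z \<ge> 0" for z by (simp add: a_def)
  have \<sigma>: "\<sigma> \<subseteq> orthant_gens n" by (auto simp: \<sigma>_def a_def split: if_splits)
  have zero: "a z = 0" if "z \<notin> \<sigma>" for z using that nn[of z] by (simp add: \<sigma>_def)
  have p: "(\<Sum>i\<le>n. coord (unit_vec j) i * coord x i) = coord x j" if "j \<le> n" for j
  proof -
    have "(\<Sum>i\<le>n. coord (unit_vec j) i * coord x i) = (\<Sum>i\<le>n. if i = j then coord x i else 0)"
      by (intro sum.cong) (auto simp: coord_unit_vec)
    then show ?thesis using that by simp
  qed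
  have m: "(\<Sum>i\<le>n. coord (- unit_vec j) i * coord x i) = - coord x j" if "j \<le> n" for j
    using p[OF that] by (simp add: sum_negf)
  have ap: "a (unit_vec j) = (if j \<le> n then max 0 (coord x j) else 0)" for j
  proof (cases "j \<le> n")
    case True
    then show ?thesis using p unit_vec_in_gens by (simp add: a_def)
  next
    case False
    have "unit_vec j \<notin> orthant_gens n"
      using False unit_vec_neq[of j] by (auto simp: orthant_gens_def unit_vec_inject)
    then show ?thesis using False by (simp add: a_def)
  qed
  have am: "a (- unit_vec j) = (if j < n then max 0 (- coord x j) else 0)" for j
    using m[of j] minus_unit_vec_in_gens[of j n] by (simp add: a_def)
  have "x = (\<Sum>z\<in>\<sigma>. a z *\<^sub>R z)"
  proof (rule poly_mapping_eqI)
    fix j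
    have "coord (\<Sum>z\<in>\<sigma>. a z *\<^sub>R z) j = a (unit_vec j) - a (- unit_vec j)"
      by (rule orthant_coord_sum[OF \<sigma> zero])
    then show "coord x j = coord (\<Sum>z\<in>\<sigma>. a z *\<^sub>R z) j"
      using assms unfolding ap am by (cases "j < n"; cases "j = n") (auto simp: Rn_def)
  qed
  moreover have "\<sigma> \<in> orthant_fan n"
    unfolding orthant_fan_def using \<sigma> ap am by (auto simp: \<sigma>_def split: if_splits)
  moreover have "\<forall>v. v \<notin> \<sigma> \<longrightarrow> a v = 0" "\<forall>v\<in>\<sigma>. 0 < a v" using zero by (auto simp: \<sigma>_def)
  ultimately have "cone_rep (orthant_fan n) a x" unfolding cone_rep_def by blast
  then show ?thesis by blast
qed

lemma orthant_part_of_basis: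
  assumes "\<sigma> \<in> orthant_fan n"
  shows "part_of_basis (Suc n) \<sigma>"
proof -
  \<comment> \<open>Take the minus sign where it occurs in \<open>\<sigma>\<close> and plus
    elsewhere, so that the signed unit vectors form a basis containing
    \<open>\<sigma>\<close>.\<close>
  define s where "s = (\<lambda>i. if - unit_vec i \<in> \<sigma> then - 1 else 1 :: int)"
  define c where "c = (\<lambda>i. of_int (s i) *\<^sub>R unit_vec i)"
  let ?C = "c ` {..n}"
  have s: "s i * s i = 1" for i by (simp add: s_def)
  then have s': "real_of_int (s i) * real_of_int (s i) = 1" for i by (metis of_int_1 of_int_mult)
  have "\<sigma> \<subseteq> ?C"
  proof
    fix z assume z: "z \<in> \<sigma>"
    then have "z \<in> orthant_gens n" using assms by (auto simp: orthant_fan_def)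
    then show "z \<in> ?C"
    proof (cases rule: orthant_gens_cases)
      case (1 j)
      then have "- unit_vec j \<notin> \<sigma>" using z assms by (auto simp: orthant_fan_def)
      then have "z = c j" using 1 by (simp add: c_def s_def)
      then show ?thesis using 1 by blast
    next
      case (2 j)
      then have "z = c j" using z by (simp add: c_def s_def)
      then show ?thesis using 2 by auto
    qed
  qed
  moreover have "lattice_basis (Suc n) ?C"
  proof (rule lattice_basisI)
    show "?C \<subseteq> Zn (Suc n)"
      by (auto simp: c_def Zn_def Rn_def coord_unit_vec)
    show "Zn (Suc n) \<subseteq> int_module.span ?C"
    proof
      fix x assume x: "x \<in> Zn (Suc n)"
      have "x = (\<Sum>i<Suc n. coord x i *\<^sub>R unit_vec i)" by (rule Rn_eq_sum_single[OF Zn_in_Rn[OF x]])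
      also have "\<dots> = (\<Sum>i<Suc n. of_int (\<lfloor>coord x i\<rfloor> * s i) *\<^sub>R c i)"
      proof (rule sum.cong[OF refl])
        fix i
        have "real_of_int \<lfloor>coord x i\<rfloor> = coord x i" using x by (simp add: Zn_def)
        then have "real_of_int (\<lfloor>coord x i\<rfloor> * s i) * real_of_int (s i) = coord x i"
          by (simp only: of_int_mult mult.assoc s' mult_1_right)
        then show "coord x i *\<^sub>R unit_vec i = of_int (\<lfloor>coord x i\<rfloor> * s i) *\<^sub>R c i"
          by (simp only: c_def scaleR_scaleR)
      qed
      also have "\<dots> \<in> int_module.span ?C"
        by (intro int_module.span_sum int_module.span_scale int_module.span_base) auto
      finally show "x \<in> int_module.span ?C" .
    qed
    fix z assume "z \<in> ?C"
    then obtain j where j: "z = c j" by blast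
    have "linear (\<lambda>x. of_int (s j) * coord x j)" using linear_real_combine(2)[OF linear_coord linear_coord] .
    moreover have "of_int (s j) * coord (c j) j = 1" using s' by (simp add: c_def coord_unit_vec)
    moreover have "of_int (s j) * coord (c i) j = 0" if "c i \<noteq> c j" for i
      using that by (auto simp: c_def coord_unit_vec)
    ultimately show "\<exists>f::point \<Rightarrow> real. linear f \<and> f z = 1 \<and> (\<forall>c'\<in>?C - {z}. f c' = 0)"
      unfolding j by (intro exI[where x = "\<lambda>x. of_int (s j) * coord x j"]) auto
  qed
  ultimately show ?thesis by (auto simp: part_of_basis_def)
qed

lemma regular_fan_orthant: "regular_fan (Suc n) {x \<in> Rn (Suc n). coord x n \<ge> 0} (orthant_fan n)"
  unfolding regular_fan_def
proof (intro conjI ballI allI impI)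
  have "orthant_fan n \<subseteq> Pow (orthant_gens n)" by (auto simp: orthant_fan_def)
  then show "finite (orthant_fan n)" using finite_orthant_gens finite_subset by blast
  show "finite \<sigma>" if "\<sigma> \<in> orthant_fan n" for \<sigma>
    using that finite_orthant_gens finite_subset by (auto simp: orthant_fan_def)
  show "part_of_basis (Suc n) \<sigma>" if "\<sigma> \<in> orthant_fan n" for \<sigma>
    using that by (rule orthant_part_of_basis)
  show "\<tau> \<in> orthant_fan n" if "\<sigma> \<in> orthant_fan n" "\<tau> \<subseteq> \<sigma>" for \<sigma> \<tau>
    using that by (auto simp: orthant_fan_def)
  show "\<exists>a. cone_rep (orthant_fan n) a x" if "x \<in> {x \<in> Rn (Suc n). coord x n \<ge> 0}" for x
    using that orthant_rep_exists by auto
  show "a = b" if "cone_rep (orthant_fan n) a x" "cone_rep (orthant_fan n) b x" for a b x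
    using orthant_rep_unique[OF that(1)] orthant_rep_unique[OF that(2)] by (intro ext) simp
qed

section \<open>Homogeneous coordinates\<close>

definition homcone :: "nat \<Rightarrow> point set \<Rightarrow> point set" where
  "homcone n S = {r *\<^sub>R snoc n y 1 | r y. r \<ge> 0 \<and> y \<in> S}"

text \<open>After scaling to height 1, the subtracted unit vector erases the height coordinate; this
  returns a point of the smaller space, which shares the ambient type.\<close>

definition dehom :: "nat \<Rightarrow> point \<Rightarrow> point" where
  "dehom n v = (1 / coord v n) *\<^sub>R v - unit_vec n"

lemma coord_snoc: "coord (snoc n x c) i = coord x i + (if i = n then c else 0)"
  by (auto simp: snoc_def coord_simps)

lemma snoc_in_Rn: "x \<in> Rn n \<Longrightarrow> snoc n x c \<in> Rn (Suc n)"
  by (auto simp: Rn_def coord_snoc)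

lemma snoc_in_Qn: "x \<in> Qn n \<Longrightarrow> c \<in> \<rat> \<Longrightarrow> snoc n x c \<in> Qn (Suc n)"
  using snoc_in_Rn[of x n c] by (auto simp: Qn_def coord_snoc)

lemma snoc_sum:
  assumes "sum a V = 1"
  shows "snoc n (\<Sum>v\<in>V. a v *\<^sub>R v) 1 = (\<Sum>v\<in>V. a v *\<^sub>R snoc n v 1)"
  using assms by (simp add: snoc_def scaleR_add_right sum.distrib flip: scaleR_sum_left)

lemma coord_n_Rn: "x \<in> Rn n \<Longrightarrow> coord x n = 0"
  by (simp add: Rn_def)

lemma dehom_scale_snoc:
  assumes "x \<in> Rn n" "r > 0"
  shows "dehom n (r *\<^sub>R snoc n x 1) = x"
  using assms by (simp add: dehom_def coord_snoc coord_n_Rn) (simp add: snoc_def)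

lemma dehom_eq:
  assumes "coord v n \<noteq> 0"
  shows "coord v n *\<^sub>R snoc n (dehom n v) 1 = v"
  using assms by (simp add: dehom_def snoc_def)

lemma dehom_in_Rn:
  assumes "v \<in> Rn (Suc n)" "coord v n \<noteq> 0"
  shows "dehom n v \<in> Rn n"
  unfolding Rn_def
proof (intro CollectI allI impI)
  fix i assume "n \<le> i"
  then show "coord (dehom n v) i = 0"
    using assms by (cases "i = n") (auto simp: dehom_def Rn_def coord_simps)
qed

text \<open>The last coordinate of a linear relation between the lifted points is the sum of its
  coefficients; the other coordinates then form an affine relation.\<close>

lemma snoc_independent:
  assumes V: "finite V" "V \<subseteq> Rn n" "\<not> affine_dependent V"
  shows "independent ((\<lambda>v. snoc n v 1) ` V)" "inj_on (\<lambda>v. snoc n v 1) V"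
proof -
  show inj: "inj_on (\<lambda>v. snoc n v 1) V" by (auto simp: inj_on_def snoc_def)
  show "independent ((\<lambda>v. snoc n v 1) ` V)"
  proof
    assume "dependent ((\<lambda>v. snoc n v 1) ` V)"
    then obtain u z where u: "z \<in> V" "u (snoc n z 1) \<noteq> 0" "(\<Sum>v\<in>V. u (snoc n v 1) *\<^sub>R snoc n v 1) = 0"
      using V(1) inj by (auto simp: dependent_finite sum.reindex o_def)
    have "coord (\<Sum>v\<in>V. u (snoc n v 1) *\<^sub>R snoc n v 1) n = (\<Sum>v\<in>V. u (snoc n v 1))"
      unfolding lookup_sum using V(2) by (intro sum.cong) (auto simp: coord_snoc coord_n_Rn subset_iff)
    then have s: "(\<Sum>v\<in>V. u (snoc n v 1)) = 0" using u(3) by simp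
    have "(\<Sum>v\<in>V. u (snoc n v 1) *\<^sub>R snoc n v 1) = (\<Sum>v\<in>V. u (snoc n v 1) *\<^sub>R v)"
      using s by (simp add: snoc_def scaleR_add_right sum.distrib flip: scaleR_sum_left)
    then have "(\<Sum>v\<in>V. u (snoc n v 1) *\<^sub>R v) = 0" using u(3) by simp
    then show False
      using affine_independent_unique[OF V(1,3), of "\<lambda>v. u (snoc n v 1)" "\<lambda>_. 0" z] s u by simp
  qed
qed

lemma homcone_convex_hull:
  assumes "finite V" "V \<noteq> {}"
  shows "homcone n (convex hull V) = {\<Sum>v\<in>V. a v *\<^sub>R snoc n v 1 | a. \<forall>v\<in>V. 0 \<le> a v}"
proof (intro equalityI subsetI)
  fix x assume "x \<in> homcone n (convex hull V)"
  then obtain r y where r: "r \<ge> 0" "y \<in> convex hull V" "x = r *\<^sub>R snoc n y 1" by (auto simp: homcone_def)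
  obtain u where u: "\<And>v. v \<in> V \<Longrightarrow> 0 \<le> u v" "sum u V = 1" "y = (\<Sum>v\<in>V. u v *\<^sub>R v)"
    using r(2) assms(1) by (rule convex_hull_finiteE) blast
  have "x = (\<Sum>v\<in>V. (r * u v) *\<^sub>R snoc n v 1)"
    unfolding r(3) u(3) snoc_sum[OF u(2)] by (simp add: scaleR_sum_right)
  then show "x \<in> {\<Sum>v\<in>V. a v *\<^sub>R snoc n v 1 | a. \<forall>v\<in>V. 0 \<le> a v}"
    using r(1) u(1) by (intro CollectI exI[where x = "\<lambda>v. r * u v"]) auto
next
  fix x assume "x \<in> {\<Sum>v\<in>V. a v *\<^sub>R snoc n v 1 | a. \<forall>v\<in>V. 0 \<le> a v}"
  then obtain a where a: "\<forall>v\<in>V. 0 \<le> a v" "x = (\<Sum>v\<in>V. a v *\<^sub>R snoc n v 1)" by blast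
  show "x \<in> homcone n (convex hull V)"
  proof (cases "sum a V = 0")
    case True
    then have "\<forall>v\<in>V. a v = 0" using a(1) assms sum_nonneg_eq_0_iff[of V a] by auto
    moreover obtain y where "y \<in> V" using assms(2) by blast
    ultimately show ?thesis unfolding homcone_def
      using a(2) hull_inc[of y V] by (intro CollectI exI[where x = 0] exI[where x = y]) auto
  next
    case False
    then have r: "sum a V > 0" using a(1) sum_nonneg[of V a] by (simp add: order_less_le)
    define y where "y = (\<Sum>v\<in>V. (a v / sum a V) *\<^sub>R v)"
    have one: "(\<Sum>v\<in>V. a v / sum a V) = 1" using r by (simp flip: sum_divide_distrib)
    have y: "y \<in> convex hull V"
      by (rule convex_hull_finiteI[where u = "\<lambda>v. a v / sum a V"])
        (use assms a r one in \<open>auto simp: y_def\<close>)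
    have "sum a V *\<^sub>R snoc n y 1 = x"
      unfolding y_def snoc_sum[OF one] a(2) using r by (simp add: scaleR_sum_right)
    then show ?thesis using y r by (auto simp: homcone_def intro!: exI[where x = "sum a V"] exI[where x = y])
  qed
qed

section \<open>Homogenized inequalities\<close>

text \<open>What the triangulation needs to know of a convex set: its homogenization is given by
  finitely many integral inequalities. Besides rational simplexes this applies to the
  parallelepipeds of the normalization.\<close>

definition cone_definable :: "nat \<Rightarrow> point set \<Rightarrow> bool" where
  "cone_definable n S \<longleftrightarrow> S \<subseteq> Rn n \<and> convex S \<and>
     (\<exists>H. finite H \<and> (\<forall>h\<in>H. integral_form (Suc n) h) \<and>
       (\<forall>x\<in>Rn (Suc n). x \<in> homcone n S \<longleftrightarrow> (\<forall>h\<in>H. 0 \<le> h x)))"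

lemma cone_definableI:
  assumes S: "S \<subseteq> Rn n" "convex S"
    and H0: "finite H0" and rat: "\<And>h. h \<in> H0 \<Longrightarrow> rational_form (Suc n) h"
    and iff0: "\<And>x. x \<in> Rn (Suc n) \<Longrightarrow> x \<in> homcone n S \<longleftrightarrow> (\<forall>h\<in>H0. 0 \<le> h x)"
  shows "cone_definable n S"
proof -
  have "\<forall>h\<in>H0. \<exists>D::nat. D > 0 \<and> integral_form (Suc n) (\<lambda>x. real D * h x)"
    using rational_form_scale[OF rat] by metis
  then obtain D :: "(point \<Rightarrow> real) \<Rightarrow> nat"
    where D: "\<And>h. h \<in> H0 \<Longrightarrow> D h > 0 \<and> integral_form (Suc n) (\<lambda>x. real (D h) * h x)" by metis
  let ?H = "(\<lambda>h x. real (D h) * h x) ` H0"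
  have "finite ?H" using H0 by simp
  moreover have "integral_form (Suc n) h" if "h \<in> ?H" for h
    using that D by (elim imageE) blast
  moreover have "x \<in> homcone n S \<longleftrightarrow> (\<forall>h\<in>?H. h x \<ge> 0)" if "x \<in> Rn (Suc n)" for x
  proof -
    have "0 \<le> real (D h) * h x \<longleftrightarrow> 0 \<le> h x" if "h \<in> H0" for h
      using D[OF that] by (auto simp: zero_le_mult_iff)
    then show ?thesis unfolding iff0[OF that] by simp
  qed
  ultimately show ?thesis
    unfolding cone_definable_def using S by (intro conjI exI[where x = ?H] ballI) auto
qed

lemma rational_simplex_definable:
  assumes S: "rational_simplex n m S"
  shows "cone_definable n S"
proof -
  let ?V = "vertices S"
  let ?W = "(\<lambda>v. snoc n v 1) ` ?V"
  have V: "?V \<subseteq> Qn n" "finite ?V" "\<not> affine_dependent ?V" "S = convex hull ?V" "?V \<noteq> {}"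
    using S by (auto simp: rational_simplex_iff)
  have W: "finite ?W" "?W \<subseteq> Qn (Suc n)" using V snoc_in_Qn by auto
  have VR: "?V \<subseteq> Rn n" using V Qn_subset_Rn by blast
  note ind = snoc_independent[OF V(2) VR V(3)]
  obtain G f where G: "finite G" "\<forall>g\<in>G. rational_form (Suc n) g"
    and f: "\<forall>v\<in>?W. rational_form (Suc n) (f v)" "\<forall>v\<in>?W. \<forall>w\<in>?W. f v w = (if w = v then 1 else 0)"
    and span: "\<forall>x\<in>Rn (Suc n). x \<in> span ?W \<longleftrightarrow> (\<forall>g\<in>G. g x = 0)"
    using rational_dual_forms[OF W ind(1)] by blast
  \<comment> \<open>An equation of the span enters as two opposite inequalities; the coordinate
    forms require nonnegative coefficients.\<close>
  define H0 where "H0 = G \<union> (\<lambda>g x. - 1 * g x) ` G \<union> f ` ?W"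
  have H0: "finite H0" using G(1) W(1) by (simp add: H0_def)
  have ratneg: "rational_form (Suc n) (\<lambda>x. - 1 * g x)" if "g \<in> G" for g
    using G(2) that linear_real_combine(2)[of g g "-1"] by (auto simp: rational_form_def)
  have rat: "rational_form (Suc n) h" if "h \<in> H0" for h
    using that G(2) f(1) ratneg unfolding H0_def by blast
  have iff0: "x \<in> homcone n S \<longleftrightarrow> (\<forall>h\<in>H0. h x \<ge> 0)" if x: "x \<in> Rn (Suc n)" for x
  proof -
    have hS: "homcone n S = {\<Sum>v\<in>?V. a v *\<^sub>R snoc n v 1 | a. \<forall>v\<in>?V. 0 \<le> a v}"
      using homcone_convex_hull[OF V(2,5), of n] V(4)[symmetric] by simp
    have "(\<forall>h\<in>H0. h x \<ge> 0) \<longleftrightarrow> (\<forall>g\<in>G. g x = 0) \<and> (\<forall>w\<in>?W. f w x \<ge> 0)"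
    proof -
      have "(\<forall>g\<in>G. g x = 0) \<longleftrightarrow> (\<forall>g\<in>G. 0 \<le> g x) \<and> (\<forall>g\<in>G. 0 \<le> - 1 * g x)"
        by (auto simp: order_eq_iff)
      then show ?thesis unfolding H0_def ball_Un by simp
    qed
    also have "\<dots> \<longleftrightarrow> x \<in> span ?W \<and> (\<forall>w\<in>?W. f w x \<ge> 0)" using span x by blast
    also have "\<dots> \<longleftrightarrow> x \<in> homcone n S"
    proof
      assume r: "x \<in> span ?W \<and> (\<forall>w\<in>?W. f w x \<ge> 0)"
      then obtain u where u: "x = (\<Sum>w\<in>?W. u w *\<^sub>R w)" using span_finite[OF W(1)] by auto
      have "f w x = u w" if "w \<in> ?W" for w
      proof -
        have "f w x = (\<Sum>z\<in>?W. u z * f w z)"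
          unfolding u using f(1) that by (intro linear_real_sum) (auto simp: rational_form_def)
        also have "\<dots> = (\<Sum>z\<in>?W. if z = w then u z else 0)"
          using f(2) that by (intro sum.cong) auto
        finally show ?thesis using that W(1) by simp
      qed
      then have "\<forall>w\<in>?W. u w \<ge> 0" using r by auto
      then show "x \<in> homcone n S"
        unfolding hS using u ind(2)
        by (intro CollectI exI[where x = "\<lambda>v. u (snoc n v 1)"]) (auto simp: sum.reindex)
    next
      assume "x \<in> homcone n S"
      then obtain a where a: "\<forall>v\<in>?V. 0 \<le> a v" "x = (\<Sum>v\<in>?V. a v *\<^sub>R snoc n v 1)"
        unfolding hS by blast
      have "x \<in> span ?W" unfolding a(2) by (intro span_sum span_scale span_base) auto
      moreover have "f (snoc n v 1) x \<ge> 0" if v: "v \<in> ?V" for v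
      proof -
        have "f (snoc n v 1) x = (\<Sum>z\<in>?V. a z * f (snoc n v 1) (snoc n z 1))"
          unfolding a(2) using f(1) v by (auto simp: rational_form_def linear_sum linear_scale)
        also have "\<dots> \<ge> 0" using a(1) f(2) v by (intro sum_nonneg) auto
        finally show ?thesis .
      qed
      ultimately show "x \<in> span ?W \<and> (\<forall>w\<in>?W. f w x \<ge> 0)" by blast
    qed
    finally show ?thesis ..
  qed
  have "S \<subseteq> Rn n" using Rn_convex_hull[OF VR] V(4) by simp
  moreover have "convex S" using V(4) convex_convex_hull[of ?V] by simp
  ultimately show ?thesis using H0 rat iff0 by (rule cone_definableI)
qed

section \<open>Regular triangulations\<close>

lemma common_denominator_Qn:
  assumes "finite V" "V \<subseteq> Qn n"
  obtains D :: nat where "D > 0" "\<And>v i. v \<in> V \<Longrightarrow> real D * coord v i \<in> \<int>"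
proof -
  let ?A = "(\<lambda>(v, i). coord v i) ` (V \<times> {..<n})"
  have "finite ?A" "?A \<subseteq> \<rat>" using assms by (auto simp: Qn_def)
  then obtain D :: nat where D: "D > 0" "\<And>r. r \<in> ?A \<Longrightarrow> real D * r \<in> \<int>"
    using common_denominator[of ?A] by blast
  have "real D * coord v i \<in> \<int>" if v: "v \<in> V" for v i
  proof (cases "i < n")
    case True
    then show ?thesis using v by (intro D(2)) auto
  next
    case False
    then show ?thesis using v assms by (auto simp: Qn_def Rn_def)
  qed
  then show ?thesis using D(1) that by blast
qed

lemma den_works:
  assumes "x \<in> Qn n"
  shows "den x > 0" "real (den x) * coord x i \<in> \<int>"
proof -
  have "finite {x}" "{x} \<subseteq> Qn n" using assms by auto
  then obtain D :: nat where "D > 0" "\<And>v i. v \<in> {x} \<Longrightarrow> real D * coord v i \<in> \<int>"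
    by (rule common_denominator_Qn) blast
  then have "\<exists>q>0. \<forall>i. real q * coord x i \<in> \<int>" by blast
  from LeastI_ex[OF this] show "den x > 0" "real (den x) * coord x i \<in> \<int>"
    by (simp_all add: den_def)
qed

lemma den_le:
  assumes "q > 0" "\<And>i. real q * coord x i \<in> \<int>"
  shows "den x \<le> q"
  unfolding den_def using assms by (intro Least_le) auto

lemma coord_homog: "x \<in> Rn n \<Longrightarrow> coord (homog n x) n = real (den x)"
  by (simp add: homog_def coord_snoc coord_n_Rn)

lemma dehom_homog: "x \<in> Qn n \<Longrightarrow> dehom n (homog n x) = x"
  using dehom_scale_snoc[of x n "real (den x)"] den_works(1)[of x n] Qn_in_Rn[of x n]
  by (simp add: homog_def)

lemma homog_in_Zn:
  assumes "x \<in> Qn n"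
  shows "homog n x \<in> Zn (Suc n)"
proof -
  have "x \<in> Rn n" using assms by (rule Qn_in_Rn)
  then have "homog n x \<in> Rn (Suc n)" unfolding homog_def by (intro Rn_scaleR snoc_in_Rn)
  moreover have "coord (homog n x) i \<in> \<int>" for i
    using den_works(2)[OF assms, of i] by (simp add: homog_def coord_snoc algebra_simps)
  ultimately show ?thesis by (simp add: Zn_def)
qed

text \<open>A member of a lattice basis is primitive, as its dual form takes the value 1 on it. Its
  last coordinate is a common denominator of the dehomogenized point, and the dual form shows that
  it divides the least one, so the two agree.\<close>

lemma dehom_primitive:
  assumes v: "v \<in> \<sigma>" "part_of_basis (Suc n) \<sigma>" and pos: "coord v n > 0"
  shows "dehom n v \<in> Qn n" "homog n (dehom n v) = v" "real (den (dehom n v)) = coord v n"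
proof -
  obtain C where C: "\<sigma> \<subseteq> C" "lattice_basis (Suc n) C" using v(2) by (auto simp: part_of_basis_def)
  obtain D :: "point \<Rightarrow> point \<Rightarrow> real" where D: "\<And>c. linear (D c)"
    "\<And>c c'. c \<in> C \<Longrightarrow> c' \<in> C \<Longrightarrow> D c c' = (if c' = c then 1 else 0)"
    "\<And>c x. x \<in> Zn (Suc n) \<Longrightarrow> D c x \<in> \<int>"
    using lattice_basis_dual[OF C(2)] by blast
  have vZ: "v \<in> Zn (Suc n)" using v C lattice_basis_subset by blast
  let ?x = "dehom n v"
  have xR: "?x \<in> Rn n" using dehom_in_Rn Zn_in_Rn[OF vZ] pos by simp
  have "coord v i \<in> \<int>" for i using vZ by (simp add: Zn_def)
  note vint = this
  then have vrat: "coord v i \<in> \<rat>" for i using Ints_subset_Rats by blast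
  have "coord ?x i \<in> \<rat>" for i
    unfolding dehom_def using vrat by (auto simp: coord_simps)
  then show xQ: "?x \<in> Qn n" using xR by (simp add: Qn_def)
  obtain k where k: "coord v n = of_int k" using vint by (auto elim: Ints_cases)
  define q where "q = nat k"
  have q: "real q = coord v n" "q > 0" using k pos by (auto simp: q_def)
  have sn: "coord v n *\<^sub>R snoc n ?x 1 = v" using dehom_eq pos by simp
  have cx: "coord v n * coord ?x i \<in> \<int>" for i
  proof (cases "i = n")
    case True
    then show ?thesis using xR by (simp add: coord_n_Rn)
  next
    case False
    then have "coord v n * coord ?x i = coord v i" using pos by (simp add: dehom_def coord_simps)
    then show ?thesis using vint by simp
  qed
  have le: "den ?x \<le> q" using cx q by (intro den_le) auto
  have "real (den ?x) / coord v n \<in> \<int>"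
  proof -
    have "homog n ?x = (real (den ?x) / coord v n) *\<^sub>R (coord v n *\<^sub>R snoc n ?x 1)"
      using pos by (simp add: homog_def)
    also have "\<dots> = (real (den ?x) / coord v n) *\<^sub>R v" unfolding sn ..
    finally have "D v (homog n ?x) = real (den ?x) / coord v n"
      using D(1,2) v C by (auto simp: linear_scale)
    then show ?thesis using D(3)[OF homog_in_Zn[OF xQ], of v] by simp
  qed
  then obtain j where j: "real (den ?x) / coord v n = of_int j" by (auto elim: Ints_cases)
  have "real (den ?x) / coord v n > 0" using den_works(1)[OF xQ] pos by simp
  then have "of_int j > (0::real)" using j by simp
  then have "j \<ge> 1" by linarith
  then have "(of_int 1 :: real) \<le> of_int j" by (subst of_int_le_iff)
  then have "real (den ?x) \<ge> coord v n" using j pos by (metis le_divide_eq_1_pos of_int_1)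
  then show den: "real (den ?x) = coord v n" using le q by linarith
  show "homog n ?x = v" using sn by (simp add: homog_def den)
qed

lemma part_of_basis_combination:
  assumes \<sigma>: "part_of_basis n \<sigma>" "finite \<sigma>" and z: "(\<Sum>v\<in>\<sigma>. a v *\<^sub>R v) \<in> Zn n" and "v \<in> \<sigma>"
  shows "a v \<in> \<int>"
proof -
  obtain C where C: "\<sigma> \<subseteq> C" "lattice_basis n C" using \<sigma> by (auto simp: part_of_basis_def)
  obtain D :: "point \<Rightarrow> point \<Rightarrow> real" where D: "\<And>c. linear (D c)"
    "\<And>c c'. c \<in> C \<Longrightarrow> c' \<in> C \<Longrightarrow> D c c' = (if c' = c then 1 else 0)"
    "\<And>c x. x \<in> Zn n \<Longrightarrow> D c x \<in> \<int>"
    using lattice_basis_dual[OF C(2)] by blast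
  have "D v (\<Sum>z\<in>\<sigma>. a z *\<^sub>R z) = (\<Sum>z\<in>\<sigma>. a z * D v z)" by (rule linear_real_sum[OF D(1)])
  also have "\<dots> = (\<Sum>z\<in>\<sigma>. if z = v then a z else 0)"
    using D(2) C(1) assms(4) by (intro sum.cong) (auto simp: subset_iff)
  also have "\<dots> = a v" using assms by simp
  finally show ?thesis using D(3)[OF z, of v] by simp
qed

lemma part_of_basis_zero:
  assumes \<sigma>: "part_of_basis n \<sigma>" "finite \<sigma>" and z: "(\<Sum>v\<in>\<sigma>. a v *\<^sub>R v) = 0" and "v \<in> \<sigma>"
  shows "a v = 0"
proof -
  obtain C where C: "\<sigma> \<subseteq> C" "lattice_basis n C" using \<sigma> by (auto simp: part_of_basis_def)
  obtain D :: "point \<Rightarrow> point \<Rightarrow> real" where D: "\<And>c. linear (D c)"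
    "\<And>c c'. c \<in> C \<Longrightarrow> c' \<in> C \<Longrightarrow> D c c' = (if c' = c then 1 else 0)"
    using lattice_basis_dual[OF C(2)] by metis
  have "D v (\<Sum>z\<in>\<sigma>. a z *\<^sub>R z) = (\<Sum>z\<in>\<sigma>. a z * D v z)" by (rule linear_real_sum[OF D(1)])
  also have "\<dots> = (\<Sum>z\<in>\<sigma>. if z = v then a z else 0)"
    using D(2) C(1) assms(4) by (intro sum.cong) (auto simp: subset_iff)
  also have "\<dots> = a v" using assms by simp
  finally show ?thesis using z D(1) by (simp add: linear_0)
qed

text \<open>An affine relation of the dehomogenized vertices, divided by the heights, is a linear
  relation of the generators.\<close>

lemma regular_vertices_dehom:
  assumes \<sigma>: "part_of_basis (Suc n) \<sigma>" "finite \<sigma>" and pos: "\<And>v. v \<in> \<sigma> \<Longrightarrow> coord v n > 0"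
  shows "regular_vertices n (dehom n ` \<sigma>)" "inj_on (dehom n) \<sigma>"
proof -
  note p = dehom_primitive[OF _ \<sigma>(1) pos]
  show inj: "inj_on (dehom n) \<sigma>" using p(2) by (metis inj_onI)
  have "\<not> affine_dependent (dehom n ` \<sigma>)"
  proof
    assume "affine_dependent (dehom n ` \<sigma>)"
    then obtain U w where U: "(\<Sum>v\<in>\<sigma>. U (dehom n v)) = 0" "w \<in> \<sigma>" "U (dehom n w) \<noteq> 0"
      "(\<Sum>v\<in>\<sigma>. U (dehom n v) *\<^sub>R dehom n v) = 0"
      using affine_dependent_explicit_finite[of "dehom n ` \<sigma>"] \<sigma>(2) inj by (auto simp: sum.reindex)
    have "(\<Sum>v\<in>\<sigma>. (U (dehom n v) / coord v n) *\<^sub>R v) = (\<Sum>v\<in>\<sigma>. U (dehom n v) *\<^sub>R snoc n (dehom n v) 1)"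
    proof (rule sum.cong[OF refl])
      fix v assume v: "v \<in> \<sigma>"
      have "v = coord v n *\<^sub>R snoc n (dehom n v) 1" using dehom_eq[of v n] pos[OF v] by simp
      then have "(U (dehom n v) / coord v n) *\<^sub>R v = (U (dehom n v) / coord v n) *\<^sub>R coord v n *\<^sub>R snoc n (dehom n v) 1"
        by simp
      also have "\<dots> = U (dehom n v) *\<^sub>R snoc n (dehom n v) 1" using pos[OF v] by simp
      finally show "(U (dehom n v) / coord v n) *\<^sub>R v = U (dehom n v) *\<^sub>R snoc n (dehom n v) 1" .
    qed
    also have "\<dots> = 0"
      using U by (simp add: snoc_def scaleR_add_right sum.distrib flip: scaleR_sum_left)
    finally have "U (dehom n w) / coord w n = 0"
      using part_of_basis_zero[OF \<sigma>, of "\<lambda>v. U (dehom n v) / coord v n"] U(2) by blast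
    then show False using U(3) pos[OF U(2)] by simp
  qed
  moreover have "homog n ` dehom n ` \<sigma> = \<sigma>" using p(2) by force
  ultimately show "regular_vertices n (dehom n ` \<sigma>)"
    using p(1) \<sigma> by (auto simp: regular_vertices_def)
qed

text \<open>Barycentric coordinates divided by the heights are cone coefficients, so a relatively
  open simplex lies in the corresponding relatively open cone.\<close>

lemma dehom_cone_rep:
  assumes \<sigma>: "\<sigma> \<in> \<Sigma>" "finite \<sigma>" "\<And>v. v \<in> \<sigma> \<Longrightarrow> coord v n > 0" "inj_on (dehom n) \<sigma>"
    and x: "x \<in> open_simplex (dehom n ` \<sigma>)"
  obtains a where "cone_rep \<Sigma> a (snoc n x 1)" "\<And>v. v \<in> \<sigma> \<longleftrightarrow> a v > 0"
proof -
  obtain u where u: "\<forall>v\<in>\<sigma>. 0 < u (dehom n v)" "(\<Sum>v\<in>\<sigma>. u (dehom n v)) = 1" "x = (\<Sum>v\<in>\<sigma>. u (dehom n v) *\<^sub>R dehom n v)"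
    using x \<sigma>(4) by (auto simp: open_simplex_def sum.reindex)
  define a where "a = (\<lambda>v. if v \<in> \<sigma> then u (dehom n v) / coord v n else 0)"
  have "snoc n x 1 = (\<Sum>v\<in>\<sigma>. u (dehom n v) *\<^sub>R snoc n (dehom n v) 1)"
    unfolding u(3) using u(2) by (simp add: snoc_def scaleR_add_right sum.distrib flip: scaleR_sum_left)
  also have "\<dots> = (\<Sum>v\<in>\<sigma>. a v *\<^sub>R v)"
  proof (rule sum.cong[OF refl])
    fix v assume v: "v \<in> \<sigma>"
    have "a v *\<^sub>R v = a v *\<^sub>R coord v n *\<^sub>R snoc n (dehom n v) 1" using dehom_eq[of v n] \<sigma>(3)[OF v] by simp
    also have "\<dots> = u (dehom n v) *\<^sub>R snoc n (dehom n v) 1" using \<sigma>(3)[OF v] v by (simp add: a_def)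
    finally show "u (dehom n v) *\<^sub>R snoc n (dehom n v) 1 = a v *\<^sub>R v" ..
  qed
  finally have "cone_rep \<Sigma> a (snoc n x 1)"
    unfolding cone_rep_def using \<sigma> u(1) by (intro bexI[where x = \<sigma>]) (auto simp: a_def)
  moreover have "v \<in> \<sigma> \<longleftrightarrow> a v > 0" for v using u(1) \<sigma>(3) by (simp add: a_def)
  ultimately show ?thesis by (rule that)
qed

text \<open>A point lies in the relative interior of at most one simplex of a dehomogenized fan, so two
  simplexes meet exactly in the simplex spanned by their common vertices.\<close>

lemma fan_complex:
  assumes fan: "regular_fan (Suc n) X \<Sigma>"
    and \<Sigma>': "\<Sigma>' \<subseteq> \<Sigma>" "\<And>\<sigma> \<tau>. \<sigma> \<in> \<Sigma>' \<Longrightarrow> \<tau> \<subseteq> \<sigma> \<Longrightarrow> \<tau> \<noteq> {} \<Longrightarrow> \<tau> \<in> \<Sigma>'"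
      "{} \<notin> \<Sigma>'" "\<And>\<sigma> v. \<sigma> \<in> \<Sigma>' \<Longrightarrow> v \<in> \<sigma> \<Longrightarrow> coord v n > 0"
  defines "\<Delta> \<equiv> (\<lambda>\<sigma>. convex hull (dehom n ` \<sigma>)) ` \<Sigma>'"
  shows "simplicial_complex_in n \<Delta>" "\<And>T. T \<in> \<Delta> \<Longrightarrow> \<exists>m. regular_simplex n m T"
proof -
  note D = regular_fanD[OF fan]
  have fin: "finite \<sigma>" and part: "part_of_basis (Suc n) \<sigma>" if "\<sigma> \<in> \<Sigma>'" for \<sigma>
    using that \<Sigma>'(1) D(2,3) by auto
  have reg: "regular_vertices n (dehom n ` \<sigma>)" and inj: "inj_on (dehom n) \<sigma>" if "\<sigma> \<in> \<Sigma>'" for \<sigma>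
    using regular_vertices_dehom[OF part[OF that] fin[OF that] \<Sigma>'(4)[OF that]] by auto
  have card: "card (dehom n ` \<sigma>) = Suc (card \<sigma> - 1)" if "\<sigma> \<in> \<Sigma>'" for \<sigma>
    using card_image[OF inj[OF that]] fin[OF that] \<Sigma>'(3) that by (cases "card \<sigma>") auto
  have simplex: "regular_simplex n (card \<sigma> - 1) (convex hull (dehom n ` \<sigma>))" if "\<sigma> \<in> \<Sigma>'" for \<sigma>
    unfolding regular_simplex_def using reg[OF that] card[OF that] by blast
  show "\<exists>m. regular_simplex n m T" if "T \<in> \<Delta>" for T
    using that simplex unfolding \<Delta>_def by blast
  have indep: "\<not> affine_dependent (dehom n ` \<sigma>)" if "\<sigma> \<in> \<Sigma>'" for \<sigma>
    using reg[OF that] by (simp add: regular_vertices_def)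
  have inter: "convex hull (dehom n ` \<sigma>) \<inter> convex hull (dehom n ` \<tau>) = convex hull (dehom n ` (\<sigma> \<inter> \<tau>))"
    if st: "\<sigma> \<in> \<Sigma>'" "\<tau> \<in> \<Sigma>'" for \<sigma> \<tau>
  proof
    show "convex hull (dehom n ` (\<sigma> \<inter> \<tau>)) \<subseteq> convex hull (dehom n ` \<sigma>) \<inter> convex hull (dehom n ` \<tau>)"
      using hull_mono[of "dehom n ` (\<sigma> \<inter> \<tau>)"] by blast
    show "convex hull (dehom n ` \<sigma>) \<inter> convex hull (dehom n ` \<tau>) \<subseteq> convex hull (dehom n ` (\<sigma> \<inter> \<tau>))"
    proof
      fix x assume x: "x \<in> convex hull (dehom n ` \<sigma>) \<inter> convex hull (dehom n ` \<tau>)"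
      have sub: "\<exists>\<sigma>'\<in>\<Sigma>'. \<sigma>' \<subseteq> \<sigma> \<and> x \<in> open_simplex (dehom n ` \<sigma>')"
        if s: "\<sigma> \<in> \<Sigma>'" "x \<in> convex hull (dehom n ` \<sigma>)" for \<sigma>
      proof -
        obtain W where W: "W \<subseteq> dehom n ` \<sigma>" "W \<noteq> {}" "x \<in> open_simplex W"
          using convex_hull_open_simplex[OF s(2)] fin[OF s(1)] by blast
        then obtain \<sigma>' where "\<sigma>' \<subseteq> \<sigma>" "W = dehom n ` \<sigma>'" by (auto simp: subset_image_iff)
        then show ?thesis using W \<Sigma>'(2)[OF s(1), of \<sigma>'] by blast
      qed
      obtain \<sigma>' where s: "\<sigma>' \<in> \<Sigma>'" "\<sigma>' \<subseteq> \<sigma>" "x \<in> open_simplex (dehom n ` \<sigma>')"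
        using sub[OF st(1)] x by blast
      obtain \<tau>' where t: "\<tau>' \<in> \<Sigma>'" "\<tau>' \<subseteq> \<tau>" "x \<in> open_simplex (dehom n ` \<tau>')"
        using sub[OF st(2)] x by blast
      obtain a where a: "cone_rep \<Sigma> a (snoc n x 1)" "\<And>v. v \<in> \<sigma>' \<longleftrightarrow> a v > 0"
        using dehom_cone_rep[OF _ fin[OF s(1)] \<Sigma>'(4)[OF s(1)] inj[OF s(1)] s(3)] \<Sigma>'(1) s(1) by blast
      obtain b where b: "cone_rep \<Sigma> b (snoc n x 1)" "\<And>v. v \<in> \<tau>' \<longleftrightarrow> b v > 0"
        using dehom_cone_rep[OF _ fin[OF t(1)] \<Sigma>'(4)[OF t(1)] inj[OF t(1)] t(3)] \<Sigma>'(1) t(1) by blast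
      have "a = b" using D(6)[OF a(1) b(1)] .
      then have "\<sigma>' = \<tau>'" using a(2) b(2) by blast
      then have "dehom n ` \<sigma>' \<subseteq> dehom n ` (\<sigma> \<inter> \<tau>)" using s t by blast
      moreover have "x \<in> convex hull (dehom n ` \<sigma>')"
        using s(3) open_simplex_subset[of "dehom n ` \<sigma>'"] fin[OF s(1)] by blast
      ultimately show "x \<in> convex hull (dehom n ` (\<sigma> \<inter> \<tau>))" using hull_mono by blast
    qed
  qed
  have face: "convex hull (dehom n ` \<tau>) face_of convex hull (dehom n ` \<sigma>)" if "\<sigma> \<in> \<Sigma>'" "\<tau> \<subseteq> \<sigma>" for \<sigma> \<tau>
    using fin[OF that(1)] indep[OF that(1)] that(2) by (intro face_of_affine_independent_convex_hull) auto
  show "simplicial_complex_in n \<Delta>"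
    unfolding simplicial_complex_in_def
  proof (intro conjI ballI allI impI)
    show "finite \<Delta>" using D(1) \<Sigma>'(1) finite_subset by (auto simp: \<Delta>_def)
    fix S assume "S \<in> \<Delta>"
    then obtain \<sigma> where \<sigma>: "\<sigma> \<in> \<Sigma>'" "S = convex hull (dehom n ` \<sigma>)" by (auto simp: \<Delta>_def)
    show "\<exists>m. simplex_in n m S"
      using simplex[OF \<sigma>(1)] rational_imp_simplex regular_imp_rational \<sigma>(2) by blast
    show "F \<in> \<Delta>" if F: "F face_of S \<and> F \<noteq> {}" for F
    proof -
      have "F = convex hull (dehom n ` \<sigma> \<inter> F)"
        using face_of_convex_hull_eq[of F "dehom n ` \<sigma>"] F \<sigma> fin[OF \<sigma>(1)] by simp
      moreover obtain \<tau> where \<tau>: "\<tau> \<subseteq> \<sigma>" "dehom n ` \<sigma> \<inter> F = dehom n ` \<tau>"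
        using subset_imageE[of "dehom n ` \<sigma> \<inter> F" "dehom n" \<sigma>] by blast
      ultimately have eq: "F = convex hull (dehom n ` \<tau>)" by simp
      then have "\<tau> \<noteq> {}" using F by auto
      then show ?thesis using eq \<Sigma>'(2)[OF \<sigma>(1) \<tau>(1)] by (auto simp: \<Delta>_def)
    qed
    fix T assume "T \<in> \<Delta>"
    then obtain \<tau> where \<tau>: "\<tau> \<in> \<Sigma>'" "T = convex hull (dehom n ` \<tau>)" by (auto simp: \<Delta>_def)
    show "S \<inter> T face_of S" "S \<inter> T face_of T"
      unfolding \<sigma>(2) \<tau>(2) inter[OF \<sigma>(1) \<tau>(1)] using face[OF \<sigma>(1)] face[OF \<tau>(1)] by auto
  qed
qed

section \<open>Regular triangulations adapted to polyhedra\<close>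

text \<open>The refined fan crosses none of the hyperplanes that bound the cones over
  \<open>F\<close>. If \<open>(x, 1)\<close> lies in the relative interior of a fan cone and
  \<open>x\<close> in \<open>S\<close>, then the whole fan cone lies over \<open>S\<close>. The last
  clause makes the complex compatible with all unions and intersections of members of
  \<open>F\<close> at once.\<close>

theorem regular_complex_exists:
  assumes F: "finite F" "\<And>S. S \<in> F \<Longrightarrow> cone_definable n S"
  shows "\<exists>\<Delta>. simplicial_complex_in n \<Delta> \<and> (\<forall>T\<in>\<Delta>. \<exists>m. regular_simplex n m T) \<and>
    (\<forall>x\<in>\<Union>F. \<exists>T\<in>\<Delta>. x \<in> T \<and> (\<forall>S\<in>F. x \<in> S \<longrightarrow> T \<subseteq> S))"
proof -
  have "\<exists>H. finite H \<and> (\<forall>h\<in>H. integral_form (Suc n) h) \<and>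
    (\<forall>x\<in>Rn (Suc n). x \<in> homcone n S \<longleftrightarrow> (\<forall>h\<in>H. h x \<ge> 0))" if S: "S \<in> F" for S
    using F(2)[OF S] by (simp add: cone_definable_def)
  then obtain H where H: "\<And>S. S \<in> F \<Longrightarrow> finite (H S)" "\<And>S h. S \<in> F \<Longrightarrow> h \<in> H S \<Longrightarrow> integral_form (Suc n) h"
    "\<And>S x. S \<in> F \<Longrightarrow> x \<in> Rn (Suc n) \<Longrightarrow> x \<in> homcone n S \<longleftrightarrow> (\<forall>h\<in>H S. h x \<ge> 0)" by metis
  let ?X = "{x \<in> Rn (Suc n). coord x n \<ge> 0}"
  obtain \<Sigma> where fan: "regular_fan (Suc n) ?X \<Sigma>" and sgn: "\<And>h. h \<in> \<Union>(H ` F) \<Longrightarrow> sign_consistent h \<Sigma>"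
  proof -
    have "finite (\<Union>(H ` F))" "\<forall>h\<in>\<Union>(H ` F). integral_form (Suc n) h" using H(1,2) F(1) by auto
    from fan_refine[OF regular_fan_orthant this] show ?thesis using that by blast
  qed
  note D = regular_fanD[OF fan]
  have SR: "S \<subseteq> Rn n" if "S \<in> F" for S
    using F(2)[OF that] by (simp add: cone_definable_def)
  \<comment> \<open>The cones inside the homogenization of some \<open>S\<close> have all generators
    at positive height, so they can be dehomogenized.\<close>
  define \<Sigma>' where "\<Sigma>' = {\<sigma>\<in>\<Sigma>. \<sigma> \<noteq> {} \<and> (\<exists>S\<in>F. \<sigma> \<subseteq> homcone n S)}"
  have nz: "v \<noteq> 0" if "\<sigma> \<in> \<Sigma>" "v \<in> \<sigma>" for \<sigma> v
    using part_of_basis_zero[OF D(3,2)[OF that(1) ] _ that(2), of "\<lambda>z. if z = v then 1 else 0"] that D(2)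
    by (auto simp: if_distrib[of "\<lambda>c. c *\<^sub>R _"] sum.delta cong: if_cong)
  have homc: "coord v n > 0 \<and> dehom n v \<in> S" if v: "S \<in> F" "v \<in> homcone n S" "v \<noteq> 0" for S v
  proof -
    obtain r y where r: "r \<ge> 0" "y \<in> S" "v = r *\<^sub>R snoc n y 1" using v(2) by (auto simp: homcone_def)
    then have "r > 0" using v(3) by (cases "r = 0") auto
    then show ?thesis
      using r SR[OF v(1)] dehom_scale_snoc[of y n r] by (auto simp: coord_snoc coord_n_Rn subset_iff)
  qed
  have pos: "coord v n > 0" if v: "\<sigma> \<in> \<Sigma>'" "v \<in> \<sigma>" for \<sigma> v
  proof -
    obtain S where "S \<in> F" "v \<in> homcone n S" "\<sigma> \<in> \<Sigma>" using v unfolding \<Sigma>'_def by blast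
    then show ?thesis using homc[of S v] nz[of \<sigma> v] v(2) by blast
  qed
  have sub: "\<tau> \<in> \<Sigma>'" if "\<sigma> \<in> \<Sigma>'" "\<tau> \<subseteq> \<sigma>" "\<tau> \<noteq> {}" for \<sigma> \<tau>
    using that D(4)[of \<sigma> \<tau>] unfolding \<Sigma>'_def by blast
  let ?\<Delta> = "(\<lambda>\<sigma>. convex hull (dehom n ` \<sigma>)) ` \<Sigma>'"
  have \<Delta>: "simplicial_complex_in n ?\<Delta>" "\<forall>T\<in>?\<Delta>. \<exists>m. regular_simplex n m T"
    using fan_complex[OF fan, of \<Sigma>'] pos sub unfolding \<Sigma>'_def by blast+
  have "\<exists>T\<in>?\<Delta>. x \<in> T \<and> (\<forall>S\<in>F. x \<in> S \<longrightarrow> T \<subseteq> S)" if x: "x \<in> \<Union>F" for x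
  proof -
    let ?x = "snoc n x 1"
    have xR: "x \<in> Rn n" using x SR by blast
    then have xX: "?x \<in> ?X" using snoc_in_Rn[OF xR] by (simp add: coord_snoc coord_n_Rn)
    then obtain a where "cone_rep \<Sigma> a ?x" using D(5) by blast
    then obtain \<sigma> where \<sigma>: "\<sigma> \<in> \<Sigma>" "\<And>v. v \<in> \<sigma> \<Longrightarrow> a v > 0" "?x = (\<Sum>v\<in>\<sigma>. a v *\<^sub>R v)"
      by (auto simp: cone_rep_def)
    have fin: "finite \<sigma>" using D(2) \<sigma>(1) .
    have "coord ?x n = 1" using xR by (simp add: coord_snoc coord_n_Rn)
    then have ne: "\<sigma> \<noteq> {}" using \<sigma>(3) by auto
    have inS: "\<sigma> \<subseteq> homcone n S" if S: "S \<in> F" "x \<in> S" for S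
    proof
      fix v assume v: "v \<in> \<sigma>"
      have vR: "v \<in> Rn (Suc n)" using fan_subset_Zn[OF fan \<sigma>(1)] v Zn_in_Rn by blast
      have xS: "?x \<in> homcone n S" using S by (auto simp: homcone_def intro!: exI[where x = 1] exI[where x = x])
      \<comment> \<open>A form negative at one generator is nonpositive at all of them, hence
        negative at the interior point \<open>(x, 1)\<close>, which lies over
        \<open>S\<close>.\<close>
      have "h v \<ge> 0" if h: "h \<in> H S" for h
      proof (rule ccontr)
        assume neg: "\<not> h v \<ge> 0"
        have "sign_consistent h \<Sigma>" using sgn h S(1) by blast
        then have le: "\<forall>w\<in>\<sigma>. h w \<le> 0" using \<sigma>(1) v neg unfolding sign_consistent_def by blast
        have "h ?x = (\<Sum>w\<in>\<sigma>. a w * h w)"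
          unfolding \<sigma>(3) using H(2)[OF S(1) h] by (intro linear_real_sum) (simp add: integral_form_def)
        also have "\<dots> < (\<Sum>w\<in>\<sigma>. 0)"
        proof (rule sum_strict_mono_ex1[OF fin])
          show "\<forall>w\<in>\<sigma>. a w * h w \<le> 0" using le \<sigma>(2) by (auto simp: mult_nonneg_nonpos less_imp_le)
          show "\<exists>w\<in>\<sigma>. a w * h w < 0" using v neg \<sigma>(2)[OF v] by (intro bexI[OF _ v]) (simp add: mult_pos_neg)
        qed
        finally show False using H(3)[OF S(1)] xX xS h by fastforce
      qed
      then show "v \<in> homcone n S" using H(3)[OF S(1) vR] by blast
    qed
    have \<sigma>': "\<sigma> \<in> \<Sigma>'" unfolding \<Sigma>'_def using \<sigma>(1) ne inS x by blast
    let ?T = "convex hull (dehom n ` \<sigma>)"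
    have "x \<in> ?T"
    proof -
      have vp: "coord v n > 0" if "v \<in> \<sigma>" for v using pos[OF \<sigma>' that] .
      have inj: "inj_on (dehom n) \<sigma>" using regular_vertices_dehom(2)[OF D(3)[OF \<sigma>(1)] fin vp] .
      have "1 = coord ?x n" using xR by (simp add: coord_snoc coord_n_Rn)
      also have "\<dots> = (\<Sum>v\<in>\<sigma>. a v * coord v n)" unfolding \<sigma>(3) by (simp add: lookup_sum)
      finally have one: "(\<Sum>v\<in>\<sigma>. a v * coord v n) = 1" ..
      have "snoc n (\<Sum>v\<in>\<sigma>. (a v * coord v n) *\<^sub>R dehom n v) 1 = (\<Sum>v\<in>\<sigma>. (a v * coord v n) *\<^sub>R snoc n (dehom n v) 1)"
        using one by (simp add: snoc_def scaleR_add_right sum.distrib flip: scaleR_sum_left)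
      also have "\<dots> = (\<Sum>v\<in>\<sigma>. a v *\<^sub>R v)"
      proof (rule sum.cong[OF refl])
        fix v assume "v \<in> \<sigma>"
        then show "(a v * coord v n) *\<^sub>R snoc n (dehom n v) 1 = a v *\<^sub>R v"
          using dehom_eq[of v n] vp[of v] by (simp flip: scaleR_scaleR)
      qed
      finally have "snoc n (\<Sum>v\<in>\<sigma>. (a v * coord v n) *\<^sub>R dehom n v) 1 = ?x" using \<sigma>(3) by simp
      then have "x = (\<Sum>v\<in>\<sigma>. (a v * coord v n) *\<^sub>R dehom n v)" by (simp add: snoc_def)
      moreover have "(\<Sum>v\<in>\<sigma>. (a v * coord v n) *\<^sub>R dehom n v) \<in> ?T"
        using one \<sigma>(2) vp fin hull_inc[of _ "dehom n ` \<sigma>" convex]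
        by (intro convex_sum) (auto simp: less_imp_le)
      ultimately show ?thesis by simp
    qed
    moreover have "?T \<subseteq> S" if S: "S \<in> F" "x \<in> S" for S
    proof (rule hull_minimal)
      show "dehom n ` \<sigma> \<subseteq> S" using homc[OF S(1)] inS[OF S] nz[OF \<sigma>(1)] by blast
      show "convex S" using F(2)[OF S(1)] by (simp add: cone_definable_def)
    qed
    ultimately show ?thesis using \<sigma>' by blast
  qed
  then show ?thesis using \<Delta> by blast
qed

lemma common_regular_triangulation:
  assumes "P \<in> rational_polyhedra n" "Q \<in> rational_polyhedra n"
  shows "\<exists>\<Delta>. simplicial_complex_in n \<Delta> \<and> (\<forall>T\<in>\<Delta>. \<exists>m. regular_simplex n m T) \<and>
    (\<forall>R\<in>{P, Q, P \<union> Q, P \<inter> Q}. \<Union>{T\<in>\<Delta>. T \<subseteq> R} = R)"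
proof -
  obtain F where F: "finite F" "\<forall>S\<in>F. \<exists>m. rational_simplex n m S" "P = \<Union>F"
    using assms(1) by (auto simp: rational_polyhedra_def)
  obtain G where G: "finite G" "\<forall>S\<in>G. \<exists>m. rational_simplex n m S" "Q = \<Union>G"
    using assms(2) by (auto simp: rational_polyhedra_def)
  have "finite (F \<union> G)" "\<And>S. S \<in> F \<union> G \<Longrightarrow> cone_definable n S"
    using F G rational_simplex_definable by auto
  then have "\<exists>\<Delta>. simplicial_complex_in n \<Delta> \<and> (\<forall>T\<in>\<Delta>. \<exists>m. regular_simplex n m T) \<and>
    (\<forall>x\<in>\<Union>(F \<union> G). \<exists>T\<in>\<Delta>. x \<in> T \<and> (\<forall>S\<in>F \<union> G. x \<in> S \<longrightarrow> T \<subseteq> S))"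
    by (rule regular_complex_exists)
  then obtain \<Delta> where \<Delta>: "simplicial_complex_in n \<Delta>" "\<forall>T\<in>\<Delta>. \<exists>m. regular_simplex n m T"
    "\<forall>x\<in>\<Union>(F \<union> G). \<exists>T\<in>\<Delta>. x \<in> T \<and> (\<forall>S\<in>F \<union> G. x \<in> S \<longrightarrow> T \<subseteq> S)"
    by (elim exE conjE) (rule that)
  have "\<exists>T\<in>\<Delta>. x \<in> T \<and> T \<subseteq> R" if R: "R \<in> {P, Q, P \<union> Q, P \<inter> Q}" "x \<in> R" for R x
  proof -
    have "x \<in> \<Union>(F \<union> G)" using R F(3) G(3) by auto
    then obtain T where T: "T \<in> \<Delta>" "x \<in> T" "\<forall>S\<in>F \<union> G. x \<in> S \<longrightarrow> T \<subseteq> S" using \<Delta>(3) by blast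
    have "x \<in> P \<Longrightarrow> T \<subseteq> P" "x \<in> Q \<Longrightarrow> T \<subseteq> Q" using T(3) F(3) G(3) by blast+
    then have "T \<subseteq> R" using R by auto
    then show ?thesis using T by blast
  qed
  then have "\<forall>R\<in>{P, Q, P \<union> Q, P \<inter> Q}. \<Union>{T\<in>\<Delta>. T \<subseteq> R} = R" by blast
  then show ?thesis using \<Delta> by blast
qed

lemma Union_regular_in_rational_polyhedra:
  assumes "finite \<Delta>" "\<forall>T\<in>\<Delta>. \<exists>m. regular_simplex n m T"
  shows "\<Union>\<Delta> \<in> rational_polyhedra n"
proof -
  have "\<forall>T\<in>\<Delta>. \<exists>m. rational_simplex n m T" using assms(2) regular_imp_rational by blast
  then show ?thesis unfolding rational_polyhedra_def using assms(1) by (intro CollectI exI[where x = \<Delta>] conjI) auto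
qed

text \<open>Serves the parallelepipeds, which are not given as unions of simplexes.\<close>

lemma cone_definable_rational_polyhedron:
  assumes "cone_definable n C"
  shows "C \<in> rational_polyhedra n"
proof -
  have "\<exists>\<Delta>. simplicial_complex_in n \<Delta> \<and> (\<forall>T\<in>\<Delta>. \<exists>m. regular_simplex n m T) \<and>
    (\<forall>x\<in>\<Union>{C}. \<exists>T\<in>\<Delta>. x \<in> T \<and> (\<forall>S\<in>{C}. x \<in> S \<longrightarrow> T \<subseteq> S))"
    using assms by (intro regular_complex_exists) auto
  then obtain \<Delta> where \<Delta>: "simplicial_complex_in n \<Delta>" "\<forall>T\<in>\<Delta>. \<exists>m. regular_simplex n m T"
    "\<forall>x\<in>C. \<exists>T\<in>\<Delta>. x \<in> T \<and> T \<subseteq> C" by auto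
  have "C = \<Union>{T\<in>\<Delta>. T \<subseteq> C}" using \<Delta>(3) by blast
  moreover have "\<Union>{T\<in>\<Delta>. T \<subseteq> C} \<in> rational_polyhedra n"
    using \<Delta> complexD(1)[OF \<Delta>(1)] by (intro Union_regular_in_rational_polyhedra) auto
  ultimately show ?thesis by simp
qed

lemma rational_polyhedra_Int:
  assumes "P \<in> rational_polyhedra n" "Q \<in> rational_polyhedra n"
  shows "P \<inter> Q \<in> rational_polyhedra n" "P \<union> Q \<in> rational_polyhedra n"
proof -
  obtain \<Delta> where \<Delta>: "simplicial_complex_in n \<Delta>" "\<forall>T\<in>\<Delta>. \<exists>m. regular_simplex n m T"
    "\<forall>R\<in>{P, Q, P \<union> Q, P \<inter> Q}. \<Union>{T\<in>\<Delta>. T \<subseteq> R} = R"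
    using common_regular_triangulation[OF assms] by blast
  have "\<Union>{T\<in>\<Delta>. T \<subseteq> R} \<in> rational_polyhedra n" for R
    using \<Delta> complexD(1)[OF \<Delta>(1)] by (intro Union_regular_in_rational_polyhedra) auto
  note U = this
  have "\<Union>{T\<in>\<Delta>. T \<subseteq> P \<inter> Q} = P \<inter> Q" "\<Union>{T\<in>\<Delta>. T \<subseteq> P \<union> Q} = P \<union> Q" using \<Delta>(3) by simp_all
  then show "P \<inter> Q \<in> rational_polyhedra n" "P \<union> Q \<in> rational_polyhedra n"
    using U[of "P \<inter> Q"] U[of "P \<union> Q"] by simp_all
qed

lemma regular_triangulation_exists:
  assumes "P \<in> rational_polyhedra n"
  obtains \<Delta> where "regular_triangulates n \<Delta> P"
proof -
  obtain \<Delta> where \<Delta>: "simplicial_complex_in n \<Delta>" "\<forall>T\<in>\<Delta>. \<exists>m. regular_simplex n m T" "\<Union>{T\<in>\<Delta>. T \<subseteq> P} = P"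
    using common_regular_triangulation[OF assms assms] by auto
  then have "regular_triangulates n {T\<in>\<Delta>. T \<subseteq> P} P"
    using subcomplex[OF \<Delta>(1)] by (auto simp: regular_triangulates_def triangulates_def)
  then show ?thesis using that by blast
qed

section \<open>Counting positive solutions of linear inequalities\<close>

text \<open>The coefficients start at 1 because they describe relatively open simplexes;
  extensionality of the functions makes the count finite.\<close>

definition positive_solutions :: "'a set \<Rightarrow> ('a \<Rightarrow> nat) \<Rightarrow> nat \<Rightarrow> ('a \<Rightarrow> nat) set" where
  "positive_solutions V q K = {c \<in> V \<rightarrow>\<^sub>E {1..}. (\<Sum>v\<in>V. c v * q v) \<le> K}"

text \<open>Mean value estimates for the power function; they make sums of powers telescope.\<close>

lemma power_diff_bounds:
  fixes a b :: real
  assumes "0 \<le> b" "b \<le> a"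
  shows "a ^ Suc m - b ^ Suc m \<le> real (Suc m) * a ^ m * (a - b)"
    and "real (Suc m) * b ^ m * (a - b) \<le> a ^ Suc m - b ^ Suc m"
proof -
  show "a ^ Suc m - b ^ Suc m \<le> real (Suc m) * a ^ m * (a - b)"
  proof (induction m)
    case (Suc m)
    have "a ^ Suc (Suc m) - b ^ Suc (Suc m) = a * (a ^ Suc m - b ^ Suc m) + (a - b) * b ^ Suc m"
      by (simp add: algebra_simps)
    also have "\<dots> \<le> a * (real (Suc m) * a ^ m * (a - b)) + (a - b) * a ^ Suc m"
      using Suc assms by (intro add_mono mult_left_mono power_mono) auto
    also have "\<dots> = real (Suc (Suc m)) * a ^ Suc m * (a - b)" by (simp add: algebra_simps)
    finally show ?case .
  qed simp
  show "real (Suc m) * b ^ m * (a - b) \<le> a ^ Suc m - b ^ Suc m"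
  proof (induction m)
    case (Suc m)
    have "real (Suc (Suc m)) * b ^ Suc m * (a - b) = b * (real (Suc m) * b ^ m * (a - b)) + (a - b) * b ^ Suc m"
      by (simp add: algebra_simps)
    also have "\<dots> \<le> b * (a ^ Suc m - b ^ Suc m) + (a - b) * a ^ Suc m"
      using Suc assms by (intro add_mono mult_left_mono power_mono) auto
    also have "\<dots> = a ^ Suc (Suc m) - b ^ Suc (Suc m)" by (simp add: algebra_simps)
    finally show ?case .
  qed simp
qed

text \<open>Each term is at most the increment of the antiderivative over one step of length
  \<open>q\<close>.\<close>

lemma power_sum_upper:
  fixes y q :: real
  assumes "q \<ge> 0" "real M * q \<le> y"
  shows "(\<Sum>j=1..M. (y - real j * q) ^ m) * q * real (Suc m) \<le> y ^ Suc m - (y - real M * q) ^ Suc m"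
  using assms(2)
proof (induction M)
  case (Suc M)
  have le: "real M * q \<le> real (Suc M) * q" using assms(1) by (intro mult_right_mono) auto
  have "real (Suc m) * (y - real (Suc M) * q) ^ m * ((y - real M * q) - (y - real (Suc M) * q))
    \<le> (y - real M * q) ^ Suc m - (y - real (Suc M) * q) ^ Suc m"
    using Suc.prems le by (intro power_diff_bounds(2)) auto
  moreover have "(y - real M * q) - (y - real (Suc M) * q) = q" by (simp add: algebra_simps)
  ultimately have "(y - real (Suc M) * q) ^ m * q * real (Suc m)
    \<le> (y - real M * q) ^ Suc m - (y - real (Suc M) * q) ^ Suc m" by (simp only: mult_ac)
  then show ?case using Suc.IH Suc.prems le by (simp add: algebra_simps)
qed simp

text \<open>Truncation at 0 lets the summation run past the zero of \<open>y - j q\<close>, where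
  the plain powers could change sign.\<close>

lemma power_sum_lower:
  fixes y q :: real
  assumes "q \<ge> 0"
  shows "(max 0 (y - q)) ^ Suc m - (max 0 (y - real (Suc M) * q)) ^ Suc m
    \<le> (\<Sum>j=1..M. (max 0 (y - real j * q)) ^ m) * q * real (Suc m)"
proof (induction M)
  case (Suc M)
  let ?a = "max 0 (y - real (Suc M) * q)" and ?b = "max 0 (y - real (Suc (Suc M)) * q)"
  have le: "real (Suc M) * q \<le> real (Suc (Suc M)) * q" using assms by (intro mult_right_mono) auto
  have "?a ^ Suc m - ?b ^ Suc m \<le> real (Suc m) * ?a ^ m * (?a - ?b)"
    using le by (intro power_diff_bounds(1)) auto
  also have "\<dots> \<le> real (Suc m) * ?a ^ m * q"
  proof (rule mult_left_mono)
    have "real (Suc (Suc M)) * q = real (Suc M) * q + q" by (simp add: algebra_simps)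
    then show "?a - ?b \<le> q" using assms by auto
  qed auto
  finally have "?a ^ Suc m - ?b ^ Suc m \<le> ?a ^ m * q * real (Suc m)" by (simp only: mult_ac)
  moreover have "(\<Sum>j=1..Suc M. (max 0 (y - real j * q)) ^ m) * q * real (Suc m) =
    (\<Sum>j=1..M. (max 0 (y - real j * q)) ^ m) * q * real (Suc m) + ?a ^ m * q * real (Suc m)"
    by (simp only: sum.cl_ivl_Suc distrib_right) (simp add: algebra_simps)
  ultimately show ?case using Suc.IH by linarith
qed simp

lemma positive_solutions_insert:
  assumes "finite V" "w \<notin> V" "q w > 0"
  shows "positive_solutions (insert w V) q K =
    (\<lambda>(j, c). c(w := j)) ` (SIGMA j:{1..K div q w}. positive_solutions V q (K - j * q w))"
    (is "?L = ?f ` ?R")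
proof -
  have sum: "(\<Sum>v\<in>insert w V. (c(w := j)) v * q v) = j * q w + (\<Sum>v\<in>V. c v * q v)" for c j
    using assms by (auto simp: sum.insert intro!: sum.cong)
  have "?L = {c \<in> ?f ` ({1..} \<times> (V \<rightarrow>\<^sub>E {1..})). (\<Sum>v\<in>insert w V. c v * q v) \<le> K}"
    by (simp add: positive_solutions_def PiE_insert_eq)
  also have "\<dots> = ?f ` {p \<in> {1..} \<times> (V \<rightarrow>\<^sub>E {1..}). fst p * q w + (\<Sum>v\<in>V. snd p v * q v) \<le> K}"
    using sum by (auto simp: image_iff simp del: fun_upd_apply)
  also have "{p \<in> {1..} \<times> (V \<rightarrow>\<^sub>E {1..}). fst p * q w + (\<Sum>v\<in>V. snd p v * q v) \<le> K} = ?R"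
    using assms(3) by (auto simp: positive_solutions_def less_eq_div_iff_mult_less_eq)
  finally show ?thesis .
qed

lemma positive_solutions_card_insert:
  assumes "finite V" "w \<notin> V" "q w > 0" "\<And>K. finite (positive_solutions V q K)"
  shows "finite (positive_solutions (insert w V) q K)"
    "card (positive_solutions (insert w V) q K) = (\<Sum>j=1..K div q w. card (positive_solutions V q (K - j * q w)))"
proof -
  let ?R = "SIGMA j:{1..K div q w}. positive_solutions V q (K - j * q w)"
  have "inj_on (\<lambda>(j, c). c(w := j)) ({1..} \<times> (V \<rightarrow>\<^sub>E {1..}) :: (nat \<times> ('a \<Rightarrow> nat)) set)"
    by (rule inj_combinator[OF assms(2), of "\<lambda>_. {1..}"])
  then have inj: "inj_on (\<lambda>(j, c). c(w := j)) ?R"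
    by (rule inj_on_subset) (auto simp: positive_solutions_def)
  show "finite (positive_solutions (insert w V) q K)"
    unfolding positive_solutions_insert[of V w q, OF assms(1-3)] using assms(4) by blast
  show "card (positive_solutions (insert w V) q K) = (\<Sum>j=1..K div q w. card (positive_solutions V q (K - j * q w)))"
    unfolding positive_solutions_insert[of V w q, OF assms(1-3)] card_image[OF inj] using assms(4) by simp
qed

text \<open>Up to the common factor the bounds are volumes: of the simplex of nonnegative real
  vectors with weighted sum at most \<open>K\<close>, and of the one shrunk by the total weight. The
  unit cubes below the solutions lie in the first and cover the second. The induction integrates one
  variable at a time.\<close>

lemma positive_solutions_bounds:
  assumes "finite V" "\<And>v. v \<in> V \<Longrightarrow> q v > 0"
  shows "finite (positive_solutions V q K) \<and>
    (max 0 (real K - real (sum q V))) ^ card V \<le> real (card (positive_solutions V q K)) * (fact (card V) * real (prod q V)) \<and>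
    real (card (positive_solutions V q K)) * (fact (card V) * real (prod q V)) \<le> real K ^ card V"
  using assms
proof (induction V arbitrary: K rule: finite_induct)
  case empty
  show ?case by (simp add: positive_solutions_def)
next
  case (insert w V)
  have q: "q w > 0" using insert by simp
  have IH: "finite (positive_solutions V q K)"
    "(max 0 (real K - real (sum q V))) ^ card V \<le> real (card (positive_solutions V q K)) * (fact (card V) * real (prod q V))"
    "real (card (positive_solutions V q K)) * (fact (card V) * real (prod q V)) \<le> real K ^ card V" for K
    using insert by blast+
  note rec = positive_solutions_card_insert[of V w q K, OF insert.hyps q IH(1)]
  let ?m = "card V" and ?M = "K div q w" and ?p = "fact (card V) * real (prod q V)"
  let ?N = "real (card (positive_solutions (insert w V) q K))"
  have Mq: "?M * q w \<le> K" by simp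
  then have Mq': "real ?M * real (q w) \<le> real K" by (metis of_nat_le_iff of_nat_mult)
  have diff: "real (K - j * q w) = real K - real j * real (q w)" if "j \<in> {1..?M}" for j
  proof -
    have "j * q w \<le> ?M * q w" using that by (intro mult_right_mono) auto
    then have "j * q w \<le> K" using Mq by linarith
    then show ?thesis by (simp add: of_nat_diff)
  qed
  have full: "?N * (fact (card (insert w V)) * real (prod q (insert w V))) =
    (\<Sum>j=1..?M. real (card (positive_solutions V q (K - j * q w))) * ?p) * real (q w) * real (Suc ?m)"
    unfolding rec(2) sum_distrib_right[symmetric] of_nat_sum[symmetric] using insert.hyps
    by (simp del: of_nat_sum of_nat_prod of_nat_Suc add: fact_Suc)
  have "(\<Sum>j=1..?M. real (card (positive_solutions V q (K - j * q w))) * ?p)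
    \<le> (\<Sum>j=1..?M. (real K - real j * real (q w)) ^ ?m)"
  proof (rule sum_mono)
    fix j assume "j \<in> {1..?M}"
    then show "real (card (positive_solutions V q (K - j * q w))) * ?p \<le> (real K - real j * real (q w)) ^ ?m"
      using IH(3)[of "K - j * q w"] diff by simp
  qed
  then have "?N * (fact (card (insert w V)) * real (prod q (insert w V))) \<le>
    (\<Sum>j=1..?M. (real K - real j * real (q w)) ^ ?m) * real (q w) * real (Suc ?m)"
    unfolding full by (intro mult_right_mono) auto
  also have "\<dots> \<le> real K ^ Suc ?m - (real K - real ?M * real (q w)) ^ Suc ?m"
    using Mq' by (intro power_sum_upper) auto
  also have "\<dots> \<le> real K ^ Suc ?m" using Mq' by simp
  finally have upper: "?N * (fact (card (insert w V)) * real (prod q (insert w V))) \<le> real K ^ Suc ?m" .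
  let ?y = "real K - real (sum q V)"
  have "(\<Sum>j=1..?M. (max 0 (?y - real j * real (q w))) ^ ?m)
    \<le> (\<Sum>j=1..?M. real (card (positive_solutions V q (K - j * q w))) * ?p)"
  proof (rule sum_mono)
    fix j assume j: "j \<in> {1..?M}"
    have "real (K - j * q w) - real (sum q V) = ?y - real j * real (q w)" using diff[OF j] by simp
    then show "(max 0 (?y - real j * real (q w))) ^ ?m \<le> real (card (positive_solutions V q (K - j * q w))) * ?p"
      using IH(2)[of "K - j * q w"] by metis
  qed
  then have l1: "(\<Sum>j=1..?M. (max 0 (?y - real j * real (q w))) ^ ?m) * real (q w) * real (Suc ?m)
    \<le> ?N * (fact (card (insert w V)) * real (prod q (insert w V)))"
    unfolding full by (intro mult_right_mono) auto
  have "K < Suc ?M * q w" using q by (simp add: dividend_less_div_times)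
  then have "real K < real (Suc ?M) * real (q w)" by (metis of_nat_less_iff of_nat_mult)
  \<comment> \<open>\<open>Suc ?M\<close> is the first index beyond \<open>K / q w\<close>, so the
    end term subtracted in \<open>power_sum_lower\<close> is 0.\<close>
  then have "max 0 (?y - real (Suc ?M) * real (q w)) = 0"
    by (smt (verit) of_nat_0_le_iff)
  then have "(max 0 (?y - real (q w))) ^ Suc ?m
    \<le> (\<Sum>j=1..?M. (max 0 (?y - real j * real (q w))) ^ ?m) * real (q w) * real (Suc ?m)"
    using power_sum_lower[of "real (q w)" ?y ?m ?M] by simp
  also note l1
  also have "?y - real (q w) = real K - real (sum q (insert w V))" using insert.hyps by simp
  finally have lower: "(max 0 (real K - real (sum q (insert w V)))) ^ Suc ?m
    \<le> ?N * (fact (card (insert w V)) * real (prod q (insert w V)))" .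
  show ?case using rec(1) lower upper insert.hyps by simp
qed

lemma positive_solutions_limit:
  assumes V: "finite V" "\<And>v. v \<in> V \<Longrightarrow> q v > 0"
  shows "(\<lambda>K. real (card (positive_solutions V q K)) / real K ^ card V) \<longlonglongrightarrow> 1 / (fact (card V) * real (prod q V))"
proof (rule tendsto_sandwich)
  let ?c = "fact (card V) * real (prod q V)" and ?s = "real (sum q V)"
  have c: "?c > 0" using V by (auto intro!: mult_pos_pos prod_pos simp del: of_nat_prod simp: of_nat_0_less_iff)
  have B: "finite (positive_solutions V q K)"
    "(max 0 (real K - real (sum q V))) ^ card V \<le> real (card (positive_solutions V q K)) * (fact (card V) * real (prod q V))"
    "real (card (positive_solutions V q K)) * (fact (card V) * real (prod q V)) \<le> real K ^ card V" for K
    using positive_solutions_bounds[of V q K] V by blast+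
  show "\<forall>\<^sub>F K in sequentially. ((real K - ?s) / real K) ^ card V / ?c \<le> real (card (positive_solutions V q K)) / real K ^ card V"
  proof (rule eventually_sequentiallyI[of "Suc (sum q V)"])
    fix K assume K: "Suc (sum q V) \<le> K"
    then have "sum q V \<le> K" by simp
    then have "?s \<le> real K" by (rule of_nat_mono)
    then have "max 0 (real K - ?s) = real K - ?s" by linarith
    then have "(real K - ?s) ^ card V \<le> real (card (positive_solutions V q K)) * ?c" using B(2)[of K] by simp
    then have "(real K - ?s) ^ card V / ?c \<le> real (card (positive_solutions V q K))"
      using c by (simp add: pos_divide_le_eq)
    then have "(real K - ?s) ^ card V / ?c / real K ^ card V \<le> real (card (positive_solutions V q K)) / real K ^ card V"
      by (rule divide_right_mono) simp
    then show "((real K - ?s) / real K) ^ card V / ?c \<le> real (card (positive_solutions V q K)) / real K ^ card V"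
      by (simp add: power_divide mult.commute)
  qed
  show "\<forall>\<^sub>F K in sequentially. real (card (positive_solutions V q K)) / real K ^ card V \<le> 1 / ?c"
  proof (rule eventually_sequentiallyI[of 1])
    fix K :: nat assume "1 \<le> K"
    then have "real K ^ card V > 0" by simp
    moreover have "real (card (positive_solutions V q K)) * ?c \<le> real K ^ card V" by (rule B(3))
    ultimately show "real (card (positive_solutions V q K)) / real K ^ card V \<le> 1 / ?c"
      using c by (simp add: pos_divide_le_eq pos_le_divide_eq del: of_nat_prod)
  qed
  have "(\<lambda>K. (1::real) - ?s * (1 / real K)) \<longlonglongrightarrow> 1 - ?s * 0"
    by (intro tendsto_intros lim_1_over_n)
  moreover have "\<forall>\<^sub>F K in sequentially. 1 - ?s * (1 / real K) = (real K - ?s) / real K"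
    by (rule eventually_sequentiallyI[of 1]) (simp add: diff_divide_distrib del: of_nat_sum)
  ultimately have "(\<lambda>K. (real K - ?s) / real K) \<longlonglongrightarrow> 1"
    by (simp add: filterlim_cong del: of_nat_sum)
  from tendsto_power[OF this, of "card V"]
  have "(\<lambda>K. ((real K - ?s) / real K) ^ card V) \<longlonglongrightarrow> 1" by simp
  moreover have "?c \<noteq> 0" using c by linarith
  ultimately show "(\<lambda>K. ((real K - ?s) / real K) ^ card V / ?c) \<longlonglongrightarrow> 1 / ?c"
    by (intro tendsto_divide tendsto_const)
qed simp

section \<open>Counting rational points by denominator\<close>

definition lattice_points :: "point set \<Rightarrow> nat \<Rightarrow> (nat \<times> point) set" where
  "lattice_points P K = {(k, x). k \<in> {1..K} \<and> x \<in> P \<and> (\<forall>i. real k * coord x i \<in> \<int>)}"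

text \<open>The lattice point \<open>k (x, 1)\<close> is a combination of the homogeneous vertices,
  which are part of a lattice basis, so its coefficients are integers; they are positive as
  \<open>x\<close> is relatively interior. Comparing heights gives \<open>k\<close> as the weighted
  sum of the denominators.\<close>

lemma lattice_points_open_simplex:
  assumes V: "regular_vertices n V" "V \<noteq> {}"
  shows "bij_betw (\<lambda>c. (\<Sum>v\<in>V. c v * den v, \<Sum>v\<in>V. (real (c v * den v) / real (\<Sum>v\<in>V. c v * den v)) *\<^sub>R v))
    (positive_solutions V den K) (lattice_points (open_simplex V) K)"
    (is "bij_betw ?f _ _")
proof -
  have VQ: "V \<subseteq> Qn n" and fin: "finite V" and ind: "\<not> affine_dependent V"
    and basis: "part_of_basis (Suc n) (homog n ` V)"
    using V by (auto simp: regular_vertices_def)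
  have dpos: "den v > 0" if "v \<in> V" for v using den_works(1) VQ that by blast
  have inj: "inj_on (homog n) V" using dehom_homog VQ by (metis inj_onI subsetD)
  have pos: "(\<Sum>v\<in>V. c v * den v) > 0" if "c \<in> positive_solutions V den K" for c
  proof -
    obtain w where w: "w \<in> V" using V(2) by blast
    have "c w \<ge> 1" using that w by (auto simp: positive_solutions_def)
    then have "c w * den w > 0" using dpos[OF w] by simp
    then show ?thesis using fin w by (metis sum_eq_0_iff bot_nat_0.not_eq_extremum)
  qed
  have u1: "(\<Sum>v\<in>V. real (c v * den v) / real (\<Sum>v\<in>V. c v * den v)) = 1"
    if "c \<in> positive_solutions V den K" for c
  proof -
    have "(\<Sum>v\<in>V. real (c v * den v) / real (\<Sum>v\<in>V. c v * den v)) = real (\<Sum>v\<in>V. c v * den v) / real (\<Sum>v\<in>V. c v * den v)"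
      by (simp only: sum_divide_distrib[symmetric] of_nat_sum)
    moreover have "real (\<Sum>v\<in>V. c v * den v) \<noteq> 0" using pos[OF that] by (metis of_nat_eq_0_iff less_irrefl)
    ultimately show ?thesis by (metis divide_self)
  qed
  show ?thesis
    unfolding bij_betw_def
  proof (intro conjI inj_onI equalityI subsetI)
    fix c d assume c: "c \<in> positive_solutions V den K" and d: "d \<in> positive_solutions V den K" and eq: "?f c = ?f d"
    let ?k = "\<Sum>v\<in>V. c v * den v"
    have k: "(\<Sum>v\<in>V. d v * den v) = ?k" using eq by simp
    have "c v = d v" if v: "v \<in> V" for v
    proof -
      have "real (c v * den v) / real ?k = real (d v * den v) / real ?k"
      proof (rule affine_independent_unique[OF fin ind _ _ v])
        show "(\<Sum>v\<in>V. real (c v * den v) / real ?k) = (\<Sum>v\<in>V. real (d v * den v) / real ?k)"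
          using u1[OF c] u1[OF d] k by simp
        show "(\<Sum>v\<in>V. (real (c v * den v) / real ?k) *\<^sub>R v) = (\<Sum>v\<in>V. (real (d v * den v) / real ?k) *\<^sub>R v)"
          using eq k by simp
      qed
      moreover have "real ?k \<noteq> 0" using pos[OF c] by (metis of_nat_eq_0_iff less_irrefl)
      ultimately have "real (c v * den v) = real (d v * den v)" by (simp only: divide_cancel_right) simp
      then have "c v * den v = d v * den v" by (rule of_nat_eq_iff[THEN iffD1])
      then show ?thesis using dpos[OF v] by simp
    qed
    moreover have "c v = d v" if "v \<notin> V" for v
      using c d that by (auto simp: positive_solutions_def PiE_def extensional_def)
    ultimately show "c = d" by blast
  next
    fix p assume "p \<in> ?f ` positive_solutions V den K"
    then obtain c where c: "c \<in> positive_solutions V den K" "p = ?f c" by blast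
    let ?k = "\<Sum>v\<in>V. c v * den v"
    have x: "snd p \<in> open_simplex V"
      unfolding open_simplex_def c(2) snd_conv mem_Collect_eq
    proof (intro exI[where x = "\<lambda>v. real (c v * den v) / real ?k"] conjI ballI)
      show "(\<Sum>v\<in>V. real (c v * den v) / real ?k) = 1" by (rule u1[OF c(1)])
      fix v assume v: "v \<in> V"
      have "c v \<ge> 1" using c(1) v by (auto simp: positive_solutions_def)
      then show "0 < real (c v * den v) / real ?k"
        using dpos[OF v] pos[OF c(1)] by (intro divide_pos_pos) (simp_all only: of_nat_0_less_iff, simp)
    qed simp
    have "real ?k * coord (snd p) i = (\<Sum>v\<in>V. real (c v) * (real (den v) * coord v i))" for i
      unfolding c(2) snd_conv lookup_sum sum_distrib_left using pos[OF c(1)]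
      by (intro sum.cong) (auto simp del: of_nat_sum)
    moreover have "(\<Sum>v\<in>V. real (c v) * (real (den v) * coord v i)) \<in> \<int>" for i
      using VQ by (intro Ints_sum Ints_mult den_works(2)) auto
    ultimately have "\<forall>i. real ?k * coord (snd p) i \<in> \<int>" by simp
    then show "p \<in> lattice_points (open_simplex V) K"
      using x pos[OF c(1)] c unfolding lattice_points_def by (auto simp: positive_solutions_def Suc_le_eq)
  next
    fix p assume "p \<in> lattice_points (open_simplex V) K"
    then obtain k x where p: "p = (k, x)" "1 \<le> k" "k \<le> K" "x \<in> open_simplex V" "\<And>i. real k * coord x i \<in> \<int>"
      by (auto simp: lattice_points_def)
    obtain u where u: "\<forall>v\<in>V. 0 < u v" "sum u V = 1" "x = (\<Sum>v\<in>V. u v *\<^sub>R v)"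
      using p(4) by (auto simp: open_simplex_def)
    have VR: "V \<subseteq> Rn n" using VQ Qn_subset_Rn by blast
    have xR: "x \<in> Rn n" unfolding u(3) using VR by (intro Rn_sum Rn_scaleR) auto
    define a where "a = (\<lambda>v. real k * u v / real (den v))"
    have "real k *\<^sub>R snoc n x 1 = (\<Sum>v\<in>V. a v *\<^sub>R homog n v)"
      unfolding u(3) snoc_sum[OF u(2)] scaleR_sum_right
      using dpos by (intro sum.cong) (auto simp: a_def homog_def)
    also have "\<dots> = (\<Sum>z\<in>homog n ` V. a (dehom n z) *\<^sub>R z)"
      unfolding sum.reindex[OF inj] using VQ dehom_homog by (intro sum.cong) (auto simp: subset_iff)
    finally have eq: "real k *\<^sub>R snoc n x 1 = (\<Sum>z\<in>homog n ` V. a (dehom n z) *\<^sub>R z)" .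
    have "real k *\<^sub>R snoc n x 1 \<in> Zn (Suc n)"
      using p(5) Rn_scaleR[OF snoc_in_Rn[OF xR]] by (auto simp: Zn_def coord_snoc algebra_simps)
    then have aint: "a v \<in> \<int>" if "v \<in> V" for v
      using part_of_basis_combination[OF basis _ , of "\<lambda>z. a (dehom n z)" "homog n v"] fin that VQ dehom_homog eq
      by (auto simp: subset_iff)
    have apos: "a v > 0" if "v \<in> V" for v using that u(1) p(2) dpos by (simp add: a_def)
    define c where "c = restrict (\<lambda>v. nat \<lfloor>a v\<rfloor>) V"
    have c: "real (c v) = a v" if "v \<in> V" for v
    proof -
      have "of_int \<lfloor>a v\<rfloor> = a v" using aint[OF that] by simp
      then show ?thesis using that apos[OF that] by (simp add: c_def)
    qed
    have cd: "real (c v * den v) = real k * u v" if "v \<in> V" for v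
      using c[OF that] dpos[OF that] by (simp add: a_def)
    have "real (\<Sum>v\<in>V. c v * den v) = real k"
    proof -
      have "real (\<Sum>v\<in>V. c v * den v) = (\<Sum>v\<in>V. real k * u v)"
        unfolding of_nat_sum by (intro sum.cong cd) auto
      then show ?thesis using u(2) by (simp flip: sum_distrib_left)
    qed
    then have k: "(\<Sum>v\<in>V. c v * den v) = k" by (rule of_nat_eq_iff[THEN iffD1])
    have "?f c = p"
      unfolding p(1) k u(3) prod.inject using cd p(2) by (auto intro!: sum.cong simp del: of_nat_mult)
    moreover have "c \<in> positive_solutions V den K"
    proof -
      have "c v \<ge> 1" if "v \<in> V" for v
        using c[OF that] apos[OF that] by (metis of_nat_0_less_iff Suc_leI One_nat_def)
      then have "c \<in> V \<rightarrow>\<^sub>E {1..}" by (auto simp: c_def PiE_def Pi_def)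
      then show ?thesis using k p(3) by (simp add: positive_solutions_def)
    qed
    ultimately show "p \<in> ?f ` positive_solutions V den K" by blast
  qed
qed

text \<open>A simplex with fewer than \<open>d + 1\<close> vertices contributes only order
  \<open>K ^ card V\<close> and vanishes in the limit.\<close>

lemma lattice_points_open_simplex_limit:
  assumes V: "regular_vertices n V" "V \<noteq> {}"
  shows "finite (lattice_points (open_simplex V) K)"
    and "card V \<le> Suc d \<Longrightarrow> (\<lambda>K. real (card (lattice_points (open_simplex V) K)) / real K ^ Suc d)
      \<longlonglongrightarrow> (if card V = Suc d then 1 / (fact (Suc d) * real (prod den V)) else 0)"
proof -
  have VQ: "V \<subseteq> Qn n" and fin: "finite V" using V by (auto simp: regular_vertices_def)
  have dpos: "den v > 0" if "v \<in> V" for v using den_works(1) VQ that by blast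
  show "finite (lattice_points (open_simplex V) K)"
    using bij_betw_finite[OF lattice_points_open_simplex[OF V], of K] positive_solutions_bounds[of V den K] fin dpos by simp
  have card: "card (lattice_points (open_simplex V) K) = card (positive_solutions V den K)" for K
    using bij_betw_same_card[OF lattice_points_open_simplex[OF V]] by simp
  note lim = positive_solutions_limit[of V den, OF fin dpos]
  assume le: "card V \<le> Suc d"
  show "(\<lambda>K. real (card (lattice_points (open_simplex V) K)) / real K ^ Suc d)
      \<longlonglongrightarrow> (if card V = Suc d then 1 / (fact (Suc d) * real (prod den V)) else 0)"
  proof (cases "card V = Suc d")
    case True
    then show ?thesis using lim card by simp
  next
    case False
    then obtain e where e: "Suc d = card V + Suc e" using le
      by (metis le_eq_less_or_eq less_imp_Suc_add add_Suc_right)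
    have "(\<lambda>K. 1 / real K) \<longlonglongrightarrow> 0" by (rule lim_1_over_n)
    from tendsto_power[OF this, of "Suc e"] have "(\<lambda>K. (1 / real K) ^ Suc e) \<longlonglongrightarrow> 0" by simp
    from tendsto_mult[OF lim this]
    have "(\<lambda>K. real (card (positive_solutions V den K)) / real K ^ card V * (1 / real K) ^ Suc e) \<longlonglongrightarrow> 0" by simp
    moreover have "real (card (positive_solutions V den K)) / real K ^ card V * (1 / real K) ^ Suc e =
      real (card (lattice_points (open_simplex V) K)) / real K ^ Suc d" for K
      unfolding card e by (simp add: power_add power_divide)
    ultimately show ?thesis using False by simp
  qed
qed

lemma lattice_points_complex_limit:
  assumes \<Delta>: "simplicial_complex_in n \<Delta>" "\<forall>T\<in>\<Delta>. \<exists>m. regular_simplex n m T"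
    and le: "\<forall>T\<in>\<Delta>. card (vertices T) \<le> Suc d"
  shows "finite (lattice_points (\<Union>\<Delta>) K)"
    and "(\<lambda>K. real (card (lattice_points (\<Union>\<Delta>) K)) / real K ^ Suc d)
      \<longlonglongrightarrow> (\<Sum>T | T \<in> \<Delta> \<and> card (vertices T) = Suc d. 1 / (fact d * real (den_simplex T))) / real (Suc d)"
proof -
  note D = complexD[OF \<Delta>(1)]
  have reg: "regular_vertices n (vertices T)" if "T \<in> \<Delta>" for T
    using \<Delta>(2) that by (auto simp: regular_simplex_iff)
  note L = lattice_points_open_simplex_limit[OF reg D(6)]
  have un: "lattice_points (\<Union>\<Delta>) K = (\<Union>T\<in>\<Delta>. lattice_points (open_simplex (vertices T)) K)" for K
  proof -
    have "x \<in> \<Union>\<Delta> \<longleftrightarrow> (\<exists>T\<in>\<Delta>. x \<in> open_simplex (vertices T))" for x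
      using complex_carrier[OF \<Delta>(1), of x] open_simplex_subset[OF D(3)] D(5) by blast
    then show ?thesis unfolding lattice_points_def by blast
  qed
  have disj: "lattice_points (open_simplex (vertices S)) K \<inter> lattice_points (open_simplex (vertices T)) K = {}"
    if "S \<in> \<Delta>" "T \<in> \<Delta>" "S \<noteq> T" for S T K
  proof -
    have "open_simplex (vertices S) \<inter> open_simplex (vertices T) = {}"
      using complex_carrier[OF \<Delta>(1)] that open_simplex_subset[OF D(3)] D(5) by blast
    then show ?thesis by (auto simp: lattice_points_def)
  qed
  show "finite (lattice_points (\<Union>\<Delta>) K)" unfolding un using D(1) L(1) by blast
  have "card (lattice_points (\<Union>\<Delta>) K) = (\<Sum>T\<in>\<Delta>. card (lattice_points (open_simplex (vertices T)) K))" for K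
    unfolding un using D(1) L(1) disj by (intro card_UN_disjoint) auto
  then have eq: "real (card (lattice_points (\<Union>\<Delta>) K)) / real K ^ Suc d =
    (\<Sum>T\<in>\<Delta>. real (card (lattice_points (open_simplex (vertices T)) K)) / real K ^ Suc d)" for K
    by (simp add: sum_divide_distrib)
  have "(\<lambda>K. \<Sum>T\<in>\<Delta>. real (card (lattice_points (open_simplex (vertices T)) K)) / real K ^ Suc d)
    \<longlonglongrightarrow> (\<Sum>T\<in>\<Delta>. if card (vertices T) = Suc d then 1 / (fact (Suc d) * real (prod den (vertices T))) else 0)"
    using L(2) le by (intro tendsto_sum) blast
  also have "(\<Sum>T\<in>\<Delta>. if card (vertices T) = Suc d then 1 / (fact (Suc d) * real (prod den (vertices T))) else 0) =
    (\<Sum>T | T \<in> \<Delta> \<and> card (vertices T) = Suc d. 1 / (fact (Suc d) * real (prod den (vertices T))))"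
    using D(1) by (simp only: sum.inter_filter)
  \<comment> \<open>\<open>fact (Suc d)\<close> splits off the factor \<open>Suc d\<close> by which
    all counting limits differ from the measure.\<close>
  also have "\<dots> = (\<Sum>T | T \<in> \<Delta> \<and> card (vertices T) = Suc d. 1 / (fact d * real (den_simplex T)) / real (Suc d))"
    by (intro sum.cong) (auto simp: den_simplex_def vertices_def algebra_simps)
  finally show "(\<lambda>K. real (card (lattice_points (\<Union>\<Delta>) K)) / real K ^ Suc d)
      \<longlonglongrightarrow> (\<Sum>T | T \<in> \<Delta> \<and> card (vertices T) = Suc d. 1 / (fact d * real (den_simplex T))) / real (Suc d)"
    unfolding eq by (simp add: sum_divide_distrib)
qed

section \<open>The rational measures by counting\<close>

lemma regular_triangulatesD:
  assumes "regular_triangulates n \<Delta> P"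
  shows "simplicial_complex_in n \<Delta>" "\<Union>\<Delta> = P" "triangulates n \<Delta> P" "\<forall>T\<in>\<Delta>. \<exists>m. regular_simplex n m T"
  using assms by (auto simp: regular_triangulates_def triangulates_def)

lemma dim_part_limit:
  assumes \<Delta>: "regular_triangulates n \<Delta> P"
  shows "(\<lambda>K. real (card (lattice_points (dim_part n d P) K)) / real K ^ Suc d)
    \<longlonglongrightarrow> (\<Sum>T\<in>maximal_simplexes n \<Delta> d. 1 / (fact d * real (den_simplex T))) / real (Suc d)"
proof -
  note D = regular_triangulatesD[OF \<Delta>]
  let ?\<Delta> = "{T\<in>\<Delta>. T \<subseteq> \<Union>(maximal_simplexes n \<Delta> d)}"
  note E = dim_part_complex[OF D(1), of d]
  have c: "simplicial_complex_in n ?\<Delta>" "\<Union>?\<Delta> = dim_part n d P"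
    using E(1) dim_part_eq[OF D(3)] by (auto simp: triangulates_def)
  have "{T \<in> ?\<Delta>. card (vertices T) = Suc d} = maximal_simplexes n \<Delta> d"
    using maximal_simplexes_top[OF c(1) E(2)] E(3) by simp
  then show ?thesis
    using lattice_points_complex_limit(2)[OF c(1) _ E(2)] D(4) c(2) by simp
qed

text \<open>The limit refers to \<open>P\<close> only through its \<open>d\<close>-dimensional part,
  so the triangulation selected by \<open>SOME\<close> disappears from the argument.\<close>

lemma rational_measure_limit:
  assumes "P \<in> rational_polyhedra n"
  shows "(\<lambda>K. real (card (lattice_points (dim_part n d P) K)) / real K ^ Suc d)
    \<longlonglongrightarrow> rational_measure n d P / real (Suc d)"
proof -
  obtain \<Delta> where "regular_triangulates n \<Delta> P" using regular_triangulation_exists[OF assms] .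
  then have "regular_triangulates n (SOME \<Delta>. regular_triangulates n \<Delta> P) P" by (rule someI)
  from dim_part_limit[OF this] show ?thesis by (simp add: rational_measure_def)
qed

lemma rational_measure_unique:
  assumes "P \<in> rational_polyhedra n"
    and "(\<lambda>K. real (card (lattice_points (dim_part n d P) K)) / real K ^ Suc d) \<longlonglongrightarrow> L / real (Suc d)"
  shows "rational_measure n d P = L"
  using LIMSEQ_unique[OF rational_measure_limit[OF assms(1)] assms(2)] by simp

lemma rational_measure_eq:
  assumes "regular_triangulates n \<Delta> P" "P \<in> rational_polyhedra n"
  shows "rational_measure n d P = (\<Sum>T\<in>maximal_simplexes n \<Delta> d. 1 / (fact d * real (den_simplex T)))"
  using assms dim_part_limit by (intro rational_measure_unique)

lemma rational_measure_limit_dim: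
  assumes P: "P \<in> rational_polyhedra n" and dim: "dim_at_most n d P"
  shows "finite (lattice_points P K)"
    and "(\<lambda>K. real (card (lattice_points P K)) / real K ^ Suc d) \<longlonglongrightarrow> rational_measure n d P / real (Suc d)"
proof -
  obtain \<Delta> where \<Delta>: "regular_triangulates n \<Delta> P" using regular_triangulation_exists[OF P] .
  note D = regular_triangulatesD[OF \<Delta>]
  have le: "\<forall>T\<in>\<Delta>. card (vertices T) \<le> Suc d" using dim_at_most_iff[OF D(3)] dim by blast
  show "finite (lattice_points P K)" using lattice_points_complex_limit(1)[OF D(1,4) le] D(2) by simp
  show "(\<lambda>K. real (card (lattice_points P K)) / real K ^ Suc d) \<longlonglongrightarrow> rational_measure n d P / real (Suc d)"
    using lattice_points_complex_limit(2)[OF D(1,4) le] rational_measure_eq[OF \<Delta> P]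
      maximal_simplexes_top[OF D(1) le] D(2) by simp
qed

lemma rational_measure_unique_dim:
  assumes "P \<in> rational_polyhedra n" "dim_at_most n d P"
    and "(\<lambda>K. real (card (lattice_points P K)) / real K ^ Suc d) \<longlonglongrightarrow> L / real (Suc d)"
  shows "rational_measure n d P = L"
  using LIMSEQ_unique[OF rational_measure_limit_dim(2)[OF assms(1,2)] assms(3)] by simp

lemma dim_part_polyhedron:
  assumes "P \<in> rational_polyhedra n"
  shows "dim_part n d P \<in> rational_polyhedra n" "dim_at_most n d (dim_part n d P)"
proof -
  obtain \<Delta> where \<Delta>: "regular_triangulates n \<Delta> P" using regular_triangulation_exists[OF assms] .
  note D = regular_triangulatesD[OF \<Delta>]
  note E = dim_part_complex[OF D(1), of d]
  have eq: "dim_part n d P = \<Union>(maximal_simplexes n \<Delta> d)" by (rule dim_part_eq[OF D(3)])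
  show "dim_part n d P \<in> rational_polyhedra n"
    unfolding eq using D(4) complexD(1)[OF D(1)]
    by (intro Union_regular_in_rational_polyhedra) (auto simp: maximal_simplexes_def)
  show "dim_at_most n d (dim_part n d P)" unfolding eq using dim_at_most_iff[OF E(1)] E(2) by blast
qed

text \<open>The two triangulations together need not form a complex, but
  \<open>tangent_cover\<close> asks only for a finite family of simplexes.\<close>

lemma dim_at_most_Un:
  assumes PQ: "P \<in> rational_polyhedra n" "Q \<in> rational_polyhedra n" and "dim_at_most n d P" "dim_at_most n d Q"
  shows "dim_at_most n d (P \<union> Q)"
proof -
  obtain \<Delta>1 \<Delta>2 where \<Delta>: "regular_triangulates n \<Delta>1 P" "regular_triangulates n \<Delta>2 Q"
    using regular_triangulation_exists PQ by metis
  note D1 = regular_triangulatesD[OF \<Delta>(1)] and D2 = regular_triangulatesD[OF \<Delta>(2)]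
  have le: "\<forall>T\<in>\<Delta>1 \<union> \<Delta>2. card (vertices T) \<le> Suc d"
    using dim_at_most_iff[OF D1(3)] dim_at_most_iff[OF D2(3)] assms by blast
  show ?thesis
    unfolding dim_at_most_def
  proof (intro allI impI, elim conjE)
    fix m S assume S: "simplex_in n m S" "S \<subseteq> P \<union> Q"
    let ?V = "vertices S"
    have V: "finite ?V" "\<not> affine_dependent ?V" "convex hull ?V = S" "card ?V = Suc m"
      using S(1) by (auto simp: simplex_in_iff)
    then have "?V \<noteq> {}" by auto
    then obtain x where x: "x \<in> open_simplex ?V" using open_simplex_nonempty[OF V(1)] by auto
    have sub: "convex hull ?V \<subseteq> \<Union>(\<Delta>1 \<union> \<Delta>2)" using S(2) V(3) D1(2) D2(2) by auto
    have vert: "finite (vertices T) \<and> \<not> affine_dependent (vertices T) \<and> T = convex hull (vertices T)"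
      if "T \<in> \<Delta>1 \<union> \<Delta>2" for T
      using that complexD(3,4,5)[OF D1(1)] complexD(3,4,5)[OF D2(1)] by (metis Un_iff)
    have fin: "finite (\<Delta>1 \<union> \<Delta>2)" using complexD(1) D1(1) D2(1) by blast
    obtain T where T: "T \<in> \<Delta>1 \<union> \<Delta>2" "directions ?V \<subseteq> directions (vertices T)"
      using tangent_cover[OF V(1) x sub fin vert] by blast
    have "vertices T \<noteq> {}" using T(1) complexD(6) D1(1) D2(1) by blast
    then have "card ?V \<le> card (vertices T)"
      using card_le_of_directions[OF V(1,2) _ _ T(2)] vert[OF T(1)] by blast
    moreover have "card (vertices T) \<le> Suc d" using le T(1) by blast
    ultimately show "m \<le> d" using V(4) by simp
  qed
qed

lemma dim_at_most_mono: "dim_at_most n d P \<Longrightarrow> Q \<subseteq> P \<Longrightarrow> dim_at_most n d Q"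
  unfolding dim_at_most_def by blast

section \<open>Elementary properties of the rational measures\<close>

lemma empty_rational_polyhedron: "{} \<in> rational_polyhedra n"
  by (auto simp: rational_polyhedra_def intro!: exI[where x = "{}"])

lemma rational_measure_nonneg: "nonneg_valued rational_measure"
  by (auto simp: nonneg_valued_def rational_measure_def intro!: sum_nonneg)

lemma rational_measure_valuation: "valuation rational_measure"
  unfolding valuation_def
proof (intro allI impI conjI ballI)
  fix n d :: nat
  show "rational_measure n d {} = 0"
  proof (rule rational_measure_unique_dim[OF empty_rational_polyhedron])
    show "dim_at_most n d {}"
    proof -
      have "S \<noteq> {}" if "simplex_in n m S" for m S
        using that unfolding simplex_in_iff by (metis card.empty convex_hull_eq_empty nat.simps(3))
      then show ?thesis unfolding dim_at_most_def by blast
    qed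
  qed (simp add: lattice_points_def)
  fix P assume P: "P \<in> rational_polyhedra n"
  show "rational_measure n d P = rational_measure n d (dim_part n d P)"
    using rational_measure_limit_dim(2)[OF dim_part_polyhedron[OF P]]
    by (rule rational_measure_unique[OF P])
  fix Q assume Q: "Q \<in> rational_polyhedra n" and dim: "dim_at_most n d P \<and> dim_at_most n d Q"
  note I = rational_polyhedra_Int[OF P Q]
  note lP = rational_measure_limit_dim[OF P] and lQ = rational_measure_limit_dim[OF Q]
  have dU: "dim_at_most n d (P \<union> Q)" using dim_at_most_Un P Q dim by blast
  then have dI: "dim_at_most n d (P \<inter> Q)" by (rule dim_at_most_mono) auto
  have "card (lattice_points P K) + card (lattice_points Q K) =
    card (lattice_points (P \<union> Q) K) + card (lattice_points (P \<inter> Q) K)" for K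
  proof -
    have "lattice_points (P \<union> Q) K = lattice_points P K \<union> lattice_points Q K"
      "lattice_points (P \<inter> Q) K = lattice_points P K \<inter> lattice_points Q K"
      by (auto simp: lattice_points_def)
    moreover have "finite (lattice_points P K)" "finite (lattice_points Q K)" using lP(1) lQ(1) dim by blast+
    ultimately show ?thesis using card_Un_Int[of "lattice_points P K" "lattice_points Q K"] by simp
  qed
  then have eq: "real (card (lattice_points P K)) / real K ^ Suc d + real (card (lattice_points Q K)) / real K ^ Suc d =
    real (card (lattice_points (P \<union> Q) K)) / real K ^ Suc d + real (card (lattice_points (P \<inter> Q) K)) / real K ^ Suc d" for K
    by (metis add_divide_distrib of_nat_add)
  have "rational_measure n d P / real (Suc d) + rational_measure n d Q / real (Suc d) =
    rational_measure n d (P \<union> Q) / real (Suc d) + rational_measure n d (P \<inter> Q) / real (Suc d)"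
  proof (rule LIMSEQ_unique)
    show "(\<lambda>K. real (card (lattice_points P K)) / real K ^ Suc d + real (card (lattice_points Q K)) / real K ^ Suc d)
      \<longlonglongrightarrow> rational_measure n d P / real (Suc d) + rational_measure n d Q / real (Suc d)"
      using dim by (intro tendsto_add lP(2) lQ(2)) auto
    show "(\<lambda>K. real (card (lattice_points P K)) / real K ^ Suc d + real (card (lattice_points Q K)) / real K ^ Suc d)
      \<longlonglongrightarrow> rational_measure n d (P \<union> Q) / real (Suc d) + rational_measure n d (P \<inter> Q) / real (Suc d)"
      unfolding eq by (intro tendsto_add rational_measure_limit_dim(2) I dU dI)
  qed
  then show "rational_measure n d P + rational_measure n d Q = rational_measure n d (P \<union> Q) + rational_measure n d (P \<inter> Q)"
    by (simp flip: add_divide_distrib)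
qed

lemma rational_polyhedron_subset_Rn:
  assumes "P \<in> rational_polyhedra n"
  shows "P \<subseteq> Rn n"
proof -
  obtain F where F: "\<forall>S\<in>F. \<exists>m. rational_simplex n m S" "P = \<Union>F"
    using assms by (auto simp: rational_polyhedra_def)
  have "S \<subseteq> Rn n" if "S \<in> F" for S
    using F(1) that rational_simplex_definable by (metis cone_definable_def)
  then show ?thesis using F(2) by blast
qed

text \<open>All dimensions share one ambient type, so \<open>(P, 0)\<close> is \<open>P\<close>
  itself and conservativity compares the same set under two indices.\<close>

lemma snoc_0: "snoc n x 0 = x"
  by (simp add: snoc_def)

lemma rational_polyhedra_Suc: "P \<in> rational_polyhedra n \<Longrightarrow> P \<in> rational_polyhedra (Suc n)"
proof -
  have "Qn n \<subseteq> Qn (Suc n)" using Rn_mono[of n "Suc n"] by (auto simp: Qn_def)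
  then have "rational_simplex n m S \<Longrightarrow> rational_simplex (Suc n) m S" for m S
    unfolding rational_simplex_iff by blast
  then show "P \<in> rational_polyhedra (Suc n)" if "P \<in> rational_polyhedra n"
  proof -
    from that obtain F where "finite F" "\<forall>S\<in>F. \<exists>m. rational_simplex n m S" "P = \<Union>F"
      by (auto simp: rational_polyhedra_def)
    then show ?thesis
      using \<open>\<And>m S. rational_simplex n m S \<Longrightarrow> rational_simplex (Suc n) m S\<close>
      unfolding rational_polyhedra_def by (intro CollectI exI[where x = F]) fast
  qed
qed

lemma dim_part_Suc:
  assumes "P \<in> rational_polyhedra n"
  shows "dim_part (Suc n) d P = dim_part n d P"
proof -
  obtain \<Delta> where "regular_triangulates n \<Delta> P" using regular_triangulation_exists[OF assms] .
  note D = regular_triangulatesD[OF this]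
  have R: "Rn n \<subseteq> Rn (Suc n)" by (rule Rn_mono) simp
  have s: "simplex_in (Suc n) m T \<longleftrightarrow> simplex_in n m T" if "T \<in> \<Delta>" for m T
    using complexD(7)[OF D(1) that] R by (auto simp: simplex_in_iff)
  have c: "simplicial_complex_in (Suc n) \<Delta>"
    using D(1) s unfolding simplicial_complex_in_def by auto
  then have "triangulates (Suc n) \<Delta> P" using D(2) by (simp add: triangulates_def)
  moreover have "maximal_simplexes (Suc n) \<Delta> d = maximal_simplexes n \<Delta> d"
    using s by (auto simp: maximal_simplexes_def)
  ultimately show ?thesis using dim_part_eq D(3) by metis
qed

lemma rational_measure_conservativity: "conservativity rational_measure"
  unfolding conservativity_def
proof (intro allI impI ballI)
  fix n d P assume P: "P \<in> rational_polyhedra n"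
  have "rational_measure (Suc n) d P = rational_measure n d P"
    using rational_measure_limit[OF P] dim_part_Suc[OF P]
    by (intro rational_measure_unique rational_polyhedra_Suc P) simp
  then show "rational_measure n d P = rational_measure (Suc n) d ((\<lambda>x. snoc n x 0) ` P)"
    by (simp add: snoc_0)
qed

section \<open>Values on regular simplexes\<close>

lemma faces_triangulate_simplex:
  assumes S: "simplex_in n m S"
  shows "triangulates n {F. F face_of S \<and> F \<noteq> {}} S"
proof -
  let ?V = "vertices S"
  have V: "finite ?V" "\<not> affine_dependent ?V" "convex hull ?V = S" "?V \<subseteq> Rn n" "?V \<noteq> {}"
    using S by (auto simp: simplex_in_iff)
  have eq: "F = convex hull (?V \<inter> F)" if "F face_of S" for F
    using face_of_convex_hull_eq[of F ?V] that V by simp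
  have simp: "\<exists>m. simplex_in n m F" if F: "F face_of S" "F \<noteq> {}" for F
  proof -
    have "?V \<inter> F \<noteq> {}" using eq[OF F(1)] F(2) by (metis convex_hull_empty)
    then have "card (?V \<inter> F) = Suc (card (?V \<inter> F) - 1)" using V(1) by (simp add: card_gt_0_iff)
    moreover have "\<not> affine_dependent (?V \<inter> F)" using affine_independent_subset[OF V(2)] by blast
    ultimately show ?thesis unfolding simplex_in_def using V eq[OF F(1)]
      by (intro exI[where x = "card (?V \<inter> F) - 1"] exI[where x = "?V \<inter> F"]) auto
  qed
  have "convex S" using V(3) convex_convex_hull[of ?V] by simp
  then have SS: "S face_of S" by (rule face_of_refl)
  have "S \<noteq> {}" using V(3,5) by (metis convex_hull_eq_empty)
  have sub: "{F. F face_of S \<and> F \<noteq> {}} \<subseteq> (\<lambda>W. convex hull W) ` Pow ?V" using eq by blast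
  have "simplicial_complex_in n {F. F face_of S \<and> F \<noteq> {}}"
    unfolding simplicial_complex_in_def
  proof (intro conjI ballI allI impI)
    show "finite {F. F face_of S \<and> F \<noteq> {}}" using sub V(1) finite_subset by blast
    fix F assume F: "F \<in> {F. F face_of S \<and> F \<noteq> {}}"
    show "\<exists>m. simplex_in n m F" using simp F by blast
    show "G \<in> {F. F face_of S \<and> F \<noteq> {}}" if "G face_of F \<and> G \<noteq> {}" for G
      using that F face_of_trans by blast
    fix G assume G: "G \<in> {F. F face_of S \<and> F \<noteq> {}}"
    have "(F \<inter> G) face_of S" using F G by (auto intro: face_of_Int)
    then show "(F \<inter> G) face_of F" "(F \<inter> G) face_of G"
      using F G face_of_imp_subset by (blast intro: face_of_subset)+
  qed
  then show ?thesis using SS \<open>S \<noteq> {}\<close> face_of_imp_subset unfolding triangulates_def by blast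
qed

lemma simplex_dim_at_most:
  assumes "simplex_in n m S"
  shows "dim_at_most n m S"
proof -
  have "card (vertices F) \<le> Suc m" if "F face_of S" for F
  proof -
    have "vertices F \<subseteq> vertices S" using extreme_point_of_face[OF that] by (auto simp: vertices_def)
    then show ?thesis using assms card_mono[of "vertices S" "vertices F"] by (auto simp: simplex_in_iff)
  qed
  then show ?thesis using dim_at_most_iff[OF faces_triangulate_simplex[OF assms]] by blast
qed

lemma rational_simplex_polyhedron: "rational_simplex n m S \<Longrightarrow> S \<in> rational_polyhedra n"
  unfolding rational_polyhedra_def by (intro CollectI exI[where x = "{S}"]) auto

lemma rational_measure_regular_simplex:
  assumes S: "regular_simplex n m S"
  shows "rational_measure n m S = 1 / (fact m * real (den_simplex S))"
proof -
  have S': "rational_simplex n m S" "simplex_in n m S"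
    using S regular_imp_rational rational_imp_simplex by blast+
  let ?\<Delta> = "{F. F face_of S \<and> F \<noteq> {}}"
  let ?V = "vertices S"
  have tri: "triangulates n ?\<Delta> S" by (rule faces_triangulate_simplex[OF S'(2)])
  then have c: "simplicial_complex_in n ?\<Delta>" by (simp add: triangulates_def)
  have V: "regular_vertices n ?V" "S = convex hull ?V" "finite ?V" using S by (auto simp: regular_simplex_iff regular_vertices_def)
  have "\<exists>k. regular_simplex n k F" if F: "F \<in> ?\<Delta>" for F
  proof -
    have sub: "vertices F \<subseteq> ?V" using F extreme_point_of_face by (auto simp: vertices_def)
    have "homog n ` vertices F \<subseteq> homog n ` ?V" using sub by blast
    then have "regular_vertices n (vertices F)"
      using V sub complexD(3,4)[OF c F] part_of_basis_mono by (auto simp: regular_vertices_def)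
    moreover have "card (vertices F) = Suc (card (vertices F) - 1)"
      using complexD(3,6)[OF c F] by (simp add: card_gt_0_iff)
    ultimately show ?thesis using complexD(5)[OF c F] unfolding regular_simplex_iff by metis
  qed
  then have reg: "regular_triangulates n ?\<Delta> S" using tri by (simp add: regular_triangulates_def)
  have "maximal_simplexes n ?\<Delta> m = {S}"
  proof -
    have ne: "S \<noteq> {}"
      using S'(2) unfolding simplex_in_iff by (metis card.empty convex_hull_eq_empty nat.simps(3))
    have "S face_of S" using V(2) convex_convex_hull face_of_refl by metis
    then show ?thesis
      using S'(2) ne face_of_imp_subset[of _ S] unfolding maximal_simplexes_def by blast
  qed
  then show ?thesis
    using rational_measure_eq[OF reg rational_simplex_polyhedron[OF S'(1)], of m] by simp
qed

lemma den_Zn: "v \<in> Zn n \<Longrightarrow> den v = 1"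
  using den_le[of 1 v] den_works(1)[of v n] by (fastforce simp: Zn_in_Qn Zn_def)

lemma den_simplex_convex_hull:
  assumes "regular_vertices n V"
  shows "den_simplex (convex hull V) = prod den V"
  using assms vertices_convex_hull[of V] by (simp add: regular_vertices_def den_simplex_def flip: vertices_def)

text \<open>An integer apex has denominator 1, so the product of denominators is unchanged and only
  the factorial contributes, by the factor \<open>k\<close>.\<close>

lemma rational_measure_pyramid: "pyramid rational_measure"
  unfolding pyramid_def
proof (intro allI impI ballI, elim conjE)
  fix n k :: nat and v :: "nat \<Rightarrow> point"
  assume k: "k \<in> {1..n}" and inj: "inj_on v {0..k}" and reg: "regular_vertices n (v ` {0..k})" and v0: "v 0 \<in> Zn n"
  have sub: "v ` {1..k} \<subseteq> v ` {0..k}" by auto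
  then have reg': "regular_vertices n (v ` {1..k})"
    using reg affine_independent_subset[OF _ sub] part_of_basis_mono[OF _ image_mono[OF sub, of "homog n"]] sub
    unfolding regular_vertices_def by auto
  have inj': "inj_on v {1..k}" using inj by (rule inj_on_subset) auto
  have c: "card (v ` {0..k}) = Suc k" "card (v ` {1..k}) = Suc (k - 1)"
    using card_image[OF inj] card_image[OF inj'] k by auto
  have r: "regular_simplex n k (convex hull (v ` {0..k}))" "regular_simplex n (k - 1) (convex hull (v ` {1..k}))"
    unfolding regular_simplex_def using reg reg' c by blast+
  have "prod den (v ` {0..k}) = (\<Prod>i=0..k. den (v i))" "prod den (v ` {1..k}) = (\<Prod>i=1..k. den (v i))"
    using inj inj' by (simp_all add: prod.reindex)
  moreover have "(\<Prod>i=0..k. den (v i)) = den (v 0) * (\<Prod>i=1..k. den (v i))"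
    by (simp add: prod.atLeast_Suc_atMost)
  ultimately have p: "prod den (v ` {0..k}) = prod den (v ` {1..k})" using den_Zn[OF v0] by simp
  have "fact k = real k * fact (k - 1)" using k by (simp add: fact_reduce)
  then show "rational_measure n k (convex hull (v ` {0..k})) = rational_measure n (k - 1) (convex hull (v ` {1..k})) / real k"
    using rational_measure_regular_simplex[OF r(1)] rational_measure_regular_simplex[OF r(2)]
      den_simplex_convex_hull[OF reg] den_simplex_convex_hull[OF reg'] p by simp
qed

section \<open>Invariance\<close>

text \<open>Injectivity is demanded on the entire ambient space, where hulls and faces are
  transported; the condition on \<open>Rn n\<close> keeps images of simplexes in the same
  space.\<close>

definition affine_embedding :: "nat \<Rightarrow> (point \<Rightarrow> point) \<Rightarrow> bool" where
  "affine_embedding n \<phi> \<longleftrightarrow> (\<forall>x\<in>Rn n. \<phi> x \<in> Rn n) \<and>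
     (\<exists>L t. linear L \<and> inj L \<and> \<phi> = (\<lambda>x. t + L x))"

lemma affine_embedding_image:
  assumes "linear L" "inj L"
  shows "inj (\<lambda>x. t + L x)"
    and "(\<lambda>x. t + L x) ` (convex hull V) = convex hull ((\<lambda>x. t + L x) ` V)"
    and "(\<lambda>x. t + L x) ` F face_of (\<lambda>x. t + L x) ` S \<longleftrightarrow> F face_of S"
    and "finite V \<Longrightarrow> \<not> affine_dependent V \<Longrightarrow> \<not> affine_dependent ((\<lambda>x. t + L x) ` V)"
proof -
  have im: "(\<lambda>x. t + L x) ` X = (+) t ` (L ` X)" for X by (simp add: image_comp o_def)
  show inj: "inj (\<lambda>x. t + L x)" using assms(2) by (auto simp: inj_def)
  show "(\<lambda>x. t + L x) ` (convex hull V) = convex hull ((\<lambda>x. t + L x) ` V)"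
    unfolding im convex_hull_linear_image[OF assms(1)] by (simp add: convex_hull_translation)
  show "(\<lambda>x. t + L x) ` F face_of (\<lambda>x. t + L x) ` S \<longleftrightarrow> F face_of S"
    unfolding im using face_of_linear_image[OF assms] by simp
  assume V: "finite V" "\<not> affine_dependent V"
  show "\<not> affine_dependent ((\<lambda>x. t + L x) ` V)"
  proof
    have injV: "inj_on (\<lambda>x. t + L x) V" using inj by (rule inj_on_subset) simp
    assume "affine_dependent ((\<lambda>x. t + L x) ` V)"
    then obtain U w where U: "(\<Sum>v\<in>V. U (t + L v)) = 0" "w \<in> V" "U (t + L w) \<noteq> 0"
      "(\<Sum>v\<in>V. U (t + L v) *\<^sub>R (t + L v)) = 0"
      using affine_dependent_explicit_finite[of "(\<lambda>x. t + L x) ` V"] V(1) injV by (auto simp: sum.reindex)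
    have "L (\<Sum>v\<in>V. U (t + L v) *\<^sub>R v) = 0"
      using U(1,4) assms(1)
      by (simp add: linear_sum linear_scale scaleR_add_right sum.distrib flip: scaleR_sum_left)
    then have "(\<Sum>v\<in>V. U (t + L v) *\<^sub>R v) = 0"
      using assms by (metis inj_eq linear_0)
    then show False
      using affine_independent_unique[OF V, of "\<lambda>v. U (t + L v)" "\<lambda>_. 0" w] U by simp
  qed
qed

lemma affine_embedding_dim_part:
  assumes \<phi>: "affine_embedding n \<phi>" and \<Delta>: "triangulates n \<Delta> P"
  shows "dim_part n d (\<phi> ` P) = \<phi> ` dim_part n d P"
    and "dim_at_most n d (\<phi> ` P) \<longleftrightarrow> dim_at_most n d P"
proof -
  obtain L t where L: "linear L" "inj L" "\<phi> = (\<lambda>x. t + L x)" using \<phi> by (auto simp: affine_embedding_def)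
  note E = affine_embedding_image[OF L(1,2), where t = t, folded L(3)]
  have c: "simplicial_complex_in n \<Delta>" "\<Union>\<Delta> = P" using \<Delta> by (auto simp: triangulates_def)
  note D = complexD[OF c(1)]
  let ?\<Delta> = "image \<phi> ` \<Delta>"
  have vert: "vertices (\<phi> ` S) = \<phi> ` vertices S" if "S \<in> \<Delta>" for S
  proof -
    have "\<phi> ` S = convex hull (\<phi> ` vertices S)" using E(2)[of "vertices S"] D(5)[OF that] by simp
    then show ?thesis using vertices_convex_hull E(4)[OF D(3,4)] that D(3) by (metis finite_imageI)
  qed
  have card: "card (vertices (\<phi> ` S)) = card (vertices S)" if "S \<in> \<Delta>" for S
    unfolding vert[OF that] using E(1) by (intro card_image) (auto intro: inj_on_subset)
  have simp: "simplex_in n m (\<phi> ` S) \<longleftrightarrow> simplex_in n m S" if S: "S \<in> \<Delta>" for S m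
  proof -
    have "\<phi> ` vertices S \<subseteq> Rn n" using D(7)[OF S] \<phi> by (auto simp: affine_embedding_def)
    moreover have "\<phi> ` S = convex hull (\<phi> ` vertices S)" using E(2)[of "vertices S"] D(5)[OF S] by simp
    moreover have "\<not> affine_dependent (\<phi> ` vertices S)" by (rule E(4)[OF D(3,4)[OF S]])
    ultimately show ?thesis
      using D(3,4,5,7)[OF S] card[OF S] vert[OF S] by (auto simp: simplex_in_iff)
  qed
  have sub: "\<phi> ` S \<subseteq> \<phi> ` T \<longleftrightarrow> S \<subseteq> T" for S T using E(1) by (simp add: inj_image_subset_iff)
  have "simplicial_complex_in n ?\<Delta>"
    unfolding simplicial_complex_in_def
  proof (intro conjI ballI allI impI)
    show "finite ?\<Delta>" using D(1) by simp
    fix S' assume "S' \<in> ?\<Delta>"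
    then obtain S where S: "S \<in> \<Delta>" "S' = \<phi> ` S" by blast
    show "\<exists>m. simplex_in n m S'" using simp[OF S(1)] D(2)[OF S(1)] S(2) by simp
    show "F \<in> ?\<Delta>" if F: "F face_of S' \<and> F \<noteq> {}" for F
    proof -
      have "F \<subseteq> \<phi> ` S" using F face_of_imp_subset S(2) by blast
      then obtain G where G: "F = \<phi> ` G" by (auto simp: subset_image_iff)
      then have "G face_of S" "G \<noteq> {}" using F S(2) E(3) by auto
      then show ?thesis using D(8)[OF S(1)] G by blast
    qed
    fix T' assume "T' \<in> ?\<Delta>"
    then obtain T where T: "T \<in> \<Delta>" "T' = \<phi> ` T" by blast
    have "S' \<inter> T' = \<phi> ` (S \<inter> T)" unfolding S(2) T(2) using E(1) by (rule image_Int[symmetric])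
    then show "(S' \<inter> T') face_of S'" "(S' \<inter> T') face_of T'"
      using D(9,10)[OF S(1) T(1)] S(2) T(2) E(3) by simp_all
  qed
  then have tri: "triangulates n ?\<Delta> (\<phi> ` P)" using c(2) by (auto simp: triangulates_def)
  have "maximal_simplexes n ?\<Delta> d = image \<phi> ` maximal_simplexes n \<Delta> d"
  proof (intro equalityI subsetI)
    fix S' assume S': "S' \<in> maximal_simplexes n ?\<Delta> d"
    then obtain S where S: "S \<in> \<Delta>" "S' = \<phi> ` S" by (auto simp: maximal_simplexes_def)
    have "T = S" if T: "T \<in> \<Delta>" "S \<subseteq> T" for T
    proof -
      have "\<forall>T\<in>?\<Delta>. \<phi> ` S \<subseteq> T \<longrightarrow> T = \<phi> ` S"
        using S' unfolding S(2) maximal_simplexes_def by simp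
      then have "\<phi> ` T = \<phi> ` S" using T sub[of S T] by simp
      then show ?thesis using E(1) by (simp add: inj_image_eq_iff)
    qed
    then have "S \<in> maximal_simplexes n \<Delta> d"
      using S S' simp[OF S(1)] by (auto simp: maximal_simplexes_def)
    then show "S' \<in> image \<phi> ` maximal_simplexes n \<Delta> d" using S(2) by blast
  next
    fix S' assume "S' \<in> image \<phi> ` maximal_simplexes n \<Delta> d"
    then obtain S where S: "S \<in> maximal_simplexes n \<Delta> d" "S' = \<phi> ` S" by blast
    then show "S' \<in> maximal_simplexes n ?\<Delta> d"
      using simp[of S d] sub unfolding maximal_simplexes_def by auto
  qed
  then show "dim_part n d (\<phi> ` P) = \<phi> ` dim_part n d P"
    unfolding dim_part_eq[OF tri] dim_part_eq[OF \<Delta>] by blast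
  show "dim_at_most n d (\<phi> ` P) \<longleftrightarrow> dim_at_most n d P"
    unfolding dim_at_most_iff[OF tri] dim_at_most_iff[OF \<Delta>] using card by auto
qed

definition preserves_denominators :: "(point \<Rightarrow> point) \<Rightarrow> bool" where
  "preserves_denominators \<phi> \<longleftrightarrow> (\<forall>x k. (\<forall>i. real k * coord (\<phi> x) i \<in> \<int>) \<longleftrightarrow> (\<forall>i. real k * coord x i \<in> \<int>))"

lemma card_lattice_points_image:
  assumes "inj \<phi>" "preserves_denominators \<phi>"
  shows "card (lattice_points (\<phi> ` P) K) = card (lattice_points P K)"
proof -
  have "lattice_points (\<phi> ` P) K = map_prod id \<phi> ` lattice_points P K"
  proof (intro equalityI subsetI)
    have pres: "(\<forall>i. real k * coord (\<phi> x) i \<in> \<int>) \<longleftrightarrow> (\<forall>i. real k * coord x i \<in> \<int>)" for k x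
      using assms(2) by (simp add: preserves_denominators_def)
    fix p
    show "p \<in> map_prod id \<phi> ` lattice_points P K" if "p \<in> lattice_points (\<phi> ` P) K"
    proof -
      from that obtain k x where p: "k \<in> {1..K}" "x \<in> P" "p = (k, \<phi> x)" "\<forall>i. real k * coord (\<phi> x) i \<in> \<int>"
        by (auto simp: lattice_points_def)
      then have "(k, x) \<in> lattice_points P K" using pres by (simp add: lattice_points_def)
      then show ?thesis using p(3) by (intro rev_image_eqI) auto
    qed
    show "p \<in> lattice_points (\<phi> ` P) K" if "p \<in> map_prod id \<phi> ` lattice_points P K"
    proof -
      from that obtain k x where p: "k \<in> {1..K}" "x \<in> P" "p = (k, \<phi> x)" "\<forall>i. real k * coord x i \<in> \<int>"
        by (auto simp: lattice_points_def)
      have "\<forall>i. real k * coord (\<phi> x) i \<in> \<int>" using p(4) pres by blast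
      then show ?thesis using p(1-3) by (simp add: lattice_points_def)
    qed
  qed
  moreover have "inj (map_prod id \<phi> :: nat \<times> point \<Rightarrow> _)" using assms(1) by (intro prod.inj_map) auto
  ultimately show ?thesis by (simp add: card_image inj_on_subset)
qed

lemma rational_measure_image:
  assumes P: "P \<in> rational_polyhedra n" "\<phi> ` P \<in> rational_polyhedra n"
    and \<phi>: "affine_embedding n \<phi>" "preserves_denominators \<phi>"
  shows "rational_measure n d (\<phi> ` P) = rational_measure n d P"
proof -
  obtain \<Delta> where "regular_triangulates n \<Delta> P" using regular_triangulation_exists[OF P(1)] .
  then have eq: "dim_part n d (\<phi> ` P) = \<phi> ` dim_part n d P"
    using affine_embedding_dim_part(1)[OF \<phi>(1) regular_triangulatesD(3)] by blast
  have "inj \<phi>" using \<phi>(1) affine_embedding_image(1) by (auto simp: affine_embedding_def)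
  then show ?thesis
    using rational_measure_limit[OF P(1), of d] card_lattice_points_image[OF _ \<phi>(2)]
    by (intro rational_measure_unique[OF P(2)]) (simp add: eq)
qed

section \<open>The action of the integral affine group\<close>

text \<open>The integral affine map erases the coordinates from \<open>n\<close> on, hence is not
  injective on the ambient space. Letting its linear part act as the identity on them repairs this
  without changing the map on \<open>Rn n\<close>.\<close>

definition linear_extension :: "nat \<Rightarrow> int mat \<Rightarrow> point \<Rightarrow> point" where
  "linear_extension n A x = (\<Sum>i<n. Poly_Mapping.single i (\<Sum>j<n. of_int (A $$ (i, j)) * coord x j)) +
     (x - (\<Sum>i<n. Poly_Mapping.single i (coord x i)))"

lemma coord_sum_single: "coord (\<Sum>i<n. Poly_Mapping.single i (c i)) k = (if k < n then c k else 0)"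
  by (simp add: coord_simps)

lemma coord_linear_extension:
  "coord (linear_extension n A x) i = (if i < n then \<Sum>j<n. of_int (A $$ (i, j)) * coord x j else coord x i)"
  by (simp add: linear_extension_def lookup_add lookup_minus coord_sum_single)

lemma linear_linear_extension: "linear (linear_extension n A)"
  by (rule linearI; rule poly_mapping_eqI)
    (simp_all add: coord_linear_extension lookup_add sum.distrib algebra_simps sum_distrib_left)

lemma linear_extension_mult:
  assumes A: "A \<in> carrier_mat n n" and B: "B \<in> carrier_mat n n" and one: "A * B = 1\<^sub>m n"
  shows "linear_extension n A (linear_extension n B x) = x"
proof (rule poly_mapping_eqI)
  fix i
  show "coord (linear_extension n A (linear_extension n B x)) i = coord x i"
  proof (cases "i < n")
    case True
    have AB: "(\<Sum>j<n. A $$ (i, j) * B $$ (j, k)) = (if i = k then 1 else 0)" if "k < n" for k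
    proof -
      have "(A * B) $$ (i, k) = (\<Sum>j<n. A $$ (i, j) * B $$ (j, k))"
        using A B True that by (simp add: scalar_prod_def lessThan_atLeast0)
      then show ?thesis using one True that by simp
    qed
    have "coord (linear_extension n A (linear_extension n B x)) i =
      (\<Sum>j<n. \<Sum>k<n. of_int (A $$ (i, j) * B $$ (j, k)) * coord x k)"
      using True by (simp add: coord_linear_extension sum_distrib_left mult.assoc)
    also have "\<dots> = (\<Sum>k<n. of_int (\<Sum>j<n. A $$ (i, j) * B $$ (j, k)) * coord x k)"
      by (subst sum.swap) (simp add: sum_distrib_right)
    also have "\<dots> = (\<Sum>k<n. if k = i then coord x k else 0)"
      using AB by (intro sum.cong) auto
    also have "\<dots> = coord x i" using True by simp
    finally show ?thesis .
  qed (simp add: coord_linear_extension)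
qed

lemma linear_extension_integral:
  assumes "\<And>i. real k * coord x i \<in> \<int>"
  shows "real k * coord (linear_extension n A x) i \<in> \<int>"
proof (cases "i < n")
  case True
  then have "real k * coord (linear_extension n A x) i = (\<Sum>j<n. of_int (A $$ (i, j)) * (real k * coord x j))"
    by (simp add: coord_linear_extension sum_distrib_left algebra_simps)
  also have "\<dots> \<in> \<int>" by (intro Ints_sum Ints_mult[OF Ints_of_int assms])
  finally show ?thesis .
qed (simp add: coord_linear_extension assms)

lemma affine_GL_Z_embedding:
  assumes "\<gamma> \<in> affine_GL_Z n"
  obtains \<phi> where "affine_embedding n \<phi>" "preserves_denominators \<phi>" "\<And>x. x \<in> Rn n \<Longrightarrow> \<gamma> x = \<phi> x"
proof -
  obtain A t where A: "A \<in> carrier_mat n n" "Determinant.det A \<in> {1, -1}" and t: "t \<in> Zn n"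
    and \<gamma>: "\<gamma> = affine_int_map n A t"
    using assms by (auto simp: affine_GL_Z_def)
  \<comment> \<open>The determinant squares to 1, so this multiple of the adjugate is an integral
    inverse.\<close>
  define B where "B = Determinant.det A \<cdot>\<^sub>m adj_mat A"
  have B: "B \<in> carrier_mat n n" "A * B = 1\<^sub>m n" "B * A = 1\<^sub>m n"
  proof -
    have d: "Determinant.det A * Determinant.det A = 1" using A(2) by auto
    note adj = adj_mat[OF A(1)]
    show "B \<in> carrier_mat n n" using adj(1) by (simp add: B_def)
    have "A * B = Determinant.det A \<cdot>\<^sub>m (A * adj_mat A)"
      unfolding B_def by (rule mult_smult_distrib[OF A(1) adj(1)])
    also have "\<dots> = (Determinant.det A * Determinant.det A) \<cdot>\<^sub>m 1\<^sub>m n" unfolding adj(2) by (rule eq_matI) auto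
    also have "\<dots> = 1\<^sub>m n" unfolding d by (rule eq_matI) auto
    finally show "A * B = 1\<^sub>m n" .
    have "B * A = Determinant.det A \<cdot>\<^sub>m (adj_mat A * A)"
      unfolding B_def by (rule mult_smult_assoc_mat[OF adj(1) A(1)])
    also have "\<dots> = (Determinant.det A * Determinant.det A) \<cdot>\<^sub>m 1\<^sub>m n" unfolding adj(3) by (rule eq_matI) auto
    also have "\<dots> = 1\<^sub>m n" unfolding d by (rule eq_matI) auto
    finally show "B * A = 1\<^sub>m n" .
  qed
  let ?L = "linear_extension n A"
  define \<phi> where "\<phi> = (\<lambda>x. t + ?L x)"
  have "inj ?L" by (rule inj_on_inverseI[of _ "linear_extension n B"]) (rule linear_extension_mult[OF B(1) A(1) B(3)])
  moreover have "\<phi> x \<in> Rn n" if "x \<in> Rn n" for x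
    using that t by (auto simp: \<phi>_def Zn_def Rn_def lookup_add coord_linear_extension)
  ultimately have emb: "affine_embedding n \<phi>"
    unfolding affine_embedding_def using linear_linear_extension \<phi>_def by blast
  have pres: "preserves_denominators \<phi>"
    unfolding preserves_denominators_def
  proof (intro allI)
    fix x k
    have tk: "real k * coord t i \<in> \<int>" for i using t by (auto simp: Zn_def)
    have "real k * coord (\<phi> x) i = real k * coord t i + real k * coord (?L x) i" for i
      by (simp add: \<phi>_def lookup_add algebra_simps)
    then have "(\<forall>i. real k * coord (\<phi> x) i \<in> \<int>) \<longleftrightarrow> (\<forall>i. real k * coord (?L x) i \<in> \<int>)"
      using tk by simp
    also have "\<dots> \<longleftrightarrow> (\<forall>i. real k * coord x i \<in> \<int>)"
      using linear_extension_integral[of k x n A] linear_extension_integral[of k "?L x" n B]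
        linear_extension_mult[OF B(1) A(1) B(3), of x] by auto
    finally show "(\<forall>i. real k * coord (\<phi> x) i \<in> \<int>) \<longleftrightarrow> (\<forall>i. real k * coord x i \<in> \<int>)" .
  qed
  have "\<gamma> x = \<phi> x" if x: "x \<in> Rn n" for x
  proof (rule poly_mapping_eqI)
    show "coord (\<gamma> x) i = coord (\<phi> x) i" for i
      using x unfolding \<gamma> affine_int_map_def \<phi>_def
      by (simp add: lookup_add coord_linear_extension coord_sum_single Rn_def)
  qed
  then show ?thesis using that emb pres by blast
qed

lemma rational_measure_invariance: "invariance rational_measure"
  unfolding invariance_def
proof (intro allI impI ballI, elim bexE)
  fix n d P Q \<gamma>
  assume PQ: "P \<in> rational_polyhedra n" "Q \<in> rational_polyhedra n" and \<gamma>: "\<gamma> \<in> affine_GL_Z n" "P = \<gamma> ` Q"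
  obtain \<phi> where \<phi>: "affine_embedding n \<phi>" "preserves_denominators \<phi>" "\<And>x. x \<in> Rn n \<Longrightarrow> \<gamma> x = \<phi> x"
    using affine_GL_Z_embedding[OF \<gamma>(1)] by blast
  have "P = \<phi> ` Q"
    using \<gamma>(2) \<phi>(3) rational_polyhedron_subset_Rn[OF PQ(2)] by (auto simp: subset_iff)
  then show "rational_measure n d P = rational_measure n d Q"
    using rational_measure_image[OF PQ(2) _ \<phi>(1,2)] PQ(1) by simp
qed

lemma translation_in_affine_GL_Z:
  assumes "t \<in> Zn n"
  obtains \<gamma> where "\<gamma> \<in> affine_GL_Z n" "\<And>x. x \<in> Rn n \<Longrightarrow> \<gamma> x = t + x"
proof
  show "affine_int_map n (1\<^sub>m n) t \<in> affine_GL_Z n"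
    unfolding affine_GL_Z_def using assms by (intro CollectI exI conjI refl) auto
  fix x assume x: "x \<in> Rn n"
  show "affine_int_map n (1\<^sub>m n) t x = t + x"
  proof (rule poly_mapping_eqI)
    fix i
    have "(\<Sum>j<n. of_int ((1\<^sub>m n :: int mat) $$ (i, j)) * coord x j) = coord x i" if "i < n"
    proof -
      have "(\<Sum>j<n. of_int ((1\<^sub>m n :: int mat) $$ (i, j)) * coord x j) = (\<Sum>j<n. if j = i then coord x j else 0)"
        using that by (intro sum.cong) auto
      then show ?thesis using that by simp
    qed
    then show "coord (affine_int_map n (1\<^sub>m n) t x) i = coord (t + x) i"
      using x by (auto simp: affine_int_map_def lookup_add coord_sum_single Rn_def)
  qed
qed

section \<open>Normalization\<close>

definition unit_cube :: "point set \<Rightarrow> point set" where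
  "unit_cube B = {\<Sum>w\<in>B. g w *\<^sub>R w | g. \<forall>w\<in>B. 0 \<le> g w \<and> g w \<le> 1}"

lemma sum_in_span: "(\<Sum>w\<in>B. a w *\<^sub>R w) \<in> span B"
  by (intro span_sum span_scale span_base)

lemma part_of_basis_independent:
  assumes "part_of_basis n B" "finite B"
  shows "independent B"
  using part_of_basis_zero[OF assms] assms(2) by (auto simp: dependent_finite)

lemma part_of_basis_Zn: "part_of_basis n B \<Longrightarrow> B \<subseteq> Zn n"
  using lattice_basis_subset by (auto simp: part_of_basis_def)

text \<open>Over height \<open>r\<close> the cube is scaled by \<open>r\<close>, so homogenization
  turns the bounds 0 and 1 of the coordinates into 0 and \<open>r\<close>. The map
  \<open>\<pi>\<close> drops the height and leaves the point whose coordinates are tested.\<close>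

lemma unit_cube_definable:
  assumes B: "part_of_basis n B" "finite B" "B \<noteq> {}"
  shows "cone_definable n (unit_cube B)"
proof -
  have BQ: "B \<subseteq> Qn n" and BR: "B \<subseteq> Rn n" using part_of_basis_Zn[OF B(1)] Zn_subset_Qn Zn_subset_Rn by blast+
  note ind = part_of_basis_independent[OF B(1,2)]
  obtain G f where G: "finite G" "\<forall>g\<in>G. rational_form n g"
    and f: "\<forall>v\<in>B. rational_form n (f v)" "\<forall>v\<in>B. \<forall>w\<in>B. f v w = (if w = v then 1 else 0)"
    and span: "\<forall>x\<in>Rn n. x \<in> span B \<longleftrightarrow> (\<forall>g\<in>G. g x = 0)"
    using rational_dual_forms[OF B(2) BQ ind] by blast
  define \<pi> where "\<pi> = (\<lambda>z. z - coord z n *\<^sub>R unit_vec n)"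
  have \<pi>R: "\<pi> z \<in> Rn n" if "z \<in> Rn (Suc n)" for z
    using that by (auto simp: \<pi>_def Rn_def lookup_minus coord_unit_vec not_less_eq_eq le_Suc_eq)
  have \<pi>Q: "\<pi> z \<in> Qn n" if "z \<in> Qn (Suc n)" for z
    using that \<pi>R[of z] by (auto simp: \<pi>_def Qn_def lookup_minus coord_unit_vec)
  have lin: "linear \<pi>"
    by (rule linearI) (simp_all add: \<pi>_def lookup_add algebra_simps)
  have split: "z = snoc n (\<pi> z) (coord z n)" for z
    by (simp add: \<pi>_def snoc_def) (simp add: poly_mapping_eqI coord_simps)
  have rat\<pi>: "rational_form (Suc n) (\<lambda>z. c * h (\<pi> z))" if "rational_form n h" "c \<in> \<rat>" for h c
    using that \<pi>Q linear_compose[OF lin, of h] linear_real_combine(2)[of "\<lambda>z. h (\<pi> z)" "\<lambda>z. h (\<pi> z)" c]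
    by (auto simp: rational_form_def o_def)
  have ratn: "rational_form (Suc n) (\<lambda>z. coord z n - 1 * (1 * h (\<pi> z)))" if "rational_form n h" for h
    using rat\<pi>[OF that, of 1] linear_real_combine(1)[OF linear_coord[of n], of "\<lambda>z. 1 * h (\<pi> z)" 1]
    by (auto simp: rational_form_def Qn_def)
  \<comment> \<open>The factors 1 fit the forms to the patterns of \<open>rat\<pi>\<close> and
    \<open>ratn\<close>.\<close>
  define H where "H = (\<lambda>g z. 1 * g (\<pi> z)) ` G \<union> (\<lambda>g z. - 1 * g (\<pi> z)) ` G \<union>
    (\<lambda>w z. 1 * f w (\<pi> z)) ` B \<union> (\<lambda>w z. coord z n - 1 * (1 * f w (\<pi> z))) ` B"
  have "finite H" using G(1) B(2) by (simp add: H_def)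
  moreover have "rational_form (Suc n) h" if "h \<in> H" for h
  proof -
    have "rational_form (Suc n) (\<lambda>z. 1 * g (\<pi> z))" "rational_form (Suc n) (\<lambda>z. - 1 * g (\<pi> z))" if "g \<in> G" for g
      using rat\<pi>[of g 1] rat\<pi>[of g "- 1"] G(2) that by auto
    moreover have "rational_form (Suc n) (\<lambda>z. 1 * f w (\<pi> z))"
      "rational_form (Suc n) (\<lambda>z. coord z n - 1 * (1 * f w (\<pi> z)))" if "w \<in> B" for w
      using rat\<pi>[of "f w" 1] ratn[of "f w"] f(1) that by auto
    ultimately show ?thesis using that unfolding H_def by blast
  qed
  moreover have "z \<in> homcone n (unit_cube B) \<longleftrightarrow> (\<forall>h\<in>H. 0 \<le> h z)" if z: "z \<in> Rn (Suc n)" for z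
  proof -
    let ?r = "coord z n" and ?y = "\<pi> z"
    have "(\<forall>g\<in>G. g ?y = 0) \<longleftrightarrow> (\<forall>g\<in>G. 0 \<le> 1 * g ?y) \<and> (\<forall>g\<in>G. 0 \<le> - 1 * g ?y)"
      by (auto simp: order_eq_iff)
    then have iff: "(\<forall>h\<in>H. 0 \<le> h z) \<longleftrightarrow> ?y \<in> span B \<and> (\<forall>w\<in>B. 0 \<le> f w ?y \<and> f w ?y \<le> ?r)"
      unfolding H_def ball_Un using span \<pi>R[OF z] by auto
    have coeff: "f w (\<Sum>w\<in>B. a w *\<^sub>R w) = a w" if "w \<in> B" for a w
    proof -
      have "f w (\<Sum>v\<in>B. a v *\<^sub>R v) = (\<Sum>v\<in>B. a v * f w v)"
        using f(1) that by (intro linear_real_sum) (auto simp: rational_form_def)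
      also have "\<dots> = (\<Sum>v\<in>B. if v = w then a v else 0)" using f(2) that by (intro sum.cong) auto
      finally show ?thesis using that B(2) by simp
    qed
    show ?thesis
      unfolding iff
    proof
      assume "z \<in> homcone n (unit_cube B)"
      then obtain r g where r: "r \<ge> 0" "\<forall>w\<in>B. 0 \<le> g w \<and> g w \<le> 1" "z = r *\<^sub>R snoc n (\<Sum>w\<in>B. g w *\<^sub>R w) 1"
        by (auto simp: homcone_def unit_cube_def)
      have yR: "(\<Sum>w\<in>B. g w *\<^sub>R w) \<in> Rn n" using BR by (intro Rn_sum Rn_scaleR) auto
      have rn: "?r = r" unfolding r(3) using yR by (simp add: coord_snoc coord_n_Rn)
      have y: "?y = (\<Sum>w\<in>B. (r * g w) *\<^sub>R w)"
        unfolding \<pi>_def rn unfolding r(3) by (simp add: snoc_def scaleR_add_right scaleR_sum_right)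
      have "r * g w \<le> r" if "w \<in> B" for w using r(1,2) that by (simp add: mult_left_le)
      then show "?y \<in> span B \<and> (\<forall>w\<in>B. 0 \<le> f w ?y \<and> f w ?y \<le> ?r)"
        unfolding rn y using r(1,2) coeff[of _ "\<lambda>w. r * g w"] by (auto intro!: sum_in_span)
    next
      assume a: "?y \<in> span B \<and> (\<forall>w\<in>B. 0 \<le> f w ?y \<and> f w ?y \<le> ?r)"
      then obtain u where u: "?y = (\<Sum>w\<in>B. u w *\<^sub>R w)" using span_finite[OF B(2)] by auto
      have u01: "0 \<le> u w \<and> u w \<le> ?r" if "w \<in> B" for w using a coeff[OF that, of u] that unfolding u by auto
      \<comment> \<open>Any \<open>w\<close> in \<open>B\<close> has a coordinate between 0 and the
        height, which is therefore nonnegative.\<close>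
      have r0: "?r \<ge> 0" using u01 B(3) by force
      \<comment> \<open>At height 0 all coefficients vanish and division by 0 gives 0, so
        \<open>?x\<close> is the origin, still a point of the cube.\<close>
      let ?x = "\<Sum>w\<in>B. (u w / ?r) *\<^sub>R w"
      have "z = ?r *\<^sub>R snoc n ?x 1"
      proof (cases "?r = 0")
        case True
        then have "u w = 0" if "w \<in> B" for w using u01[OF that] by simp
        then have "?y = 0" unfolding u by simp
        then show ?thesis using split[of z] True by (simp add: snoc_def)
      next
        case False
        then have "?r *\<^sub>R ?x = ?y" unfolding u by (simp add: scaleR_sum_right)
        moreover have "?r *\<^sub>R Poly_Mapping.single n 1 = Poly_Mapping.single n ?r"
          by (simp add: poly_mapping_eqI coord_simps)
        ultimately have "?r *\<^sub>R snoc n ?x 1 = snoc n ?y ?r" by (simp add: snoc_def scaleR_add_right)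
        then show ?thesis using split[of z] by simp
      qed
      moreover have "?x \<in> unit_cube B"
        unfolding unit_cube_def using u01 r0
        by (intro CollectI exI[where x = "\<lambda>w. u w / ?r"]) (auto simp: divide_le_eq_1)
      ultimately show "z \<in> homcone n (unit_cube B)" unfolding homcone_def using r0 by blast
    qed
  qed
  moreover have "unit_cube B \<subseteq> Rn n"
    unfolding unit_cube_def using BR by (auto intro!: Rn_sum Rn_scaleR)
  moreover have "convex (unit_cube B)"
  proof (rule convexI)
    fix x y and u v :: real assume xy: "x \<in> unit_cube B" "y \<in> unit_cube B" and uv: "0 \<le> u" "0 \<le> v" "u + v = 1"
    obtain g h where g: "\<forall>w\<in>B. 0 \<le> g w \<and> g w \<le> 1" "x = (\<Sum>w\<in>B. g w *\<^sub>R w)"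
      and h: "\<forall>w\<in>B. 0 \<le> h w \<and> h w \<le> 1" "y = (\<Sum>w\<in>B. h w *\<^sub>R w)"
      using xy by (auto simp: unit_cube_def)
    have "u *\<^sub>R x + v *\<^sub>R y = (\<Sum>w\<in>B. (u * g w + v * h w) *\<^sub>R w)"
      unfolding g(2) h(2) by (simp add: sum.distrib scaleR_sum_right algebra_simps)
    moreover have "0 \<le> u * g w + v * h w \<and> u * g w + v * h w \<le> 1" if "w \<in> B" for w
    proof -
      have "u * g w \<le> u * 1" "v * h w \<le> v * 1" using g(1) h(1) that uv by (intro mult_left_mono; simp)+
      then show ?thesis using g(1) h(1) that uv by auto
    qed
    ultimately show "u *\<^sub>R x + v *\<^sub>R y \<in> unit_cube B"
      unfolding unit_cube_def by (intro CollectI exI[where x = "\<lambda>w. u * g w + v * h w"]) simp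
  qed
  ultimately show ?thesis by (intro cone_definableI) auto
qed

lemma unit_cube_dim:
  assumes "finite B" "card B = j"
  shows "dim_at_most n j (unit_cube B)"
  unfolding dim_at_most_def
proof (intro allI impI, elim conjE)
  fix m S assume S: "simplex_in n m S" "S \<subseteq> unit_cube B"
  let ?V = "vertices S"
  have V: "finite ?V" "\<not> affine_dependent ?V" "convex hull ?V = S" "card ?V = Suc m"
    using S(1) by (auto simp: simplex_in_iff)
  then obtain a where a: "a \<in> ?V" by (metis card.empty ex_in_conv nat.simps(3))
  have "?V \<subseteq> unit_cube B" using S(2) V(3) hull_subset[of ?V convex] by simp
  moreover have "unit_cube B \<subseteq> span B" by (auto simp: unit_cube_def intro!: sum_in_span)
  ultimately have "?V \<subseteq> span B" by blast
  then have "(\<lambda>v. - a + v) ` (?V - {a}) \<subseteq> span B" using a by (auto intro!: span_diff)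
  moreover have "independent ((\<lambda>v. - a + v) ` (?V - {a}))" using V(2) a affine_dependent_iff_dependent2 by blast
  ultimately have "card ((\<lambda>v. - a + v) ` (?V - {a})) \<le> card B" using independent_span_bound[OF assms(1)] by blast
  then show "m \<le> j" using card_diff_image[OF V(1) a] V(4) assms(2) by simp
qed

text \<open>As \<open>B\<close> is part of a lattice basis, the coordinates at level
  \<open>k\<close> are \<open>c / k\<close> with an integer \<open>c\<close> between 0 and
  \<open>k\<close>: \<open>k + 1\<close> choices for each vector.\<close>

lemma unit_cube_lattice_points:
  assumes B: "part_of_basis n B" "finite B"
  shows "card (lattice_points (unit_cube B) K) = (\<Sum>k=1..K. Suc k ^ card B)"
proof -
  let ?f = "\<lambda>(k, c). (k, \<Sum>w\<in>B. (real (c w) / real k) *\<^sub>R w)"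
  let ?A = "SIGMA k:{1..K}. B \<rightarrow>\<^sub>E {0..k}"
  have "bij_betw ?f ?A (lattice_points (unit_cube B) K)"
    unfolding bij_betw_def
  proof (intro conjI inj_onI equalityI subsetI)
    fix p q assume p: "p \<in> ?A" and q: "q \<in> ?A" and eq: "?f p = ?f q"
    obtain k c where pc: "p = (k, c)" by fastforce
    obtain l d where qd: "q = (l, d)" by fastforce
    have k: "l = k" "k \<ge> 1" using eq p by (auto simp: pc qd)
    have "(\<Sum>w\<in>B. (real (c w) / real k - real (d w) / real k) *\<^sub>R w) = 0"
      using eq k by (simp add: pc qd scaleR_diff_left sum_subtractf)
    then have "real (c w) / real k - real (d w) / real k = 0" if "w \<in> B" for w
      using part_of_basis_zero[OF B, of "\<lambda>w. real (c w) / real k - real (d w) / real k"] that by blast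
    then have "c w = d w" if "w \<in> B" for w using k that by force
    moreover have "c w = d w" if "w \<notin> B" for w
      using p q that by (auto simp: pc qd PiE_def extensional_def)
    ultimately show "p = q" using k by (auto simp: pc qd)
  next
    fix p assume "p \<in> ?f ` ?A"
    then obtain k c where p: "k \<in> {1..K}" "c \<in> B \<rightarrow>\<^sub>E {0..k}" "p = (k, \<Sum>w\<in>B. (real (c w) / real k) *\<^sub>R w)" by auto
    have "(\<Sum>w\<in>B. (real (c w) / real k) *\<^sub>R w) \<in> unit_cube B"
      unfolding unit_cube_def using p(1,2)
      by (intro CollectI exI[where x = "\<lambda>w. real (c w) / real k"]) (auto simp: PiE_iff divide_le_eq_1)
    moreover have "real k * coord (\<Sum>w\<in>B. (real (c w) / real k) *\<^sub>R w) i \<in> \<int>" for i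
    proof -
      have "real k * coord (\<Sum>w\<in>B. (real (c w) / real k) *\<^sub>R w) i = (\<Sum>w\<in>B. real (c w) * coord w i)"
        using p(1) by (simp add: lookup_sum sum_distrib_left)
      also have "\<dots> \<in> \<int>" using part_of_basis_Zn[OF B(1)] by (intro Ints_sum Ints_mult) (auto simp: Zn_def)
      finally show ?thesis .
    qed
    ultimately show "p \<in> lattice_points (unit_cube B) K" using p(1,3) by (simp add: lattice_points_def)
  next
    fix p assume "p \<in> lattice_points (unit_cube B) K"
    then obtain k g where p: "k \<in> {1..K}" "\<forall>w\<in>B. 0 \<le> g w \<and> g w \<le> 1" "p = (k, \<Sum>w\<in>B. g w *\<^sub>R w)"
      "\<And>i. real k * coord (\<Sum>w\<in>B. g w *\<^sub>R w) i \<in> \<int>"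
      by (auto simp: lattice_points_def unit_cube_def)
    have BR: "B \<subseteq> Rn n" using part_of_basis_Zn[OF B(1)] Zn_subset_Rn by blast
    have eq: "real k *\<^sub>R (\<Sum>w\<in>B. g w *\<^sub>R w) = (\<Sum>w\<in>B. (real k * g w) *\<^sub>R w)" by (simp add: scaleR_sum_right)
    have "real k *\<^sub>R (\<Sum>w\<in>B. g w *\<^sub>R w) \<in> Rn n" using BR by (intro Rn_scaleR Rn_sum) auto
    then have "real k *\<^sub>R (\<Sum>w\<in>B. g w *\<^sub>R w) \<in> Zn n" using p(4) by (simp add: Zn_def)
    then have "real k * g w \<in> \<int>" if "w \<in> B" for w
      using part_of_basis_combination[OF B, of "\<lambda>w. real k * g w"] eq that by simp
    note int = this
    define c where "c = restrict (\<lambda>w. nat \<lfloor>real k * g w\<rfloor>) B"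
    have c: "real (c w) = real k * g w" if w: "w \<in> B" for w
    proof -
      have "of_int \<lfloor>real k * g w\<rfloor> = real k * g w" using int[OF w] by simp
      moreover have "real k * g w \<ge> 0" using p(2) w by simp
      ultimately show ?thesis using w by (simp add: c_def)
    qed
    have "c w \<le> k" if w: "w \<in> B" for w
    proof -
      have "real k * g w \<le> real k * 1" using p(2) w by (intro mult_left_mono) auto
      then have "real (c w) \<le> real k" using c[OF w] by simp
      then show ?thesis by simp
    qed
    then have "(k, c) \<in> ?A" using p(1) by (auto simp: c_def)
    moreover have "p = ?f (k, c)"
      unfolding p(3) using c p(1) by (auto intro!: sum.cong)
    ultimately show "p \<in> ?f ` ?A" by (rule rev_image_eqI)
  qed
  then have "card (lattice_points (unit_cube B) K) = card ?A" by (rule bij_betw_same_card[symmetric])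
  also have "\<dots> = (\<Sum>k=1..K. card (B \<rightarrow>\<^sub>E {0..k}))" using B(2) by (intro card_SigmaI) (auto intro!: finite_PiE)
  also have "\<dots> = (\<Sum>k=1..K. Suc k ^ card B)" using B(2) by (simp add: card_PiE)
  finally show ?thesis .
qed

text \<open>Telescoping with \<open>power_diff_bounds\<close> puts \<open>j + 1\<close> times the
  sum between \<open>(K + 1) ^ (j + 1) - 1\<close> and \<open>(K + 2) ^ (j + 1)\<close>; the lower
  end is at least \<open>K ^ (j + 1)\<close>.\<close>

lemma power_sum_limit:
  "(\<lambda>K. real (\<Sum>k=1..K. Suc k ^ j) / real K ^ Suc j) \<longlonglongrightarrow> 1 / real (Suc j)"
proof (rule tendsto_sandwich)
  have lower: "real (Suc K) ^ Suc j - 1 \<le> real (Suc j) * real (\<Sum>k=1..K. Suc k ^ j)" for K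
  proof (induction K)
    case (Suc K)
    have "real (Suc (Suc K)) ^ Suc j - real (Suc K) ^ Suc j \<le> real (Suc j) * real (Suc (Suc K)) ^ j"
      using power_diff_bounds(1)[of "real (Suc K)" "real (Suc (Suc K))" j] by simp
    then show ?case using Suc by (simp add: distrib_left)
  qed simp
  have upper: "real (Suc j) * real (\<Sum>k=1..K. Suc k ^ j) \<le> real (Suc (Suc K)) ^ Suc j" for K
  proof (induction K)
    case (Suc K)
    have "real (Suc j) * real (Suc (Suc K)) ^ j \<le> real (Suc (Suc (Suc K))) ^ Suc j - real (Suc (Suc K)) ^ Suc j"
      using power_diff_bounds(2)[of "real (Suc (Suc K))" "real (Suc (Suc (Suc K)))" j] by simp
    then show ?case using Suc by (simp add: distrib_left)
  qed simp
  show "\<forall>\<^sub>F K in sequentially. 1 / real (Suc j) \<le> real (\<Sum>k=1..K. Suc k ^ j) / real K ^ Suc j"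
  proof (rule eventually_sequentiallyI[of 1])
    fix K :: nat assume K: "1 \<le> K"
    have "K ^ Suc j < Suc K ^ Suc j" by (rule power_strict_mono) auto
    then have "K ^ Suc j + 1 \<le> Suc K ^ Suc j" by simp
    then have "real (K ^ Suc j + 1) \<le> real (Suc K ^ Suc j)" by (rule of_nat_mono)
    then have "real K ^ Suc j + 1 \<le> real (Suc K) ^ Suc j"
      by (simp only: of_nat_add of_nat_power of_nat_1)
    then have "real K ^ Suc j \<le> real (Suc K) ^ Suc j - 1" by linarith
    then have "real K ^ Suc j \<le> real (Suc j) * real (\<Sum>k=1..K. Suc k ^ j)" using lower[of K] by linarith
    then have "1 * real K ^ Suc j \<le> real (\<Sum>k=1..K. Suc k ^ j) * real (Suc j)" by (simp only: mult_ac mult_1)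
    moreover have "real K ^ Suc j > 0" using K by simp
    ultimately show "1 / real (Suc j) \<le> real (\<Sum>k=1..K. Suc k ^ j) / real K ^ Suc j"
      by (subst frac_le_eq) (simp_all only: divide_le_0_iff mult_pos_pos of_nat_0_less_iff zero_less_Suc, auto)
  qed
  show "\<forall>\<^sub>F K in sequentially. real (\<Sum>k=1..K. Suc k ^ j) / real K ^ Suc j \<le> (1 + 2 * (1 / real K)) ^ Suc j / real (Suc j)"
  proof (rule eventually_sequentiallyI[of 1])
    fix K :: nat assume K: "1 \<le> K"
    then have "real (Suc (Suc K)) = real K * (1 + 2 * (1 / real K))" by (simp add: field_simps)
    then have "real (Suc j) * real (\<Sum>k=1..K. Suc k ^ j) \<le> real K ^ Suc j * (1 + 2 * (1 / real K)) ^ Suc j"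
      using upper[of K] by (simp only: power_mult_distrib)
    moreover have "real K ^ Suc j > 0" using K by simp
    ultimately show "real (\<Sum>k=1..K. Suc k ^ j) / real K ^ Suc j \<le> (1 + 2 * (1 / real K)) ^ Suc j / real (Suc j)"
    proof -
      assume a: "real (Suc j) * real (\<Sum>k=1..K. Suc k ^ j) \<le> real K ^ Suc j * (1 + 2 * (1 / real K)) ^ Suc j"
        and p: "0 < real K ^ Suc j"
      have "a / c \<le> b / d" if "d * a \<le> c * b" "c > 0" "d > 0" for a b c d :: real
        using that by (simp add: field_simps)
      from this[OF a p] show ?thesis by simp
    qed
  qed
  have "(\<lambda>K. (1 + 2 * (1 / real K)) ^ Suc j / real (Suc j)) \<longlonglongrightarrow> (1 + 2 * 0) ^ Suc j / real (Suc j)"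
    by (intro tendsto_intros lim_1_over_n) auto
  then show "(\<lambda>K. (1 + 2 * (1 / real K)) ^ Suc j / real (Suc j)) \<longlonglongrightarrow> 1 / real (Suc j)" by simp
qed simp

lemma rational_measure_unit_cube:
  assumes B: "part_of_basis n B" "card B = j" "j \<ge> 1"
  shows "unit_cube B \<in> rational_polyhedra n" "rational_measure n j (unit_cube B) = 1"
proof -
  have fin: "finite B" "B \<noteq> {}" using B(2,3) by (metis card.infinite not_one_le_zero, auto)
  show P: "unit_cube B \<in> rational_polyhedra n"
    by (intro cone_definable_rational_polyhedron unit_cube_definable B(1) fin)
  have "(\<lambda>K. real (card (lattice_points (unit_cube B) K)) / real K ^ Suc j) \<longlonglongrightarrow> 1 / real (Suc j)"
    unfolding unit_cube_lattice_points[OF B(1) fin(1)] B(2) by (rule power_sum_limit)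
  then show "rational_measure n j (unit_cube B) = 1"
    using P unit_cube_dim[OF fin(1) B(2)] by (intro rational_measure_unique_dim)
qed

lemma rational_measure_normalization: "normalization rational_measure"
  unfolding normalization_def using rational_measure_unit_cube(2) by (auto simp: unit_cube_def)

section \<open>Hausdorff measure\<close>

lemma euclid_dist_coord: "\<bar>coord (x - y) i\<bar> \<le> euclid_dist x y"
proof (cases "i \<in> Poly_Mapping.keys (x - y)")
  case True
  have "\<bar>coord (x - y) i\<bar> \<le> L2_set (\<lambda>i. \<bar>coord (x - y) i\<bar>) (Poly_Mapping.keys (x - y))"
    using True by (intro member_le_L2_set) auto
  then show ?thesis by (simp add: euclid_dist_def L2_set_def)
next
  case False
  then show ?thesis by (simp add: euclid_dist_def in_keys_iff)
qed

lemma euclid_dist_le_sum: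
  assumes "x \<in> Rn n" "y \<in> Rn n"
  shows "euclid_dist x y \<le> (\<Sum>i<n. \<bar>coord (x - y) i\<bar>)"
proof -
  have "x - y \<in> Rn n" using assms by (rule Rn_diff)
  then have keys: "Poly_Mapping.keys (x - y) \<subseteq> {..<n}" by (auto simp: Rn_def in_keys_iff not_le[symmetric])
  have "euclid_dist x y \<le> (\<Sum>i\<in>Poly_Mapping.keys (x - y). \<bar>coord (x - y) i\<bar>)"
    unfolding euclid_dist_def by (rule L2_set_le_sum_abs)
  also have "\<dots> \<le> (\<Sum>i<n. \<bar>coord (x - y) i\<bar>)" using keys by (intro sum_mono2) auto
  finally show ?thesis .
qed

lemma euclid_dist_homothety:
  assumes "r > 0"
  shows "euclid_dist (t + r *\<^sub>R x) (t + r *\<^sub>R y) = r * euclid_dist x y"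
proof -
  have d: "(t + r *\<^sub>R x) - (t + r *\<^sub>R y) = r *\<^sub>R (x - y)" by (simp add: algebra_simps)
  have "Poly_Mapping.keys (r *\<^sub>R (x - y)) = Poly_Mapping.keys (x - y)"
    using assms by (auto simp: in_keys_iff)
  moreover have "coord (r *\<^sub>R (x - y)) = (\<lambda>i. r * coord (x - y) i)" by (rule ext) simp
  ultimately show ?thesis
    unfolding euclid_dist_def d using assms by (simp only: L2_set_right_distrib less_imp_le)
qed

lemma euclid_diam_homothety:
  assumes "r > 0"
  shows "euclid_diam ((\<lambda>x. t + r *\<^sub>R x) ` U) = ennreal r * euclid_diam U"
proof -
  have "euclid_diam ((\<lambda>x. t + r *\<^sub>R x) ` U) = (SUP x\<in>U. SUP y\<in>U. ennreal r * ennreal (euclid_dist x y))"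
    unfolding euclid_diam_def image_image euclid_dist_homothety[OF assms]
    using assms by (simp add: ennreal_mult')
  then show ?thesis by (simp add: euclid_diam_def SUP_mult_left_ennreal)
qed

lemma euclid_diam_le:
  assumes "\<And>x y. x \<in> U \<Longrightarrow> y \<in> U \<Longrightarrow> euclid_dist x y \<le> D"
  shows "euclid_diam U \<le> ennreal D"
  unfolding euclid_diam_def using assms by (intro SUP_least ennreal_leI) auto

lemma euclid_dist_le_diam: "x \<in> U \<Longrightarrow> y \<in> U \<Longrightarrow> ennreal (euclid_dist x y) \<le> euclid_diam U"
  unfolding euclid_diam_def by (meson SUP_upper2 order_refl)

lemma hausdorff_weight_homothety:
  assumes "r > 0"
  shows "hausdorff_weight m ((\<lambda>x. t + r *\<^sub>R x) ` U) = ennreal (r ^ m) * hausdorff_weight m U"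
proof -
  have "(ennreal r * euclid_diam U / 2) ^ m = ennreal (r ^ m) * (euclid_diam U / 2) ^ m"
    using assms by (simp add: ennreal_times_divide[symmetric] power_mult_distrib ennreal_power)
  then show ?thesis
    by (simp add: hausdorff_weight_def euclid_diam_homothety[OF assms] mult.left_commute)
qed

lemma hausdorff_premeasure_le:
  assumes "S \<subseteq> (\<Union>i. U i)" "\<And>i. euclid_diam (U i) \<le> ennreal \<delta>"
  shows "hausdorff_premeasure m \<delta> S \<le> (suminf (\<lambda>i. hausdorff_weight m (U i)))"
  unfolding hausdorff_premeasure_def using assms by (intro INF_lower) auto

lemma hausdorff_premeasure_greatest:
  assumes "\<And>U. S \<subseteq> (\<Union>i. U i) \<Longrightarrow> (\<And>i. euclid_diam (U i) \<le> ennreal \<delta>) \<Longrightarrow> x \<le> (suminf (\<lambda>i. hausdorff_weight m (U i)))"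
  shows "x \<le> hausdorff_premeasure m \<delta> S"
  unfolding hausdorff_premeasure_def using assms by (intro INF_greatest) auto

lemma hausdorff_premeasure_approx:
  assumes "hausdorff_premeasure m \<delta> S < top_class.top" "e > 0"
  obtains U :: "nat \<Rightarrow> point set" where "S \<subseteq> (\<Union>i. U i)" "\<And>i. euclid_diam (U i) \<le> ennreal \<delta>"
    "(suminf (\<lambda>i. hausdorff_weight m (U i))) \<le> hausdorff_premeasure m \<delta> S + ennreal e"
proof -
  have "hausdorff_premeasure m \<delta> S < hausdorff_premeasure m \<delta> S + ennreal e"
    using assms by (simp add: ennreal_add_left_cancel_less less_top)
  then have "\<exists>U\<in>{U :: nat \<Rightarrow> point set. S \<subseteq> (\<Union>i. U i) \<and> (\<forall>i. euclid_diam (U i) \<le> ennreal \<delta>)}.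
    (suminf (\<lambda>i. hausdorff_weight m (U i))) < hausdorff_premeasure m \<delta> S + ennreal e"
    by (subst (asm) (1) hausdorff_premeasure_def) (simp add: INF_less_iff)
  then show ?thesis using that less_imp_le by blast
qed

lemma hausdorff_weight_empty: "hausdorff_weight m {} = 0"
  by (simp add: hausdorff_weight_def)

lemma euclid_diam_empty: "euclid_diam {} \<le> ennreal \<delta>"
  by (simp add: euclid_diam_def bot_ennreal)

lemma hausdorff_premeasure_Un:
  "hausdorff_premeasure m \<delta> (S \<union> T) \<le> hausdorff_premeasure m \<delta> S + hausdorff_premeasure m \<delta> T"
proof (rule ennreal_le_epsilon)
  let ?P = "hausdorff_premeasure m \<delta>"
  fix e :: real assume fin: "?P S + ?P T < top_class.top" and e: "0 < e"
  have finS: "?P S < top_class.top" "?P T < top_class.top" using fin by (auto simp: ennreal_add_less_top)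
  obtain U :: "nat \<Rightarrow> point set" where U: "S \<subseteq> (\<Union>i. U i)" "\<And>i. euclid_diam (U i) \<le> ennreal \<delta>"
    "(suminf (\<lambda>i. hausdorff_weight m (U i))) \<le> ?P S + ennreal (e/2)"
    using hausdorff_premeasure_approx[OF finS(1), of "e/2"] e by auto
  obtain V :: "nat \<Rightarrow> point set" where V: "T \<subseteq> (\<Union>i. V i)" "\<And>i. euclid_diam (V i) \<le> ennreal \<delta>"
    "(suminf (\<lambda>i. hausdorff_weight m (V i))) \<le> ?P T + ennreal (e/2)"
    using hausdorff_premeasure_approx[OF finS(2), of "e/2"] e by auto
  \<comment> \<open>Both covers are merged as rows 0 and 1 of a doubly indexed family whose other
    rows are empty; \<open>prod_decode\<close> lists it as one sequence.\<close>
  define F where "F = (\<lambda>(i, j). if i = 0 then U j else if i = (1::nat) then V j else {})"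
  define g where "g = (\<lambda>i. suminf (\<lambda>j. hausdorff_weight m (F (i, j))))"
  have g: "g 0 = (suminf (\<lambda>i. hausdorff_weight m (U i)))" "g 1 = (suminf (\<lambda>i. hausdorff_weight m (V i)))" "g i = 0" if "i \<notin> {0, 1}" for i
    using that by (auto simp: g_def F_def hausdorff_weight_empty)
  have "?P (S \<union> T) \<le> (suminf (\<lambda>k. hausdorff_weight m (F (prod_decode k))))"
  proof (rule hausdorff_premeasure_le)
    show "S \<union> T \<subseteq> (\<Union>k. F (prod_decode k))"
    proof
      fix x assume "x \<in> S \<union> T"
      then consider i where "x \<in> U i" | i where "x \<in> V i" using U(1) V(1) by blast
      then have "\<exists>p. x \<in> F p"
      proof cases
        case (1 i)
        then show ?thesis by (intro exI[where x = "(0, i)"]) (simp add: F_def)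
      next
        case (2 i)
        then show ?thesis by (intro exI[where x = "(1, i)"]) (simp add: F_def)
      qed
      then obtain p where "x \<in> F p" by blast
      then have "x \<in> F (prod_decode (prod_encode p))" by simp
      then show "x \<in> (\<Union>k. F (prod_decode k))" by blast
    qed
    show "euclid_diam (F (prod_decode k)) \<le> ennreal \<delta>" for k
      using U(2) V(2) euclid_diam_empty by (auto simp: F_def split: prod.split)
  qed
  also have "\<dots> = suminf g"
    by (rule suminf_ennreal_2dimen[where f = "\<lambda>p. hausdorff_weight m (F p)"]) (simp add: g_def)
  also have "\<dots> = (\<Sum>i\<in>{0, 1}. g i)" using g by (intro suminf_finite) auto
  also have "\<dots> = (suminf (\<lambda>i. hausdorff_weight m (U i))) + (suminf (\<lambda>i. hausdorff_weight m (V i)))"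
    by (simp add: g_def F_def)
  also have "\<dots> \<le> (?P S + ennreal (e/2)) + (?P T + ennreal (e/2))" using U(3) V(3) by (rule add_mono)
  also have "\<dots> = ?P S + ?P T + (ennreal (e/2) + ennreal (e/2))" by (simp add: ac_simps)
  also have "ennreal (e/2) + ennreal (e/2) = ennreal e" using e by (simp flip: ennreal_plus)
  finally show "?P (S \<union> T) \<le> ?P S + ?P T + ennreal e" .
qed

lemma hausdorff_premeasure_single:
  assumes "euclid_diam U \<le> ennreal \<delta>" "S \<subseteq> U"
  shows "hausdorff_premeasure m \<delta> S \<le> hausdorff_weight m U"
proof -
  have "hausdorff_premeasure m \<delta> S \<le> (suminf (\<lambda>i. hausdorff_weight m (if i = (0::nat) then U else {})))"
    using assms euclid_diam_empty by (intro hausdorff_premeasure_le) auto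
  also have "\<dots> = (\<Sum>i\<in>{0::nat}. hausdorff_weight m (if i = 0 then U else {}))"
    by (intro suminf_finite) (auto simp: hausdorff_weight_empty)
  finally show ?thesis by simp
qed

lemma hausdorff_premeasure_UN:
  assumes "finite I"
  shows "hausdorff_premeasure m \<delta> (\<Union>i\<in>I. S i) \<le> (\<Sum>i\<in>I. hausdorff_premeasure m \<delta> (S i))"
  using assms
proof (induction I rule: finite_induct)
  case empty
  have "hausdorff_premeasure m \<delta> {} \<le> hausdorff_weight m {}"
    using euclid_diam_empty by (intro hausdorff_premeasure_single) auto
  then show ?case by (simp add: hausdorff_weight_empty)
next
  case (insert i I)
  have "hausdorff_premeasure m \<delta> (\<Union>i\<in>insert i I. S i) \<le>
    hausdorff_premeasure m \<delta> (S i) + hausdorff_premeasure m \<delta> (\<Union>i\<in>I. S i)"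
    using hausdorff_premeasure_Un[of m \<delta> "S i"] by simp
  also have "\<dots> \<le> hausdorff_premeasure m \<delta> (S i) + (\<Sum>i\<in>I. hausdorff_premeasure m \<delta> (S i))"
    using insert.IH by (rule add_left_mono)
  finally show ?case using insert.hyps by simp
qed

lemma hausdorff_premeasure_le_measure: "\<delta> > 0 \<Longrightarrow> hausdorff_premeasure m \<delta> S \<le> hausdorff_measure m S"
  unfolding hausdorff_measure_def by (intro SUP_upper) auto

lemma hausdorff_measure_least:
  assumes "\<And>\<delta>. \<delta> > 0 \<Longrightarrow> hausdorff_premeasure m \<delta> S \<le> x"
  shows "hausdorff_measure m S \<le> x"
  unfolding hausdorff_measure_def using assms by (intro SUP_least) auto

lemma hausdorff_measure_UN:
  assumes "finite I"
  shows "hausdorff_measure m (\<Union>i\<in>I. S i) \<le> (\<Sum>i\<in>I. hausdorff_measure m (S i))"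
proof (rule hausdorff_measure_least)
  fix \<delta> :: real assume "\<delta> > 0"
  have "hausdorff_premeasure m \<delta> (\<Union>i\<in>I. S i) \<le> (\<Sum>i\<in>I. hausdorff_premeasure m \<delta> (S i))"
    using assms by (rule hausdorff_premeasure_UN)
  also have "\<dots> \<le> (\<Sum>i\<in>I. hausdorff_measure m (S i))"
    using \<open>\<delta> > 0\<close> by (intro sum_mono hausdorff_premeasure_le_measure)
  finally show "hausdorff_premeasure m \<delta> (\<Union>i\<in>I. S i) \<le> (\<Sum>i\<in>I. hausdorff_measure m (S i))" .
qed

lemma hausdorff_measure_mono:
  assumes "S \<subseteq> T"
  shows "hausdorff_measure m S \<le> hausdorff_measure m T"
proof (rule hausdorff_measure_least)
  fix \<delta> :: real assume "\<delta> > 0"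
  have "hausdorff_premeasure m \<delta> S \<le> hausdorff_premeasure m \<delta> T"
  proof (rule hausdorff_premeasure_greatest)
    fix U :: "nat \<Rightarrow> point set" assume U: "T \<subseteq> (\<Union>i. U i)" "\<And>i. euclid_diam (U i) \<le> ennreal \<delta>"
    then show "hausdorff_premeasure m \<delta> S \<le> (suminf (\<lambda>i. hausdorff_weight m (U i)))"
      using assms by (intro hausdorff_premeasure_le) auto
  qed
  also have "\<dots> \<le> hausdorff_measure m T" using \<open>\<delta> > 0\<close> by (rule hausdorff_premeasure_le_measure)
  finally show "hausdorff_premeasure m \<delta> S \<le> hausdorff_measure m T" .
qed

lemma hausdorff_measure_Un: "hausdorff_measure m (S \<union> T) \<le> hausdorff_measure m S + hausdorff_measure m T"
  using hausdorff_measure_UN[of "{True, False}" m "\<lambda>b. if b then S else T"]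
  by (simp add: Un_commute)

lemma hausdorff_measure_homothety_le:
  assumes r: "r > 0"
  shows "hausdorff_measure m ((\<lambda>x. t + r *\<^sub>R x) ` S) \<le> ennreal (r ^ m) * hausdorff_measure m S"
proof (rule hausdorff_measure_least)
  fix \<delta> :: real assume \<delta>: "\<delta> > 0"
  let ?f = "\<lambda>x. t + r *\<^sub>R x"
  let ?P = "hausdorff_premeasure m \<delta> (?f ` S)"
  have c: "ennreal (r ^ m) * ennreal (1 / r ^ m) = 1"
    using r by (simp flip: ennreal_mult'' add: ennreal_mult[symmetric])
  have "ennreal (1 / r ^ m) * ?P \<le> hausdorff_premeasure m (\<delta> / r) S"
  proof (rule hausdorff_premeasure_greatest)
    fix U :: "nat \<Rightarrow> point set" assume U: "S \<subseteq> (\<Union>i. U i)" "\<And>i. euclid_diam (U i) \<le> ennreal (\<delta> / r)"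
    have "?P \<le> (suminf (\<lambda>i. hausdorff_weight m (?f ` U i)))"
    proof (rule hausdorff_premeasure_le)
      show "?f ` S \<subseteq> (\<Union>i. ?f ` U i)" using U(1) by blast
      fix i
      have "euclid_diam (?f ` U i) \<le> ennreal r * ennreal (\<delta> / r)"
        unfolding euclid_diam_homothety[OF r] using U(2) by (rule mult_left_mono) simp
      also have "\<dots> = ennreal \<delta>" using r \<delta> by (simp flip: ennreal_mult)
      finally show "euclid_diam (?f ` U i) \<le> ennreal \<delta>" .
    qed
    also have "\<dots> = ennreal (r ^ m) * (suminf (\<lambda>i. hausdorff_weight m (U i)))"
      unfolding hausdorff_weight_homothety[OF r] by simp
    finally have "ennreal (1 / r ^ m) * ?P \<le> ennreal (1 / r ^ m) * (ennreal (r ^ m) * (suminf (\<lambda>i. hausdorff_weight m (U i))))"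
      by (rule mult_left_mono) simp
    also have "\<dots> = (suminf (\<lambda>i. hausdorff_weight m (U i)))" using c by (simp add: mult.assoc[symmetric] mult.commute)
    finally show "ennreal (1 / r ^ m) * ?P \<le> (suminf (\<lambda>i. hausdorff_weight m (U i)))" .
  qed
  also have "\<dots> \<le> hausdorff_measure m S" using r \<delta> by (intro hausdorff_premeasure_le_measure) simp
  finally have "ennreal (r ^ m) * (ennreal (1 / r ^ m) * ?P) \<le> ennreal (r ^ m) * hausdorff_measure m S"
    by (rule mult_left_mono) simp
  then show "?P \<le> ennreal (r ^ m) * hausdorff_measure m S" using c by (simp add: mult.assoc[symmetric])
qed

text \<open>The reverse inequality is the same estimate for the inverse homothety.\<close>

lemma hausdorff_measure_homothety:
  assumes r: "r > 0"
  shows "hausdorff_measure m ((\<lambda>x. t + r *\<^sub>R x) ` S) = ennreal (r ^ m) * hausdorff_measure m S"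
proof (rule antisym)
  show "hausdorff_measure m ((\<lambda>x. t + r *\<^sub>R x) ` S) \<le> ennreal (r ^ m) * hausdorff_measure m S"
    using r by (rule hausdorff_measure_homothety_le)
  let ?T = "(\<lambda>x. t + r *\<^sub>R x) ` S"
  have "(\<lambda>x. - (1 / r) *\<^sub>R t + (1 / r) *\<^sub>R x) ` ?T = S"
    using r by (simp add: image_image scaleR_add_right)
  then have "hausdorff_measure m S \<le> ennreal ((1 / r) ^ m) * hausdorff_measure m ?T"
    using hausdorff_measure_homothety_le[of "1 / r" m "- (1 / r) *\<^sub>R t" ?T] r by simp
  then have "ennreal (r ^ m) * hausdorff_measure m S \<le> ennreal (r ^ m) * (ennreal ((1 / r) ^ m) * hausdorff_measure m ?T)"
    by (rule mult_left_mono) simp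
  also have "\<dots> = hausdorff_measure m ?T"
  proof -
    have "ennreal (r ^ m) * ennreal ((1 / r) ^ m) = 1"
      using r by (simp add: power_divide flip: ennreal_mult)
    then show ?thesis by (simp add: mult.assoc[symmetric])
  qed
  finally show "ennreal (r ^ m) * hausdorff_measure m S \<le> hausdorff_measure m ?T" .
qed

section \<open>Lattice cells\<close>

text \<open>Coordinates on a rational direction space. The integer vectors \<open>W\<close> may
  generate a proper sublattice of the lattice vectors in their span: only ratios for two bodies are
  formed, and the index cancels.\<close>

locale lattice_frame =
  fixes n :: nat and W :: "point set" and f :: "point \<Rightarrow> point \<Rightarrow> real"
  assumes fin: "finite W" and WZ: "W \<subseteq> Zn n"
    and lin: "\<And>w. w \<in> W \<Longrightarrow> linear (f w)"
    and dual: "\<And>v w. v \<in> W \<Longrightarrow> w \<in> W \<Longrightarrow> f v w = (if w = v then 1 else 0)"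
begin

definition comb :: "(point \<Rightarrow> real) \<Rightarrow> point" where
  "comb s = (\<Sum>w\<in>W. s w *\<^sub>R w)"

text \<open>Half-open, so that the floors of the coordinates select the cell containing a
  point.\<close>

definition cell :: "point \<Rightarrow> real \<Rightarrow> point set" where
  "cell a r = {a + comb s | s. \<forall>w\<in>W. 0 \<le> s w \<and> s w < r}"

abbreviation H :: "point set \<Rightarrow> ennreal" where
  "H \<equiv> hausdorff_measure (card W)"

lemma comb_add: "comb s + comb t = comb (\<lambda>w. s w + t w)"
  by (simp add: comb_def sum.distrib scaleR_add_left)

lemma comb_diff: "comb s - comb t = comb (\<lambda>w. s w - t w)"
  by (simp add: comb_def sum_subtractf scaleR_diff_left)

lemma comb_scale: "r *\<^sub>R comb s = comb (\<lambda>w. r * s w)"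
  by (simp add: comb_def scaleR_sum_right)

lemma comb_cong: "(\<And>w. w \<in> W \<Longrightarrow> s w = t w) \<Longrightarrow> comb s = comb t"
  unfolding comb_def by (intro sum.cong) auto

lemma WR: "W \<subseteq> Rn n"
  using WZ Zn_subset_Rn by blast

lemma comb_Rn: "comb s \<in> Rn n"
  unfolding comb_def using WR by (intro Rn_sum Rn_scaleR) auto

lemma comb_span: "comb s \<in> span W"
  unfolding comb_def by (rule sum_in_span)

lemma f_comb: "w \<in> W \<Longrightarrow> f w (comb s) = s w"
proof -
  assume w: "w \<in> W"
  have "f w (comb s) = (\<Sum>v\<in>W. s v * f w v)" unfolding comb_def using lin[OF w] by (rule linear_real_sum)
  also have "\<dots> = (\<Sum>v\<in>W. if v = w then s v else 0)" using dual w by (intro sum.cong) auto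
  finally show ?thesis using w fin by simp
qed

lemma comb_f: "x \<in> span W \<Longrightarrow> comb (\<lambda>w. f w x) = x"
proof -
  assume "x \<in> span W"
  then obtain u where u: "x = comb u" using span_finite[OF fin] by (auto simp: comb_def)
  show ?thesis unfolding u by (rule comb_cong) (rule f_comb)
qed

lemma cell_homothety: "r > 0 \<Longrightarrow> cell a r = (\<lambda>x. a + r *\<^sub>R x) ` cell 0 1"
proof (intro equalityI subsetI)
  fix x assume r: "r > 0"
  show "x \<in> (\<lambda>x. a + r *\<^sub>R x) ` cell 0 1" if "x \<in> cell a r"
  proof -
    from that obtain s where s: "x = a + comb s" "\<forall>w\<in>W. 0 \<le> s w \<and> s w < r" by (auto simp: cell_def)
    have "comb (\<lambda>w. s w / r) \<in> cell 0 1" unfolding cell_def using s(2) r by auto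
    moreover have "x = a + r *\<^sub>R comb (\<lambda>w. s w / r)" unfolding s(1) comb_scale using r by simp
    ultimately show ?thesis by blast
  qed
  show "x \<in> cell a r" if "x \<in> (\<lambda>x. a + r *\<^sub>R x) ` cell 0 1"
  proof -
    from that obtain s where s: "x = a + r *\<^sub>R comb s" "\<forall>w\<in>W. 0 \<le> s w \<and> s w < 1" by (auto simp: cell_def)
    then have "x = a + comb (\<lambda>w. r * s w)" by (simp add: comb_scale)
    moreover have "\<forall>w\<in>W. 0 \<le> r * s w \<and> r * s w < r" using s(2) r by auto
    ultimately show ?thesis unfolding cell_def by blast
  qed
qed

lemma H_cell: "r > 0 \<Longrightarrow> H (cell a r) = ennreal (r ^ card W) * H (cell 0 1)"
  by (simp add: cell_homothety[of r] hausdorff_measure_homothety)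

lemma grid_floor:
  assumes "k > 0" "x - a \<in> span W"
  shows "x \<in> cell (a + comb (\<lambda>w. of_int \<lfloor>real k * f w (x - a)\<rfloor> / real k)) (1 / real k)"
proof -
  let ?j = "\<lambda>w. \<lfloor>real k * f w (x - a)\<rfloor>"
  let ?s = "\<lambda>w. f w (x - a) - of_int (?j w) / real k"
  have "x = a + comb (\<lambda>w. f w (x - a))" using comb_f[OF assms(2)] by simp
  also have "\<dots> = a + comb (\<lambda>w. of_int (?j w) / real k) + comb ?s"
    by (simp add: comb_add add.assoc)
  finally have x: "x = a + comb (\<lambda>w. of_int (?j w) / real k) + comb ?s" .
  have "0 \<le> ?s w \<and> ?s w < 1 / real k" for w
  proof -
    have "of_int (?j w) \<le> real k * f w (x - a)" "real k * f w (x - a) < of_int (?j w) + 1" by linarith+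
    then have "of_int (?j w) / real k \<le> f w (x - a)" "f w (x - a) < (of_int (?j w) + 1) / real k"
      using assms(1) by (simp_all add: pos_divide_le_eq pos_less_divide_eq mult.commute)
    then show ?thesis by (simp add: add_divide_distrib)
  qed
  then show ?thesis unfolding cell_def using x by blast
qed

lemma cell_subset_grid:
  assumes "k > 0"
  shows "cell (a + comb (\<lambda>w. - real L)) (2 * real L) \<subseteq>
    (\<Union>j \<in> W \<rightarrow>\<^sub>E {- int (L * k)..<int (L * k)}. cell (a + comb (\<lambda>w. of_int (j w) / real k)) (1 / real k))"
proof
  fix x assume "x \<in> cell (a + comb (\<lambda>w. - real L)) (2 * real L)"
  then obtain s where s: "x = a + comb (\<lambda>w. - real L) + comb s" "\<forall>w\<in>W. 0 \<le> s w \<and> s w < 2 * real L"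
    by (auto simp: cell_def)
  let ?u = "\<lambda>w. - real L + s w"
  have xa: "x - a = comb ?u" unfolding s(1) by (simp add: comb_add add.assoc)
  let ?j = "restrict (\<lambda>w. \<lfloor>real k * f w (x - a)\<rfloor>) W"
  have "comb (\<lambda>w. of_int (?j w) / real k) = comb (\<lambda>w. of_int \<lfloor>real k * f w (x - a)\<rfloor> / real k)"
    by (rule comb_cong) simp
  moreover have "x \<in> cell (a + comb (\<lambda>w. of_int \<lfloor>real k * f w (x - a)\<rfloor> / real k)) (1 / real k)"
    using assms xa comb_span by (intro grid_floor) auto
  moreover have "?j \<in> W \<rightarrow>\<^sub>E {- int (L * k)..<int (L * k)}"
  proof (rule restrict_PiE_iff[THEN iffD2], rule ballI)
    fix w assume w: "w \<in> W"
    have fw: "f w (x - a) = ?u w" unfolding xa by (rule f_comb[OF w])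
    have b: "- real L \<le> ?u w" "?u w < real L" using s(2) w by auto
    have "real k * - real L \<le> real k * ?u w" using b(1) by (rule mult_left_mono) simp
    then have "of_int (- int (L * k)) \<le> real k * ?u w" by (simp add: mult.commute)
    then have "- int (L * k) \<le> \<lfloor>real k * ?u w\<rfloor>" by (simp only: le_floor_iff)
    moreover have "real k * ?u w < real k * real L" using b(2) assms by (intro mult_strict_left_mono) auto
    then have "real k * ?u w < of_int (int (L * k))" by (simp add: mult.commute)
    then have "\<lfloor>real k * ?u w\<rfloor> < int (L * k)" by (simp only: floor_less_iff)
    ultimately show "\<lfloor>real k * f w (x - a)\<rfloor> \<in> {- int (L * k)..<int (L * k)}" unfolding fw by simp
  qed
  ultimately show "x \<in> (\<Union>j \<in> W \<rightarrow>\<^sub>E {- int (L * k)..<int (L * k)}. cell (a + comb (\<lambda>w. of_int (j w) / real k)) (1 / real k))"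
    by (intro UN_I[of ?j]) auto
qed

lemma card_grid: "card (W \<rightarrow>\<^sub>E {- int (L * k)..<int (L * k)}) = (2 * L * k) ^ card W"
proof -
  have "card {- int (L * k)..<int (L * k)} = nat (int (2 * L * k))" by (simp add: algebra_simps)
  then have "card {- int (L * k)..<int (L * k)} = 2 * L * k" by (simp only: nat_int)
  then show ?thesis using fin by (simp only: card_PiE prod_constant)
qed

lemma cell_dist:
  assumes "a \<in> Rn n" "x \<in> cell a r" "y \<in> cell a r"
  shows "euclid_dist x y \<le> r * (\<Sum>i<n. \<Sum>w\<in>W. \<bar>coord w i\<bar>)"
proof -
  obtain s t where s: "x = a + comb s" "\<forall>w\<in>W. 0 \<le> s w \<and> s w < r" and t: "y = a + comb t" "\<forall>w\<in>W. 0 \<le> t w \<and> t w < r"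
    using assms by (auto simp: cell_def)
  have d: "x - y = comb (\<lambda>w. s w - t w)" unfolding s(1) t(1) by (simp add: comb_diff[symmetric])
  have "x \<in> Rn n" "y \<in> Rn n" unfolding s(1) t(1) using assms(1) comb_Rn by (auto intro: Rn_add)
  then have "euclid_dist x y \<le> (\<Sum>i<n. \<bar>coord (x - y) i\<bar>)" by (rule euclid_dist_le_sum)
  also have "\<dots> \<le> (\<Sum>i<n. \<Sum>w\<in>W. r * \<bar>coord w i\<bar>)"
  proof (rule sum_mono)
    fix i
    have "\<bar>coord (x - y) i\<bar> = \<bar>\<Sum>w\<in>W. (s w - t w) * coord w i\<bar>"
      unfolding d by (simp add: comb_def lookup_sum)
    also have "\<dots> \<le> (\<Sum>w\<in>W. \<bar>(s w - t w) * coord w i\<bar>)" by (rule sum_abs)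
    also have "\<dots> \<le> (\<Sum>w\<in>W. r * \<bar>coord w i\<bar>)"
    proof (rule sum_mono)
      fix w assume "w \<in> W"
      then have "0 \<le> s w" "s w < r" "0 \<le> t w" "t w < r" using s(2) t(2) by auto
      then have "\<bar>s w - t w\<bar> \<le> r" by linarith
      then show "\<bar>(s w - t w) * coord w i\<bar> \<le> r * \<bar>coord w i\<bar>" by (simp add: abs_mult mult_right_mono)
    qed
    finally show "\<bar>coord (x - y) i\<bar> \<le> (\<Sum>w\<in>W. r * \<bar>coord w i\<bar>)" .
  qed
  also have "\<dots> = r * (\<Sum>i<n. \<Sum>w\<in>W. \<bar>coord w i\<bar>)" by (simp add: sum_distrib_left)
  finally show ?thesis .
qed

section \<open>The unit cell has finite and positive measure\<close>

text \<open>With \<open>m\<close> for \<open>card W\<close>, a box of side 2 is cut into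
  \<open>(2 k') ^ m\<close> cells of diameter at most \<open>C / k'\<close>. The resulting bound on
  the total weight is independent of \<open>k'\<close>, so it survives as the mesh tends to
  0.\<close>

lemma H_cell_finite: "H (cell 0 1) < top_class.top"
proof -
  define C where "C = (\<Sum>i<n. \<Sum>w\<in>W. \<bar>coord w i\<bar>)"
  have C: "C \<ge> 0" unfolding C_def by (intro sum_nonneg) auto
  define M where "M = unit_ball_vol (real (card W)) * (2 * C / 2) ^ card W"
  have "H (cell (0 + comb (\<lambda>w. - real 1)) (2 * real 1)) \<le> ennreal M"
  proof (rule hausdorff_measure_least)
    fix \<delta> :: real assume \<delta>: "\<delta> > 0"
    obtain k :: nat where k: "C / \<delta> < real k" using reals_Archimedean2 by blast
    define k' where "k' = Suc k"
    have k': "k' > 0" "C / real k' \<le> \<delta>"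
    proof -
      show "k' > 0" by (simp add: k'_def)
      have "C < real k * \<delta>" using k \<delta> by (simp add: pos_divide_less_eq)
      also have "\<dots> \<le> real k' * \<delta>" using \<delta> by (simp add: k'_def)
      finally show "C / real k' \<le> \<delta>" by (simp add: pos_divide_le_eq k'_def mult.commute less_imp_le)
    qed
    let ?J = "W \<rightarrow>\<^sub>E {- int (1 * k')..<int (1 * k')}"
    let ?cell = "\<lambda>j. cell (0 + comb (\<lambda>w. of_int (j w) / real k')) (1 / real k')"
    have finJ: "finite ?J" using fin by (intro finite_PiE) auto
    have diam: "euclid_diam (?cell j) \<le> ennreal (C / real k')" for j :: "point \<Rightarrow> int"
    proof (rule euclid_diam_le)
      fix x y assume "x \<in> ?cell j" "y \<in> ?cell j"
      moreover have "0 + comb (\<lambda>w. of_int (j w) / real k') \<in> Rn n" using comb_Rn by simp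
      ultimately show "euclid_dist x y \<le> C / real k'"
        using cell_dist[of "0 + comb (\<lambda>w. of_int (j w) / real k')" x "1 / real k'" y] by (simp add: C_def)
    qed
    have "hausdorff_premeasure (card W) \<delta> (cell (0 + comb (\<lambda>w. - real 1)) (2 * real 1))
      \<le> hausdorff_premeasure (card W) \<delta> (\<Union>j\<in>?J. ?cell j)"
    proof (rule hausdorff_premeasure_greatest)
      fix U :: "nat \<Rightarrow> point set" assume "(\<Union>j\<in>?J. ?cell j) \<subseteq> (\<Union>i. U i)" "\<And>i. euclid_diam (U i) \<le> ennreal \<delta>"
      then show "hausdorff_premeasure (card W) \<delta> (cell (0 + comb (\<lambda>w. - real 1)) (2 * real 1)) \<le> (suminf (\<lambda>i. hausdorff_weight (card W) (U i)))"
        by (intro hausdorff_premeasure_le order_trans[OF cell_subset_grid[OF k'(1), of 0 1]])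
    qed
    also have "\<dots> \<le> (\<Sum>j\<in>?J. hausdorff_premeasure (card W) \<delta> (?cell j))"
      by (rule hausdorff_premeasure_UN[OF finJ])
    also have "\<dots> \<le> (\<Sum>j\<in>?J. ennreal (unit_ball_vol (real (card W)) * (C / real k' / 2) ^ card W))"
    proof (rule sum_mono)
      fix j :: "point \<Rightarrow> int"
      have "hausdorff_premeasure (card W) \<delta> (?cell j) \<le> hausdorff_weight (card W) (?cell j)"
        using order_trans[OF diam ennreal_leI[OF k'(2)]] by (intro hausdorff_premeasure_single) auto
      also have "\<dots> \<le> ennreal (unit_ball_vol (real (card W))) * (euclid_diam (?cell j) / 2) ^ card W"
        by (simp add: hausdorff_weight_def)
      also have "\<dots> \<le> ennreal (unit_ball_vol (real (card W))) * (ennreal (C / real k') / 2) ^ card W"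
        using diam by (intro mult_left_mono power_mono divide_right_mono_ennreal) auto
      also have "ennreal (C / real k') / 2 = ennreal (C / real k' / 2)"
        using C k'(1) divide_ennreal[of "C / real k'" 2] by simp
      also have "ennreal (unit_ball_vol (real (card W))) * ennreal (C / real k' / 2) ^ card W =
        ennreal (unit_ball_vol (real (card W)) * (C / real k' / 2) ^ card W)"
        using C k'(1) by (simp add: ennreal_power ennreal_mult)
      finally show "hausdorff_premeasure (card W) \<delta> (?cell j) \<le> ennreal (unit_ball_vol (real (card W)) * (C / real k' / 2) ^ card W)" .
    qed
    also have "\<dots> = ennreal (real (card ?J) * (unit_ball_vol (real (card W)) * (C / real k' / 2) ^ card W))"
      using C by (simp add: ennreal_mult ennreal_of_nat_eq_real_of_nat)
    also have "real (card ?J) * (unit_ball_vol (real (card W)) * (C / real k' / 2) ^ card W) = M"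
    proof -
      have "real (card ?J) = (2 * real k') ^ card W" unfolding card_grid by simp
      then have "real (card ?J) * (unit_ball_vol (real (card W)) * (C / real k' / 2) ^ card W) =
        unit_ball_vol (real (card W)) * (2 * real k' * (C / real k' / 2)) ^ card W"
        by (simp only: power_mult_distrib mult.left_commute mult.assoc)
      also have "2 * real k' * (C / real k' / 2) = 2 * C / 2" using k'(1) by simp
      finally show ?thesis by (simp add: M_def)
    qed
    finally show "hausdorff_premeasure (card W) \<delta> (cell (0 + comb (\<lambda>w. - real 1)) (2 * real 1)) \<le> ennreal M" .
  qed
  then have "ennreal (2 ^ card W) * H (cell 0 1) \<le> ennreal M" using H_cell[of 2] by simp
  then have "ennreal (2 ^ card W) * H (cell 0 1) < top_class.top" using ennreal_less_top le_less_trans by blast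
  then show ?thesis by (auto simp: ennreal_mult_less_top)
qed

lemma f_lipschitz:
  obtains C where "C > 0" "\<And>w x y. w \<in> W \<Longrightarrow> x \<in> Rn n \<Longrightarrow> y \<in> Rn n \<Longrightarrow> \<bar>f w (x - y)\<bar> \<le> C * euclid_dist x y"
proof
  \<comment> \<open>The added 1 keeps the constant positive even if \<open>W\<close> is
    empty.\<close>
  define C where "C = 1 + (\<Sum>w\<in>W. \<Sum>i<n. \<bar>f w (unit_vec i)\<bar>)"
  have nn: "(\<Sum>i<n. \<bar>f w (unit_vec i)\<bar>) \<ge> 0" for w by (intro sum_nonneg) auto
  then have "(\<Sum>w\<in>W. \<Sum>i<n. \<bar>f w (unit_vec i)\<bar>) \<ge> 0" by (rule sum_nonneg)
  then show "C > 0" by (simp add: C_def)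
  fix w x y assume w: "w \<in> W" and xy: "x \<in> Rn n" "y \<in> Rn n"
  have d0: "euclid_dist x y \<ge> 0" by (simp add: euclid_dist_def)
  have "\<bar>f w (x - y)\<bar> = \<bar>\<Sum>i<n. coord (x - y) i * f w (unit_vec i)\<bar>"
    using linear_Rn_sum[OF lin[OF w] Rn_diff[OF xy]] by simp
  also have "\<dots> \<le> (\<Sum>i<n. \<bar>coord (x - y) i * f w (unit_vec i)\<bar>)" by (rule sum_abs)
  also have "\<dots> \<le> (\<Sum>i<n. euclid_dist x y * \<bar>f w (unit_vec i)\<bar>)"
    using euclid_dist_coord[of x y] by (intro sum_mono) (simp add: abs_mult mult_right_mono)
  also have "\<dots> = euclid_dist x y * (\<Sum>i<n. \<bar>f w (unit_vec i)\<bar>)" by (simp add: sum_distrib_left)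
  also have "\<dots> \<le> euclid_dist x y * C"
  proof (rule mult_left_mono[OF _ d0])
    have "(\<Sum>i<n. \<bar>f w (unit_vec i)\<bar>) \<le> (\<Sum>w\<in>W. \<Sum>i<n. \<bar>f w (unit_vec i)\<bar>)"
      using fin w nn by (intro member_le_sum) auto
    then show "(\<Sum>i<n. \<bar>f w (unit_vec i)\<bar>) \<le> C" by (simp add: C_def)
  qed
  finally show "\<bar>f w (x - y)\<bar> \<le> C * euclid_dist x y" by (simp add: mult.commute)
qed

text \<open>Coordinates map a set of diameter \<open>D\<close> into a box of side \<open>2 C D\<close>, so a cover of the unit cell
  yields a cover of the unit box, whose Lebesgue measure is \<open>1\<close>.\<close>

lemma H_cell_pos: "H (cell 0 1) > 0"
proof -
  obtain C where C: "C > 0" "\<And>w x y. w \<in> W \<Longrightarrow> x \<in> Rn n \<Longrightarrow> y \<in> Rn n \<Longrightarrow> \<bar>f w (x - y)\<bar> \<le> C * euclid_dist x y"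
    using f_lipschitz by blast
  define \<omega> where "\<omega> = unit_ball_vol (real (card W))"
  have \<omega>: "\<omega> > 0" by (simp add: \<omega>_def)
  \<comment> \<open>Chosen so that a box of side \<open>2 C D\<close> has volume
    \<open>1 / c\<close> times the Hausdorff weight of a set of diameter \<open>D\<close>.\<close>
  define c where "c = \<omega> / (4 * C) ^ card W"
  have c: "c > 0" using \<omega> C(1) by (simp add: c_def)
  let ?M = "PiM W (\<lambda>_. lborel :: real measure)"
  interpret product_sigma_finite "\<lambda>_::point. lborel :: real measure" by standard
  have "ennreal c \<le> hausdorff_premeasure (card W) 1 (cell 0 1)"
  proof (rule hausdorff_premeasure_greatest)
    fix U :: "nat \<Rightarrow> point set" assume U: "cell 0 1 \<subseteq> (\<Union>i. U i)" "\<And>i. euclid_diam (U i) \<le> ennreal 1"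
    \<comment> \<open>A sample point in each set that meets the cell becomes the centre of its box;
      sets that miss the cell get an empty box.\<close>
    define x where "x = (\<lambda>i. SOME y. y \<in> U i \<inter> cell 0 1)"
    define D where "D = (\<lambda>i. enn2real (euclid_diam (U i)))"
    have D: "euclid_diam (U i) = ennreal (D i)" "D i \<ge> 0" for i
    proof -
      have "euclid_diam (U i) < top_class.top" using U(2)[of i] ennreal_less_top le_less_trans by blast
      then show "euclid_diam (U i) = ennreal (D i)" by (simp add: D_def)
    qed (simp add: D_def)
    define B where "B = (\<lambda>i. if U i \<inter> cell 0 1 = {} then {} else
      PiE W (\<lambda>w. {f w (x i) - C * D i .. f w (x i) + C * D i}))"
    have x: "x i \<in> U i \<inter> cell 0 1" if "U i \<inter> cell 0 1 \<noteq> {}" for i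
      unfolding x_def by (rule someI_ex) (use that in auto)
    have cellR: "cell 0 1 \<subseteq> Rn n" using comb_Rn by (auto simp: cell_def)
    have box: "PiE W (\<lambda>w. {0..<1}) \<subseteq> (\<Union>i. B i)"
    proof
      fix s :: "point \<Rightarrow> real" assume s: "s \<in> PiE W (\<lambda>w. {0..<1})"
      have y: "comb s \<in> cell 0 1" unfolding cell_def using s by (auto simp: PiE_iff)
      then obtain i where i: "comb s \<in> U i" using U(1) by blast
      then have ne: "U i \<inter> cell 0 1 \<noteq> {}" using y by blast
      have "s w \<in> {f w (x i) - C * D i .. f w (x i) + C * D i}" if w: "w \<in> W" for w
      proof -
        have "ennreal (euclid_dist (comb s) (x i)) \<le> euclid_diam (U i)"
          using i x[OF ne] by (intro euclid_dist_le_diam) auto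
        then have "euclid_dist (comb s) (x i) \<le> D i" unfolding D(1) using D(2) by simp
        then have "C * euclid_dist (comb s) (x i) \<le> C * D i" using C(1) by simp
        moreover have "\<bar>f w (comb s - x i)\<bar> \<le> C * euclid_dist (comb s) (x i)"
          using x[OF ne] cellR comb_Rn w by (intro C(2)) auto
        moreover have "f w (comb s - x i) = s w - f w (x i)"
          using lin[OF w] f_comb[OF w] by (simp add: linear_diff)
        ultimately show ?thesis by (simp add: abs_le_iff algebra_simps)
      qed
      then have "s \<in> B i" using ne s by (auto simp: B_def PiE_iff)
      then show "s \<in> (\<Union>i. B i)" by blast
    qed
    have Bsets: "range B \<subseteq> sets ?M"
      using fin by (auto simp: B_def intro!: sets_PiM_I_finite)
    have "1 = emeasure ?M (PiE W (\<lambda>w. {0..<1}))"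
      using emeasure_PiM[OF fin, of "\<lambda>_. {0..<1}"] by simp
    also have "\<dots> \<le> emeasure ?M (\<Union>i. B i)" using box Bsets by (intro emeasure_mono) auto
    also have "\<dots> \<le> (suminf (\<lambda>i. emeasure ?M (B i)))" using Bsets by (rule emeasure_subadditive_countably)
    also have "\<dots> \<le> (suminf (\<lambda>i. ennreal (1 / c) * hausdorff_weight (card W) (U i)))"
    proof (intro suminf_le allI)
      fix i
      show "emeasure ?M (B i) \<le> ennreal (1 / c) * hausdorff_weight (card W) (U i)"
      proof (cases "U i \<inter> cell 0 1 = {}")
        case True
        then show ?thesis by (simp add: B_def)
      next
        case False
        then have ne: "U i \<noteq> {}" by blast
        have CD: "C * D i \<ge> 0" using C(1) D(2) by simp
        have "emeasure ?M (B i) = (\<Prod>w\<in>W. emeasure lborel {f w (x i) - C * D i .. f w (x i) + C * D i})"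
          using False emeasure_PiM[OF fin, of "\<lambda>w. {f w (x i) - C * D i .. f w (x i) + C * D i}"] by (simp add: B_def)
        also have "\<dots> = (\<Prod>w\<in>W. ennreal (2 * (C * D i)))" using CD by (intro prod.cong) auto
        also have "\<dots> = ennreal ((2 * (C * D i)) ^ card W)" using CD by (simp add: ennreal_power)
        also have "(2 * (C * D i)) ^ card W = (1 / c) * (\<omega> * (D i / 2) ^ card W)"
        proof -
          have "2 * (C * D i) = 4 * C * (D i / 2)" by simp
          then have "(2 * (C * D i)) ^ card W = (4 * C) ^ card W * (D i / 2) ^ card W"
            by (simp only: power_mult_distrib)
          then show ?thesis using \<omega> by (simp add: c_def)
        qed
        also have "ennreal ((1 / c) * (\<omega> * (D i / 2) ^ card W)) = ennreal (1 / c) * hausdorff_weight (card W) (U i)"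
        proof -
          have "euclid_diam (U i) / 2 = ennreal (D i / 2)"
            unfolding D(1) using D(2)[of i] divide_ennreal[of "D i" 2] by simp
          then have "hausdorff_weight (card W) (U i) = ennreal (\<omega> * (D i / 2) ^ card W)"
            using ne D(2) \<omega> by (simp add: hausdorff_weight_def \<omega>_def[symmetric] ennreal_power ennreal_mult)
          moreover have "\<omega> * (D i / 2) ^ card W \<ge> 0" using \<omega> D(2)[of i] by simp
          moreover have "1 / c \<ge> 0" using c by simp
          ultimately show ?thesis by (simp only: ennreal_mult)
        qed
        finally show ?thesis by simp
      qed
    qed auto
    also have "\<dots> = ennreal (1 / c) * (suminf (\<lambda>i. hausdorff_weight (card W) (U i)))" by simp
    finally have "ennreal c * 1 \<le> ennreal c * (ennreal (1 / c) * (suminf (\<lambda>i. hausdorff_weight (card W) (U i))))"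
      by (rule mult_left_mono) simp
    also have "\<dots> = (suminf (\<lambda>i. hausdorff_weight (card W) (U i)))"
    proof -
      have "ennreal c * ennreal (1 / c) = 1" using c by (simp flip: ennreal_mult)
      then show ?thesis by (simp add: mult.assoc[symmetric])
    qed
    finally show "ennreal c \<le> (suminf (\<lambda>i. hausdorff_weight (card W) (U i)))" by simp
  qed
  also have "\<dots> \<le> H (cell 0 1)" by (rule hausdorff_premeasure_le_measure) simp
  finally have le: "ennreal c \<le> H (cell 0 1)" .
  have "0 < ennreal c" using c by simp
  then show ?thesis using le by (rule less_le_trans)
qed

end

section \<open>Grid points and Hausdorff measure\<close>

context lattice_frame
begin

text \<open>Algebraic substitute for a bounded convex set with relative interior point
  \<open>p\<close>: all perturbations of \<open>p\<close> with coordinates of absolute value up to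
  \<open>\<rho>\<close> stay inside.\<close>

definition body :: "point \<Rightarrow> real \<Rightarrow> point set \<Rightarrow> bool" where
  "body p \<rho> Q \<longleftrightarrow> convex Q \<and> 0 < \<rho> \<and> (\<forall>x\<in>Q. x - p \<in> span W) \<and>
     (\<forall>s. (\<forall>w\<in>W. \<bar>s w\<bar> \<le> \<rho>) \<longrightarrow> p + comb s \<in> Q) \<and> (\<exists>R. \<forall>x\<in>Q. \<forall>w\<in>W. \<bar>f w (x - p)\<bar> \<le> R)"

definition homothety :: "point \<Rightarrow> real \<Rightarrow> point set \<Rightarrow> point set" where
  "homothety p r Q = (\<lambda>x. (1 - r) *\<^sub>R p + r *\<^sub>R x) ` Q"

definition grid_point :: "point \<Rightarrow> nat \<Rightarrow> (point \<Rightarrow> int) \<Rightarrow> point" where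
  "grid_point a k j = a + comb (\<lambda>w. of_int (j w) / real k)"

definition grid_in :: "point set \<Rightarrow> point \<Rightarrow> nat \<Rightarrow> (point \<Rightarrow> int) set" where
  "grid_in Q a k = {j \<in> W \<rightarrow>\<^sub>E UNIV. grid_point a k j \<in> Q}"

lemma H_homothety: "r > 0 \<Longrightarrow> H (homothety p r Q) = ennreal (r ^ card W) * H Q"
  unfolding homothety_def by (rule hausdorff_measure_homothety)

text \<open>Moving \<open>x\<close> by the fraction \<open>\<epsilon>\<close> towards
  \<open>p\<close> gains room \<open>\<epsilon> \<rho>\<close> in every coordinate.\<close>

lemma body_move:
  assumes b: "body p \<rho> Q" and \<epsilon>: "0 < \<epsilon>" "\<epsilon> < 1" and x: "x \<in> Q" and s: "\<forall>w\<in>W. \<bar>s w\<bar> \<le> \<epsilon> * \<rho>"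
  shows "\<epsilon> *\<^sub>R p + (1 - \<epsilon>) *\<^sub>R x + comb s \<in> Q"
proof -
  have "\<forall>w\<in>W. \<bar>s w / \<epsilon>\<bar> \<le> \<rho>" using s \<epsilon> by (auto simp: abs_divide pos_divide_le_eq mult.commute)
  then have "p + comb (\<lambda>w. s w / \<epsilon>) \<in> Q" using b by (auto simp: body_def)
  then have "\<epsilon> *\<^sub>R (p + comb (\<lambda>w. s w / \<epsilon>)) + (1 - \<epsilon>) *\<^sub>R x \<in> Q"
    using b x \<epsilon> by (intro convexD) (auto simp: body_def)
  moreover have "\<epsilon> *\<^sub>R (p + comb (\<lambda>w. s w / \<epsilon>)) + (1 - \<epsilon>) *\<^sub>R x = \<epsilon> *\<^sub>R p + (1 - \<epsilon>) *\<^sub>R x + comb s"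
    using \<epsilon> by (simp add: scaleR_add_right comb_scale)
  ultimately show ?thesis by simp
qed

lemma body_center: "body p \<rho> Q \<Longrightarrow> p \<in> Q"
proof -
  assume b: "body p \<rho> Q"
  then have "p + comb (\<lambda>_. 0) \<in> Q" unfolding body_def by auto
  then show "p \<in> Q" by (simp add: comb_def)
qed

lemma grid_coord:
  assumes "w \<in> W"
  shows "f w (grid_point a k j - a) = of_int (j w) / real k"
  using f_comb[OF assms] by (simp add: grid_point_def)

lemma grid_point_inj: "k > 0 \<Longrightarrow> inj_on (grid_point a k) (W \<rightarrow>\<^sub>E UNIV)"
proof (rule inj_onI)
  fix i j assume k: "k > 0" and ij: "i \<in> W \<rightarrow>\<^sub>E UNIV" "j \<in> W \<rightarrow>\<^sub>E UNIV" and eq: "grid_point a k i = grid_point a k j"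
  show "i = j"
  proof (rule PiE_ext[OF ij])
    fix w assume "w \<in> W"
    then have "of_int (i w) / real k = of_int (j w) / real k" using grid_coord eq by metis
    then show "i w = j w" using k by simp
  qed
qed

lemma grid_in_box:
  assumes b: "body p \<rho> Q" and a: "a - p \<in> span W" and k: "k > 0"
  obtains L :: nat where "L > 0" "grid_in Q a k \<subseteq> W \<rightarrow>\<^sub>E {- int (L * k)..<int (L * k)}"
proof -
  obtain R where R: "\<forall>x\<in>Q. \<forall>w\<in>W. \<bar>f w (x - p)\<bar> \<le> R" using b by (auto simp: body_def)
  obtain L0 :: nat where L0: "R + (\<Sum>w\<in>W. \<bar>f w (a - p)\<bar>) < real L0" using reals_Archimedean2 by blast
  define L where "L = Suc L0"
  have "j w \<in> {- int (L * k)..<int (L * k)}" if j: "j \<in> grid_in Q a k" and w: "w \<in> W" for j w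
  proof -
    let ?g = "grid_point a k j"
    have "f w (?g - a) = f w (?g - p) - f w (a - p)"
      using lin[OF w] by (simp add: linear_diff)
    moreover have "\<bar>f w (?g - p)\<bar> \<le> R" using R j w by (auto simp: grid_in_def)
    moreover have "\<bar>f w (a - p)\<bar> \<le> (\<Sum>w\<in>W. \<bar>f w (a - p)\<bar>)" using fin w by (intro member_le_sum) auto
    ultimately have "\<bar>f w (?g - a)\<bar> < real L" using L0 unfolding L_def by linarith
    then have "\<bar>of_int (j w) / real k\<bar> < real L" unfolding grid_coord[OF w] .
    then have "\<bar>of_int (j w)\<bar> < real L * real k" using k by (simp add: abs_divide pos_divide_less_eq)
    then have "real_of_int \<bar>j w\<bar> < real_of_int (int (L * k))" by simp
    then have "\<bar>j w\<bar> < int (L * k)" by (simp only: of_int_less_iff)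
    then show ?thesis by auto
  qed
  then have "grid_in Q a k \<subseteq> W \<rightarrow>\<^sub>E {- int (L * k)..<int (L * k)}"
  proof (intro subsetI PiE_I)
    fix j w assume "\<And>j w. j \<in> grid_in Q a k \<Longrightarrow> w \<in> W \<Longrightarrow> j w \<in> {- int (L * k)..<int (L * k)}"
      and "j \<in> grid_in Q a k" "w \<in> W"
    then show "j w \<in> {- int (L * k)..<int (L * k)}" by blast
  next
    fix j w assume "j \<in> grid_in Q a k" "w \<notin> W"
    then show "j w = undefined" by (auto simp: grid_in_def PiE_def extensional_def)
  qed
  then show ?thesis using that[of L] by (simp add: L_def)
qed

lemma finite_grid_in:
  assumes "body p \<rho> Q" "a - p \<in> span W" "k > 0"
  shows "finite (grid_in Q a k)"
proof -
  obtain L :: nat where "grid_in Q a k \<subseteq> W \<rightarrow>\<^sub>E {- int (L * k)..<int (L * k)}"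
    by (rule grid_in_box[OF assms])
  moreover have "finite (W \<rightarrow>\<^sub>E {- int (L * k)..<int (L * k)})" using fin by (intro finite_PiE) auto
  ultimately show ?thesis by (rule finite_subset)
qed

text \<open>A point of the body shrunk by \<open>1 - \<epsilon>\<close> has room for coordinate
  steps of length \<open>1 / k\<close>, so the corner of its cell is a grid point of
  \<open>Q\<close>. The cells at grid points of \<open>Q\<close> therefore cover the shrunk
  body.\<close>

lemma grid_cells_upper:
  assumes b: "body p \<rho> Q" and a: "a - p \<in> span W" and k: "k > 0" "1 / real k \<le> \<epsilon> * \<rho>" and \<epsilon>: "0 < \<epsilon>" "\<epsilon> < 1"
  shows "ennreal ((1 - \<epsilon>) ^ card W) * H Q \<le> of_nat (card (grid_in Q a k)) * (ennreal ((1 / real k) ^ card W) * H (cell 0 1))"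
proof -
  have "homothety p (1 - \<epsilon>) Q \<subseteq> (\<Union>j\<in>grid_in Q a k. cell (grid_point a k j) (1 / real k))"
  proof
    fix y assume "y \<in> homothety p (1 - \<epsilon>) Q"
    then obtain x where x: "x \<in> Q" "y = \<epsilon> *\<^sub>R p + (1 - \<epsilon>) *\<^sub>R x" by (auto simp: homothety_def)
    have "y - a = (1 - \<epsilon>) *\<^sub>R (x - p) - (a - p)" unfolding x(2) by (simp add: algebra_simps)
    then have ya: "y - a \<in> span W"
      using b x(1) a by (simp only: span_diff span_scale body_def)
    let ?j = "restrict (\<lambda>w. \<lfloor>real k * f w (y - a)\<rfloor>) W"
    have g: "grid_point a k ?j = a + comb (\<lambda>w. of_int \<lfloor>real k * f w (y - a)\<rfloor> / real k)"
      unfolding grid_point_def by (intro arg_cong2[where f = "(+)"] comb_cong) simp_all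
    define z where "z = grid_point a k ?j"
    have y: "y \<in> cell z (1 / real k)"
      unfolding z_def g using k(1) ya by (rule grid_floor)
    then obtain s where s: "y = z + comb s" "\<forall>w\<in>W. 0 \<le> s w \<and> s w < 1 / real k"
      by (auto simp: cell_def)
    have "z = y + comb (\<lambda>w. - s w)"
      unfolding s(1) by (simp add: comb_def sum_negf)
    also have "\<dots> \<in> Q"
      unfolding x(2) using s(2) k(2) by (intro body_move[OF b \<epsilon> x(1)]) auto
    finally have "?j \<in> grid_in Q a k" by (simp add: grid_in_def z_def)
    then show "y \<in> (\<Union>j\<in>grid_in Q a k. cell (grid_point a k j) (1 / real k))" using y unfolding z_def by blast
  qed
  then have "H (homothety p (1 - \<epsilon>) Q) \<le> H (\<Union>j\<in>grid_in Q a k. cell (grid_point a k j) (1 / real k))"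
    by (rule hausdorff_measure_mono)
  also have "\<dots> \<le> (\<Sum>j\<in>grid_in Q a k. H (cell (grid_point a k j) (1 / real k)))"
    by (rule hausdorff_measure_UN[OF finite_grid_in[OF b a k(1)]])
  also have "\<dots> = (\<Sum>j\<in>grid_in Q a k. ennreal ((1 / real k) ^ card W) * H (cell 0 1))"
    using k(1) by (intro sum.cong H_cell) auto
  finally show ?thesis using \<epsilon> by (simp add: H_homothety)
qed

text \<open>Subadditivity does not bound \<open>H Q\<close> from below directly. But a box of known
  measure is covered by the slightly enlarged body, which contains all cells at grid points of
  \<open>Q\<close>, together with the remaining cells of the box.\<close>

lemma grid_cells_lower:
  assumes b: "body p \<rho> Q" and a: "a - p \<in> span W" and k: "k > 0" "1 / real k \<le> \<epsilon> * \<rho>" and \<epsilon>: "0 < \<epsilon>" "\<epsilon> < 1"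
  obtains L :: nat where "card (grid_in Q a k) \<le> (2 * L * k) ^ card W"
    "ennreal ((2 * real L) ^ card W) * H (cell 0 1) \<le> ennreal ((1 / (1 - \<epsilon>)) ^ card W) * H Q +
      of_nat ((2 * L * k) ^ card W - card (grid_in Q a k)) * (ennreal ((1 / real k) ^ card W) * H (cell 0 1))"
proof -
  obtain L :: nat where L: "L > 0" "grid_in Q a k \<subseteq> W \<rightarrow>\<^sub>E {- int (L * k)..<int (L * k)}"
    by (rule grid_in_box[OF b a k(1)])
  let ?J = "W \<rightarrow>\<^sub>E {- int (L * k)..<int (L * k)}"
  let ?G = "grid_in Q a k"
  let ?Q = "homothety p (1 / (1 - \<epsilon>)) Q"
  let ?R = "cell (a + comb (\<lambda>w. - real L)) (2 * real L)"
  have finJ: "finite ?J" using fin by (intro finite_PiE) auto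
  have cellQ: "cell (grid_point a k j) (1 / real k) \<subseteq> ?Q" if j: "j \<in> ?G" for j
  proof
    fix y assume "y \<in> cell (grid_point a k j) (1 / real k)"
    then obtain s where s: "y = grid_point a k j + comb s" "\<forall>w\<in>W. 0 \<le> s w \<and> s w < 1 / real k"
      by (auto simp: cell_def)
    \<comment> \<open>The image of \<open>y\<close> under the inverse homothety; showing it in
      \<open>Q\<close> puts \<open>y\<close> in the enlarged body.\<close>
    define z where "z = \<epsilon> *\<^sub>R p + (1 - \<epsilon>) *\<^sub>R grid_point a k j + comb (\<lambda>w. (1 - \<epsilon>) * s w)"
    have "\<forall>w\<in>W. \<bar>(1 - \<epsilon>) * s w\<bar> \<le> \<epsilon> * \<rho>"
    proof
      fix w assume "w \<in> W"
      then have sw: "0 \<le> s w" "s w \<le> \<epsilon> * \<rho>" using s(2) k(2) by fastforce+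
      have "(1 - \<epsilon>) * s w \<le> 1 * s w" using sw \<epsilon> by (intro mult_right_mono) auto
      then show "\<bar>(1 - \<epsilon>) * s w\<bar> \<le> \<epsilon> * \<rho>" using sw \<epsilon> by (simp add: abs_mult)
    qed
    then have z: "z \<in> Q" unfolding z_def using j by (intro body_move[OF b \<epsilon>]) (auto simp: grid_in_def)
    have zy: "z = \<epsilon> *\<^sub>R p + (1 - \<epsilon>) *\<^sub>R y"
      unfolding z_def s(1) by (simp add: scaleR_add_right comb_scale add.assoc)
    have "(1 / (1 - \<epsilon>)) *\<^sub>R z = (\<epsilon> / (1 - \<epsilon>)) *\<^sub>R p + y"
      unfolding zy using \<epsilon> by (simp add: scaleR_add_right)
    moreover have "1 - 1 / (1 - \<epsilon>) = - (\<epsilon> / (1 - \<epsilon>))" using \<epsilon> by (simp add: field_simps)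
    ultimately have "y = (1 - 1 / (1 - \<epsilon>)) *\<^sub>R p + (1 / (1 - \<epsilon>)) *\<^sub>R z" by simp
    then show "y \<in> ?Q" unfolding homothety_def using z by blast
  qed
  have "?R \<subseteq> (\<Union>j\<in>?J. cell (grid_point a k j) (1 / real k))"
    unfolding grid_point_def by (rule cell_subset_grid[OF k(1)])
  then have "?R \<subseteq> ?Q \<union> (\<Union>j\<in>?J - ?G. cell (grid_point a k j) (1 / real k))"
    using cellQ by blast
  then have "H ?R \<le> H (?Q \<union> (\<Union>j\<in>?J - ?G. cell (grid_point a k j) (1 / real k)))"
    by (rule hausdorff_measure_mono)
  also have "\<dots> \<le> H ?Q + H (\<Union>j\<in>?J - ?G. cell (grid_point a k j) (1 / real k))"
    by (rule hausdorff_measure_Un)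
  also have "\<dots> \<le> H ?Q + (\<Sum>j\<in>?J - ?G. H (cell (grid_point a k j) (1 / real k)))"
    using finJ by (intro add_left_mono hausdorff_measure_UN) auto
  also have "(\<Sum>j\<in>?J - ?G. H (cell (grid_point a k j) (1 / real k))) =
    (\<Sum>j\<in>?J - ?G. ennreal ((1 / real k) ^ card W) * H (cell 0 1))"
    using k(1) by (intro sum.cong H_cell) auto
  finally have le: "H ?R \<le> H ?Q + of_nat (card (?J - ?G)) * (ennreal ((1 / real k) ^ card W) * H (cell 0 1))"
    by simp
  have c: "card (?J - ?G) = (2 * L * k) ^ card W - card ?G"
    using card_Diff_subset[OF finite_subset[OF L(2) finJ] L(2)] card_grid by simp
  have "card ?G \<le> (2 * L * k) ^ card W" using card_mono[OF finJ L(2)] card_grid by simp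
  moreover have "ennreal ((2 * real L) ^ card W) * H (cell 0 1) \<le> ennreal ((1 / (1 - \<epsilon>)) ^ card W) * H Q +
      of_nat ((2 * L * k) ^ card W - card ?G) * (ennreal ((1 / real k) ^ card W) * H (cell 0 1))"
    using le L(1) \<epsilon> unfolding c by (simp add: H_cell[of "2 * real L"] H_homothety)
  ultimately show ?thesis using that by blast
qed

definition volume :: "point set \<Rightarrow> real" where
  "volume Q = enn2real (H Q)"

definition cell_volume :: real where
  "cell_volume = enn2real (H (cell 0 1))"

lemma cell_volume: "H (cell 0 1) = ennreal cell_volume" "cell_volume > 0"
proof -
  show "H (cell 0 1) = ennreal cell_volume" unfolding cell_volume_def using H_cell_finite by simp
  then show "cell_volume > 0" using H_cell_pos by (simp add: ennreal_zero_less_divide)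
qed

lemma volume_finite:
  assumes b: "body p \<rho> Q"
  shows "H Q = ennreal (volume Q)"
proof -
  obtain k :: nat where k: "1 / (1/2 * \<rho>) < real k" using reals_Archimedean2 by blast
  have \<rho>: "\<rho> > 0" using b by (simp add: body_def)
  then have "0 < 1 / (1/2 * \<rho>)" by simp
  then have k0: "k > 0" using k by (cases k) auto
  have "1 < real k * (1/2 * \<rho>)" using k \<rho> by (subst (asm) pos_divide_less_eq) auto
  then have "1 / real k \<le> 1/2 * \<rho>" using k0 by (simp add: pos_divide_le_eq mult.commute)
  from grid_cells_upper[OF b _ k0 this, of p]
  have "ennreal ((1/2) ^ card W) * H Q \<le> of_nat (card (grid_in Q p k)) * (ennreal ((1 / real k) ^ card W) * H (cell 0 1))"
    by (simp add: span_zero)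
  also have "\<dots> < top_class.top" using H_cell_finite
    by (simp add: ennreal_mult_less_top of_nat_less_top)
  finally have "H Q < top_class.top" by (auto simp: ennreal_mult_less_top)
  then show ?thesis unfolding volume_def by simp
qed

lemma grid_bounds:
  assumes b: "body p \<rho> Q" and a: "a - p \<in> span W" and k: "k > 0" "1 / real k \<le> \<epsilon> * \<rho>" and \<epsilon>: "0 < \<epsilon>" "\<epsilon> < 1"
  shows "(1 - \<epsilon>) ^ card W * volume Q \<le> real (card (grid_in Q a k)) * (1 / real k) ^ card W * cell_volume"
    and "(1 - \<epsilon>) ^ card W * (real (card (grid_in Q a k)) * (1 / real k) ^ card W * cell_volume) \<le> volume Q"
proof -
  let ?m = "card W" and ?N = "card (grid_in Q a k)"
  note c = cell_volume
  have v: "volume Q \<ge> 0" by (simp add: volume_def)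
  have "ennreal ((1 - \<epsilon>) ^ ?m * volume Q) \<le> ennreal (real ?N * ((1 / real k) ^ ?m * cell_volume))"
    using grid_cells_upper[OF assms] v c(2) \<epsilon> unfolding c(1) volume_finite[OF b]
    by (simp add: ennreal_mult ennreal_of_nat_eq_real_of_nat)
  then show "(1 - \<epsilon>) ^ ?m * volume Q \<le> real ?N * (1 / real k) ^ ?m * cell_volume"
    using c(2) by (subst (asm) ennreal_le_iff) (auto simp: mult.assoc)
  obtain L :: nat where L: "?N \<le> (2 * L * k) ^ ?m"
    "ennreal ((2 * real L) ^ ?m) * H (cell 0 1) \<le> ennreal ((1 / (1 - \<epsilon>)) ^ ?m) * H Q +
      of_nat ((2 * L * k) ^ ?m - ?N) * (ennreal ((1 / real k) ^ ?m) * H (cell 0 1))"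
    by (rule grid_cells_lower[OF assms])
  let ?e = "(1 / (1 - \<epsilon>)) ^ ?m" and ?D = "real ((2 * L * k) ^ ?m - ?N)" and ?q = "(1 / real k) ^ ?m"
  have e: "?e \<ge> 0" using \<epsilon> by simp
  have "ennreal ((2 * real L) ^ ?m * cell_volume) \<le> ennreal (?e * volume Q + ?D * (?q * cell_volume))"
    using L(2) v c(2) e unfolding c(1) volume_finite[OF b]
    by (simp add: ennreal_mult ennreal_of_nat_eq_real_of_nat)
  then have "(2 * real L) ^ ?m * cell_volume \<le> ?e * volume Q + ?D * (?q * cell_volume)"
    using v c(2) e by (subst (asm) ennreal_le_iff) auto
  also have "?D = (2 * real L * real k) ^ ?m - real ?N" using L(1) by (simp add: of_nat_diff)
  \<comment> \<open>The remaining cells are all cells of the box minus \<open>?N\<close>, so the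
    measure of the whole box cancels on both sides.\<close>
  also have "((2 * real L * real k) ^ ?m - real ?N) * (?q * cell_volume) =
    (2 * real L) ^ ?m * cell_volume - real ?N * ?q * cell_volume"
  proof -
    have "(2 * real L * real k) ^ ?m * ?q = (2 * real L) ^ ?m"
    proof -
      have "2 * real L * real k * (1 / real k) = 2 * real L" using k(1) by simp
      then show ?thesis by (metis power_mult_distrib)
    qed
    then have "(2 * real L * real k) ^ ?m * (?q * cell_volume) = (2 * real L) ^ ?m * cell_volume"
      by (metis mult.assoc)
    then show ?thesis by (simp only: left_diff_distrib mult.assoc)
  qed
  finally have le: "real ?N * ?q * cell_volume \<le> ?e * volume Q" by linarith
  have "(1 - \<epsilon>) ^ ?m * (real ?N * ?q * cell_volume) \<le> (1 - \<epsilon>) ^ ?m * (?e * volume Q)"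
    using le \<epsilon> by (intro mult_left_mono) auto
  also have "\<dots> = volume Q"
  proof -
    have "(1 - \<epsilon>) * (1 / (1 - \<epsilon>)) = 1" using \<epsilon> by simp
    then have "(1 - \<epsilon>) ^ ?m * ?e = 1" by (metis power_mult_distrib power_one)
    then show ?thesis by (simp only: mult.assoc[symmetric] mult_1_left)
  qed
  finally show "(1 - \<epsilon>) ^ ?m * (real ?N * ?q * cell_volume) \<le> volume Q" .
qed

lemma large_k:
  fixes \<delta> :: real
  assumes "\<delta> > 0"
  obtains k0 :: nat where "k0 > 0" "\<And>k. k \<ge> k0 \<Longrightarrow> 1 / real k \<le> \<delta>"
proof -
  obtain k0 :: nat where k0: "1 / \<delta> < real k0" using reals_Archimedean2 by blast
  have pos: "0 < 1 / \<delta>" using assms by simp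
  have "1 / real k \<le> \<delta>" if "k \<ge> k0" for k
  proof -
    have "1 / \<delta> \<le> real k" using k0 that by linarith
    then have "1 \<le> real k * \<delta>" using assms by (simp add: pos_divide_le_eq)
    moreover have "real k > 0" using k0 that pos by linarith
    ultimately show ?thesis by (simp add: pos_divide_le_eq mult.commute)
  qed
  moreover have "k0 > 0" using k0 pos by (cases k0) auto
  ultimately show ?thesis using that by blast
qed

text \<open>The centre \<open>p\<close> is itself a point of the grid based at \<open>p\<close>, so
  the number of grid points in \<open>Q\<close> is positive.\<close>

lemma volume_pos:
  assumes b: "body p \<rho> Q"
  shows "volume Q > 0"
proof -
  have "1/2 * \<rho> > 0" using b by (simp add: body_def)
  then obtain k :: nat where k: "k > 0" "1 / real k \<le> 1/2 * \<rho>" using large_k by (metis order_refl)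
  let ?j = "restrict (\<lambda>_. 0::int) W"
  have "grid_point p k ?j = p"
    unfolding grid_point_def comb_def by simp
  then have "?j \<in> grid_in Q p k" using body_center[OF b] by (simp add: grid_in_def)
  then have "card (grid_in Q p k) > 0"
    using finite_grid_in[OF b _ k(1), of p] by (auto simp: card_gt_0_iff span_zero)
  then have "0 < (1 - 1/2) ^ card W * (real (card (grid_in Q p k)) * (1 / real k) ^ card W * cell_volume)"
    using k(1) cell_volume(2) by simp
  also have "\<dots> \<le> volume Q" using k by (intro grid_bounds(2)[OF b]) (auto simp: span_zero)
  finally show ?thesis .
qed

section \<open>Comparison of lattice slices\<close>

definition slice :: "point set \<Rightarrow> nat \<Rightarrow> point set" where
  "slice Q k = {x \<in> Q. \<forall>i. real k * coord x i \<in> \<int>}"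

text \<open>Both sides count the pairs of a point of \<open>slice Q k\<close> and a point of \<open>slice Q' k\<close> that differ
  by a vector of the lattice spanned by \<open>W\<close> scaled by \<open>1 / k\<close>.\<close>

lemma slice_compare:
  assumes b: "body p \<rho> Q" "body p' \<rho>' Q'" and pp: "p - p' \<in> span W"
    and finS: "finite (slice Q k)" "finite (slice Q' k)"
    and k: "k > 0" "1 / real k \<le> \<epsilon> * \<rho>" "1 / real k \<le> \<epsilon> * \<rho>'" and \<epsilon>: "0 < \<epsilon>" "\<epsilon> < 1"
  shows "real (card (slice Q k)) * volume Q' * ((1 - \<epsilon>) ^ card W) ^ 2 \<le> real (card (slice Q' k)) * volume Q"
proof -
  \<comment> \<open>\<open>?t\<close> is the measure of one cell of side
    \<open>1 / k\<close>.\<close>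
  let ?m = "card W" and ?t = "(1 / real k) ^ card W * cell_volume"
  have t: "?t > 0" using k(1) cell_volume(2) by simp
  define rel where "rel = (\<lambda>x y. \<exists>j \<in> W \<rightarrow>\<^sub>E UNIV. y = grid_point x k j)"
  have sym: "rel x y \<longleftrightarrow> rel y x" for x y
  proof -
    have "rel y x" if "rel x y" for x y
    proof -
      from that obtain j where j: "y = grid_point x k j" by (auto simp: rel_def)
      have "x = grid_point y k (restrict (\<lambda>w. - j w) W)"
        unfolding j by (simp add: grid_point_def comb_def sum_negf)
      moreover have "restrict (\<lambda>w. - j w) W \<in> W \<rightarrow>\<^sub>E UNIV" by simp
      ultimately show ?thesis unfolding rel_def by (rule bexI)
    qed
    then show ?thesis by blast
  qed
  have card: "card {y \<in> slice P k. rel x y} = card (grid_in P x k)"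
    if x: "\<forall>i. real k * coord x i \<in> \<int>" for x P
  proof -
    have int: "real k * coord (grid_point x k j) i \<in> \<int>" for j i
    proof -
      have "real k * coord (grid_point x k j) i = real k * coord x i + (\<Sum>w\<in>W. of_int (j w) * coord w i)"
        using k(1) by (simp add: grid_point_def comb_def lookup_add lookup_sum distrib_left sum_distrib_left)
      moreover have "(\<Sum>w\<in>W. of_int (j w) * coord w i) \<in> \<int>"
        using WZ by (intro Ints_sum Ints_mult) (auto simp: Zn_def)
      ultimately show ?thesis using x by simp
    qed
    have "{y \<in> slice P k. rel x y} = grid_point x k ` grid_in P x k"
      unfolding slice_def rel_def grid_in_def using int by blast
    moreover have "inj_on (grid_point x k) (grid_in P x k)"
      using grid_point_inj[OF k(1)] by (rule inj_on_subset) (auto simp: grid_in_def)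
    ultimately show ?thesis by (simp add: card_image)
  qed
  have sp: "x - p' \<in> span W" if "x \<in> slice Q k" for x
  proof -
    have "x - p \<in> span W" using b(1) that by (simp add: body_def slice_def)
    then have "(x - p) + (p - p') \<in> span W" using pp by (rule span_add)
    then show ?thesis by simp
  qed
  have sp': "y - p \<in> span W" if "y \<in> slice Q' k" for y
  proof -
    have "y - p' \<in> span W" using b(2) that by (simp add: body_def slice_def)
    then have "(y - p') - (p - p') \<in> span W" using pp by (rule span_diff)
    then show ?thesis by simp
  qed
  let ?pairs = "\<Sum>x\<in>slice Q k. card {y \<in> slice Q' k. rel x y}"
  have swap: "?pairs = (\<Sum>y\<in>slice Q' k. card {x \<in> slice Q k. rel y x})"
  proof -
    have "?pairs = (\<Sum>x\<in>slice Q k. \<Sum>y\<in>slice Q' k. if rel x y then 1 else 0)"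
      using finS(2) by (intro sum.cong) (auto simp: sum.If_cases Int_def)
    also have "\<dots> = (\<Sum>y\<in>slice Q' k. \<Sum>x\<in>slice Q k. if rel x y then 1 else 0)" by (rule sum.swap)
    also have "\<dots> = (\<Sum>y\<in>slice Q' k. card {x \<in> slice Q k. rel y x})"
      using finS(1) sym by (intro sum.cong) (auto simp: sum.If_cases Int_def)
    finally show ?thesis .
  qed
  have "real (card (slice Q k)) * ((1 - \<epsilon>) ^ ?m * volume Q') = (\<Sum>x\<in>slice Q k. (1 - \<epsilon>) ^ ?m * volume Q')" by simp
  also have "\<dots> \<le> (\<Sum>x\<in>slice Q k. real (card {y \<in> slice Q' k. rel x y}) * ?t)"
  proof (rule sum_mono)
    fix x assume x: "x \<in> slice Q k"
    have "(1 - \<epsilon>) ^ ?m * volume Q' \<le> real (card (grid_in Q' x k)) * (1 / real k) ^ ?m * cell_volume"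
      using k \<epsilon> by (intro grid_bounds(1)[OF b(2) sp[OF x]])
    then show "(1 - \<epsilon>) ^ ?m * volume Q' \<le> real (card {y \<in> slice Q' k. rel x y}) * ?t"
      using card[of x Q'] x by (simp add: slice_def mult.assoc)
  qed
  also have "\<dots> = real ?pairs * ?t" by (simp add: sum_distrib_right)
  finally have 1: "real (card (slice Q k)) * ((1 - \<epsilon>) ^ ?m * volume Q') \<le> real ?pairs * ?t" .
  have "(1 - \<epsilon>) ^ ?m * (real ?pairs * ?t) = (\<Sum>y\<in>slice Q' k. (1 - \<epsilon>) ^ ?m * (real (card {x \<in> slice Q k. rel y x}) * ?t))"
    unfolding swap by (simp add: sum_distrib_right sum_distrib_left)
  also have "\<dots> \<le> (\<Sum>y\<in>slice Q' k. volume Q)"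
  proof (rule sum_mono)
    fix y assume y: "y \<in> slice Q' k"
    have "(1 - \<epsilon>) ^ ?m * (real (card (grid_in Q y k)) * (1 / real k) ^ ?m * cell_volume) \<le> volume Q"
      using k \<epsilon> by (intro grid_bounds(2)[OF b(1) sp'[OF y]])
    then show "(1 - \<epsilon>) ^ ?m * (real (card {x \<in> slice Q k. rel y x}) * ?t) \<le> volume Q"
      using card[of y Q] y by (simp add: slice_def mult.assoc)
  qed
  also have "\<dots> = real (card (slice Q' k)) * volume Q" by simp
  finally have 2: "(1 - \<epsilon>) ^ ?m * (real ?pairs * ?t) \<le> real (card (slice Q' k)) * volume Q" .
  have "(1 - \<epsilon>) ^ ?m * (real (card (slice Q k)) * ((1 - \<epsilon>) ^ ?m * volume Q')) \<le> (1 - \<epsilon>) ^ ?m * (real ?pairs * ?t)"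
    using 1 \<epsilon> by (intro mult_left_mono) auto
  also note 2
  finally show ?thesis by (simp add: power2_eq_square mult_ac)
qed

lemma lattice_points_slices:
  assumes "finite (lattice_points Q K)"
  shows "card (lattice_points Q K) = (\<Sum>k=1..K. card (slice Q k))" "k \<in> {1..K} \<Longrightarrow> finite (slice Q k)"
proof -
  have eq: "lattice_points Q K = (SIGMA k:{1..K}. slice Q k)"
    by (auto simp: lattice_points_def slice_def)
  have sub: "slice Q k \<subseteq> snd ` lattice_points Q K" if "k \<in> {1..K}" for k
  proof
    fix x assume "x \<in> slice Q k"
    then have "(k, x) \<in> lattice_points Q K" using that eq by simp
    then show "x \<in> snd ` lattice_points Q K" by force
  qed
  then show fin: "k \<in> {1..K} \<Longrightarrow> finite (slice Q k)" for k
    using assms finite_subset by blast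
  show "card (lattice_points Q K) = (\<Sum>k=1..K. card (slice Q k))"
    unfolding eq using fin by (intro card_SigmaI) auto
qed

text \<open>The slices are comparable only from some level \<open>k0\<close> on. The finitely many
  earlier levels contribute a constant, lost on division by \<open>K ^ (d + 1)\<close>; then
  \<open>\<epsilon>\<close> tends to 0.\<close>

lemma volume_limit_le:
  assumes b: "body p \<rho> Q" "body p' \<rho>' Q'" and pp: "p - p' \<in> span W"
    and finL: "\<And>K. finite (lattice_points Q K)" "\<And>K. finite (lattice_points Q' K)"
    and lim: "(\<lambda>K. real (card (lattice_points Q K)) / real K ^ Suc d) \<longlonglongrightarrow> l"
      "(\<lambda>K. real (card (lattice_points Q' K)) / real K ^ Suc d) \<longlonglongrightarrow> l'"
  shows "l * volume Q' \<le> l' * volume Q"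
proof -
  let ?N = "\<lambda>Q K. real (card (lattice_points Q K))"
  have v: "volume Q > 0" "volume Q' > 0" using volume_pos b by blast+
  have \<rho>: "\<rho> > 0" "\<rho>' > 0" using b by (auto simp: body_def)
  have \<epsilon>: "l * (volume Q' * ((1 - \<epsilon>) ^ card W) ^ 2) \<le> l' * volume Q" if \<epsilon>: "0 < \<epsilon>" "\<epsilon> < 1" for \<epsilon>
  proof -
    let ?u = "volume Q' * ((1 - \<epsilon>) ^ card W) ^ 2"
    have u: "?u \<ge> 0" using v by simp
    have "\<epsilon> * min \<rho> \<rho>' > 0" using \<epsilon> \<rho> by simp
    then obtain k0 :: nat where k0: "k0 > 0" "\<And>k. k \<ge> k0 \<Longrightarrow> 1 / real k \<le> \<epsilon> * min \<rho> \<rho>'"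
      using large_k by blast
    have step: "real (card (slice Q k)) * ?u \<le> real (card (slice Q' k)) * volume Q" if k: "k \<ge> k0" for k
    proof -
      have kpos: "k > 0" using k k0(1) by linarith
      have "\<epsilon> * min \<rho> \<rho>' \<le> \<epsilon> * \<rho>" "\<epsilon> * min \<rho> \<rho>' \<le> \<epsilon> * \<rho>'" using \<epsilon> by (auto intro: mult_left_mono)
      then have "1 / real k \<le> \<epsilon> * \<rho>" "1 / real k \<le> \<epsilon> * \<rho>'" using k0(2)[OF k] by linarith+
      moreover have "finite (slice Q k)" "finite (slice Q' k)"
        using lattice_points_slices(2)[OF finL(1), of k k] lattice_points_slices(2)[OF finL(2), of k k] kpos by auto
      ultimately show ?thesis
        using slice_compare[OF b pp _ _ kpos _ _ \<epsilon>] by (simp add: mult.assoc)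
    qed
    have bound: "?N Q K * ?u \<le> ?N Q k0 * ?u + ?N Q' K * volume Q" for K
    proof (cases "K \<le> k0")
      case True
      have "lattice_points Q K \<subseteq> lattice_points Q k0" using True by (auto simp: lattice_points_def)
      then have "?N Q K \<le> ?N Q k0" using finL(1) by (simp add: card_mono)
      then have "?N Q K * ?u \<le> ?N Q k0 * ?u" using u by (rule mult_right_mono)
      moreover have "0 \<le> ?N Q' K * volume Q" using v by simp
      ultimately show ?thesis by linarith
    next
      case False
      have split: "{1..K} = {1..k0} \<union> {Suc k0..K}" "{1..k0} \<inter> {Suc k0..K} = {}" using False by auto
      have "?N Q K = ?N Q k0 + (\<Sum>k=Suc k0..K. real (card (slice Q k)))"
        unfolding lattice_points_slices(1)[OF finL(1)] of_nat_sum split(1)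
        by (rule sum.union_disjoint) (use split(2) in auto)
      then have "?N Q K * ?u = ?N Q k0 * ?u + (\<Sum>k=Suc k0..K. real (card (slice Q k)) * ?u)"
        by (simp only: distrib_right sum_distrib_right)
      also have "(\<Sum>k=Suc k0..K. real (card (slice Q k)) * ?u) \<le> (\<Sum>k=Suc k0..K. real (card (slice Q' k)) * volume Q)"
        using step by (intro sum_mono) auto
      also have "\<dots> \<le> (\<Sum>k=1..K. real (card (slice Q' k)) * volume Q)"
        using v by (intro sum_mono2) auto
      also have "\<dots> = ?N Q' K * volume Q"
        unfolding lattice_points_slices(1)[OF finL(2)] by (simp add: sum_distrib_right)
      finally show ?thesis by simp
    qed
    have "(\<lambda>K. ?N Q K / real K ^ Suc d * ?u) \<longlonglongrightarrow> l * ?u" by (intro tendsto_intros lim)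
    moreover have "(\<lambda>K. ?N Q k0 * ?u * (1 / real K) ^ Suc d + ?N Q' K / real K ^ Suc d * volume Q)
      \<longlonglongrightarrow> ?N Q k0 * ?u * 0 ^ Suc d + l' * volume Q"
      by (intro tendsto_intros lim lim_1_over_n)
    moreover have "?N Q K / real K ^ Suc d * ?u \<le> ?N Q k0 * ?u * (1 / real K) ^ Suc d + ?N Q' K / real K ^ Suc d * volume Q" for K
    proof -
      have "?N Q K * ?u / real K ^ Suc d \<le> (?N Q k0 * ?u + ?N Q' K * volume Q) / real K ^ Suc d"
        using bound[of K] by (rule divide_right_mono) simp
      then show ?thesis by (simp add: add_divide_distrib power_divide)
    qed
    ultimately have "l * ?u \<le> ?N Q k0 * ?u * 0 ^ Suc d + l' * volume Q"
      by (intro LIMSEQ_le) auto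
    then show ?thesis by simp
  qed
  \<comment> \<open>The values \<open>1 / (i + 2)\<close> of \<open>\<epsilon>\<close> lie strictly
    between 0 and 1 for every \<open>i\<close>.\<close>
  have "(\<lambda>i. l * (volume Q' * ((1 - inverse (real (Suc (Suc i)))) ^ card W) ^ 2)) \<longlonglongrightarrow> l * (volume Q' * ((1 - 0) ^ card W) ^ 2)"
    by (intro tendsto_intros LIMSEQ_Suc[OF LIMSEQ_inverse_real_of_nat])
  then have "l * (volume Q' * ((1 - 0) ^ card W) ^ 2) \<le> l' * volume Q"
    by (rule LIMSEQ_le_const2) (intro exI allI impI \<epsilon>; simp add: inverse_less_1_iff)
  then show ?thesis by simp
qed

section \<open>Simplexes as bodies of a lattice frame\<close>

lemma simplex_body:
  assumes V: "finite V" "V \<noteq> {}" and dir: "directions V = span W"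
  obtains p \<rho> where "body p \<rho> (convex hull V)"
proof -
  let ?N = "real (card V)"
  have N: "?N > 0" using V by (simp add: card_gt_0_iff)
  define p where "p = (\<Sum>v\<in>V. (1 / ?N) *\<^sub>R v)"
  have one: "(\<Sum>v\<in>V. 1 / ?N) = 1" using N by simp
  have p: "p \<in> convex hull V"
    by (rule convex_hull_finiteI[where u = "\<lambda>_. 1 / ?N"]) (use V one in \<open>auto simp: p_def\<close>)
  have "\<forall>w\<in>W. \<exists>c. sum c V = 0 \<and> w = (\<Sum>v\<in>V. c v *\<^sub>R v)"
    using dir span_superset[of W] unfolding directions_def by blast
  then obtain c where c: "\<And>w. w \<in> W \<Longrightarrow> sum (c w) V = 0" "\<And>w. w \<in> W \<Longrightarrow> w = (\<Sum>v\<in>V. c w v *\<^sub>R v)"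
    by metis
  define S where "S = (\<Sum>v\<in>V. \<Sum>w\<in>W. \<bar>c w v\<bar>)"
  have S: "S \<ge> 0" unfolding S_def by (intro sum_nonneg) auto
  define \<rho> where "\<rho> = 1 / (?N * (1 + S))"
  have \<rho>: "\<rho> > 0" using N S by (simp add: \<rho>_def)
  have move: "p + comb s \<in> convex hull V" if s: "\<forall>w\<in>W. \<bar>s w\<bar> \<le> \<rho>" for s
  proof (rule convex_hull_finiteI[OF V(1), where u = "\<lambda>v. 1 / ?N + (\<Sum>w\<in>W. s w * c w v)"])
    have "comb s = (\<Sum>w\<in>W. \<Sum>v\<in>V. (s w * c w v) *\<^sub>R v)"
      unfolding comb_def
    proof (rule sum.cong[OF refl])
      fix w assume "w \<in> W"
      then have "s w *\<^sub>R w = s w *\<^sub>R (\<Sum>v\<in>V. c w v *\<^sub>R v)" using c(2) by metis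
      then show "s w *\<^sub>R w = (\<Sum>v\<in>V. (s w * c w v) *\<^sub>R v)" by (simp add: scaleR_sum_right)
    qed
    also have "\<dots> = (\<Sum>v\<in>V. (\<Sum>w\<in>W. s w * c w v) *\<^sub>R v)"
      by (subst sum.swap) (simp add: scaleR_sum_left)
    finally show "p + comb s = (\<Sum>v\<in>V. (1 / ?N + (\<Sum>w\<in>W. s w * c w v)) *\<^sub>R v)"
      by (simp add: p_def scaleR_add_left sum.distrib)
    have "(\<Sum>v\<in>V. \<Sum>w\<in>W. s w * c w v) = (\<Sum>w\<in>W. s w * sum (c w) V)"
      by (subst sum.swap) (simp add: sum_distrib_left)
    also have "\<dots> = 0" using c(1) by simp
    finally show "(\<Sum>v\<in>V. 1 / ?N + (\<Sum>w\<in>W. s w * c w v)) = 1" using one by (simp add: sum.distrib)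
    fix v assume v: "v \<in> V"
    have "\<bar>\<Sum>w\<in>W. s w * c w v\<bar> \<le> (\<Sum>w\<in>W. \<bar>s w * c w v\<bar>)" by (rule sum_abs)
    also have "\<dots> \<le> (\<Sum>w\<in>W. \<rho> * \<bar>c w v\<bar>)" using s by (intro sum_mono) (simp add: abs_mult mult_right_mono)
    also have "\<dots> = \<rho> * (\<Sum>w\<in>W. \<bar>c w v\<bar>)" by (simp add: sum_distrib_left)
    also have "\<dots> \<le> \<rho> * (1 + S)"
    proof (rule mult_left_mono)
      have "(\<Sum>w\<in>W. \<bar>c w v\<bar>) \<le> S" unfolding S_def using V(1) v by (intro member_le_sum) (auto intro: sum_nonneg)
      then show "(\<Sum>w\<in>W. \<bar>c w v\<bar>) \<le> 1 + S" by simp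
    qed (use \<rho> in simp)
    also have "\<dots> = 1 / ?N" using S by (simp add: \<rho>_def)
    finally show "0 \<le> 1 / ?N + (\<Sum>w\<in>W. s w * c w v)" by linarith
  qed
  have "\<bar>f w (x - p)\<bar> \<le> (\<Sum>w\<in>W. \<Sum>v\<in>V. \<bar>f w (v - p)\<bar>)" if x: "x \<in> convex hull V" and w: "w \<in> W" for x w
  proof -
    obtain u where u: "\<And>v. v \<in> V \<Longrightarrow> 0 \<le> u v" "sum u V = 1" "x = (\<Sum>v\<in>V. u v *\<^sub>R v)"
      using x V(1) by (rule convex_hull_finiteE) blast
    have "x - p = (\<Sum>v\<in>V. u v *\<^sub>R (v - p))"
      unfolding u(3) using u(2) by (simp add: scaleR_diff_right sum_subtractf flip: scaleR_sum_left)
    then have "f w (x - p) = (\<Sum>v\<in>V. u v * f w (v - p))"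
      using lin[OF w] by (simp add: linear_sum linear_scale)
    then have "\<bar>f w (x - p)\<bar> \<le> (\<Sum>v\<in>V. \<bar>u v * f w (v - p)\<bar>)" by simp
    also have "\<dots> \<le> (\<Sum>v\<in>V. \<bar>f w (v - p)\<bar>)"
    proof (rule sum_mono)
      fix v assume v: "v \<in> V"
      have "u v \<le> 1" using member_le_sum[OF v, of u] u V(1) by auto
      then have "u v * \<bar>f w (v - p)\<bar> \<le> 1 * \<bar>f w (v - p)\<bar>" by (rule mult_right_mono) simp
      then show "\<bar>u v * f w (v - p)\<bar> \<le> \<bar>f w (v - p)\<bar>" using u(1)[OF v] by (simp add: abs_mult)
    qed
    also have "\<dots> \<le> (\<Sum>w\<in>W. \<Sum>v\<in>V. \<bar>f w (v - p)\<bar>)"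
      using fin w by (intro member_le_sum) (auto intro: sum_nonneg)
    finally show ?thesis .
  qed
  then have "body p \<rho> (convex hull V)"
    unfolding body_def using \<rho> move diff_in_directions[OF _ p V(1)] dir by auto
  then show ?thesis by (rule that)
qed

end

text \<open>The edge vectors at one vertex, multiplied by a common denominator of all vertices, are
  independent integer vectors.\<close>

lemma lattice_frame_exists:
  assumes Q: "rational_simplex n m Q"
  obtains W f where "lattice_frame n W f" "card W = m" "span W = directions (vertices Q)"
proof -
  let ?V = "vertices Q"
  have V: "?V \<subseteq> Qn n" "finite ?V" "card ?V = Suc m" "\<not> affine_dependent ?V"
    using Q by (auto simp: rational_simplex_iff)
  then obtain a where a: "a \<in> ?V" by (metis card.empty ex_in_conv nat.simps(3))
  obtain D :: nat where D: "D > 0" "\<And>v i. v \<in> ?V \<Longrightarrow> real D * coord v i \<in> \<int>"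
    using common_denominator_Qn[OF V(2,1)] by blast
  let ?W0 = "(\<lambda>v. - a + v) ` (?V - {a})"
  define W where "W = (\<lambda>x. real D *\<^sub>R x) ` ?W0"
  have inj: "inj (\<lambda>x::point. real D *\<^sub>R x)" using D(1) by (auto simp: inj_def)
  have fin: "finite W" using V(2) by (simp add: W_def)
  have "?V \<subseteq> Rn n" using V(1) Qn_subset_Rn by blast
  then have WR: "W \<subseteq> Rn n" using a unfolding W_def by (auto intro!: Rn_scaleR Rn_diff)
  have WZ: "W \<subseteq> Zn n"
  proof
    fix w assume w: "w \<in> W"
    then obtain v where v: "v \<in> ?V" "w = real D *\<^sub>R (- a + v)" by (auto simp: W_def)
    have "coord w i \<in> \<int>" for i
    proof -
      have "coord w i = real D * coord v i - real D * coord a i"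
        unfolding v(2) by (simp add: lookup_add lookup_minus algebra_simps)
      then show ?thesis using D(2)[OF v(1)] D(2)[OF a] by simp
    qed
    then show "w \<in> Zn n" using WR w by (auto simp: Zn_def)
  qed
  have "independent ?W0" using V(4) a affine_dependent_iff_dependent2 by blast
  then have ind: "independent W"
    unfolding W_def
  proof (rule linear_independent_injective_image[rotated])
    show "linear (\<lambda>x::point. real D *\<^sub>R x)" by (rule linearI) (simp_all add: scaleR_add_right)
    show "inj_on (\<lambda>x. real D *\<^sub>R x) (span ?W0)" using inj by (rule inj_on_subset) simp
  qed
  have "W \<subseteq> Qn n" using WZ Zn_subset_Qn by blast
  then obtain f where f: "\<forall>w\<in>W. rational_form n (f w)" "\<forall>v\<in>W. \<forall>w\<in>W. f v w = (if w = v then 1 else 0)"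
    using rational_dual_forms[OF fin _ ind, of n] by blast
  have "lattice_frame n W f"
  proof (rule lattice_frame.intro[OF fin WZ])
    fix v w assume v: "v \<in> W"
    then show "linear (f v)" using f(1) by (simp add: rational_form_def)
    assume "w \<in> W"
    then show "f v w = (if w = v then 1 else 0)" using f(2) v by blast
  qed
  moreover have "card W = m"
    unfolding W_def using card_image[OF inj_on_subset[OF inj]] card_diff_image[OF V(2) a] V(3) by simp
  moreover have "span W = directions ?V"
  proof -
    have "real D *\<^sub>R x \<in> span ?W0" if "x \<in> ?W0" for x using that by (intro span_scale span_base)
    then have "span W \<subseteq> span ?W0" unfolding W_def by (intro span_minimal subspace_span) blast
    moreover have "?W0 \<subseteq> span W"
    proof
      fix x assume "x \<in> ?W0"
      then have "(1 / real D) *\<^sub>R (real D *\<^sub>R x) \<in> span W" unfolding W_def by (intro span_scale span_base imageI)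
      then show "x \<in> span W" using D(1) by simp
    qed
    then have "span ?W0 \<subseteq> span W" by (simp add: span_minimal)
    ultimately show ?thesis using directions_eq_span[OF V(2) a] by simp
  qed
  ultimately show ?thesis by (rule that)
qed

section \<open>Proportionality\<close>

lemma directions_affine_hull:
  fixes V :: "'a::real_vector set"
  assumes "finite V" "x \<in> affine hull V" "y \<in> affine hull V"
  shows "x - y \<in> directions V"
proof -
  obtain u where u: "sum u V = 1" "x = (\<Sum>v\<in>V. u v *\<^sub>R v)" using assms by (auto simp: affine_hull_finite)
  obtain w where w: "sum w V = 1" "y = (\<Sum>v\<in>V. w v *\<^sub>R v)" using assms by (auto simp: affine_hull_finite)
  show ?thesis
    unfolding directions_def using u w
    by (intro CollectI exI[where x = "\<lambda>v. u v - w v"]) (simp add: sum_subtractf scaleR_diff_left)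
qed

lemma simplex_directions_eq:
  assumes A: "affine_dim_eq m A" and Q: "simplex_in n m Q" "Q \<subseteq> A"
  obtains U where "finite U" "A = affine hull U" "directions (vertices Q) = directions U"
proof -
  obtain U where U: "finite U" "card U = Suc m" "\<not> affine_dependent U" "affine hull U = A"
    using A by (auto simp: affine_dim_eq_def)
  let ?V = "vertices Q"
  have V: "finite ?V" "\<not> affine_dependent ?V" "Q = convex hull ?V" "card ?V = Suc m"
    using Q(1) by (auto simp: simplex_in_iff)
  then obtain a where a: "a \<in> ?V" by (metis card.empty ex_in_conv nat.simps(3))
  have VA: "?V \<subseteq> affine hull U"
  proof
    fix v assume "v \<in> ?V"
    then have "v \<in> convex hull ?V" by (rule hull_inc)
    then show "v \<in> affine hull U" using V(3) Q(2) U(4) by blast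
  qed
  have "directions ?V \<subseteq> directions U"
    unfolding directions_eq_span[OF V(1) a]
  proof (intro span_minimal subspace_directions subsetI)
    fix x assume "x \<in> (\<lambda>v. - a + v) ` (?V - {a})"
    then obtain v where "v \<in> ?V" "x = v - a" by auto
    then show "x \<in> directions U" using directions_affine_hull[OF U(1)] VA a by blast
  qed
  moreover have "U \<noteq> {}" using U(2) by auto
  ultimately have "directions ?V = directions U"
    using directions_eqI[OF V(1,2) U(1)] U(2) V(4) by simp
  then show ?thesis using that U by blast
qed

lemma rational_measure_simplex_compare:
  assumes A: "affine_dim_eq m A" and Q: "rational_simplex n m Q" "Q \<subseteq> A" "rational_simplex n m Q'" "Q' \<subseteq> A"
  shows "rational_measure n m Q * enn2real (hausdorff_measure m Q') = rational_measure n m Q' * enn2real (hausdorff_measure m Q)"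
    and "hausdorff_measure m Q = ennreal (enn2real (hausdorff_measure m Q))" "enn2real (hausdorff_measure m Q) > 0"
proof -
  have S: "simplex_in n m Q" "simplex_in n m Q'" using Q rational_imp_simplex by blast+
  obtain W f where W: "lattice_frame n W f" "card W = m" "span W = directions (vertices Q)"
    using lattice_frame_exists[OF Q(1)] by blast
  interpret lattice_frame n W f by (rule W(1))
  obtain U where U: "finite U" "A = affine hull U" "directions (vertices Q) = directions U"
    using simplex_directions_eq[OF A S(1) Q(2)] by blast
  obtain U' where U': "finite U'" "A = affine hull U'" "directions (vertices Q') = directions U'"
    using simplex_directions_eq[OF A S(2) Q(4)] by blast
  \<comment> \<open>The direction space depends only on the affine hull, so \<open>Q\<close> and
    \<open>Q'\<close> share the frame \<open>W\<close>.\<close>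
  have eqU: "directions U = {x - y | x y. x \<in> affine hull U \<and> y \<in> affine hull U}" if "finite U" "U \<noteq> {}" for U :: "point set"
  proof (intro equalityI subsetI)
    fix x assume "x \<in> directions U"
    then obtain c where c: "sum c U = 0" "x = (\<Sum>v\<in>U. c v *\<^sub>R v)" by (auto simp: directions_def)
    obtain a where a: "a \<in> U" using \<open>U \<noteq> {}\<close> by blast
    define g where "g = (\<lambda>v. c v + (if v = a then 1 else 0))"
    have "sum g U = 1" using c(1) a \<open>finite U\<close> by (simp add: g_def sum.distrib)
    moreover have "(\<Sum>v\<in>U. g v *\<^sub>R v) = x + a"
    proof -
      have "(\<Sum>v\<in>U. g v *\<^sub>R v) = x + (\<Sum>v\<in>U. (if v = a then 1 else 0) *\<^sub>R v)"
        unfolding c(2) by (simp add: g_def scaleR_add_left sum.distrib)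
      also have "(\<Sum>v\<in>U. (if v = a then 1 else 0) *\<^sub>R v) = (\<Sum>v\<in>U. if v = a then v else 0)"
        by (intro sum.cong) auto
      finally show ?thesis using a \<open>finite U\<close> by simp
    qed
    ultimately have "x + a \<in> affine hull U" unfolding affine_hull_finite[OF \<open>finite U\<close>] by blast
    moreover have "a \<in> affine hull U" using a by (rule hull_inc)
    ultimately show "x \<in> {x - y | x y. x \<in> affine hull U \<and> y \<in> affine hull U}"
      by (intro CollectI exI[where x = "x + a"] exI[where x = a]) simp
  next
    fix x assume "x \<in> {x - y | x y. x \<in> affine hull U \<and> y \<in> affine hull U}"
    then show "x \<in> directions U" using directions_affine_hull[OF \<open>finite U\<close>] by blast
  qed
  have V: "finite (vertices Q)" "vertices Q \<noteq> {}" "convex hull (vertices Q) = Q"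
    and V': "finite (vertices Q')" "vertices Q' \<noteq> {}" "convex hull (vertices Q') = Q'"
    using S by (auto simp: simplex_in_iff)
  have "Q \<noteq> {}" using V by (metis convex_hull_eq_empty)
  then have "U \<noteq> {}" "U' \<noteq> {}" using Q(2) U(2) U'(2) by auto
  then have dir: "directions (vertices Q') = span W" using eqU[of U] eqU[of U'] U U' W(3) by simp
  obtain p \<rho> where b: "body p \<rho> Q" using simplex_body[OF V(1,2)] V(3) W(3) by metis
  obtain p' \<rho>' where b': "body p' \<rho>' Q'" using simplex_body[OF V'(1,2) dir] V'(3) by metis
  have "p \<in> A" "p' \<in> A" using body_center b b' Q by blast+
  then have pp: "p - p' \<in> span W" "p' - p \<in> span W"
    using directions_affine_hull[OF U(1)] U(2,3) W(3) by auto
  note L = rational_measure_limit_dim[OF rational_simplex_polyhedron[OF Q(1)] simplex_dim_at_most[OF S(1)]]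
  note L' = rational_measure_limit_dim[OF rational_simplex_polyhedron[OF Q(3)] simplex_dim_at_most[OF S(2)]]
  have "rational_measure n m Q / real (Suc m) * volume Q' \<le> rational_measure n m Q' / real (Suc m) * volume Q"
    by (rule volume_limit_le[OF b b' pp(1) L(1) L'(1) L(2) L'(2)])
  moreover have "rational_measure n m Q' / real (Suc m) * volume Q \<le> rational_measure n m Q / real (Suc m) * volume Q'"
    by (rule volume_limit_le[OF b' b pp(2) L'(1) L(1) L'(2) L(2)])
  ultimately have "rational_measure n m Q / real (Suc m) * volume Q' = rational_measure n m Q' / real (Suc m) * volume Q"
    by (rule antisym)
  then show "rational_measure n m Q * enn2real (hausdorff_measure m Q') = rational_measure n m Q' * enn2real (hausdorff_measure m Q)"
    by (simp add: volume_def W(2) del: of_nat_Suc)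
  show "hausdorff_measure m Q = ennreal (enn2real (hausdorff_measure m Q))" "enn2real (hausdorff_measure m Q) > 0"
    using volume_finite[OF b] volume_pos[OF b] by (simp_all add: volume_def W(2))
qed

text \<open>By \<open>tangent_cover\<close> some simplex of the triangulation has all directions of
  \<open>Q\<close>, so at least one positive term occurs.\<close>

lemma rational_measure_simplex_pos:
  assumes Q: "rational_simplex n m Q"
  shows "rational_measure n m Q > 0"
proof -
  have S: "simplex_in n m Q" using Q by (rule rational_imp_simplex)
  have P: "Q \<in> rational_polyhedra n" using Q by (rule rational_simplex_polyhedron)
  obtain \<Delta> where \<Delta>: "regular_triangulates n \<Delta> Q" using regular_triangulation_exists[OF P] .
  note D = regular_triangulatesD[OF \<Delta>] and C = complexD[OF regular_triangulatesD(1)[OF \<Delta>]]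
  have le: "\<forall>T\<in>\<Delta>. card (vertices T) \<le> Suc m" using dim_at_most_iff[OF D(3)] simplex_dim_at_most[OF S] by blast
  have top: "maximal_simplexes n \<Delta> m = {T\<in>\<Delta>. card (vertices T) = Suc m}" by (rule maximal_simplexes_top[OF D(1) le])
  have V: "finite (vertices Q)" "vertices Q \<noteq> {}" "convex hull (vertices Q) = Q" "\<not> affine_dependent (vertices Q)"
    "card (vertices Q) = Suc m"
    using S by (auto simp: simplex_in_iff)
  obtain x where x: "x \<in> open_simplex (vertices Q)" using open_simplex_nonempty[OF V(1,2)] by auto
  have "convex hull (vertices Q) \<subseteq> \<Union>\<Delta>" using V(3) D(2) by simp
  then obtain T where T: "T \<in> \<Delta>" "directions (vertices Q) \<subseteq> directions (vertices T)"
    using tangent_cover[OF V(1) x, of \<Delta>] C by blast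
  have "card (vertices Q) \<le> card (vertices T)"
    by (rule card_le_of_directions[OF V(1,4) C(3,6)[OF T(1)] T(2)])
  then have ne: "T \<in> maximal_simplexes n \<Delta> m" using le T(1) V(5) top by (simp add: le_antisym)
  have "0 < 1 / (fact m * real (den_simplex T))" if "T \<in> \<Delta>" for T
  proof -
    have "vertices T \<subseteq> Qn n" using D(4) that by (auto simp: regular_simplex_iff regular_vertices_def)
    then have "den_simplex T > 0"
      unfolding den_simplex_def vertices_def[symmetric] using den_works(1) by (intro prod_pos) blast
    then show ?thesis by simp
  qed
  then show ?thesis
    unfolding rational_measure_eq[OF \<Delta> P] using C(1) ne
    by (intro sum_pos) (auto simp: maximal_simplexes_def)
qed

text \<open>One reference simplex fixes the constant; the comparison of any two simplexes of
  \<open>A\<close> does the rest.\<close>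

lemma rational_measure_proportionality: "proportionality rational_measure"
  unfolding proportionality_def
proof (intro allI impI, elim conjE)
  fix n m A assume A: "affine_dim_eq m A"
  show "\<exists>\<kappa>>0. \<forall>Q. rational_simplex n m Q \<and> Q \<subseteq> A \<longrightarrow>
    ennreal (rational_measure n m Q) = ennreal \<kappa> * hausdorff_measure m Q"
  proof (cases "\<exists>Q. rational_simplex n m Q \<and> Q \<subseteq> A")
    case True
    then obtain Q0 where Q0: "rational_simplex n m Q0" "Q0 \<subseteq> A" by blast
    let ?h = "\<lambda>Q. enn2real (hausdorff_measure m Q)"
    define \<kappa> where "\<kappa> = rational_measure n m Q0 / ?h Q0"
    note C = rational_measure_simplex_compare[OF A]
    have h0: "?h Q0 > 0" by (rule C(3)[OF Q0 Q0])
    have \<kappa>: "\<kappa> > 0" using rational_measure_simplex_pos[OF Q0(1)] h0 by (simp add: \<kappa>_def)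
    have "ennreal (rational_measure n m Q) = ennreal \<kappa> * hausdorff_measure m Q"
      if Q: "rational_simplex n m Q" "Q \<subseteq> A" for Q
    proof -
      have "rational_measure n m Q = \<kappa> * ?h Q"
        using C(1)[OF Q Q0] h0 by (simp add: \<kappa>_def field_simps)
      then have "ennreal (rational_measure n m Q) = ennreal \<kappa> * ennreal (?h Q)"
        using \<kappa> by (simp add: ennreal_mult)
      then show ?thesis using C(2)[OF Q Q] by simp
    qed
    then show ?thesis using \<kappa> by blast
  next
    \<comment> \<open>Without rational \<open>m\<close>-simplexes in \<open>A\<close> any positive
      constant serves.\<close>
    case False
    then show ?thesis by (intro exI[where x = 1]) auto
  qed
qed

section \<open>Uniqueness\<close>

lemma valuation_lower_dim:
  assumes \<mu>: "valuation \<mu>" "n \<ge> 1" "d \<le> n" and R: "R \<in> rational_polyhedra n" "triangulates n \<Delta> R"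
    and card: "\<And>T. T \<in> \<Delta> \<Longrightarrow> card (vertices T) \<noteq> Suc d"
  shows "\<mu> n d R = 0"
proof -
  have "maximal_simplexes n \<Delta> d = {}" using card by (auto simp: maximal_simplexes_def simplex_in_iff)
  then have "dim_part n d R = {}" using dim_part_eq[OF R(2)] by simp
  moreover have "\<mu> n d R = \<mu> n d (dim_part n d R)" "\<mu> n d {} = 0"
    using \<mu> R(1) unfolding valuation_def by blast+
  ultimately show ?thesis by simp
qed

lemma complex_face_card:
  assumes \<Delta>: "simplicial_complex_in n \<Delta>" "S \<in> \<Delta>" "T \<in> \<Delta>" "S \<subseteq> T"
  shows "card (vertices S) \<le> card (vertices T)"
proof -
  have "S face_of T" using complexD(10)[OF \<Delta>(1-3)] \<Delta>(4) by (simp add: Int_absorb2)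
  then have "vertices S \<subseteq> vertices T" using extreme_point_of_face by (auto simp: vertices_def)
  then show ?thesis using complexD(3)[OF \<Delta>(1,3)] by (rule card_mono[rotated])
qed

text \<open>Simplexes are added one at a time. What a new one shares with the earlier ones contains
  no \<open>d\<close>-simplex of the complex, so it has the value 0 and drops out of the valuation
  identity.\<close>

lemma valuation_complex_sum:
  assumes \<mu>: "valuation \<mu>" "n \<ge> 1" "d \<le> n"
    and \<Delta>: "simplicial_complex_in n \<Delta>" "\<forall>T\<in>\<Delta>. \<exists>m. regular_simplex n m T" "\<forall>T\<in>\<Delta>. card (vertices T) \<le> Suc d"
    and \<T>: "\<T> \<subseteq> \<Delta>"
  shows "\<mu> n d (\<Union>\<T>) = (\<Sum>T | T \<in> \<T> \<and> card (vertices T) = Suc d. \<mu> n d T)"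
proof -
  have "finite \<T>" using \<T> complexD(1)[OF \<Delta>(1)] by (rule finite_subset)
  then show ?thesis using \<T>
  proof (induction \<T> rule: finite_induct)
    case empty
    have "\<mu> n d {} = 0" using \<mu> unfolding valuation_def by blast
    then show ?case by simp
  next
    case (insert T \<T>)
    note D = complexD[OF \<Delta>(1)]
    have T: "T \<in> \<Delta>" and sub: "\<T> \<subseteq> \<Delta>" using insert.prems by auto
    have poly: "\<Union>\<S> \<in> rational_polyhedra n" if "\<S> \<subseteq> \<Delta>" for \<S>
      using that \<Delta>(2) D(1) finite_subset by (intro Union_regular_in_rational_polyhedra) auto
    have PT: "T \<in> rational_polyhedra n" using poly[of "{T}"] T by simp
    have PU: "\<Union>\<T> \<in> rational_polyhedra n" using poly[OF sub] .
    have "dim_at_most n d (\<Union>\<Delta>)" using dim_at_most_iff[of n \<Delta> "\<Union>\<Delta>"] \<Delta> by (simp add: triangulates_def)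
    then have dim: "dim_at_most n d T" "dim_at_most n d (\<Union>\<T>)"
      using T sub by (auto elim!: dim_at_most_mono)
    let ?I = "T \<inter> \<Union>\<T>"
    have PI: "?I \<in> rational_polyhedra n" by (rule rational_polyhedra_Int(1)[OF PT PU])
    have val: "\<mu> n d T + \<mu> n d (\<Union>\<T>) = \<mu> n d (T \<union> \<Union>\<T>) + \<mu> n d ?I"
      using \<mu> PT PU dim unfolding valuation_def by blast
    let ?\<Delta> = "{F\<in>\<Delta>. F \<subseteq> ?I}"
    have "x \<in> \<Union>?\<Delta>" if x: "x \<in> ?I" for x
    proof -
      obtain T' where T': "T' \<in> \<T>" "x \<in> T'" using x by blast
      have "T \<inter> T' \<in> \<Delta>" using D(8)[OF T D(9)[OF T]] T' sub x by blast
      then show ?thesis using T' x by blast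
    qed
    then have "\<Union>?\<Delta> = ?I" by blast
    then have tri: "triangulates n ?\<Delta> ?I"
      unfolding triangulates_def by (intro conjI subcomplex[OF \<Delta>(1)])
    \<comment> \<open>A face with \<open>d + 1\<close> vertices in the intersection equals
      \<open>T\<close>; a relative interior point places it in an earlier \<open>T'\<close>, which
      then equals \<open>T\<close> as well.\<close>
    have small: "card (vertices F) \<noteq> Suc d" if F: "F \<in> ?\<Delta>" for F
    proof
      assume c: "card (vertices F) = Suc d"
      have F\<Delta>: "F \<in> \<Delta>" "F \<subseteq> T" using F by auto
      have FT: "F = T" using complex_face_eq[OF \<Delta>(1) F\<Delta>(1) T F\<Delta>(2)] \<Delta>(3) T c by simp
      obtain x where x: "x \<in> open_simplex (vertices F)" using open_simplex_nonempty[OF D(3,6)] F\<Delta>(1) by auto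
      then have "x \<in> F" using open_simplex_subset[OF D(3)] D(5) F\<Delta>(1) by blast
      then obtain T' where T': "T' \<in> \<T>" "x \<in> T'" using F by blast
      have T'\<Delta>: "T' \<in> \<Delta>" using T' sub by blast
      have "F \<subseteq> T'" by (rule complex_subset_of_open_simplex[OF \<Delta>(1) F\<Delta>(1) T'\<Delta> x T'(2)])
      then have "F = T'" using complex_face_eq[OF \<Delta>(1) F\<Delta>(1) T'\<Delta>] \<Delta>(3) T'\<Delta> c by simp
      then show False using FT T'(1) insert.hyps(2) by simp
    qed
    have "\<mu> n d ?I = 0" by (rule valuation_lower_dim[OF \<mu> PI tri small])
    then have eq: "\<mu> n d (\<Union>(insert T \<T>)) = \<mu> n d T + \<mu> n d (\<Union>\<T>)" using val by simp
    have IH: "\<mu> n d (\<Union>\<T>) = (\<Sum>T | T \<in> \<T> \<and> card (vertices T) = Suc d. \<mu> n d T)" using insert.IH sub .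
    show ?case
    proof (cases "card (vertices T) = Suc d")
      case True
      then have "{S. S \<in> insert T \<T> \<and> card (vertices S) = Suc d} = insert T {S. S \<in> \<T> \<and> card (vertices S) = Suc d}" by auto
      then show ?thesis using eq IH insert.hyps by simp
    next
      case False
      then have set: "{S. S \<in> insert T \<T> \<and> card (vertices S) = Suc d} = {S. S \<in> \<T> \<and> card (vertices S) = Suc d}" by auto
      have tT: "triangulates n {F\<in>\<Delta>. F \<subseteq> T} T" using subcomplex[OF \<Delta>(1)] T by (auto simp: triangulates_def)
      have "card (vertices F) \<noteq> Suc d" if "F \<in> {F\<in>\<Delta>. F \<subseteq> T}" for F
        using complex_face_card[OF \<Delta>(1) _ T, of F] that \<Delta>(3) T False by fastforce
      then have "\<mu> n d T = 0" using valuation_lower_dim[OF \<mu> PT tT] by blast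
      then show ?thesis using eq IH set by simp
    qed
  qed
qed

lemma valuation_maximal_sum:
  assumes \<mu>: "valuation \<mu>" "n \<ge> 1" "d \<le> n" and \<Delta>: "regular_triangulates n \<Delta> P" and P: "P \<in> rational_polyhedra n"
  shows "\<mu> n d P = (\<Sum>T\<in>maximal_simplexes n \<Delta> d. \<mu> n d T)"
proof -
  note D = regular_triangulatesD[OF \<Delta>]
  note E = dim_part_complex[OF D(1), of d]
  let ?\<Delta> = "{T\<in>\<Delta>. T \<subseteq> \<Union>(maximal_simplexes n \<Delta> d)}"
  have c: "simplicial_complex_in n ?\<Delta>" "\<forall>T\<in>?\<Delta>. \<exists>m. regular_simplex n m T" using E(1) D(4) by (auto simp: triangulates_def)
  have sub: "maximal_simplexes n \<Delta> d \<subseteq> ?\<Delta>" by (auto simp: maximal_simplexes_def)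
  have "\<mu> n d P = \<mu> n d (dim_part n d P)" using \<mu> P unfolding valuation_def by blast
  also have "\<dots> = \<mu> n d (\<Union>(maximal_simplexes n \<Delta> d))" unfolding dim_part_eq[OF D(3)] ..
  also have "\<dots> = (\<Sum>T | T \<in> maximal_simplexes n \<Delta> d \<and> card (vertices T) = Suc d. \<mu> n d T)"
    by (rule valuation_complex_sum[OF \<mu> c E(2) sub])
  also have "{T. T \<in> maximal_simplexes n \<Delta> d \<and> card (vertices T) = Suc d} = maximal_simplexes n \<Delta> d"
    by (auto simp: maximal_simplexes_def simplex_in_iff)
  finally show ?thesis .
qed

text \<open>Proportionality speaks of simplexes only; additivity carries the constant to all
  polyhedra in \<open>A\<close>, in particular to parallelepipeds. Hausdorff measure cancels between
  the two families.\<close>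

lemma proportional_to_rational_measure:
  assumes \<mu>: "nonneg_valued \<mu>" "valuation \<mu>" "proportionality \<mu>" "n \<ge> 1" "m \<le> n"
    and A: "rational_affine_subspace n A" "affine_dim_eq m A"
  shows "\<exists>\<rho>. \<forall>P\<in>rational_polyhedra n. P \<subseteq> A \<longrightarrow> \<mu> n m P = \<rho> * rational_measure n m P"
proof -
  obtain \<kappa> where \<kappa>: "\<kappa> > 0" "\<And>Q. rational_simplex n m Q \<Longrightarrow> Q \<subseteq> A \<Longrightarrow> ennreal (\<mu> n m Q) = ennreal \<kappa> * hausdorff_measure m Q"
    using \<mu>(3,4,5) A unfolding proportionality_def by blast
  obtain \<kappa>' where \<kappa>': "\<kappa>' > 0" "\<And>Q. rational_simplex n m Q \<Longrightarrow> Q \<subseteq> A \<Longrightarrow>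
    ennreal (rational_measure n m Q) = ennreal \<kappa>' * hausdorff_measure m Q"
    using rational_measure_proportionality \<mu>(4,5) A unfolding proportionality_def by blast
  have simplex: "\<mu> n m Q = \<kappa> / \<kappa>' * rational_measure n m Q" if Q: "rational_simplex n m Q" "Q \<subseteq> A" for Q
  proof -
    let ?h = "enn2real (hausdorff_measure m Q)"
    have h: "hausdorff_measure m Q = ennreal ?h" "?h \<ge> 0"
      using rational_measure_simplex_compare(2,3)[OF A(2) Q Q] by auto
    have nn: "\<mu> n m Q \<ge> 0" "rational_measure n m Q \<ge> 0"
      using \<mu>(1,4,5) rational_measure_nonneg rational_simplex_polyhedron[OF Q(1)] unfolding nonneg_valued_def by blast+
    have "ennreal (\<mu> n m Q) = ennreal (\<kappa> * ?h)" "ennreal (rational_measure n m Q) = ennreal (\<kappa>' * ?h)"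
      using \<kappa>(2)[OF Q] \<kappa>'(2)[OF Q] h \<kappa>(1) \<kappa>'(1) by (simp_all add: ennreal_mult)
    then have "\<mu> n m Q = \<kappa> * ?h" "rational_measure n m Q = \<kappa>' * ?h"
      using nn h(2) \<kappa>(1) \<kappa>'(1) by simp_all
    then show ?thesis using \<kappa>'(1) by simp
  qed
  have "\<mu> n m P = \<kappa> / \<kappa>' * rational_measure n m P" if P: "P \<in> rational_polyhedra n" "P \<subseteq> A" for P
  proof -
    obtain \<Delta> where \<Delta>: "regular_triangulates n \<Delta> P" using regular_triangulation_exists[OF P(1)] .
    note D = regular_triangulatesD[OF \<Delta>]
    have "rational_simplex n m T \<and> T \<subseteq> A" if T: "T \<in> maximal_simplexes n \<Delta> m" for T
    proof -
      have T': "T \<in> \<Delta>" "simplex_in n m T" using T by (auto simp: maximal_simplexes_def)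
      obtain k where k: "rational_simplex n k T" using D(4) T'(1) regular_imp_rational by blast
      then have "k = m" using simplex_in_unique[OF rational_imp_simplex T'(2)] by blast
      then show ?thesis using k T'(1) D(2) P(2) by blast
    qed
    then show ?thesis
      unfolding valuation_maximal_sum[OF \<mu>(2,4,5) \<Delta> P(1)]
        valuation_maximal_sum[OF rational_measure_valuation \<mu>(4,5) \<Delta> P(1)] sum_distrib_left
      using simplex by (intro sum.cong) auto
  qed
  then show ?thesis by blast
qed

section \<open>Affine hulls and cones over simplexes\<close>

text \<open>The equations of the span of the homogenized vertices become affine equations at height
  1.\<close>

lemma rational_affine_hull:
  assumes V: "finite V" "V \<noteq> {}" "V \<subseteq> Qn n" "\<not> affine_dependent V"
  shows "rational_affine_subspace n (affine hull V)"
proof -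
  have VR: "V \<subseteq> Rn n" using V(3) Qn_subset_Rn by blast
  note ind = snoc_independent[OF V(1) VR V(4)]
  let ?W = "(\<lambda>v. snoc n v 1) ` V"
  have "finite ?W" "?W \<subseteq> Qn (Suc n)" using V(1,3) snoc_in_Qn by auto
  then obtain G where G: "finite G" "\<forall>g\<in>G. rational_form (Suc n) g"
    "\<forall>x\<in>Rn (Suc n). x \<in> span ?W \<longleftrightarrow> (\<forall>g\<in>G. g x = 0)"
    using rational_dual_forms[OF _ _ ind(1), of "Suc n"] by blast
  define a where "a = (\<lambda>g::point \<Rightarrow> real. \<Sum>i<n. Poly_Mapping.single i (g (unit_vec i)))"
  have ca: "coord (a g) i = (if i < n then g (unit_vec i) else 0)" for g i
    unfolding a_def by (rule coord_sum_single)
  have aQ: "a g \<in> Qn n" if "g \<in> G" for g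
    using G(2) that single_in_Zn[of _ "Suc n"] Zn_in_Qn
    by (auto simp: Qn_def[of n] Rn_def[of n] ca rational_form_def)
  have gs: "g (snoc n x 1) = (\<Sum>i<n. coord (a g) i * coord x i) + g (unit_vec n)" if "g \<in> G" "x \<in> Rn n" for g x
  proof -
    have lin: "linear g" using G(2) that(1) by (simp add: rational_form_def)
    have "g (snoc n x 1) = g x + g (unit_vec n)" unfolding snoc_def by (rule linear_add[OF lin])
    also have "g x = (\<Sum>i<n. coord (a g) i * coord x i)"
      unfolding linear_Rn_sum[OF lin that(2)] by (intro sum.cong) (auto simp: ca)
    finally show ?thesis .
  qed
  have hull: "x \<in> affine hull V \<longleftrightarrow> x \<in> Rn n \<and> (\<forall>g\<in>G. g (snoc n x 1) = 0)" for x
  proof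
    assume "x \<in> affine hull V"
    then obtain u where u: "sum u V = 1" "x = (\<Sum>v\<in>V. u v *\<^sub>R v)" using V(1) by (auto simp: affine_hull_finite)
    have xR: "x \<in> Rn n" unfolding u(2) using VR by (intro Rn_sum Rn_scaleR) auto
    have "snoc n x 1 \<in> span ?W"
      unfolding u(2) snoc_sum[OF u(1)] by (intro span_sum span_scale span_base) auto
    then show "x \<in> Rn n \<and> (\<forall>g\<in>G. g (snoc n x 1) = 0)" using G(3) snoc_in_Rn[OF xR] xR by blast
  next
    assume x: "x \<in> Rn n \<and> (\<forall>g\<in>G. g (snoc n x 1) = 0)"
    then have "snoc n x 1 \<in> span ?W" using G(3) snoc_in_Rn by blast
    then obtain u where u: "snoc n x 1 = (\<Sum>w\<in>?W. u w *\<^sub>R w)" using span_finite[OF finite_imageI[OF V(1)]] by auto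
    let ?u = "\<lambda>v. u (snoc n v 1)"
    have eq: "snoc n x 1 = (\<Sum>v\<in>V. ?u v *\<^sub>R snoc n v 1)" unfolding u by (simp add: sum.reindex[OF ind(2)])
    have "coord (snoc n x 1) n = coord (\<Sum>v\<in>V. ?u v *\<^sub>R snoc n v 1) n" using eq by simp
    also have "\<dots> = sum ?u V"
      unfolding lookup_sum using VR by (intro sum.cong) (auto simp: coord_snoc coord_n_Rn subset_iff)
    finally have one: "sum ?u V = 1" using x by (simp add: coord_snoc coord_n_Rn)
    have "snoc n x 1 = snoc n (\<Sum>v\<in>V. ?u v *\<^sub>R v) 1" unfolding eq snoc_sum[OF one] ..
    then have "x = (\<Sum>v\<in>V. ?u v *\<^sub>R v)" by (simp add: snoc_def)
    then show "x \<in> affine hull V" unfolding affine_hull_finite[OF V(1)] using one by blast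
  qed
  define h where "h = (\<lambda>g. {x \<in> Rn n. (\<Sum>i<n. coord (a g) i * coord x i) + g (unit_vec n) = 0})"
  \<comment> \<open>An equation with \<open>a g = 0\<close> is constant at height 1; it vanishes at
    a vertex, hence everywhere there, and defines no hyperplane.\<close>
  let ?F = "h ` {g\<in>G. a g \<noteq> 0}"
  have "\<forall>H\<in>?F. rational_hyperplane n H"
  proof
    fix H assume "H \<in> ?F"
    then obtain g where g: "g \<in> G" "a g \<noteq> 0" "H = h g" by blast
    have "g (unit_vec n) \<in> \<rat>"
      using G(2) g(1) Zn_in_Qn[OF single_in_Zn[of n "Suc n"]] by (auto simp: rational_form_def)
    then show "rational_hyperplane n H"
      unfolding rational_hyperplane_def g(3) h_def using aQ[OF g(1)] g(2) by blast
  qed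
  moreover have "affine hull V = Rn n \<inter> \<Inter>?F"
  proof (intro equalityI subsetI)
    fix x assume "x \<in> affine hull V"
    then show "x \<in> Rn n \<inter> \<Inter>?F" using hull gs by (auto simp: h_def)
  next
    fix x assume x: "x \<in> Rn n \<inter> \<Inter>?F"
    have "g (snoc n x 1) = 0" if g: "g \<in> G" for g
    proof (cases "a g = 0")
      case True
      obtain v where v: "v \<in> V" using V(2) by blast
      then have "v \<in> affine hull V" by (rule hull_inc)
      then have "g (snoc n v 1) = 0" using hull g by blast
      then have "g (unit_vec n) = 0" using gs[OF g, of v] v VR True by auto
      then show ?thesis using gs[OF g, of x] x True by simp
    next
      case False
      then have "x \<in> h g" using x g by blast
      then show ?thesis using gs[OF g, of x] by (simp add: h_def)
    qed
    then show "x \<in> affine hull V" using hull x by blast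
  qed
  moreover have "finite ?F" using G(1) by simp
  ultimately show ?thesis unfolding rational_affine_subspace_def by (intro exI[where x = ?F] conjI)
qed

lemma rational_polyhedra_translation:
  assumes P: "P \<in> rational_polyhedra n" and t: "t \<in> Qn n"
  shows "(+) t ` P \<in> rational_polyhedra n"
proof -
  obtain F where F: "finite F" "\<forall>S\<in>F. \<exists>m. rational_simplex n m S" "P = \<Union>F"
    using P by (auto simp: rational_polyhedra_def)
  have "\<exists>m. rational_simplex n m ((+) t ` S)" if S: "S \<in> F" for S
  proof -
    obtain m V where V: "V \<subseteq> Qn n" "finite V" "card V = Suc m" "\<not> affine_dependent V" "S = convex hull V"
      using F(2) S unfolding rational_simplex_def by blast
    have "(+) t ` V \<subseteq> Qn n" using V(1) t by (auto simp: Qn_def Rn_def lookup_add)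
    moreover have "card ((+) t ` V) = Suc m" using V(3) by (simp add: card_image)
    moreover have "\<not> affine_dependent ((+) t ` V)" using V(4) affine_dependent_translation_eq by blast
    moreover have "(+) t ` S = convex hull ((+) t ` V)" unfolding V(5) by (rule convex_hull_translation[symmetric])
    ultimately show ?thesis unfolding rational_simplex_def using V(2) by blast
  qed
  moreover have "(+) t ` P = \<Union>(image ((+) t) ` F)" unfolding F(3) by blast
  ultimately show ?thesis unfolding rational_polyhedra_def using F(1) by (intro CollectI exI[where x = "image ((+) t) ` F"]) auto
qed

text \<open>Lifting a lattice basis of \<open>\<int>\<^sup>n\<^sup>+\<^sup>1\<close>: the homogenizing coordinate moves from position \<open>n\<close> to
  position \<open>n + 1\<close>, and the homogeneous correspondent of the integer point \<open>(0, \<dots>, 0, -1)\<close> is added.\<close>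

lemma lattice_basis_lift:
  assumes C: "lattice_basis (Suc n) C"
  defines "\<psi> \<equiv> \<lambda>x. x - coord x n *\<^sub>R unit_vec n + coord x n *\<^sub>R unit_vec (Suc n)"
    and "z \<equiv> unit_vec (Suc n) - unit_vec n"
  shows "lattice_basis (Suc (Suc n)) (insert z (\<psi> ` C))"
proof (rule lattice_basisI)
  let ?N = "Suc (Suc n)" and ?C = "insert z (\<psi> ` C)"
  have c\<psi>: "coord (\<psi> x) i = (if i = n then 0 else if i = Suc n then coord x (Suc n) + coord x n else coord x i)" for x i
    by (auto simp: \<psi>_def lookup_add lookup_minus coord_unit_vec)
  have cz: "coord z i = (if i = n then - 1 else if i = Suc n then 1 else 0)" for i
    by (auto simp: z_def lookup_minus coord_unit_vec)
  have CZ: "C \<subseteq> Zn (Suc n)" by (rule lattice_basis_subset[OF C])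
  have \<psi>Z: "\<psi> x \<in> Zn ?N" if "x \<in> Zn (Suc n)" for x
    using that by (auto simp: Zn_def Rn_def c\<psi>)
  have "z \<in> Zn ?N" by (auto simp: Zn_def Rn_def cz)
  then show "?C \<subseteq> Zn ?N" using \<psi>Z CZ by auto
  \<comment> \<open>A left inverse of \<open>\<psi>\<close> on the old lattice that sends
    \<open>z\<close> to 0; composed with the old dual forms it gives those of the lifted
    vectors.\<close>
  define \<theta> where "\<theta> = (\<lambda>x. x + coord x (Suc n) *\<^sub>R unit_vec n - coord x (Suc n) *\<^sub>R unit_vec (Suc n))"
  have c\<theta>: "coord (\<theta> x) i = (if i = n then coord x n + coord x (Suc n) else if i = Suc n then 0 else coord x i)" for x i
    by (auto simp: \<theta>_def lookup_add lookup_minus coord_unit_vec)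
  have \<theta>\<psi>: "\<theta> (\<psi> x) = x" if "x \<in> Zn (Suc n)" for x
    using that by (intro poly_mapping_eqI) (auto simp: c\<theta> c\<psi> Zn_def Rn_def)
  have \<theta>z: "\<theta> z = 0" by (intro poly_mapping_eqI) (auto simp: c\<theta> cz)
  have lin\<theta>: "linear \<theta>" by (rule linearI; rule poly_mapping_eqI) (auto simp: c\<theta> lookup_add algebra_simps)
  show "Zn ?N \<subseteq> int_module.span ?C"
  proof
    fix x assume x: "x \<in> Zn ?N"
    have "int_module.subspace {y. \<psi> y \<in> int_module.span ?C}"
    proof (rule int_module.subspaceI)
      have "\<psi> 0 = 0" by (simp add: \<psi>_def)
      then show "0 \<in> {y. \<psi> y \<in> int_module.span ?C}" by (simp add: int_module.span_zero)
      fix y y' assume "y \<in> {y. \<psi> y \<in> int_module.span ?C}" "y' \<in> {y. \<psi> y \<in> int_module.span ?C}"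
      moreover have "\<psi> (y + y') = \<psi> y + \<psi> y'" by (simp add: \<psi>_def lookup_add algebra_simps)
      ultimately show "y + y' \<in> {y. \<psi> y \<in> int_module.span ?C}" by (simp add: int_module.span_add)
    next
      fix c y assume y: "y \<in> {y. \<psi> y \<in> int_module.span ?C}"
      have "\<psi> (of_int c *\<^sub>R y) = of_int c *\<^sub>R \<psi> y" by (simp add: \<psi>_def algebra_simps)
      then show "of_int c *\<^sub>R y \<in> {y. \<psi> y \<in> int_module.span ?C}" using y int_module.span_scale by simp
    qed
    moreover have "C \<subseteq> {y. \<psi> y \<in> int_module.span ?C}" by (auto intro: int_module.span_base)
    ultimately have "int_module.span C \<subseteq> {y. \<psi> y \<in> int_module.span ?C}" by (intro int_module.span_minimal)
    moreover have "\<theta> x \<in> Zn (Suc n)" using x by (auto simp: Zn_def Rn_def c\<theta> Suc_le_eq)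
    ultimately have "\<psi> (\<theta> x) \<in> int_module.span ?C" using C by (auto simp: lattice_basis_def)
    \<comment> \<open>Coordinate \<open>n\<close> is 0 on the image of \<open>\<psi>\<close> and -1
      at \<open>z\<close>, which fixes the multiple of \<open>z\<close>.\<close>
    moreover have "of_int (- \<lfloor>coord x n\<rfloor>) *\<^sub>R z \<in> int_module.span ?C"
      by (intro int_module.span_scale int_module.span_base) simp
    ultimately have "\<psi> (\<theta> x) + of_int (- \<lfloor>coord x n\<rfloor>) *\<^sub>R z \<in> int_module.span ?C" by (rule int_module.span_add)
    moreover have "\<psi> (\<theta> x) + of_int (- \<lfloor>coord x n\<rfloor>) *\<^sub>R z = x"
    proof (rule poly_mapping_eqI)
      fix i
      have "real_of_int (- \<lfloor>coord x n\<rfloor>) = - coord x n" using x by (simp add: Zn_def)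
      then show "coord (\<psi> (\<theta> x) + of_int (- \<lfloor>coord x n\<rfloor>) *\<^sub>R z) i = coord x i"
        by (simp only: lookup_add lookup_scaleR c\<psi> c\<theta> cz real_scaleR_def) auto
    qed
    ultimately show "x \<in> int_module.span ?C" by simp
  qed
  obtain D :: "point \<Rightarrow> point \<Rightarrow> real" where D: "\<And>c. linear (D c)"
    "\<And>c c'. c \<in> C \<Longrightarrow> c' \<in> C \<Longrightarrow> D c c' = (if c' = c then 1 else 0)"
    using lattice_basis_dual[OF C] by metis
  fix c assume c: "c \<in> ?C"
  show "\<exists>f::point \<Rightarrow> real. linear f \<and> f c = 1 \<and> (\<forall>c'\<in>?C - {c}. f c' = 0)"
  proof (cases "c = z")
    case True
    have "linear (\<lambda>x. - 1 * coord x n)" by (rule linear_real_combine(2)[OF linear_coord linear_coord])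
    moreover have "- 1 * coord z n = 1" by (simp add: cz)
    moreover have "- 1 * coord (\<psi> y) n = 0" for y by (simp add: c\<psi>)
    ultimately show ?thesis unfolding True by (intro exI[where x = "\<lambda>x. - 1 * coord x n"]) auto
  next
    case False
    then obtain b where b: "b \<in> C" "c = \<psi> b" using c by blast
    have \<theta>C: "\<theta> (\<psi> y) = y" if "y \<in> C" for y using \<theta>\<psi> CZ that by blast
    have "linear (\<lambda>x. D b (\<theta> x))" using linear_compose[OF lin\<theta> D(1)[of b]] by (simp add: o_def)
    moreover have "D b (\<theta> c) = 1" using b \<theta>C D(2) by simp
    moreover have "D b (\<theta> c') = 0" if c': "c' \<in> ?C - {c}" for c'
    proof (cases "c' = z")
      case True
      then show ?thesis using \<theta>z D(1) by (simp add: linear_0)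
    next
      case False
      then obtain b' where b': "b' \<in> C" "c' = \<psi> b'" using c' by blast
      then have "b' \<noteq> b" using c' b by blast
      then show ?thesis using b b' \<theta>C D(2) by simp
    qed
    ultimately show ?thesis by (intro exI[where x = "\<lambda>x. D b (\<theta> x)"]) auto
  qed
qed

text \<open>The apex of the cone over a regular simplex is chosen as \<open>(0, \<dots>, 0, -1)\<close>, since then the
  multiples \<open>den v *\<^sub>R (v - apex)\<close> of the edges at the apex are the homogeneous correspondents of the vertices.\<close>

lemma regular_cone:
  assumes V: "regular_vertices n V"
  shows "regular_vertices (Suc n) (insert (- unit_vec n) V)"
proof -
  let ?v0 = "- unit_vec n"
  have VQ: "V \<subseteq> Qn n" and fin: "finite V" using V by (auto simp: regular_vertices_def)
  obtain C where C: "homog n ` V \<subseteq> C" "lattice_basis (Suc n) C"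
    using V by (auto simp: regular_vertices_def part_of_basis_def)
  let ?\<psi> = "\<lambda>x. x - coord x n *\<^sub>R unit_vec n + coord x n *\<^sub>R unit_vec (Suc n)"
  let ?z = "unit_vec (Suc n) - unit_vec n"
  have Q: "Qn n \<subseteq> Qn (Suc n)" using Rn_mono[of n "Suc n"] by (auto simp: Qn_def)
  have v0: "?v0 \<in> Zn (Suc n)" by (auto simp: Zn_def Rn_def coord_unit_vec)
  have h0: "homog (Suc n) ?v0 = ?z"
    by (simp add: homog_def den_Zn[OF v0] snoc_def)
  have h: "homog (Suc n) v = ?\<psi> (homog n v)" if "v \<in> V" for v
  proof -
    have "v \<in> Rn n" using VQ that Qn_in_Rn by blast
    then have c: "coord (homog n v) n = real (den v)" by (rule coord_homog)
    show ?thesis unfolding c by (simp add: homog_def snoc_def scaleR_add_right)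
  qed
  have "homog (Suc n) ` insert ?v0 V \<subseteq> insert ?z (?\<psi> ` C)"
    using h0 h C(1) by auto
  then have part: "part_of_basis (Suc (Suc n)) (homog (Suc n) ` insert ?v0 V)"
    using lattice_basis_lift[OF C(2)] unfolding part_of_basis_def by blast
  have all: "insert ?v0 V \<subseteq> Qn (Suc n)" using VQ Q Zn_in_Qn[OF v0] by blast
  have pos: "coord v (Suc n) > 0" if v: "v \<in> homog (Suc n) ` insert ?v0 V" for v
  proof -
    obtain y where y: "y \<in> insert ?v0 V" "v = homog (Suc n) y" using v by blast
    then have "y \<in> Qn (Suc n)" using all by blast
    then show ?thesis using y(2) coord_homog[OF Qn_in_Rn] den_works(1) by simp
  qed
  \<comment> \<open>Affine independence comes from dehomogenizing the extended part of a basis,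
    which returns the original points.\<close>
  have "dehom (Suc n) ` homog (Suc n) ` insert ?v0 V = insert ?v0 V"
  proof -
    have "dehom (Suc n) (homog (Suc n) y) = y" if "y \<in> insert ?v0 V" for y
      using all that by (intro dehom_homog) blast
    then show ?thesis unfolding image_image by (simp cong: image_cong)
  qed
  then show ?thesis
    using regular_vertices_dehom(1)[OF part _ pos] fin by simp
qed

section \<open>Uniqueness on regular simplexes and on polyhedra\<close>

lemma regular_simplex_measure_unique:
  assumes \<mu>: "nonneg_valued \<mu>" "characteristic_properties \<mu>" and n: "n \<ge> 1" "d \<le> n"
    and T: "regular_simplex n d T"
  shows "\<mu> n d T = rational_measure n d T"
proof -
  let ?V = "vertices T" and ?N = "Suc n" and ?v0 = "- unit_vec n"
  have V: "regular_vertices n ?V" "card ?V = Suc d" "T = convex hull ?V" using T by (auto simp: regular_simplex_iff)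
  have VQ: "?V \<subseteq> Qn n" and fin: "finite ?V" using V(1) by (auto simp: regular_vertices_def)
  have \<lambda>: "valuation rational_measure" "invariance rational_measure" "conservativity rational_measure"
    "pyramid rational_measure" "normalization rational_measure"
    using rational_measure_valuation rational_measure_invariance rational_measure_conservativity
      rational_measure_pyramid rational_measure_normalization by blast+
  have \<mu>': "invariance \<mu>" "valuation \<mu>" "conservativity \<mu>" "pyramid \<mu>" "normalization \<mu>" "proportionality \<mu>"
    using \<mu>(2) by (auto simp: characteristic_properties_def)
  define U where "U = insert ?v0 ?V"
  have U: "regular_vertices ?N U" unfolding U_def by (rule regular_cone[OF V(1)])
  have v0: "?v0 \<in> Zn ?N" by (auto simp: Zn_def Rn_def coord_unit_vec)
  have v0V: "?v0 \<notin> ?V"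
  proof
    assume "?v0 \<in> ?V"
    then have "coord ?v0 n = 0" using VQ Qn_in_Rn coord_n_Rn by blast
    then show False by (simp add: coord_unit_vec)
  qed
  have cU: "card U = Suc (Suc d)" using v0V fin V(2) by (simp add: U_def)
  have UQ: "U \<subseteq> Qn ?N" "finite U" "\<not> affine_dependent U" using U by (auto simp: regular_vertices_def)
  let ?A = "affine hull U"
  have A: "rational_affine_subspace ?N ?A" "affine_dim_eq (Suc d) ?A"
  proof -
    show "rational_affine_subspace ?N ?A" using UQ by (intro rational_affine_hull) (auto simp: U_def)
    show "affine_dim_eq (Suc d) ?A" unfolding affine_dim_eq_def using UQ cU by blast
  qed
  have N: "?N \<ge> 1" "Suc d \<le> ?N" "d \<le> ?N" using n by auto
  obtain \<rho> where \<rho>: "\<And>P. P \<in> rational_polyhedra ?N \<Longrightarrow> P \<subseteq> ?A \<Longrightarrow> \<mu> ?N (Suc d) P = \<rho> * rational_measure ?N (Suc d) P"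
    using proportional_to_rational_measure[OF \<mu>(1) \<mu>'(2,6) N(1,2) A] by blast
  let ?B = "homog n ` ?V"
  have inj: "inj_on (homog n) ?V" using dehom_homog VQ by (metis inj_onI subsetD)
  have B: "part_of_basis ?N ?B" "card ?B = Suc d" "?B \<subseteq> Zn ?N"
    using V(1,2) card_image[OF inj] homog_in_Zn VQ by (auto simp: regular_vertices_def)
  \<comment> \<open>A unit parallelepiped with a corner at the apex; its edges
    \<open>den v (v - apex)\<close> keep it in the affine hull of the cone.\<close>
  let ?P = "(+) ?v0 ` unit_cube ?B"
  have cube: "unit_cube ?B \<in> rational_polyhedra ?N" by (rule rational_measure_unit_cube(1)[OF B(1,2)]) simp
  have P: "?P \<in> rational_polyhedra ?N" by (rule rational_polyhedra_translation[OF cube Zn_in_Qn[OF v0]])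
  have PA: "?P \<subseteq> ?A"
  proof
    fix x assume "x \<in> ?P"
    then obtain g where g: "x = ?v0 + (\<Sum>w\<in>?B. g w *\<^sub>R w)" by (auto simp: unit_cube_def)
    let ?c = "\<lambda>v. g (homog n v) * real (den v)"
    have "(\<Sum>w\<in>?B. g w *\<^sub>R w) = (\<Sum>v\<in>?V. ?c v *\<^sub>R (v - ?v0))"
      unfolding sum.reindex[OF inj] by (intro sum.cong) (auto simp: homog_def snoc_def)
    also have "\<dots> = (\<Sum>v\<in>?V. ?c v *\<^sub>R v) - sum ?c ?V *\<^sub>R ?v0"
      by (simp add: scaleR_diff_right sum_subtractf sum.distrib scaleR_add_right flip: scaleR_sum_left)
    finally have x: "x = (1 - sum ?c ?V) *\<^sub>R ?v0 + (\<Sum>v\<in>?V. ?c v *\<^sub>R v)"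
      unfolding g by (simp add: scaleR_diff_left)
    let ?u = "\<lambda>v. if v = ?v0 then 1 - sum ?c ?V else ?c v"
    have "sum ?u ?V = sum ?c ?V" "(\<Sum>v\<in>?V. ?u v *\<^sub>R v) = (\<Sum>v\<in>?V. ?c v *\<^sub>R v)"
      using v0V by (auto intro!: sum.cong)
    then have "sum ?u U = 1" "(\<Sum>v\<in>U. ?u v *\<^sub>R v) = x"
      unfolding U_def x using fin v0V by simp_all
    then show "x \<in> ?A" unfolding affine_hull_finite[OF UQ(2)] by blast
  qed
  \<comment> \<open>The apex is an integer point, so invariance moves the parallelepiped to the
    origin, where normalization applies.\<close>
  have one: "\<nu> ?N (Suc d) ?P = 1" if "invariance \<nu>" "normalization \<nu>" for \<nu>
  proof -
    obtain \<gamma> where \<gamma>: "\<gamma> \<in> affine_GL_Z ?N" "\<And>x. x \<in> Rn ?N \<Longrightarrow> \<gamma> x = ?v0 + x"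
      using translation_in_affine_GL_Z[OF v0] by blast
    have "?P = \<gamma> ` unit_cube ?B"
      using \<gamma>(2) rational_polyhedron_subset_Rn[OF cube] by (intro image_cong) auto
    then have "\<nu> ?N (Suc d) ?P = \<nu> ?N (Suc d) (unit_cube ?B)"
      (is "_ = ?cube") using that(1) P cube \<gamma>(1) N unfolding invariance_def by blast
    moreover have "?cube = 1"
    proof -
      have "Suc d \<in> {1..?N}" using N by simp
      then show ?thesis
        using that(2) B N(1) unfolding normalization_def unit_cube_def[symmetric] by blast
    qed
    ultimately show ?thesis by simp
  qed
  \<comment> \<open>Both families take the value 1 on \<open>?P\<close>, so the factor between them
    is 1.\<close>
  have "\<rho> = 1" using \<rho>[OF P PA] one[OF \<mu>'(1,5)] one[OF \<lambda>(2,5)] by simp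
  let ?S = "convex hull U"
  have S: "rational_simplex ?N (Suc d) ?S" unfolding rational_simplex_def using UQ cU by blast
  have eqS: "\<mu> ?N (Suc d) ?S = rational_measure ?N (Suc d) ?S"
    using \<rho>[OF rational_simplex_polyhedron[OF S] convex_hull_subset_affine_hull] \<open>\<rho> = 1\<close> by simp
  obtain e where e: "bij_betw e {1..Suc d} ?V"
    using ex_bij_betw_nat_finite_1[OF fin] V(2) by auto
  define v where "v = e(0 := ?v0)"
  have v1: "v ` {1..Suc d} = ?V"
    using bij_betw_imp_surj_on[OF e] by (auto simp: v_def)
  have split: "{0..Suc d} = insert 0 {1..Suc d}" by auto
  have vU: "v ` {0..Suc d} = U"
    unfolding split image_insert v1 by (simp add: U_def v_def)
  have vinj: "inj_on v {0..Suc d}"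
    by (rule eq_card_imp_inj_on) (use vU cU in auto)
  have pyr: "\<nu> ?N (Suc d) ?S = \<nu> ?N d T / real (Suc d)" if "pyramid \<nu>" for \<nu>
  proof -
    have "inj_on v {0..Suc d} \<and> regular_vertices ?N (v ` {0..Suc d}) \<and> v 0 \<in> Zn ?N"
      using vinj U v0 unfolding vU by (simp add: v_def)
    moreover have "Suc d \<in> {1..?N}" using N by simp
    ultimately have "\<nu> ?N (Suc d) (convex hull (v ` {0..Suc d})) =
      \<nu> ?N (Suc d - 1) (convex hull (v ` {1..Suc d})) / real (Suc d)"
      using that N(1) unfolding pyramid_def by blast
    then show ?thesis unfolding vU v1 V(3)[symmetric] by simp
  qed
  have TP: "T \<in> rational_polyhedra n" using T regular_imp_rational rational_simplex_polyhedron by blast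
  have cons: "\<nu> ?N d T = \<nu> n d T" if "conservativity \<nu>" for \<nu>
    using that TP n unfolding conservativity_def snoc_0 by simp
  have "\<mu> ?N d T / real (Suc d) = rational_measure ?N d T / real (Suc d)"
    using eqS pyr[OF \<mu>'(4)] pyr[OF \<lambda>(4)] by simp
  then have "\<mu> ?N d T = rational_measure ?N d T" by simp
  then show ?thesis using cons[OF \<mu>'(3)] cons[OF \<lambda>(3)] by simp
qed

lemma rational_measure_characterized:
  assumes \<mu>: "nonneg_valued \<mu>" "characteristic_properties \<mu>" and n: "n \<ge> 1" "d \<le> n"
    and P: "P \<in> rational_polyhedra n"
  shows "\<mu> n d P = rational_measure n d P"
proof -
  obtain \<Delta> where \<Delta>: "regular_triangulates n \<Delta> P" using regular_triangulation_exists[OF P] .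
  have val: "valuation \<mu>" using \<mu>(2) by (simp add: characteristic_properties_def)
  have "regular_simplex n d T" if T: "T \<in> maximal_simplexes n \<Delta> d" for T
  proof -
    have T': "T \<in> \<Delta>" "simplex_in n d T" using T by (auto simp: maximal_simplexes_def)
    then show ?thesis using regular_triangulatesD(4)[OF \<Delta>] by (auto simp: regular_simplex_iff simplex_in_iff)
  qed
  then show ?thesis
    unfolding valuation_maximal_sum[OF val n \<Delta> P] valuation_maximal_sum[OF rational_measure_valuation n \<Delta> P]
    using regular_simplex_measure_unique[OF \<mu> n] by (intro sum.cong) auto
qed

theorem theorem8p2:
  shows "nonneg_valued rational_measure \<and> characteristic_properties rational_measure \<and>
    (\<forall>\<mu>. nonneg_valued \<mu> \<and> characteristic_properties \<mu> \<longrightarrow>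
      (\<forall>n\<ge>1. \<forall>d\<le>n. \<forall>P\<in>rational_polyhedra n. \<mu> n d P = rational_measure n d P))"
proof (intro conjI allI ballI impI)
  show "nonneg_valued rational_measure" by (rule rational_measure_nonneg)
  show "characteristic_properties rational_measure"
    unfolding characteristic_properties_def
    by (intro conjI rational_measure_invariance rational_measure_valuation rational_measure_conservativity
        rational_measure_pyramid rational_measure_normalization rational_measure_proportionality)
qed (elim conjE, rule rational_measure_characterized)

end
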